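(* Let $b<0<a$ and let $$f_1(r)=\begin{cases}1+ar & \text{if } -1/a<r\le 0,\\ e^{-br} & \text{if } r>0,\end{cases}\qquad P_1(m)=-\partial_r^2-f_1^{-1}f_1'\,\partial_r+f_1^{-2}m^2 \quad\text{on } (-1/a,\infty).$$ For any integer $m>0$ there are $\lambda_0>0$ and $k_0\in\mathbb{N}$ such that the resonances of $P_1(m)$ in the region $\{\operatorname{Re}\lambda\ge\lambda_0\}$ form a sequence $(\lambda_k)_{k\ge k_0}$ satisfying, as $k\to\infty$, $$\lambda_k=\pi a k-\frac{ija}{2}\log k+O(1),$$ where $j=1$ if $a+b\ne 0$, and $j=2$ if $a+b=0$.
   Context: Let $X_1=(-1/a,\infty)\times S^1$, $S^1=\mathbb{R}/2\pi\mathbb{Z}$, with metric $g_1=dr^2+f_1(r)^2d\theta^2$ (a surface of revolution with a cone point at $r=-1/a$ and a funnel end $r\to\infty$). The nonnegative Laplacian $\Delta_{g_1}$ (Friedrichs extension at the cone point) acts on functions $u(r)e^{im\theta}$ by $\Delta_{g_1}(u(r)e^{im\theta})=(P_1(m)u)(r)\,e^{im\theta}$. Accordingly $P_1(m)$ is regarded as a nonnegative self-adjoint operator on $L^2((-1/a,\infty),f_1(r)\,dr)$, using the Friedrichs extension at $r=-1/a$ and with $u,u'$ continuous at $r=0$ for $u$ in its domain. For $\operatorname{Im}\lambda>0$ the resolvent $(P_1(m)-\lambda^2)^{-1}$ is bounded on this space and has an integral kernel $R(r,r')$, meaning that $u(r)=\int R(r,r')v(r')\,dr'$ solves $(P_1(m)-\lambda^2)u=v$;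 this kernel continues meromorphically in $\lambda$ from $\{\operatorname{Im}\lambda>0\}$ across the half-line $\{\lambda\in\mathbb{R}:\lambda>|b|/2\}$ to $\{\operatorname{Re}\lambda>|b|/2\}$. The resonances of $P_1(m)$ are the poles of this continuation. *)

theory Defs
  imports "HOL-Complex_Analysis.Complex_Analysis" "HOL-Library.Landau_Symbols"
begin

section \<open>Friedrichs extension of an operator in an \<open>L\<^sup>2\<close> space\<close>

text \<open>
  Elements of \<open>L\<^sup>2\<close> are represented by functions; equality almost everywhere is not
  quotiented out.
\<close>

definition L2_space :: "'a measure \<Rightarrow> ('a \<Rightarrow> complex) set" where
  "L2_space M = {u \<in> borel_measurable M. integrable M (\<lambda>x. (cmod (u x))\<^sup>2)}"

definition L2_inner :: "'a measure \<Rightarrow> ('a \<Rightarrow> complex) \<Rightarrow> ('a \<Rightarrow> complex) \<Rightarrow> complex" where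
  "L2_inner M u v = (\<integral>x. u x * cnj (v x) \<partial>M)"

text \<open>
  \<open>adjoint_graph M D T u w\<close>: \<open>u\<close> lies in the domain of the adjoint of \<open>T\<close> (with domain \<open>D\<close>,
  dense in \<open>L\<^sup>2\<close>) and the adjoint maps \<open>u\<close> to \<open>w\<close>.
\<close>

definition adjoint_graph ::
  "'a measure \<Rightarrow> ('a \<Rightarrow> complex) set \<Rightarrow> (('a \<Rightarrow> complex) \<Rightarrow> 'a \<Rightarrow> complex)
    \<Rightarrow> ('a \<Rightarrow> complex) \<Rightarrow> ('a \<Rightarrow> complex) \<Rightarrow> bool" where
  "adjoint_graph M D T u w \<longleftrightarrow>
     u \<in> L2_space M \<and> w \<in> L2_space M \<and> (\<forall>\<phi>\<in>D. L2_inner M u (T \<phi>) = L2_inner M w \<phi>)"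

text \<open>
  The domain of the closure of the quadratic form \<open>\<phi> \<mapsto> \<langle>T \<phi>, \<phi>\<rangle>\<close>, \<open>\<phi> \<in> D\<close>,
  for symmetric nonnegative \<open>T\<close>: \<open>L\<^sup>2\<close> limits of sequences that are Cauchy for the form.
\<close>

definition form_domain ::
  "'a measure \<Rightarrow> ('a \<Rightarrow> complex) set \<Rightarrow> (('a \<Rightarrow> complex) \<Rightarrow> 'a \<Rightarrow> complex)
    \<Rightarrow> ('a \<Rightarrow> complex) set" where
  "form_domain M D T = {u \<in> L2_space M. \<exists>\<phi> :: nat \<Rightarrow> 'a \<Rightarrow> complex.
     (\<forall>n. \<phi> n \<in> D) \<and>
     (\<lambda>n. \<integral>x. (cmod (\<phi> n x - u x))\<^sup>2 \<partial>M) \<longlonglongrightarrow> 0 \<and>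
     (\<forall>\<epsilon>>0. \<exists>N. \<forall>j\<ge>N. \<forall>k\<ge>N.
        Re (L2_inner M (T (\<lambda>x. \<phi> j x - \<phi> k x)) (\<lambda>x. \<phi> j x - \<phi> k x)) < \<epsilon>)}"

text \<open>
  The Friedrichs extension of a symmetric nonnegative \<open>T\<close> is the restriction of its adjoint to
  the form domain; \<open>friedrichs_graph M D T u w\<close> says that it maps \<open>u\<close> to \<open>w\<close>.
\<close>

definition friedrichs_graph ::
  "'a measure \<Rightarrow> ('a \<Rightarrow> complex) set \<Rightarrow> (('a \<Rightarrow> complex) \<Rightarrow> 'a \<Rightarrow> complex)
    \<Rightarrow> ('a \<Rightarrow> complex) \<Rightarrow> ('a \<Rightarrow> complex) \<Rightarrow> bool" where
  "friedrichs_graph M D T u w \<longleftrightarrow> u \<in> form_domain M D T \<and> adjoint_graph M D T u w"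


section \<open>The radial operator on the surface of revolution\<close>

text \<open>Only the values for \<open>r > -1/a\<close> are used.\<close>

definition f1 :: "real \<Rightarrow> real \<Rightarrow> real \<Rightarrow> real" where
  "f1 a b r = (if r \<le> 0 then 1 + a * r else exp (- b * r))"

definition radial_measure :: "real \<Rightarrow> real \<Rightarrow> real measure" where
  "radial_measure a b =
     density (restrict_space lborel {- 1 / a<..}) (\<lambda>r. ennreal (f1 a b r))"

definition d_r :: "(real \<Rightarrow> complex) \<Rightarrow> real \<Rightarrow> complex" where
  "d_r u r = vector_derivative u (at r)"

definition P1 :: "real \<Rightarrow> real \<Rightarrow> int \<Rightarrow> (real \<Rightarrow> complex) \<Rightarrow> real \<Rightarrow> complex" where
  \<comment> \<open>If \<open>a + b \<noteq> 0\<close>, \<open>f1\<close> has a kink at \<open>0\<close> and the value at the single point \<open>r = 0\<close>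
      is meaningless; in \<open>L\<^sup>2\<close> it does not matter.\<close>
  "P1 a b m u r =
     - d_r (d_r u) r
     - of_real (deriv (f1 a b) r / f1 a b r) * d_r u r
     + of_real ((real_of_int m)\<^sup>2 / (f1 a b r)\<^sup>2) * u r"

definition test_functions :: "real \<Rightarrow> (real \<Rightarrow> complex) set" where
  "test_functions a = {\<phi>.
     (\<forall>n r. ((d_r ^^ n) \<phi>) differentiable (at r)) \<and>
     (\<exists>c d. - 1 / a < c \<and> (\<forall>r. r \<notin> {c..d} \<longrightarrow> \<phi> r = 0))}"

text \<open>
  The Friedrichs extension starting from smooth functions compactly supported in
  \<open>(-1/a, \<infinity>)\<close>. The matching condition that \<open>u\<close> and \<open>u'\<close> are continuous
  at \<open>r = 0\<close> is contained in this: the test functions do not have to vanish near \<open>0\<close>, so that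
  for \<open>u\<close> in the domain of the adjoint both \<open>u\<close> and \<open>f1 u'\<close> are locally absolutely continuous.
\<close>

definition P1_graph ::
  "real \<Rightarrow> real \<Rightarrow> int \<Rightarrow> (real \<Rightarrow> complex) \<Rightarrow> (real \<Rightarrow> complex) \<Rightarrow> bool" where
  "P1_graph a b m = friedrichs_graph (radial_measure a b) (test_functions a) (P1 a b m)"


section \<open>Resolvent kernel and resonances\<close>

text \<open>
  \<open>z\<close> is the spectral parameter, usually written \<open>\<lambda>\<close>.
  The equation \<open>(P\<^sub>1(m) - z\<^sup>2) u = v\<close> is written as \<open>P\<^sub>1(m) u = v + z\<^sup>2 u\<close>. An integral kernel
  is a priori determined only almost everywhere; continuity makes its values at points
  meaningful.
\<close>

definition is_resolvent_kernel ::
  "real \<Rightarrow> real \<Rightarrow> int \<Rightarrow> complex \<Rightarrow> (real \<Rightarrow> real \<Rightarrow> complex) \<Rightarrow> bool" where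
  "is_resolvent_kernel a b m z R \<longleftrightarrow>
     continuous_on ({- 1 / a<..} \<times> {- 1 / a<..}) (\<lambda>(r, r'). R r r') \<and>
     (\<forall>v \<in> L2_space (radial_measure a b).
        (\<forall>r > - 1 / a. set_integrable lborel {- 1 / a<..} (\<lambda>r'. R r r' * v r')) \<and>
        (let u = (\<lambda>r. LBINT r':{- 1 / a<..}. R r r' * v r')
         in P1_graph a b m u (\<lambda>r. v r + z\<^sup>2 * u r)))"

definition is_continued_resolvent_kernel ::
  "real \<Rightarrow> real \<Rightarrow> int \<Rightarrow> (complex \<Rightarrow> real \<Rightarrow> real \<Rightarrow> complex) \<Rightarrow> bool" where
  "is_continued_resolvent_kernel a b m K \<longleftrightarrow>
     (\<forall>z. Im z > 0 \<longrightarrow> is_resolvent_kernel a b m z (K z)) \<and>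
     (\<forall>r > - 1 / a. \<forall>r' > - 1 / a.
        (\<lambda>z. K z r r') meromorphic_on {z. Im z > 0 \<or> Re z > \<bar>b\<bar> / 2})"

text \<open>
  By the identity theorem the poles do not depend on the choice of \<open>K\<close>.
\<close>

definition resonances :: "real \<Rightarrow> real \<Rightarrow> int \<Rightarrow> complex set" where
  "resonances a b m = {z. Re z > \<bar>b\<bar> / 2 \<and>
     (\<exists>K. is_continued_resolvent_kernel a b m K \<and>
        (\<exists>r > - 1 / a. \<exists>r' > - 1 / a. is_pole (\<lambda>w. K w r r') z))}"

end

theory Submission
 imports Defs "HOL-Real_Asymp.Real_Asymp"
begin

text \<open>
 On the cone the radial equation is Bessel's equation in \<open>z (1 + a r) / a\<close>; on the funnel it becomes
 \<open>y'' = (\<beta>\<^sup>2/4 - z\<^sup>2 + m\<^sup>2 e\<^sup>-\<^sup>2\<^sup>\<beta>\<^sup>r) y\<close> with \<open>\<beta> = - b\<close>. On either side the solution recessive at the end is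
 a \<open>\<^sub>0F\<^sub>1\<close> series, holomorphic in \<open>z\<close>. With \<open>W\<close> the Wronskian of the two solutions, Green's kernel \<open>f(r') \<phi>(min) \<psi>(max) / W\<close> is
 the resolvent kernel for \<open>Im z > 0\<close>: an energy estimate puts the solution into the form domain for data of compact
 support, and the general case follows by density. A continuous kernel is unique, hence
 the resonances are the zeros of \<open>W\<close>.

 As \<open>Re z \<rightarrow> \<infinity>\<close>, the Bessel solution is a combination, with nonzero coefficients because it is real, of two
 solutions \<open>e\<^sup>\<plusminus>\<^sup>i\<^sup>\<zeta>(1 + o(1))\<close>, \<open>\<zeta> = z/a\<close>, uniformly in a half-plane, while the funnel solution behaves like \<open>e\<^sup>i\<^sup>\<sigma>\<^sup>r\<close>
 with \<open>\<sigma> = z + O(1/z)\<close>. The kink of \<open>f\<close> at \<open>0\<close> reflects a fraction of order \<open>z\<^sup>-\<^sup>1\<close> of the incoming wave; if \<open>a + b = 0\<close> only the jump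
 of \<open>f''\<close> is left and the fraction is of order \<open>z\<^sup>-\<^sup>2\<close>. So \<open>W = 0\<close> reads \<open>e\<^sup>2\<^sup>i\<^sup>z\<^sup>/\<^sup>a = C z\<^sup>j (1 + o(1))\<close>, and taking logarithms gives one zero
 at bounded distance from each \<open>\<pi> a k - (i j a / 2) log k\<close>.
\<close>

text \<open>The zeros drift to depth of order log k below the real axis, so the asymptotics must
  hold in a half-plane Re z > X with no bound on Im z. This is why the oscillating solutions are
  built by integration along horizontal rays: for purely imaginary c the modulus of exp (c w) is
  constant there, while the forcing decays like |w|^-4. In logarithmic form the equation for the
  zeros is a perturbation of the identity with small Lipschitz constant, so Banach's theorem,
  applied once per integer, replaces a contour count. When a + b = 0, the exponent 2 rests on an
  exact cancellation: the m^2 contributions of the cone and of the funnel annul each other, and z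
  times the coefficient of the mode exp (i z / a) tends to i a^2 / 4, which is not 0. The condition
  m > 0 also carries the approximation by test functions at the cone point: the cutoffs have
  derivatives as large as 1 / distance to the tip, and their squares are absorbed by the term m^2 /
  f^2 of the quadratic form.\<close>

lemma holomorphic_on_local:
 assumes "\<And>z. z \<in> S \<Longrightarrow> \<exists>U. open U \<and> z \<in> U \<and> f holomorphic_on U"
 shows "f holomorphic_on S" unfolding holomorphic_on_def
proof
 fix z assume "z \<in> S"
 then obtain U where "open U" "z \<in> U" "f holomorphic_on U" using assms by blast
 then have "f field_differentiable at z" using holomorphic_on_imp_differentiable_at by blast
 then show "f field_differentiable at z within S" using field_differentiable_at_within by blast
qed

text \<open>Coefficients and argument both vary with the parameter, so facts about one fixed power
  series do not suffice; the majorant \<open>M\<close>, uniform on \<open>U\<close>, makes the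
  holomorphic partial sums converge uniformly.\<close>

lemma holomorphic_power_series_param:
 fixes c :: "nat \<Rightarrow> complex \<Rightarrow> complex"
 assumes U: "open U" and c: "\<And>k. c k holomorphic_on U" and x: "x holomorphic_on U"
  and bd: "\<And>k z. z \<in> U \<Longrightarrow> cmod (c k z * x z ^ k) \<le> M k" and M: "summable M"
 shows "(\<lambda>z. eval_fps (Abs_fps (\<lambda>k. c k z)) (x z)) holomorphic_on U"
proof -
 have ul: "uniform_limit U (\<lambda>n z. \<Sum>k<n. c k z * x z ^ k) (\<lambda>z. \<Sum>k. c k z * x z ^ k) sequentially"
  by (rule Weierstrass_m_test[OF bd M])
 have "(\<lambda>z. \<Sum>k. c k z * x z ^ k) holomorphic_on U"
 proof (rule holomorphic_uniform_sequence[OF U])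
  show "(\<lambda>z. \<Sum>k<n. c k z * x z ^ k) holomorphic_on U" for n by (intro holomorphic_intros c x)
  fix z assume "z \<in> U"
  then obtain d where "d > 0" "cball z d \<subseteq> U" using U open_contains_cball by blast
  then show "\<exists>d>0. cball z d \<subseteq> U \<and> uniform_limit (cball z d) (\<lambda>n z. \<Sum>k<n. c k z * x z ^ k) (\<lambda>z. \<Sum>k. c k z * x z ^ k) sequentially"
   using uniform_limit_on_subset[OF ul] by blast
 qed
 then show ?thesis by (simp add: eval_fps_def)
qed

section \<open>Confluent hypergeometric limit function\<close>

text \<open>The hypergeometric series 0F1(; B; x). For \<open>B\<close> = \<nu> + 1 and x = - s^2 /
  4 it is the Bessel function of order \<nu> up to a constant and a power of s.\<close>

definition hyp01_fps :: "complex \<Rightarrow> complex fps" where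
 "hyp01_fps B = Abs_fps (\<lambda>k. 1 / (fact k * pochhammer B k))"

definition hyp01 :: "complex \<Rightarrow> complex \<Rightarrow> complex" where
 "hyp01 B x = eval_fps (hyp01_fps B) x"

lemma pochhammer_norm_ge:
 fixes B :: complex
 assumes "\<And>k. cmod (B + of_nat k) \<ge> d" "d \<ge> 0"
 shows "cmod (pochhammer B k) \<ge> d ^ k"
proof (induction k)
 case (Suc k)
 then show ?case using assms by (simp add: pochhammer_Suc norm_mult mult.commute[of d] mult_mono)
qed auto

text \<open>The number \<open>d\<close> bounds the distance of \<open>B\<close> from the poles 0,
  -1, -2, ... from below. Each factor of the Pochhammer symbol is at least \<open>d\<close> in
  modulus, which leaves the exponential series as majorant.\<close>

lemma hyp01_coeff_bound:
 assumes d: "\<And>k. cmod (B + of_nat k) \<ge> d" "d > 0"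
 shows "cmod (fps_nth (hyp01_fps B) k * x ^ k) \<le> (cmod x / d) ^ k / fact k"
proof -
 have p: "cmod (pochhammer B k) \<ge> d ^ k" using pochhammer_norm_ge[OF d(1)] d(2) by auto
 have "cmod (fps_nth (hyp01_fps B) k * x ^ k) = cmod x ^ k / (fact k * cmod (pochhammer B k))"
  by (simp add: hyp01_fps_def norm_divide norm_mult norm_power)
 also have "\<dots> \<le> cmod x ^ k / (fact k * d ^ k)"
 proof -
  have "0 < d ^ k" using d(2) by simp
  then have "0 < cmod (pochhammer B k)" using p by linarith
  then show ?thesis using p \<open>0 < d ^ k\<close> by (intro divide_left_mono mult_left_mono mult_pos_pos) auto
 qed
 also have "\<dots> = (cmod x / d) ^ k / fact k" by (simp add: power_divide)
 finally show ?thesis .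
qed

lemma summable_exp_real: "summable (\<lambda>k. (x::real) ^ k / fact k)" using summable_exp[of x] by (simp add: divide_inverse mult.commute)

lemma hyp01_conv_radius:
 assumes d: "\<And>k. cmod (B + of_nat k) \<ge> d" "d > 0"
 shows "fps_conv_radius (hyp01_fps B) = \<infinity>"
proof -
 have s: "summable (\<lambda>k. fps_nth (hyp01_fps B) k * of_real x ^ k)" for x :: real by (rule summable_comparison_test'[OF summable_exp_real])
    (rule hyp01_coeff_bound[OF d])
 have "conv_radius (fps_nth (hyp01_fps B)) \<ge> \<infinity>"
 proof (rule conv_radius_geI_ex)
  show "\<exists>z. norm z = r \<and> summable (\<lambda>n. fps_nth (hyp01_fps B) n * z ^ n)" if "0 < r" for r
   using s[of r] that by (intro exI[of _ "of_real r"]) auto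
 qed
 then show ?thesis by (simp add: fps_conv_radius_def)
qed

lemma shift_norm_ge:
 fixes B :: complex
 assumes "\<And>k. cmod (B + of_nat k) \<ge> d"
 shows "cmod (B + 1 + of_nat k) \<ge> d" "cmod (B + 2 + of_nat k) \<ge> d"
 using assms[of "Suc k"] assms[of "Suc (Suc k)"] by (simp_all add: algebra_simps)

lemma hyp01_holomorphic:
 assumes U: "open U" and B: "B holomorphic_on U" and x: "x holomorphic_on U"
  and d: "\<And>z. z \<in> U \<Longrightarrow> \<exists>V d. open V \<and> z \<in> V \<and> d > 0 \<and> (\<forall>w\<in>V. \<forall>k. cmod (B w + of_nat k) \<ge> d)"
 shows "(\<lambda>z. hyp01 (B z) (x z)) holomorphic_on U"
proof (rule holomorphic_on_local)
 fix z assume z: "z \<in> U"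
 obtain V d where V: "open V" "z \<in> V" "d > 0" "\<forall>w\<in>V. \<forall>k. cmod (B w + of_nat k) \<ge> d" using d[OF z] by blast
 \<comment> \<open>A neighbourhood on which one lower bound \<open>d\<close> and one upper bound for
   \<open>x\<close> serve all points, so that a single exponential series majorises.\<close>
 define W where "W = U \<inter> V \<inter> {w \<in> U. cmod (x w) < cmod (x z) + 1}"
 have cx: "continuous_on U (\<lambda>w. cmod (x w))" using x holomorphic_on_imp_continuous_on continuous_on_norm by blast
 have "open (U \<inter> (\<lambda>w. cmod (x w)) -` {..<cmod (x z) + 1})" by (rule continuous_open_preimage[OF cx U]) simp
 also have "U \<inter> (\<lambda>w. cmod (x w)) -` {..<cmod (x z) + 1} = {w \<in> U. cmod (x w) < cmod (x z) + 1}" by blast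
 finally have W: "open W" "z \<in> W" "W \<subseteq> U" using U V(1,2) z unfolding W_def by (blast intro: open_Int, simp, blast)
 have WV: "cmod (B w + of_nat k) \<ge> d" "cmod (x w) \<le> cmod (x z) + 1" if "w \<in> W" for w k
 proof -
  have "w \<in> V" "cmod (x w) < cmod (x z) + 1" using that unfolding W_def by blast+
  then show "cmod (B w + of_nat k) \<ge> d" "cmod (x w) \<le> cmod (x z) + 1" using V(4) by auto
 qed
 have nz: "pochhammer (B w) k \<noteq> 0" if "w \<in> W" for w k
 proof -
  have "cmod (pochhammer (B w) k) \<ge> d ^ k" using WV(1)[OF that] V(3) by (intro pochhammer_norm_ge) auto
  moreover have "d ^ k > 0" using V by simp
  ultimately show ?thesis by auto
 qed
 have "(\<lambda>z. eval_fps (Abs_fps (\<lambda>k. 1 / (fact k * pochhammer (B z) k))) (x z)) holomorphic_on W"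
 proof (rule holomorphic_power_series_param[where M = "\<lambda>k. ((cmod (x z) + 1) / d) ^ k / fact k"])
  show "open W" by fact
  have BW: "B holomorphic_on W" using B W(3) holomorphic_on_subset by blast
  show "(\<lambda>z. 1 / (fact k * pochhammer (B z) k)) holomorphic_on W" for k using nz BW by (intro holomorphic_intros) auto
  show "x holomorphic_on W" using x W(3) holomorphic_on_subset by blast
  fix k w assume w: "w \<in> W"
  have "cmod (1 / (fact k * pochhammer (B w) k) * x w ^ k) \<le> (cmod (x w) / d) ^ k / fact k"
   using hyp01_coeff_bound[OF WV(1)[OF w] V(3), of k "x w"] by (simp add: hyp01_fps_def)
  also have "\<dots> \<le> ((cmod (x z) + 1) / d) ^ k / fact k" using WV(2)[OF w] V(3) by (intro divide_right_mono power_mono) auto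
  finally show "cmod (1 / (fact k * pochhammer (B w) k) * x w ^ k) \<le> ((cmod (x z) + 1) / d) ^ k / fact k" .
 qed (rule summable_exp_real)
 then have "(\<lambda>z. hyp01 (B z) (x z)) holomorphic_on W" unfolding hyp01_def hyp01_fps_def .
 then show "\<exists>U. open U \<and> z \<in> U \<and> (\<lambda>z. hyp01 (B z) (x z)) holomorphic_on U" using W(1,2) by blast
qed

lemma hyp01_deriv:
 assumes d: "\<And>k. cmod (B + of_nat k) \<ge> d" "d > 0"
 shows "(hyp01 B has_field_derivative hyp01 (B + 1) x / B) (at x)"
proof -
 have B: "B \<noteq> 0" using d(1)[of 0] d(2) by auto
 have e: "fps_deriv (hyp01_fps B) = fps_const (1 / B) * hyp01_fps (B + 1)"
 proof (rule fps_ext)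
  fix n
  have "fps_nth (fps_deriv (hyp01_fps B)) n = of_nat (Suc n) * (1 / (of_nat (Suc n) * fact n * (B * pochhammer (B + 1) n)))"
   by (simp only: fps_deriv_nth hyp01_fps_def fps_nth_Abs_fps pochhammer_rec fact_Suc Suc_eq_plus1[symmetric])
  also have "\<dots> = 1 / B * (1 / (fact n * pochhammer (B + 1) n))" by (simp add: mult_ac del: of_nat_Suc)
  finally show "fps_nth (fps_deriv (hyp01_fps B)) n = fps_nth (fps_const (1 / B) * hyp01_fps (B + 1)) n" by (simp add: hyp01_fps_def)
 qed
 have "(eval_fps (hyp01_fps B) has_field_derivative eval_fps (fps_deriv (hyp01_fps B)) x) (at x)"
  using hyp01_conv_radius[OF d] by (intro has_field_derivative_eval_fps) auto
 moreover have "fps_conv_radius (hyp01_fps (B + 1)) = \<infinity>" using shift_norm_ge(1)[OF d(1)] d(2) by (rule hyp01_conv_radius)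
 then have "eval_fps (fps_deriv (hyp01_fps B)) x = hyp01 (B + 1) x / B" by (simp add: e hyp01_def eval_fps_mult)
 ultimately show ?thesis by (simp add: hyp01_def[abs_def])
qed

text \<open>Since differentiation raises \<open>B\<close> by 1, this three-term relation is the
  differential equation of 0F1 in another form. It closes the computation of the second derivative
  in \<open>dec_sol_deriv\<close>.\<close>

lemma hyp01_contiguous:
 assumes d: "\<And>k. cmod (B + of_nat k) \<ge> d" "d > 0"
 shows "hyp01 B x = hyp01 (B + 1) x + x / (B * (B + 1)) * hyp01 (B + 2) x"
proof -
 have nz: "B + of_nat k \<noteq> 0" for k using d(1)[of k] d(2) by auto
 have B: "B \<noteq> 0" "B + 1 \<noteq> 0" using nz[of 0] nz[of 1] by auto
 have pnz: "pochhammer (B + 2) k \<noteq> 0" for k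
 proof -
  have "0 < d ^ k" using d(2) by simp
  then have "0 < cmod (pochhammer (B + 2) k)" using pochhammer_norm_ge[OF shift_norm_ge(2)[OF d(1)], of k] d(2) by linarith
  then show ?thesis by auto
 qed
 define c where "c = 1 / (B * (B + 1))"
 have e: "hyp01_fps B = hyp01_fps (B + 1) + fps_X * (fps_const c * hyp01_fps (B + 2))"
 proof (rule fps_ext)
  fix k
  show "fps_nth (hyp01_fps B) k = fps_nth (hyp01_fps (B + 1) + fps_X * (fps_const c * hyp01_fps (B + 2))) k"
  proof (cases k)
   case 0 then show ?thesis by (simp add: hyp01_fps_def)
  next
   case (Suc n)
   define P where "P = pochhammer (B + 2) n"
   define s where "s = (of_nat (Suc n) :: complex)"
   define Fn where "Fn = (fact n :: complex)"
   have r2: "pochhammer (B + 1) (Suc n) = (B + 1) * P" by (simp only: pochhammer_rec[of "B + 1"] add.assoc one_add_one P_def)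
   have r1: "pochhammer B (Suc n) = B * ((B + 1) * P) / (B + s)"
   proof -
    have "(B + s) * pochhammer B (Suc n) = B * ((B + 1) * P)"
     using pochhammer_rec'[of B "Suc n"] unfolding pochhammer_rec[of B "Suc n"] r2 s_def by (rule sym)
    moreover have "B + s \<noteq> 0" unfolding s_def by (rule nz)
    ultimately show ?thesis by (metis nonzero_mult_div_cancel_left)
   qed
   have nzs: "P \<noteq> 0" "Fn \<noteq> 0" "s \<noteq> 0" "B + s \<noteq> 0"
    unfolding P_def Fn_def s_def by (rule pnz, rule fact_nonzero, rule of_nat_neq_0, rule nz)
   have aux: "1 / (s * Fn * (B * (C * P) / (B + s))) = 1 / (s * Fn * (C * P)) + 1 / (B * C) * (1 / (Fn * P))"
    for C
   proof -
    have "1 / (s * Fn * (B * (C * P) / (B + s))) = (B + s) / (s * Fn * B * C * P)" by (simp add: mult_ac)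
    also have "\<dots> = B / (s * Fn * B * C * P) + s / (s * Fn * B * C * P)" by (rule add_divide_distrib)
    also have "B / (s * Fn * B * C * P) = 1 / (s * Fn * (C * P))" using B(1) by (simp add: mult_ac)
    also have "s / (s * Fn * B * C * P) = 1 / (B * C) * (1 / (Fn * P))" using nzs by (simp add: mult_ac)
    finally show ?thesis .
   qed
   have "fps_nth (hyp01_fps B) (Suc n) = 1 / (s * Fn * (B * ((B + 1) * P) / (B + s)))"
    by (simp only: hyp01_fps_def fps_nth_Abs_fps r1 fact_Suc s_def Fn_def of_nat_fact of_nat_mult)
   also have "\<dots> = 1 / (s * Fn * ((B + 1) * P)) + c * (1 / (Fn * P))" unfolding c_def by (rule aux)
   also have "1 / (s * Fn * ((B + 1) * P)) = fps_nth (hyp01_fps (B + 1)) (Suc n)"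
    by (simp only: hyp01_fps_def fps_nth_Abs_fps r2 fact_Suc s_def Fn_def of_nat_fact of_nat_mult)
   also have "c * (1 / (Fn * P)) = fps_nth (fps_X * (fps_const c * hyp01_fps (B + 2))) (Suc n)" by (simp add: hyp01_fps_def P_def Fn_def)
   finally show ?thesis unfolding Suc fps_add_nth .
  qed
 qed
 have R: "fps_conv_radius (hyp01_fps (B + 1)) = \<infinity>" "fps_conv_radius (hyp01_fps (B + 2)) = \<infinity>"
  using hyp01_conv_radius[OF shift_norm_ge(1)[OF d(1)] d(2)]
   hyp01_conv_radius[OF shift_norm_ge(2)[OF d(1)] d(2)] by auto
 have c: "c \<noteq> 0" using B by (simp add: c_def)
 have R2: "fps_conv_radius (fps_const c * hyp01_fps (B + 2)) = \<infinity>" using c R by (simp add: fps_conv_radius_cmult_left)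
 then have R3: "fps_conv_radius (fps_X * (fps_const c * hyp01_fps (B + 2))) = \<infinity>"
  using fps_conv_radius_mult[of fps_X "fps_const c * hyp01_fps (B + 2)"] by simp
 have "eval_fps (hyp01_fps B) x = hyp01 (B + 1) x + eval_fps (fps_X * (fps_const c * hyp01_fps (B + 2))) x"
  unfolding e hyp01_def using R R3 by (subst eval_fps_add) auto
 also have "eval_fps (fps_X * (fps_const c * hyp01_fps (B + 2))) x = x * (c * hyp01 (B + 2) x)" using R R2 by (simp add: hyp01_def eval_fps_mult)
 finally show ?thesis by (simp add: hyp01_def c_def)
qed

section \<open>The equation \<open>y'' = (A + B e\<^sup>-\<^sup>c\<^sup>t) y\<close>\<close>

text \<open>Taylor coefficients at 0 of the solution of y'' = q y with Cauchy data
  \<open>y0\<close>, \<open>y1\<close>. The type is any normed field so that the same recursion, run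
  over the reals with absolute values, serves as a majorant.\<close>

fun ivp_coeff :: "(nat \<Rightarrow> 'a::real_normed_field) \<Rightarrow> 'a \<Rightarrow> 'a \<Rightarrow> nat \<Rightarrow> 'a" where
 "ivp_coeff q y0 y1 0 = y0"
| "ivp_coeff q y0 y1 (Suc 0) = y1"
| "ivp_coeff q y0 y1 (Suc (Suc n)) =
   (\<Sum>i\<le>n. q i * ivp_coeff q y0 y1 (n - i)) / of_nat ((n + 1) * (n + 2))"

lemma ivp_coeff_norm_le:
 fixes q :: "nat \<Rightarrow> 'a::real_normed_field"
 assumes "\<And>k. norm (q k) \<le> q' k" "norm y0 \<le> y0'" "norm y1 \<le> y1'"
 shows "norm (ivp_coeff q y0 y1 n) \<le> ivp_coeff q' y0' y1' n" using assms
proof (induction q y0 y1 n rule: ivp_coeff.induct)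
 case (3 q y0 y1 n)
 have "norm (\<Sum>i\<le>n. q i * ivp_coeff q y0 y1 (n - i)) \<le> (\<Sum>i\<le>n. q' i * ivp_coeff q' y0' y1' (n - i))"
  using 3 by (intro sum_norm_le order_trans[OF norm_mult_ineq] mult_mono) (auto intro: order_trans[OF norm_ge_zero])
 then show ?case by (simp only: ivp_coeff.simps norm_divide norm_of_nat) (intro divide_right_mono, auto)
qed auto

text \<open>Once the divisor (n + 1)(n + 2) outweighs \<rho>^2 S, with S the sum of the potential's
  series at \<rho>, the scaled coefficients can no longer exceed the maximum of the earlier
  ones.\<close>

lemma ivp_coeff_growth:
 fixes q :: "nat \<Rightarrow> real"
 assumes q: "\<And>k. q k \<ge> 0" and y: "y0 \<ge> 0" "y1 \<ge> 0" and \<rho>: "\<rho> > 0"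
  and s: "summable (\<lambda>k. q k * \<rho> ^ k)"
 obtains M where "\<And>n. ivp_coeff q y0 y1 n * \<rho> ^ n \<le> M"
proof -
 define S where "S = (\<Sum>k. q k * \<rho> ^ k)"
 define a where "a = ivp_coeff q y0 y1"
 obtain N :: nat where N: "\<rho>^2 * S \<le> real N" using real_arch_simple by blast
 define M where "M = Max ((\<lambda>n. a n * \<rho> ^ n) ` {..Suc N})"
 have a0: "a n \<ge> 0" for n
 proof (induction n rule: less_induct)
  case (less n)
  show ?case
  proof (cases "n < 2")
   case True
   then have "n = 0 \<or> n = Suc 0" by auto
   then show ?thesis using y by (auto simp: a_def)
  next
   case False
   define k where "k = n - 2"
   have k: "n = Suc (Suc k)" using False by (simp add: k_def)
   show ?thesis unfolding k a_def ivp_coeff.simps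
    using less q by (intro divide_nonneg_nonneg sum_nonneg mult_nonneg_nonneg of_nat_0_le_iff) (auto simp: a_def k)
  qed
 qed
 have M: "a n * \<rho> ^ n \<le> M" if "n \<le> Suc N" for n unfolding M_def using that by (intro Max_ge) auto
 have M0: "M \<ge> 0" using M[of 0] a0[of 0] by simp
 have "a n * \<rho> ^ n \<le> M" for n
 proof (induction n rule: less_induct)
  case (less n)
  show ?case
  proof (cases "n \<le> Suc N")
   case False
   define k where "k = n - 2"
   have k: "n = Suc (Suc k)" "k \<ge> N" using False by (auto simp: k_def)
   have "(\<Sum>i\<le>k. q i * a (k - i)) * \<rho> ^ k = (\<Sum>i\<le>k. (q i * \<rho> ^ i) * (a (k - i) * \<rho> ^ (k - i)))"
    by (subst sum_distrib_right, rule sum.cong) (auto simp: power_add[symmetric] mult_ac)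
   also have "\<dots> \<le> (\<Sum>i\<le>k. (q i * \<rho> ^ i) * M)" using less k q \<rho> by (intro sum_mono mult_left_mono) auto
   also have "\<dots> = (\<Sum>i\<le>k. q i * \<rho> ^ i) * M" by (simp add: sum_distrib_right)
   also have "\<dots> \<le> S * M" unfolding S_def using M0 q \<rho> s by (intro mult_right_mono sum_le_suminf) auto
   finally have 1: "(\<Sum>i\<le>k. q i * a (k - i)) * \<rho> ^ k \<le> S * M" .
   define d where "d = real ((k + 1) * (k + 2))"
   have "real N \<le> real k" using k by simp
   moreover have "real k \<le> d" unfolding d_def by (simp only: of_nat_le_iff) simp
   ultimately have d2: "\<rho>^2 * S \<le> d" using N by linarith
   have d1: "d > 0" unfolding d_def by (simp only: of_nat_0_less_iff) simp
   note d = d1 d2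
   have "a n * \<rho> ^ n = \<rho>^2 * ((\<Sum>i\<le>k. q i * a (k - i)) * \<rho> ^ k) / d" by (simp add: a_def k(1) d_def power2_eq_square)
   also have "\<dots> \<le> \<rho>^2 * (S * M) / d" using 1 d by (intro divide_right_mono mult_left_mono) auto
   also have "\<dots> = (\<rho>^2 * S) * M / d" by simp
   also have "\<dots> \<le> d * M / d" using d M0 by (intro divide_right_mono mult_right_mono) auto
   also have "\<dots> = M" using d by simp
   finally show ?thesis .
  qed (use M in auto)
 qed
 then show ?thesis using that a_def by blast
qed

definition exp_pot :: "complex \<Rightarrow> complex \<Rightarrow> complex \<Rightarrow> complex fps" where
 "exp_pot A B c = fps_const A + fps_const B * fps_exp (- c)"

definition ivp_fps :: "complex \<Rightarrow> complex \<Rightarrow> complex \<Rightarrow> complex \<Rightarrow> complex \<Rightarrow> complex fps" where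
 "ivp_fps A B c y0 y1 = Abs_fps (ivp_coeff (fps_nth (exp_pot A B c)) y0 y1)"

definition ivp_sol :: "complex \<Rightarrow> complex \<Rightarrow> complex \<Rightarrow> complex \<Rightarrow> complex \<Rightarrow> complex \<Rightarrow> complex" where
 "ivp_sol A B c y0 y1 x = eval_fps (ivp_fps A B c y0 y1) x"

definition ivp_sol' :: "complex \<Rightarrow> complex \<Rightarrow> complex \<Rightarrow> complex \<Rightarrow> complex \<Rightarrow> complex \<Rightarrow> complex" where
 "ivp_sol' A B c y0 y1 x = eval_fps (fps_deriv (ivp_fps A B c y0 y1)) x"

text \<open>The bound \<open>M\<close> depends on the data only through \<open>L\<close>. This
  uniformity yields holomorphic dependence on parameters as well as an infinite radius of
  convergence.\<close>

lemma ivp_coeff_bound: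
 assumes \<rho>: "\<rho> > 0"
 obtains M where "\<And>n A B y0 y1. cmod A \<le> L \<Longrightarrow> cmod B \<le> L \<Longrightarrow> cmod y0 \<le> L \<Longrightarrow> cmod y1 \<le> L \<Longrightarrow>
   cmod (fps_nth (ivp_fps A B c y0 y1) n) * \<rho> ^ n \<le> M"
proof (cases "L \<ge> 0")
 case True
 \<comment> \<open>Majorises the Taylor coefficients of A + B exp (- c x); the constant
   \<open>A\<close> contributes at index 0 only.\<close>
 define q where "q = (\<lambda>k. (if k = 0 then L else 0) + L * (cmod c ^ k / fact k))"
 have "summable (\<lambda>k. (if k = 0 then L else 0) + L * ((cmod c * \<rho>) ^ k / fact k))"
  by (intro summable_add summable_mult summable_exp_real summable_finite[of "{0}"]) auto
 also have "(\<lambda>k. (if k = 0 then L else 0) + L * ((cmod c * \<rho>) ^ k / fact k)) = (\<lambda>k. q k * \<rho> ^ k)"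
  by (rule ext) (simp add: q_def power_mult_distrib algebra_simps)
 finally have s: "summable (\<lambda>k. q k * \<rho> ^ k)" .
 have q0: "q k \<ge> 0" for k using True by (simp add: q_def)
 obtain M where M: "\<And>n. ivp_coeff q L L n * \<rho> ^ n \<le> M" using ivp_coeff_growth[OF q0 True True \<rho> s] by blast
 have "cmod (fps_nth (ivp_fps A B c y0 y1) n) * \<rho> ^ n \<le> M"
  if "cmod A \<le> L" "cmod B \<le> L" "cmod y0 \<le> L" "cmod y1 \<le> L" for n A B y0 y1
 proof -
  have "cmod (fps_nth (exp_pot A B c) k) \<le> q k" for k unfolding exp_pot_def q_def fps_add_nth using that True
   by (intro order_trans[OF norm_triangle_ineq] add_mono)
     (auto simp: norm_mult norm_divide norm_power intro!: divide_right_mono mult_right_mono)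
  then have "cmod (ivp_coeff (fps_nth (exp_pot A B c)) y0 y1 n) \<le> ivp_coeff q L L n" using that by (intro ivp_coeff_norm_le) auto
  then have "cmod (ivp_coeff (fps_nth (exp_pot A B c)) y0 y1 n) * \<rho> ^ n \<le> ivp_coeff q L L n * \<rho> ^ n"
   using \<rho> by (intro mult_right_mono) auto
  then show ?thesis using M[of n] unfolding ivp_fps_def fps_nth_Abs_fps by linarith
 qed
 then show ?thesis using that by blast
next
 case False
 have "\<not> cmod A \<le> L" for A using False norm_ge_zero[of A] by linarith
 then show ?thesis using that[of 0] by blast
qed

lemma ivp_fps_conv_radius: "fps_conv_radius (ivp_fps A B c y0 y1) = \<infinity>"
proof -
 have "conv_radius (fps_nth (ivp_fps A B c y0 y1)) \<ge> \<infinity>"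
 proof (rule conv_radius_geI_ex')
  fix r :: real assume r: "r > 0"
  define L where "L = cmod A + cmod B + cmod y0 + cmod y1"
  \<comment> \<open>The coefficients are bounded at twice the radius, so the terms at radius
    \<open>r\<close> decay like 2^-n.\<close>
  obtain M where M: "\<And>n. cmod (fps_nth (ivp_fps A B c y0 y1) n) * (2 * r) ^ n \<le> M"
  proof -
   have L: "cmod A \<le> L" "cmod B \<le> L" "cmod y0 \<le> L" "cmod y1 \<le> L" by (auto simp: L_def)
   have r2: "0 < 2 * r" using r by simp
   show ?thesis by (rule ivp_coeff_bound[OF r2, of L c]) (rule that, blast intro: L)
  qed
  have b: "cmod (fps_nth (ivp_fps A B c y0 y1) n * of_real r ^ n) \<le> M * (1 / 2) ^ n" for n
  proof -
   have "cmod (fps_nth (ivp_fps A B c y0 y1) n * of_real r ^ n)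
     = cmod (fps_nth (ivp_fps A B c y0 y1) n) * (2 * r) ^ n * (1 / 2) ^ n"
    using r by (simp add: norm_mult norm_power power_mult_distrib power_one_over)
   also have "\<dots> \<le> M * (1 / 2) ^ n" using M[of n] by (intro mult_right_mono) auto
   finally show ?thesis .
  qed
  then show "summable (\<lambda>n. fps_nth (ivp_fps A B c y0 y1) n * of_real r ^ n)"
   by (rule summable_comparison_test'[of "\<lambda>n. M * (1 / 2) ^ n", rotated])
     (rule summable_mult, rule summable_geometric, simp)
 qed
 then show ?thesis by (simp add: fps_conv_radius_def)
qed

lemma ivp_fps_ode: "fps_deriv (fps_deriv (ivp_fps A B c y0 y1)) = exp_pot A B c * ivp_fps A B c y0 y1"
proof (rule fps_ext)
 fix n
 have nz: "(of_nat ((n + 1) * (n + 2)) :: complex) \<noteq> 0" by (simp only: of_nat_eq_0_iff) simp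
 have "fps_nth (fps_deriv (fps_deriv (ivp_fps A B c y0 y1))) n =
   of_nat ((n + 1) * (n + 2)) * fps_nth (ivp_fps A B c y0 y1) (Suc (Suc n))" by (simp add: algebra_simps)
 also have "\<dots> = (\<Sum>i\<le>n. fps_nth (exp_pot A B c) i * fps_nth (ivp_fps A B c y0 y1) (n - i))"
  unfolding ivp_fps_def fps_nth_Abs_fps ivp_coeff.simps times_divide_eq_right by (rule nonzero_mult_div_cancel_left[OF nz])
 finally show "fps_nth (fps_deriv (fps_deriv (ivp_fps A B c y0 y1))) n = fps_nth (exp_pot A B c * ivp_fps A B c y0 y1) n"
  by (simp add: fps_mult_nth atLeast0AtMost)
qed

lemma exp_pot_conv_radius: "fps_conv_radius (exp_pot A B c) = \<infinity>" using fps_conv_radius_add[of "fps_const A" "fps_const B * fps_exp (- c)"]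
  fps_conv_radius_mult[of "fps_const B" "fps_exp (- c)"] by (simp add: exp_pot_def)

lemma eval_exp_pot: "eval_fps (exp_pot A B c) x = A + B * exp (- c * x)" using fps_conv_radius_mult[of "fps_const B" "fps_exp (- c)"]
 unfolding exp_pot_def by (subst eval_fps_add) (auto simp: eval_fps_mult)

lemma ivp_sol_0 [simp]: "ivp_sol A B c y0 y1 0 = y0" "ivp_sol' A B c y0 y1 0 = y1"
 by (simp_all add: ivp_sol_def ivp_sol'_def eval_fps_at_0 ivp_fps_def)

lemma ivp_sol_deriv:
 "(ivp_sol A B c y0 y1 has_field_derivative ivp_sol' A B c y0 y1 x) (at x)"
 using has_field_derivative_eval_fps[of x "ivp_fps A B c y0 y1" UNIV] ivp_fps_conv_radius[of A B c y0 y1]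
 by (simp add: ivp_sol_def[abs_def] ivp_sol'_def)

lemma ivp_sol'_deriv:
 "(ivp_sol' A B c y0 y1 has_field_derivative (A + B * exp (- c * x)) * ivp_sol A B c y0 y1 x) (at x)"
proof -
 have R: "fps_conv_radius (fps_deriv (ivp_fps A B c y0 y1)) = \<infinity>"
  using fps_conv_radius_deriv[of "ivp_fps A B c y0 y1"] ivp_fps_conv_radius[of A B c y0 y1] by simp
 have "eval_fps (fps_deriv (fps_deriv (ivp_fps A B c y0 y1))) x = (A + B * exp (- c * x)) * ivp_sol A B c y0 y1 x"
  by (simp add: ivp_fps_ode eval_fps_mult exp_pot_conv_radius ivp_fps_conv_radius eval_exp_pot ivp_sol_def)
 then show ?thesis using has_field_derivative_eval_fps[of x "fps_deriv (ivp_fps A B c y0 y1)" UNIV] R by (simp add: ivp_sol'_def[abs_def])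
qed

lemma continuous_locally_bounded:
 fixes f :: "complex \<Rightarrow> complex"
 assumes "open U" "continuous_on U f" "z \<in> U"
 obtains V where "open V" "z \<in> V" "V \<subseteq> U" "\<And>w. w \<in> V \<Longrightarrow> cmod (f w) \<le> cmod (f z) + 1"
proof -
 have "open (U \<inter> f -` ball (f z) 1)" by (rule continuous_open_preimage[OF assms(2,1)]) simp
 moreover have "cmod (f w) \<le> cmod (f z) + 1" if "w \<in> U \<inter> f -` ball (f z) 1" for w
  using that norm_triangle_ineq2[of "f w" "f z"] by (simp add: dist_norm norm_minus_commute)
 ultimately show ?thesis using that[of "U \<inter> f -` ball (f z) 1"] assms(3) by auto
qed

lemma ivp_sol_holomorphic:
 assumes U: "open U" and h: "A holomorphic_on U" "B holomorphic_on U" "y0 holomorphic_on U" "y1 holomorphic_on U"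
 shows "(\<lambda>z. ivp_sol (A z) (B z) c (y0 z) (y1 z) x) holomorphic_on U"
proof (rule holomorphic_on_local)
 fix z assume z: "z \<in> U"
 obtain V1 where V1: "open V1" "z \<in> V1" "V1 \<subseteq> U" "\<And>w. w \<in> V1 \<Longrightarrow> cmod (A w) \<le> cmod (A z) + 1"
  by (rule continuous_locally_bounded[OF U holomorphic_on_imp_continuous_on[OF h(1)] z], rule that)
 obtain V2 where V2: "open V2" "z \<in> V2" "V2 \<subseteq> U" "\<And>w. w \<in> V2 \<Longrightarrow> cmod (B w) \<le> cmod (B z) + 1"
  by (rule continuous_locally_bounded[OF U holomorphic_on_imp_continuous_on[OF h(2)] z], rule that)
 obtain V3 where V3: "open V3" "z \<in> V3" "V3 \<subseteq> U" "\<And>w. w \<in> V3 \<Longrightarrow> cmod (y0 w) \<le> cmod (y0 z) + 1"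
  by (rule continuous_locally_bounded[OF U holomorphic_on_imp_continuous_on[OF h(3)] z], rule that)
 obtain V4 where V4: "open V4" "z \<in> V4" "V4 \<subseteq> U" "\<And>w. w \<in> V4 \<Longrightarrow> cmod (y1 w) \<le> cmod (y1 z) + 1"
  by (rule continuous_locally_bounded[OF U holomorphic_on_imp_continuous_on[OF h(4)] z], rule that)
 define V where "V = V1 \<inter> V2 \<inter> V3 \<inter> V4"
 define L where "L = 1 + cmod (A z) + cmod (B z) + cmod (y0 z) + cmod (y1 z)"
 \<comment> \<open>At least twice |x|, which leaves a factor 2^-k for the summation at
   \<open>x\<close>.\<close>
 define \<rho> where "\<rho> = 2 * (cmod x + 1)"
 have V: "open V" "z \<in> V" "V \<subseteq> U" using V1 V2 V3 V4 by (auto simp: V_def)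
 have hV: "A holomorphic_on V" "B holomorphic_on V" "y0 holomorphic_on V" "y1 holomorphic_on V" using h V holomorphic_on_subset by blast+
 have LV: "cmod (A w) \<le> L" "cmod (B w) \<le> L" "cmod (y0 w) \<le> L" "cmod (y1 w) \<le> L" if "w \<in> V" for w
 proof -
  note n = norm_ge_zero[of "A z"] norm_ge_zero[of "B z"] norm_ge_zero[of "y0 z"] norm_ge_zero[of "y1 z"]
  have w: "w \<in> V1" "w \<in> V2" "w \<in> V3" "w \<in> V4" using that by (auto simp: V_def)
  show "cmod (A w) \<le> L" using V1(4)[OF w(1)] n unfolding L_def by linarith
  show "cmod (B w) \<le> L" using V2(4)[OF w(2)] n unfolding L_def by linarith
  show "cmod (y0 w) \<le> L" using V3(4)[OF w(3)] n unfolding L_def by linarith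
  show "cmod (y1 w) \<le> L" using V4(4)[OF w(4)] n unfolding L_def by linarith
 qed
 have \<rho>: "\<rho> > 0" by (simp add: \<rho>_def add_nonneg_pos)
 obtain M where M: "\<And>n w. w \<in> V \<Longrightarrow> cmod (fps_nth (ivp_fps (A w) (B w) c (y0 w) (y1 w)) n) * \<rho> ^ n \<le> M"
  by (rule ivp_coeff_bound[OF \<rho>, of L c]) (rule that, blast intro: LV)
 have coeff: "(\<lambda>w. ivp_coeff (fps_nth (exp_pot (A w) (B w) c)) (y0 w) (y1 w) n) holomorphic_on V" for n
 proof (induction n rule: less_induct)
  case (less n)
  show ?case
  proof (cases "n < 2")
   case True
   then have "n = 0 \<or> n = 1" by auto
   then show ?thesis using hV by auto
  next
   case False
   define k where "k = n - 2"
   have k: "n = Suc (Suc k)" using False by (simp add: k_def)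
   have "(\<lambda>w. fps_nth (exp_pot (A w) (B w) c) i) holomorphic_on V" for i
    unfolding exp_pot_def by (cases "i = 0") (auto intro!: holomorphic_intros hV)
   then show ?thesis unfolding k ivp_coeff.simps
   proof (intro holomorphic_on_divide holomorphic_on_sum holomorphic_on_mult holomorphic_on_const)
    show "(\<lambda>w. ivp_coeff (fps_nth (exp_pot (A w) (B w) c)) (y0 w) (y1 w) (k - i)) holomorphic_on V" for i by (rule less) (simp add: k)
    show "of_nat ((k + 1) * (k + 2)) \<noteq> (0 :: complex)" by (simp only: of_nat_eq_0_iff) simp
   qed
  qed
 qed
 have "(\<lambda>w. eval_fps (Abs_fps (\<lambda>k. ivp_coeff (fps_nth (exp_pot (A w) (B w) c)) (y0 w) (y1 w) k)) ((\<lambda>_. x) w)) holomorphic_on V"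
 proof (rule holomorphic_power_series_param[OF V(1) coeff, where M = "\<lambda>k. M * (1 / 2) ^ k"])
  fix k w assume w: "w \<in> V"
  have "cmod x \<le> \<rho> / 2" by (simp add: \<rho>_def)
  then have "cmod x ^ k \<le> (\<rho> / 2) ^ k" by (intro power_mono) auto
  then have "cmod (fps_nth (ivp_fps (A w) (B w) c (y0 w) (y1 w)) k) * cmod x ^ k
    \<le> cmod (fps_nth (ivp_fps (A w) (B w) c (y0 w) (y1 w)) k) * (\<rho> / 2) ^ k" by (intro mult_left_mono) auto
  also have "\<dots> = cmod (fps_nth (ivp_fps (A w) (B w) c (y0 w) (y1 w)) k) * \<rho> ^ k * (1 / 2) ^ k" by (simp add: power_divide)
  also have "\<dots> \<le> M * (1 / 2) ^ k" using M[OF w, of k] by (intro mult_right_mono) auto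
  finally show "cmod (ivp_coeff (fps_nth (exp_pot (A w) (B w) c)) (y0 w) (y1 w) k * x ^ k) \<le> M * (1 / 2) ^ k"
   by (simp add: ivp_fps_def norm_mult norm_power)
 qed (auto intro!: summable_mult summable_geometric)
 then show "\<exists>U. open U \<and> z \<in> U \<and> (\<lambda>z. ivp_sol (A z) (B z) c (y0 z) (y1 z) x) holomorphic_on U"
  using V unfolding ivp_sol_def ivp_fps_def by blast
qed

text \<open>For c > 0, the solution of y'' = (\<rho>^2 + B exp (- c t)) y for which exp (\<rho> t) y
  tends to 1 as t grows. Normalising at infinity keeps it holomorphic in \<rho> and \<open>B\<close>
  as long as 2 \<rho> / c + 1 avoids 0, -1, -2, ...\<close>

definition dec_sol :: "complex \<Rightarrow> complex \<Rightarrow> complex \<Rightarrow> complex \<Rightarrow> complex" where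
 "dec_sol \<rho> B c t = exp (- \<rho> * t) * hyp01 (2 * \<rho> / c + 1) (B / c^2 * exp (- c * t))"

definition dec_sol' :: "complex \<Rightarrow> complex \<Rightarrow> complex \<Rightarrow> complex \<Rightarrow> complex" where
 "dec_sol' \<rho> B c t = exp (- \<rho> * t) *
   (- \<rho> * hyp01 (2 * \<rho> / c + 1) (B / c^2 * exp (- c * t))
   - B / c * exp (- c * t) / (2 * \<rho> / c + 1) * hyp01 (2 * \<rho> / c + 2) (B / c^2 * exp (- c * t)))"

text \<open>The second derivative brings in the series with its parameter raised by 2; the
  contiguous relation trades it against the two lower ones.\<close>

lemma dec_sol_deriv:
 assumes d: "\<And>k. cmod (2 * \<rho> / c + 1 + of_nat k) \<ge> d" "d > 0" and c: "c \<noteq> 0"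
 shows "(dec_sol \<rho> B c has_field_derivative dec_sol' \<rho> B c t) (at t)" (is ?A)
  and "(dec_sol' \<rho> B c has_field_derivative (\<rho>^2 + B * exp (- c * t)) * dec_sol \<rho> B c t) (at t)" (is ?B)
proof -
 define b where "b = 2 * \<rho> / c + 1"
 have b: "b \<noteq> 0" "b + 1 \<noteq> 0" using d(1)[of 0] d(1)[of 1] d(2) by (auto simp: b_def)
 have db: "\<And>k. cmod (b + of_nat k) \<ge> d" using d(1) by (simp add: b_def)
 have b1: "2 * \<rho> / c + 1 = b" "2 * \<rho> / c + 2 = b + 1" by (simp_all add: b_def)
 note D1 = DERIV_chain2[OF hyp01_deriv[OF db d(2)]]
 note D2 = DERIV_chain2[OF hyp01_deriv[OF shift_norm_ge(1)[OF db] d(2)]]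
 define x where "x = (\<lambda>t. B / c^2 * exp (- c * t))"
 have x: "(x has_field_derivative - c * x t) (at t)" for t
 proof -
  define K where "K = B / c^2"
  show ?thesis unfolding x_def K_def[symmetric] by (auto intro!: derivative_eq_intros)
 qed
 have f: "dec_sol \<rho> B c = (\<lambda>t. exp (- \<rho> * t) * hyp01 b (x t))" by (rule ext) (simp add: dec_sol_def b1 x_def)
 have f': "dec_sol' \<rho> B c = (\<lambda>t. exp (- \<rho> * t) * (- \<rho> * hyp01 b (x t) - c / b * x t * hyp01 (b + 1) (x t)))"
  using c by (intro ext) (simp add: dec_sol'_def b1 x_def power2_eq_square)
 show ?A
  unfolding f f' by (rule derivative_eq_intros D1 x refl)+ (simp add: algebra_simps)
 have e: "c^2 * x t = B * exp (- c * t)" using c by (simp add: x_def)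
 have contig: "hyp01 b (x t) = hyp01 (b + 1) (x t) + x t / (b * (b + 1)) * hyp01 (b + 1 + 1) (x t)"
  using hyp01_contiguous[OF db d(2)] by (simp add: add.assoc)
 have r: "\<rho> = c * (b - 1) / 2" using c by (simp add: b_def)
 show ?B unfolding f f' e[symmetric]
 proof -
  define X where "X = x t"
  define E where "E = exp (- \<rho> * t)"
  define H where "H = hyp01 (b + 1) X"
  define H' where "H' = hyp01 (b + 1 + 1) X"
  define u where "u = inverse b"
  define v where "v = inverse (b + 1)"
  have cX: "hyp01 b X = H + X * (u * v) * H'" using contig by (simp add: X_def H_def H'_def u_def v_def divide_inverse)
  have ub: "b * u = 1" using b by (simp add: u_def)
  have rb: "2 * \<rho> = c * (b - 1)" using c by (simp add: b_def)
  have "((\<lambda>t. exp (- \<rho> * t) * (- \<rho> * hyp01 b (x t) - c / b * x t * hyp01 (b + 1) (x t)))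
    has_field_derivative
     (E * (- \<rho>)) * (- \<rho> * (H + X * (u * v) * H') - c * u * X * H)
     + (- \<rho> * (H * u * (- c * X)) - (c * u * (- c * X) * H + c * u * X * (H' * v * (- c * X)))) * E) (at t)" unfolding E_def
   by (rule derivative_eq_intros D1 D2 x refl)+
     (simp_all add: X_def[symmetric] cX H_def H'_def u_def v_def divide_inverse mult_ac)
  \<comment> \<open>With the reciprocals named, this is a polynomial identity modulo
    \<open>b u = 1\<close> and \<open>2 \<rho> = c (b - 1)\<close>.\<close>
  moreover have "(E * (- \<rho>)) * (- \<rho> * (H + X * (u * v) * H') - c * u * X * H)
     + (- \<rho> * (H * u * (- c * X)) - (c * u * (- c * X) * H + c * u * X * (H' * v * (- c * X)))) * E
    = (\<rho>^2 + c^2 * X) * (E * (H + X * (u * v) * H'))" using ub rb by algebra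
  moreover have "hyp01 b (x t) = H + X * (u * v) * H'" unfolding contig by (simp add: X_def H_def H'_def u_def v_def divide_inverse)
  ultimately show "((\<lambda>t. exp (- \<rho> * t) * (- \<rho> * hyp01 b (x t) - c / b * x t * hyp01 (b + 1) (x t)))
    has_field_derivative (\<rho>^2 + c^2 * x t) * (exp (- \<rho> * t) * hyp01 b (x t))) (at t)" by (simp only: X_def E_def)
 qed
qed

section \<open>Solutions of Jost type on a half-plane\<close>

text \<open>In the right half-plane the modulus of a sum with a positive number loses at most a
  factor sqrt 2. Its fourth power is the factor 4 in the estimates along horizontal rays.\<close>

lemma norm_add_real_ge:
 assumes "Re \<zeta> \<ge> 0" "s \<ge> 0"
 shows "cmod \<zeta> + s \<le> sqrt 2 * cmod (\<zeta> + of_real s)"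
proof -
 have "(cmod \<zeta> + s)^2 \<le> 2 * ((cmod \<zeta>)^2 + s^2)" using sum_squares_bound[of "cmod \<zeta>" s] by (simp add: power2_sum)
 also have "\<dots> \<le> 2 * (cmod (\<zeta> + of_real s))^2" using assms by (simp add: cmod_power2 power2_sum)
 also have "\<dots> = (sqrt 2 * cmod (\<zeta> + of_real s))^2" by (simp add: power_mult_distrib)
 finally show ?thesis by (rule power2_le_imp_le) simp
qed

text \<open>Mean value inequality along the ray, compared with a real primitive of 4 M / (R + s)^4,
  where R = |\<zeta>|.\<close>

lemma horizontal_increment:
 assumes \<zeta>: "Re \<zeta> \<ge> 0" "\<zeta> \<noteq> 0" and M: "M \<ge> 0" and s: "0 \<le> s1" "s1 \<le> s2"
  and D: "\<And>s. s \<ge> 0 \<Longrightarrow> (\<Phi> has_field_derivative \<phi> (\<zeta> + of_real s)) (at (\<zeta> + of_real s))"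
  and b: "\<And>s. s \<ge> 0 \<Longrightarrow> cmod (\<phi> (\<zeta> + of_real s)) \<le> M / cmod (\<zeta> + of_real s) ^ 4"
 shows "cmod (\<Phi> (\<zeta> + of_real s2) - \<Phi> (\<zeta> + of_real s1)) \<le> 4 * M / 3 / (cmod \<zeta> + s1) ^ 3"
proof (cases "s1 = s2")
 case True
 then show ?thesis using M s by simp
next
 case False
 define R where "R = cmod \<zeta>"
 have R: "R > 0" using \<zeta> by (simp add: R_def)
 define p where "p = (\<lambda>s. - (4 * M / 3) * inverse (R + s) ^ 3)"
 have vd: "((\<lambda>s. \<Phi> (\<zeta> + of_real s)) has_vector_derivative \<phi> (\<zeta> + of_real s)) (at s)" if "s \<ge> 0" for s
 proof -
  have "((\<lambda>s. \<zeta> + of_real s) has_vector_derivative 1) (at s)" by (auto intro!: derivative_eq_intros)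
  from field_vector_diff_chain_at[OF this D[OF that]] show ?thesis by (simp add: o_def)
 qed
 have pd: "(p has_vector_derivative 4 * M / (R + s) ^ 4) (at s)" if "s \<ge> 0" for s
 proof -
  have "R + s \<noteq> 0" using R that by simp
  define v where "v = inverse (R + s)"
  have "((\<lambda>s. inverse (R + s)) has_real_derivative - (v * 1 * v)) (at s)"
   unfolding v_def using \<open>R + s \<noteq> 0\<close> by (intro DERIV_inverse') (auto intro!: derivative_eq_intros)
  from DERIV_cmult[OF DERIV_power[OF this, of 3], of "- (4 * M / 3)"]
  have "(p has_real_derivative - (4 * M / 3) * (of_nat 3 * (- (v * 1 * v) * v ^ (3 - Suc 0)))) (at s)" by (simp only: p_def v_def)
  moreover have "- (4 * M / 3) * (of_nat 3 * (- (v * 1 * v) * v ^ (3 - Suc 0))) = 4 * M / (R + s) ^ 4"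
  proof -
   have "4 * M / (R + s) ^ 4 = 4 * M * v ^ 4" by (simp only: v_def divide_inverse power_inverse)
   moreover have "(3::nat) - Suc 0 = 2" by simp
   moreover have "- (4 * M / 3) * (of_nat 3 * (- (v * 1 * v) * v^2)) = 4 * M * v ^ 4" by (simp add: power2_eq_square power4_eq_xxxx)
   ultimately show ?thesis by metis
  qed
  ultimately show ?thesis unfolding has_real_derivative_iff_has_vector_derivative by (simp only:)
 qed
 have bd: "cmod (\<phi> (\<zeta> + of_real s)) \<le> 4 * M / (R + s) ^ 4" if "s \<ge> 0" for s
 proof -
  have g: "R + s \<le> sqrt 2 * cmod (\<zeta> + of_real s)" using norm_add_real_ge[OF \<zeta>(1) that] by (simp add: R_def)
  have "(R + s) ^ 4 \<le> (sqrt 2 * cmod (\<zeta> + of_real s)) ^ 4" using g R that by (intro power_mono) auto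
  also have "\<dots> = 4 * cmod (\<zeta> + of_real s) ^ 4"
  proof -
   have "sqrt 2 ^ 4 = (sqrt 2 ^ 2) ^ 2" by (simp only: power_mult[symmetric]) simp
   then show ?thesis by (simp add: power_mult_distrib)
  qed
  finally have g4: "(R + s) ^ 4 \<le> 4 * cmod (\<zeta> + of_real s) ^ 4" .
  have pos: "(R + s) ^ 4 > 0" using R that by simp
  have "M / cmod (\<zeta> + of_real s) ^ 4 = 4 * M / (4 * cmod (\<zeta> + of_real s) ^ 4)" by simp
  also have "\<dots> \<le> 4 * M / (R + s) ^ 4" using g4 pos M by (intro divide_left_mono mult_pos_pos) auto
  finally show ?thesis using b[OF that] by linarith
 qed
 have "norm (\<Phi> (\<zeta> + of_real s2) - \<Phi> (\<zeta> + of_real s1)) \<le> p s2 - p s1"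
 proof (rule differentiable_bound_general[where f = "\<lambda>s. \<Phi> (\<zeta> + of_real s)" and \<phi> = p
    and f' = "\<lambda>s. \<phi> (\<zeta> + of_real s)" and \<phi>' = "\<lambda>s. 4 * M / (R + s) ^ 4"])
  show "s1 < s2" using False s by simp
  show "continuous_on {s1..s2} (\<lambda>s. \<Phi> (\<zeta> + of_real s))"
   using s by (intro continuous_at_imp_continuous_on ballI vd[THEN has_vector_derivative_continuous]) auto
  show "continuous_on {s1..s2} p" using s by (intro continuous_at_imp_continuous_on ballI pd[THEN has_vector_derivative_continuous]) auto
 qed (use s vd pd bd in auto)
 also have "\<dots> \<le> 4 * M / 3 / (R + s1) ^ 3"
 proof -
  have "p s2 \<le> 0" unfolding p_def using M R s by (intro mult_nonpos_nonneg) auto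
  moreover have "- p s1 = 4 * M / 3 / (R + s1) ^ 3" unfolding p_def divide_inverse power_inverse mult_minus_left by (rule minus_minus)
  ultimately show ?thesis by linarith
 qed
 finally show ?thesis by (simp add: R_def)
qed

text \<open>The oscillating factor has constant modulus on a horizontal line and can be pulled out
  of every estimate, however large Im \<zeta> is.\<close>

lemma cmod_exp_imag_add_real:
 assumes "Re c = 0"
 shows "cmod (exp (c * (\<zeta> + of_real s))) = cmod (exp (c * \<zeta>))" using assms by simp

text \<open>The integrating factor exp (c w) turns the equation into (exp (c w) G)' = - exp (c w) F,
  and the decay of \<open>G\<close> removes the boundary term at the far end of the ray. The
  constant 4/3 is rounded up to 2.\<close>

lemma decaying_apriori_bound:
 assumes c: "Re c = 0" and X: "X \<ge> 0" and M: "M \<ge> 0"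
  and D: "\<And>w. Re w > X \<Longrightarrow> (G has_field_derivative - c * G w - F w) (at w)"
  and F: "\<And>w. Re w > X \<Longrightarrow> cmod (F w) \<le> M / cmod w ^ 4"
  and lim: "\<And>w. Re w > X \<Longrightarrow> (\<lambda>n. G (w + of_nat n)) \<longlonglongrightarrow> 0"
  and \<zeta>: "Re \<zeta> > X"
 shows "cmod (G \<zeta>) \<le> 2 * M / cmod \<zeta> ^ 3"
proof -
 define E where "E = cmod (exp (c * \<zeta>))"
 have E: "E > 0" by (simp add: E_def)
 define \<Phi> where "\<Phi> = (\<lambda>w. exp (c * w) * G w)"
 have \<zeta>0: "\<zeta> \<noteq> 0" "Re \<zeta> \<ge> 0" using \<zeta> X by auto
 have inc: "cmod (\<Phi> (\<zeta> + of_real (real n)) - \<Phi> (\<zeta> + of_real 0)) \<le> 4 * (E * M) / 3 / (cmod \<zeta> + 0) ^ 3" for n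
 proof (rule horizontal_increment[where \<phi> = "\<lambda>w. - (exp (c * w) * F w)"])
  fix s :: real assume s: "s \<ge> 0"
  then have r: "Re (\<zeta> + of_real s) > X" using \<zeta> by simp
  show "(\<Phi> has_field_derivative - (exp (c * (\<zeta> + of_real s)) * F (\<zeta> + of_real s))) (at (\<zeta> + of_real s))"
   unfolding \<Phi>_def by (rule derivative_eq_intros D[OF r] refl)+ (simp add: algebra_simps)
  show "cmod (- (exp (c * (\<zeta> + of_real s)) * F (\<zeta> + of_real s))) \<le> E * M / cmod (\<zeta> + of_real s) ^ 4"
   using mult_left_mono[OF F[OF r], of E] E unfolding norm_minus_cancel norm_mult cmod_exp_imag_add_real[OF c] E_def by simp
 qed (use \<zeta>0 M E in auto)
 have "(\<lambda>n. G (\<zeta> + of_nat n) * exp (c * (\<zeta> + of_nat n))) \<longlonglongrightarrow> 0"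
 proof (rule Lim_null_comparison[where g = "\<lambda>n. cmod (G (\<zeta> + of_nat n)) * E"])
  show "\<forall>\<^sub>F n in sequentially. cmod (G (\<zeta> + of_nat n) * exp (c * (\<zeta> + of_nat n))) \<le> cmod (G (\<zeta> + of_nat n)) * E"
   by (simp add: norm_mult E_def c)
  show "(\<lambda>n. cmod (G (\<zeta> + of_nat n)) * E) \<longlonglongrightarrow> 0" by (intro tendsto_mult_left_zero tendsto_norm_zero lim \<zeta>)
 qed
 then have "(\<lambda>n. \<Phi> (\<zeta> + of_nat n)) \<longlonglongrightarrow> 0" by (simp add: \<Phi>_def mult.commute)
 then have "(\<lambda>n. cmod (\<Phi> (\<zeta> + of_nat n) - \<Phi> \<zeta>)) \<longlonglongrightarrow> cmod (0 - \<Phi> \<zeta>)"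
  by (intro tendsto_intros)
 then have "cmod (\<Phi> \<zeta>) \<le> 4 * (E * M) / 3 / cmod \<zeta> ^ 3"
  using inc by (intro tendsto_upperbound[of "\<lambda>n. cmod (\<Phi> (\<zeta> + of_nat n) - \<Phi> \<zeta>)"]) auto
 then have "E * cmod (G \<zeta>) \<le> E * (4 * M / 3 / cmod \<zeta> ^ 3)" by (simp add: \<Phi>_def norm_mult E_def)
 then have "cmod (G \<zeta>) \<le> 4 * M / 3 / cmod \<zeta> ^ 3" using E by (simp only: mult_le_cancel_left_pos)
 also have "\<dots> \<le> 2 * M / cmod \<zeta> ^ 3" using M by (intro divide_right_mono) auto
 finally show ?thesis .
qed

text \<open>\<open>G\<close> is exp (- c w) times the integral of exp (c w) F from w to infinity
  along the horizontal ray. It is holomorphic only if the primitive has the same limit at the end of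
  all rays, and this is the point to be shown.\<close>

lemma decaying_exists:
 assumes c: "Re c = 0" and X: "X \<ge> 0" and M: "M \<ge> 0"
  and hF: "F holomorphic_on {w. Re w > X}"
  and F: "\<And>w. Re w > X \<Longrightarrow> cmod (F w) \<le> M / cmod w ^ 4"
 shows "\<exists>G. (\<forall>w. Re w > X \<longrightarrow> (G has_field_derivative - c * G w - F w) (at w)) \<and>
   (\<forall>w. Re w > X \<longrightarrow> (\<lambda>n. G (w + of_nat n)) \<longlonglongrightarrow> 0)"
proof -
 define H where "H = {w. Re w > X}"
 have op: "open H" and cv: "convex H" unfolding H_def by (rule open_halfspace_Re_gt, rule convex_halfspace_Re_gt)
 define \<phi> where "\<phi> = (\<lambda>w. exp (c * w) * F w)"
 have "\<phi> holomorphic_on H" unfolding \<phi>_def using hF by (intro holomorphic_intros) (auto simp: H_def)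
 then obtain \<Phi> where \<Phi>: "\<And>w. w \<in> H \<Longrightarrow> (\<Phi> has_field_derivative \<phi> w) (at w within H)"
  using holomorphic_convex_primitive'[OF cv op] by blast
 then have \<Phi>: "\<And>w. w \<in> H \<Longrightarrow> (\<Phi> has_field_derivative \<phi> w) (at w)" using at_within_open[OF _ op] by metis
 have inc: "cmod (\<Phi> (\<zeta> + of_real s2) - \<Phi> (\<zeta> + of_real s1)) \<le> 4 * (cmod (exp (c * \<zeta>)) * M) / 3 / (cmod \<zeta> + s1) ^ 3"
  if "\<zeta> \<in> H" "0 \<le> s1" "s1 \<le> s2" for \<zeta> s1 s2
 proof (rule horizontal_increment[where \<phi> = \<phi>])
  fix s :: real assume s: "s \<ge> 0"
  then have r: "Re (\<zeta> + of_real s) > X" using that by (simp add: H_def)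
  then show "(\<Phi> has_field_derivative \<phi> (\<zeta> + of_real s)) (at (\<zeta> + of_real s))" by (intro \<Phi>) (simp add: H_def)
  show "cmod (\<phi> (\<zeta> + of_real s)) \<le> cmod (exp (c * \<zeta>)) * M / cmod (\<zeta> + of_real s) ^ 4"
   using mult_left_mono[OF F[OF r], of "cmod (exp (c * \<zeta>))"] unfolding \<phi>_def norm_mult cmod_exp_imag_add_real[OF c] by simp
 qed (use that X M in \<open>auto simp: H_def\<close>)
 have to0: "(\<lambda>n. K / (R + real n) ^ 3) \<longlonglongrightarrow> 0" for K R :: real
  by (intro tendsto_divide_0[OF tendsto_const] filterlim_at_top_imp_at_infinity filterlim_pow_at_top
    filterlim_tendsto_add_at_top[OF tendsto_const] filterlim_real_sequentially) auto
 have lim: "convergent (\<lambda>n. \<Phi> (\<zeta> + of_nat n))" if "\<zeta> \<in> H" for \<zeta>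
 proof -
  define K where "K = 4 * (cmod (exp (c * \<zeta>)) * M) / 3"
  have b: "cmod (\<Phi> (\<zeta> + of_nat n) - \<Phi> (\<zeta> + of_nat m)) \<le> K / (cmod \<zeta> + real m) ^ 3" if "m \<le> n" for m n
   using inc[OF \<open>\<zeta> \<in> H\<close>, of "real m" "real n"] that by (simp add: K_def)
  have "Cauchy (\<lambda>n. \<Phi> (\<zeta> + of_nat n))"
  proof (rule CauchyI')
   fix e :: real assume "e > 0"
   then have "\<forall>\<^sub>F m in sequentially. K / (cmod \<zeta> + real m) ^ 3 < e" using order_tendstoD(2)[OF to0] by blast
   then obtain N where N: "\<And>m. m \<ge> N \<Longrightarrow> K / (cmod \<zeta> + real m) ^ 3 < e" by (auto simp: eventually_sequentially)
   show "\<exists>N. \<forall>m\<ge>N. \<forall>n>m. dist (\<Phi> (\<zeta> + of_nat m)) (\<Phi> (\<zeta> + of_nat n)) < e"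
   proof (intro exI[of _ N] allI impI)
    fix m n :: nat assume "m \<ge> N" "n > m"
    then show "dist (\<Phi> (\<zeta> + of_nat m)) (\<Phi> (\<zeta> + of_nat n)) < e"
     using b[of m n] N[of m] by (simp add: dist_norm norm_minus_commute)
   qed
  qed
  then show ?thesis by (simp add: Cauchy_convergent_iff)
 qed
 define w0 where "w0 = (of_real (X + 1) :: complex)"
 have Imw0: "Im w0 = 0" by (simp add: w0_def)
 have w0: "w0 \<in> H" by (simp add: w0_def H_def)
 obtain L where L: "(\<lambda>n. \<Phi> (w0 + of_nat n)) \<longlonglongrightarrow> L" using lim[OF w0] by (auto simp: convergent_def)
 \<comment> \<open>Two rays are joined, n steps to the right, by a segment of fixed length.
   Imaginary parts stay bounded on it, \<open>w0\<close> being real, so the integrand there is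
   O(n^-4).\<close>
 have L': "(\<lambda>n. \<Phi> (\<zeta> + of_nat n)) \<longlonglongrightarrow> L" if \<zeta>: "\<zeta> \<in> H" for \<zeta>
 proof -
  define Y where "Y = cmod c * \<bar>Im \<zeta>\<bar>"
  have "cmod (\<Phi> (\<zeta> + of_nat n) - \<Phi> (w0 + of_nat n)) \<le> (exp Y * M / real n ^ 4) * cmod (\<zeta> - w0)" if n: "n > 0" for n
  proof -
   let ?S = "closed_segment (\<zeta> + of_nat n) (w0 + of_nat n)"
   have mem: "Re w > X" "real n \<le> cmod w" "\<bar>Im w\<bar> \<le> \<bar>Im \<zeta>\<bar>" if w: "w \<in> ?S" for w
   proof -
    have "?S \<subseteq> {w. Re w > X + n}" using \<zeta> w0 by (intro closed_segment_subset convex_halfspace_Re_gt) (auto simp: H_def)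
    then have re: "Re w > X + n" using w by auto
    then show "Re w > X" by simp
    show "real n \<le> cmod w" using re X complex_Re_le_cmod[of w] by linarith
    obtain u where u: "0 \<le> u" "u \<le> 1" "w = (1 - u) *\<^sub>R (\<zeta> + of_nat n) + u *\<^sub>R (w0 + of_nat n)"
     using w by (auto simp: closed_segment_def)
    have imw: "Im w = (1 - u) * Im \<zeta>" unfolding u(3) using Imw0 by simp
    have "\<bar>Im w\<bar> = (1 - u) * \<bar>Im \<zeta>\<bar>" unfolding imw using u(1,2) by (simp add: abs_mult)
    also have "\<dots> \<le> 1 * \<bar>Im \<zeta>\<bar>" using u by (intro mult_right_mono) auto
    finally show "\<bar>Im w\<bar> \<le> \<bar>Im \<zeta>\<bar>" by simp
   qed
   have "cmod (\<Phi> (\<zeta> + of_nat n) - \<Phi> (w0 + of_nat n)) \<le> (exp Y * M / real n ^ 4) * cmod ((\<zeta> + of_nat n) - (w0 + of_nat n))"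
   proof (rule field_differentiable_bound[where S = ?S and f' = \<phi>])
    fix w assume w: "w \<in> ?S"
    show "(\<Phi> has_field_derivative \<phi> w) (at w within ?S)"
     using \<Phi>[of w] mem(1)[OF w] has_field_derivative_at_within unfolding H_def by blast
    have "Re (c * w) \<le> Y"
    proof -
     have "Re (c * w) = - Im c * Im w" using c by simp
     also have "\<dots> \<le> \<bar>Im c\<bar> * \<bar>Im w\<bar>" by (metis abs_ge_self abs_minus_cancel abs_mult)
     also have "\<dots> \<le> cmod c * \<bar>Im \<zeta>\<bar>" using mem(3)[OF w] by (intro mult_mono abs_Im_le_cmod) auto
     finally show ?thesis by (simp add: Y_def)
    qed
    moreover have "cmod (F w) \<le> M / real n ^ 4"
    proof -
     have "cmod (F w) \<le> M / cmod w ^ 4" by (rule F[OF mem(1)[OF w]])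
     also have "real n ^ 4 \<le> cmod w ^ 4" using mem(2)[OF w] by (intro power_mono) auto
     then have "M / cmod w ^ 4 \<le> M / real n ^ 4" using M n mem(2)[OF w] by (intro divide_left_mono mult_pos_pos zero_less_power) auto
     finally show ?thesis .
    qed
    ultimately have "cmod (exp (c * w)) * cmod (F w) \<le> exp Y * (M / real n ^ 4)" by (intro mult_mono) auto
    then show "cmod (\<phi> w) \<le> exp Y * M / real n ^ 4" by (simp add: \<phi>_def norm_mult)
   qed (auto simp: convex_closed_segment)
   then show ?thesis by simp
  qed
  then have "\<forall>\<^sub>F n in sequentially. cmod (\<Phi> (\<zeta> + of_nat n) - \<Phi> (w0 + of_nat n)) \<le> (exp Y * M / real n ^ 4) * cmod (\<zeta> - w0)"
   by (auto simp: eventually_sequentially intro!: exI[of _ 1])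
  moreover have "(\<lambda>n. (exp Y * M / real n ^ 4) * cmod (\<zeta> - w0)) \<longlonglongrightarrow> 0"
   by (intro tendsto_mult_left_zero tendsto_divide_0[OF tendsto_const] filterlim_at_top_imp_at_infinity
     filterlim_pow_at_top filterlim_real_sequentially) auto
  ultimately have "(\<lambda>n. \<Phi> (\<zeta> + of_nat n) - \<Phi> (w0 + of_nat n)) \<longlonglongrightarrow> 0" by (rule Lim_null_comparison)
  from tendsto_add[OF this L] show ?thesis by simp
 qed
 define G where "G = (\<lambda>w. exp (- (c * w)) * (L - \<Phi> w))"
 have "(G has_field_derivative - c * G w - F w) (at w)" if "Re w > X" for w
 proof -
  have "w \<in> H" using that by (simp add: H_def)
  define e where "e = exp (- (c * w))"
  have "((\<lambda>w. exp (- (c * w)) * (L - \<Phi> w)) has_field_derivative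
    (e * (- (c * 1))) * (L - \<Phi> w) + (0 - \<phi> w) * e) (at w)"
   unfolding e_def by (intro DERIV_mult DERIV_exp[THEN DERIV_chain2] DERIV_minus DERIV_cmult DERIV_ident Deriv.field_differentiable_diff DERIV_const \<Phi>[OF \<open>w \<in> H\<close>])
  moreover have "\<phi> w * e = F w" by (simp add: \<phi>_def e_def exp_minus)
  then have "(e * (- (c * 1))) * (L - \<Phi> w) + (0 - \<phi> w) * e = - c * G w - F w" by (simp add: G_def e_def algebra_simps)
  ultimately show ?thesis by (simp only: G_def)
 qed
 moreover have "(\<lambda>n. G (w + of_nat n)) \<longlonglongrightarrow> 0" if "Re w > X" for w
 proof -
  have w: "w \<in> H" using that by (simp add: H_def)
  have "(\<lambda>n. L - \<Phi> (w + of_nat n)) \<longlonglongrightarrow> L - L" by (rule tendsto_diff[OF tendsto_const L'[OF w]])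
  then have "(\<lambda>n. cmod (L - \<Phi> (w + of_nat n)) * cmod (exp (- (c * w)))) \<longlonglongrightarrow> 0"
   by (intro tendsto_mult_left_zero tendsto_norm_zero) simp
  moreover have "cmod (G (w + of_nat n)) = cmod (L - \<Phi> (w + of_nat n)) * cmod (exp (- (c * w)))" for n using c by (simp add: G_def norm_mult)
  ultimately have "(\<lambda>n. cmod (G (w + of_nat n))) \<longlonglongrightarrow> 0" by (simp only:)
  then show ?thesis by (rule tendsto_norm_zero_cancel)
 qed
 ultimately show ?thesis by blast
qed

text \<open>\<open>D\<close> solves D'' + c D' = F and decays along horizontal rays together with
  its derivative \<open>E\<close>.\<close>

definition jost_pair ::
 "complex \<Rightarrow> real \<Rightarrow> (complex \<Rightarrow> complex) \<Rightarrow> (complex \<Rightarrow> complex) \<Rightarrow> (complex \<Rightarrow> complex) \<Rightarrow> bool" where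
 "jost_pair c X F D E \<longleftrightarrow> (\<forall>w. Re w > X \<longrightarrow>
   (D has_field_derivative E w) (at w) \<and> (E has_field_derivative F w - c * E w) (at w) \<and>
   (\<lambda>n. D (w + of_nat n)) \<longlonglongrightarrow> 0 \<and> (\<lambda>n. E (w + of_nat n)) \<longlonglongrightarrow> 0)"

text \<open>The second-order equation decouples into first-order ones of the type in
  \<open>decaying_apriori_bound\<close>: for - E with constant \<open>c\<close>, and for - E - c D
  with constant 0. \<open>D\<close> is recovered from the two by |c| = 2.\<close>

lemma jost_pair_bound:
 assumes c: "Re c = 0" "cmod c = 2" and X: "X \<ge> 0" and M: "M \<ge> 0"
  and J: "jost_pair c X F D E"
  and F: "\<And>w. Re w > X \<Longrightarrow> cmod (F w) \<le> M / cmod w ^ 4" and \<zeta>: "Re \<zeta> > X"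
 shows "cmod (D \<zeta>) \<le> 2 * M / cmod \<zeta> ^ 3" (is ?A) "cmod (E \<zeta>) \<le> 2 * M / cmod \<zeta> ^ 3" (is ?B)
proof -
 note J' = J[unfolded jost_pair_def, rule_format]
 have c0: "c \<noteq> 0" using c by auto
 have 1: "cmod (- E \<zeta>) \<le> 2 * M / cmod \<zeta> ^ 3"
 proof (rule decaying_apriori_bound[OF c(1) X M _ F _ \<zeta>, where G = "\<lambda>w. - E w"])
  fix w assume w: "Re w > X"
  have "((\<lambda>w. - E w) has_field_derivative - (F w - c * E w)) (at w)" using J'[OF w] by (intro DERIV_minus) auto
  then show "((\<lambda>w. - E w) has_field_derivative - c * - E w - F w) (at w)" by (simp add: algebra_simps)
  have "(\<lambda>n. - E (w + of_nat n)) \<longlonglongrightarrow> - 0" using J'[OF w] by (intro tendsto_minus) auto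
  then show "(\<lambda>n. - E (w + of_nat n)) \<longlonglongrightarrow> 0" by simp
 qed auto
 then show ?B by simp
 have 2: "cmod (- E \<zeta> - c * D \<zeta>) \<le> 2 * M / cmod \<zeta> ^ 3"
 proof (rule decaying_apriori_bound[where G = "\<lambda>w. - E w - c * D w" and c = 0, OF _ X M _ F _ \<zeta>])
  fix w assume w: "Re w > X"
  have "((\<lambda>w. - E w - c * D w) has_field_derivative - (F w - c * E w) - c * E w) (at w)"
   using J'[OF w] by (intro DERIV_minus Deriv.field_differentiable_diff DERIV_cmult) auto
  then show "((\<lambda>w. - E w - c * D w) has_field_derivative - 0 * (- E w - c * D w) - F w) (at w)" by simp
  have "(\<lambda>n. - E (w + of_nat n) - c * D (w + of_nat n)) \<longlonglongrightarrow> - 0 - c * 0"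
   using J'[OF w] by (intro tendsto_diff tendsto_minus tendsto_mult tendsto_const) auto
  then show "(\<lambda>n. - E (w + of_nat n) - c * D (w + of_nat n)) \<longlonglongrightarrow> 0" by simp
 qed auto
 have "2 * cmod (D \<zeta>) = cmod ((- E \<zeta>) - (- E \<zeta> - c * D \<zeta>))" using c by (simp add: norm_mult)
 also have "\<dots> \<le> cmod (- E \<zeta>) + cmod (- E \<zeta> - c * D \<zeta>)" by (rule norm_triangle_ineq4)
 also have "\<dots> \<le> 2 * M / cmod \<zeta> ^ 3 + 2 * M / cmod \<zeta> ^ 3" using 1 2 by (rule add_mono)
 finally show ?A by linarith
qed

text \<open>The decoupling of \<open>jost_pair_bound\<close> read backwards: \<open>G1\<close> is to
  be - E and \<open>G0\<close> is to be - E - c D.\<close>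

lemma jost_pair_exists:
 assumes c: "Re c = 0" "cmod c = 2" and X: "X \<ge> 0" and M: "M \<ge> 0"
  and hF: "F holomorphic_on {w. Re w > X}"
  and F: "\<And>w. Re w > X \<Longrightarrow> cmod (F w) \<le> M / cmod w ^ 4"
 shows "\<exists>D E. jost_pair c X F D E"
proof -
 have c0: "c \<noteq> 0" using c by auto
 obtain G1 where G1: "\<And>w. Re w > X \<Longrightarrow> (G1 has_field_derivative - c * G1 w - F w) (at w)"
  "\<And>w. Re w > X \<Longrightarrow> (\<lambda>n. G1 (w + of_nat n)) \<longlonglongrightarrow> 0" using decaying_exists[OF c(1) X M hF F] by blast
 obtain G0 where G0: "\<And>w. Re w > X \<Longrightarrow> (G0 has_field_derivative - 0 * G0 w - F w) (at w)"
  "\<And>w. Re w > X \<Longrightarrow> (\<lambda>n. G0 (w + of_nat n)) \<longlonglongrightarrow> 0"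
  using decaying_exists[where c = 0, OF _ X M hF F] by auto
 have "jost_pair c X F (\<lambda>w. inverse c * (G1 w - G0 w)) (\<lambda>w. - G1 w)" unfolding jost_pair_def
 proof (intro allI impI conjI)
  fix w assume w: "Re w > X"
  have "((\<lambda>w. inverse c * (G1 w - G0 w)) has_field_derivative inverse c * ((- c * G1 w - F w) - (- 0 * G0 w - F w))) (at w)"
   by (intro DERIV_cmult Deriv.field_differentiable_diff G1 G0 w)
  moreover have "inverse c * ((- c * G1 w - F w) - (- 0 * G0 w - F w)) = - G1 w" using c0 by (simp add: field_simps)
  ultimately show "((\<lambda>w. inverse c * (G1 w - G0 w)) has_field_derivative - G1 w) (at w)" by (simp only:)
  have "((\<lambda>w. - G1 w) has_field_derivative - (- c * G1 w - F w)) (at w)" by (intro DERIV_minus G1 w)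
  then show "((\<lambda>w. - G1 w) has_field_derivative F w - c * - G1 w) (at w)" by (simp add: algebra_simps)
  have "(\<lambda>n. inverse c * (G1 (w + of_nat n) - G0 (w + of_nat n))) \<longlonglongrightarrow> inverse c * (0 - 0)"
   by (intro tendsto_intros G1 G0 w)
  then show "(\<lambda>n. inverse c * (G1 (w + of_nat n) - G0 (w + of_nat n))) \<longlonglongrightarrow> 0" by simp
  have "(\<lambda>n. - G1 (w + of_nat n)) \<longlonglongrightarrow> - 0" by (intro tendsto_intros G1 w)
  then show "(\<lambda>n. - G1 (w + of_nat n)) \<longlonglongrightarrow> 0" by simp
 qed
 then show ?thesis by blast
qed

lemma jost_pair_diff:
 assumes "jost_pair c X F D E" "jost_pair c X F' D' E'"
 shows "jost_pair c X (\<lambda>w. F w - F' w) (\<lambda>w. D w - D' w) (\<lambda>w. E w - E' w)" unfolding jost_pair_def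
proof (intro allI impI conjI)
 fix w assume w: "Re w > X"
 note a = assms(1)[unfolded jost_pair_def, rule_format, OF w] assms(2)[unfolded jost_pair_def, rule_format, OF w]
 show "((\<lambda>w. D w - D' w) has_field_derivative E w - E' w) (at w)" using a by (intro Deriv.field_differentiable_diff) auto
 have "((\<lambda>w. E w - E' w) has_field_derivative (F w - c * E w) - (F' w - c * E' w)) (at w)"
  using a by (intro Deriv.field_differentiable_diff) auto
 then show "((\<lambda>w. E w - E' w) has_field_derivative F w - F' w - c * (E w - E' w)) (at w)" by (simp add: algebra_simps)
 have "(\<lambda>n. D (w + of_nat n) - D' (w + of_nat n)) \<longlonglongrightarrow> 0 - 0" using a by (intro tendsto_diff) auto
 then show "(\<lambda>n. D (w + of_nat n) - D' (w + of_nat n)) \<longlonglongrightarrow> 0" by simp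
 have "(\<lambda>n. E (w + of_nat n) - E' (w + of_nat n)) \<longlonglongrightarrow> 0 - 0" using a by (intro tendsto_diff) auto
 then show "(\<lambda>n. E (w + of_nat n) - E' (w + of_nat n)) \<longlonglongrightarrow> 0" by simp
qed

lemma jost_pair_zero: "jost_pair c X (\<lambda>w. 0) (\<lambda>w. 0) (\<lambda>w. 0)" by (simp add: jost_pair_def)

lemma jost_pair_sum:
 fixes N :: nat
 assumes "\<And>n. jost_pair c X (F n) (D n) (E n)"
 shows "jost_pair c X (\<lambda>w. \<Sum>n<N. F n w) (\<lambda>w. \<Sum>n<N. D n w) (\<lambda>w. \<Sum>n<N. E n w)"
proof (induction N)
 case (Suc N)
 have "jost_pair c X (\<lambda>w. (\<Sum>n<N. F n w) - (0 - F N w)) (\<lambda>w. (\<Sum>n<N. D n w) - (0 - D N w)) (\<lambda>w. (\<Sum>n<N. E n w) - (0 - E N w))"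
  by (rule jost_pair_diff[OF Suc jost_pair_diff[OF jost_pair_zero assms]])
 then show ?case by simp
qed (simp add: jost_pair_zero)

lemma summable_norm_comparison:
 assumes "summable g" "\<And>n. norm (f n) \<le> g n"
 shows "summable (\<lambda>n. norm (f n))" using assms(2) by (intro summable_comparison_test'[OF assms(1), where N = 0]) simp

text \<open>Neumann series for the Volterra equation \<open>F = r + \<kappa> D / \<zeta>\<^sup>2\<close>, where \<open>D\<close> is the decaying solution
 of \<open>D'' + c D' = F\<close>.\<close>

lemma jost_fixed_point:
 assumes c: "Re c = 0" "cmod c = 2" and X: "X > 0" "X \<ge> 4 * cmod \<kappa>" and M: "M \<ge> 0"
  and hr: "r holomorphic_on {w. Re w > X}"
  and r: "\<And>w. Re w > X \<Longrightarrow> cmod (r w) \<le> M / cmod w ^ 4"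
 shows "\<exists>D E. (\<forall>w. Re w > X \<longrightarrow>
   (D has_field_derivative E w) (at w) \<and>
   (E has_field_derivative r w + \<kappa> / w^2 * D w - c * E w) (at w) \<and>
   cmod (D w) \<le> 4 * M / cmod w ^ 3 \<and> cmod (E w) \<le> 4 * M / cmod w ^ 3)"
proof -
 define H where "H = {w. Re w > X}"
 have op: "open H" unfolding H_def by (rule open_halfspace_Re_gt)
 have X0: "X \<ge> 0" using X by simp
 define P where "P = (\<lambda>F DE. jost_pair c X F (fst DE) (snd DE))"
 \<comment> \<open>Picks some decaying solution for each forcing. Linearity is not built into the
   choice; it is recovered from the a priori bound applied to differences.\<close>
 define T where "T = (\<lambda>F. SOME DE. P F DE)"
 define F where "F = rec_nat r (\<lambda>_ F w. \<kappa> / w^2 * fst (T F) w)"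
 have F0: "F 0 = r" and FS: "F (Suc n) = (\<lambda>w. \<kappa> / w^2 * fst (T (F n)) w)" for n by (simp_all add: F_def)
 have T: "jost_pair c X F (fst (T F)) (snd (T F))"
  if "F holomorphic_on H" "\<And>w. w \<in> H \<Longrightarrow> cmod (F w) \<le> M' / cmod w ^ 4" "M' \<ge> 0" for F M'
 proof -
  have "\<exists>D E. jost_pair c X F D E" by (rule jost_pair_exists[OF c X0 that(3)]) (use that in \<open>auto simp: H_def\<close>)
  then have "\<exists>DE. P F DE" unfolding P_def by (metis fst_conv snd_conv)
  then have "P F (T F)" unfolding T_def by (rule someI_ex)
  then show ?thesis by (simp add: P_def)
 qed
 have Fn: "F n holomorphic_on H \<and> (\<forall>w\<in>H. cmod (F n w) \<le> M * (1 / 2) ^ n / cmod w ^ 4)" for n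
 proof (induction n)
  case 0
  then show ?case using hr r by (simp add: F0 H_def)
 next
  case (Suc n)
  have Mn: "M * (1 / 2) ^ n \<ge> 0" using M by simp
  have J: "jost_pair c X (F n) (fst (T (F n))) (snd (T (F n)))" using Suc Mn by (intro T[of _ "M * (1 / 2) ^ n"]) auto
  have "fst (T (F n)) field_differentiable at w" if "w \<in> H" for w using J that unfolding jost_pair_def H_def field_differentiable_def by blast
  then have "fst (T (F n)) holomorphic_on H" by (auto simp: holomorphic_on_def intro: field_differentiable_at_within)
  moreover have "w^2 \<noteq> 0" if "w \<in> H" for w using that X by (auto simp: H_def)
  ultimately have h: "F (Suc n) holomorphic_on H" unfolding FS by (intro holomorphic_intros) auto
  have "cmod (F (Suc n) w) \<le> M * (1 / 2) ^ Suc n / cmod w ^ 4" if w: "w \<in> H" for w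
  proof -
   define R where "R = cmod w"
   have Rw: "R > X" using w complex_Re_le_cmod[of w] by (simp add: H_def R_def)
   then have R: "R > 0" "R \<ge> 4 * cmod \<kappa>" using X by auto
   have "cmod (fst (T (F n)) w) \<le> 2 * (M * (1 / 2) ^ n) / R ^ 3"
    unfolding R_def using Suc w Mn by (intro jost_pair_bound(1)[OF c X0 _ J]) (auto simp: H_def)
   then have "cmod \<kappa> / R^2 * cmod (fst (T (F n)) w) \<le> cmod \<kappa> / R^2 * (2 * (M * (1 / 2) ^ n) / R ^ 3)" by (intro mult_left_mono) auto
   also have "\<dots> = (cmod \<kappa> / R) * (2 * (M * (1 / 2) ^ n) / R ^ 4)" using R by (simp add: power2_eq_square power3_eq_cube power4_eq_xxxx)
   \<comment> \<open>This is where X \<ge> 4 |\<kappa>| enters: the factor 1/4 beats the factor 2 of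
     the a priori bound, and each iterate is half as large as the previous one.\<close>
   also have "\<dots> \<le> (1 / 4) * (2 * (M * (1 / 2) ^ n) / R ^ 4)" using R Mn by (intro mult_right_mono) (auto simp: field_simps)
   also have "\<dots> = M * (1 / 2) ^ Suc n / R ^ 4" by simp
   finally show ?thesis by (simp add: FS norm_mult norm_divide norm_power R_def)
  qed
  with h show ?case by blast
 qed
 then have FH: "\<And>n. F n holomorphic_on H" and Fb: "\<And>n w. w \<in> H \<Longrightarrow> cmod (F n w) \<le> M * (1 / 2) ^ n / cmod w ^ 4"
  by auto
 have geo: "(\<lambda>n. M * (1 / 2) ^ n) sums (M * 2)" using sums_mult[OF geometric_sums[of "1 / 2 :: real"], of M] by simp
 define Fs where "Fs = (\<lambda>w. \<Sum>n. F n w)"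
 have sumF: "(\<lambda>n. F n w) sums Fs w" "cmod (Fs w) \<le> 2 * M / cmod w ^ 4" if w: "w \<in> H" for w
 proof -
  have g: "(\<lambda>n. M * (1 / 2) ^ n / cmod w ^ 4) sums (M * 2 / cmod w ^ 4)" by (rule sums_divide[OF geo])
  have sn: "summable (\<lambda>n. cmod (F n w))" by (rule summable_norm_comparison[OF sums_summable[OF g] Fb[OF w]])
  show "(\<lambda>n. F n w) sums Fs w" unfolding Fs_def by (rule summable_sums[OF summable_norm_cancel[OF sn]])
  have "cmod (Fs w) \<le> (\<Sum>n. cmod (F n w))" unfolding Fs_def by (rule summable_norm[OF sn])
  also have "\<dots> \<le> M * 2 / cmod w ^ 4" using suminf_le[OF Fb[OF w] sn sums_summable[OF g]] sums_unique[OF g] by simp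
  finally show "cmod (Fs w) \<le> 2 * M / cmod w ^ 4" by (simp add: mult.commute)
 qed
 have tail: "cmod (Fs w - (\<Sum>n<N. F n w)) \<le> 2 * M * (1 / 2) ^ N / cmod w ^ 4" if w: "w \<in> H" for w N
 proof -
  have s: "summable (\<lambda>n. F n w)" using sumF(1)[OF w] by (rule sums_summable)
  have e: "Fs w - (\<Sum>n<N. F n w) = (\<Sum>n. F (n + N) w)" unfolding Fs_def using suminf_split_initial_segment[OF s, of N] by simp
  have g: "(\<lambda>n. (1 / 2) ^ N * (M * (1 / 2) ^ n / cmod w ^ 4)) sums ((1 / 2) ^ N * (M * 2 / cmod w ^ 4))"
   by (rule sums_mult[OF sums_divide[OF geo]])
  have b: "cmod (F (n + N) w) \<le> (1 / 2) ^ N * (M * (1 / 2) ^ n / cmod w ^ 4)" for n using Fb[OF w, of "n + N"] by (simp add: power_add mult_ac)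
  have sn: "summable (\<lambda>n. cmod (F (n + N) w))" by (rule summable_norm_comparison[OF sums_summable[OF g] b])
  have "cmod (\<Sum>n. F (n + N) w) \<le> (\<Sum>n. cmod (F (n + N) w))" by (rule summable_norm[OF sn])
  also have "\<dots> \<le> (1 / 2) ^ N * (M * 2 / cmod w ^ 4)" using suminf_le[OF b sn sums_summable[OF g]] sums_unique[OF g] by simp
  finally show ?thesis unfolding e by (simp add: mult_ac)
 qed
 have hFs: "Fs holomorphic_on H"
 proof (rule holomorphic_uniform_sequence[OF op, where f = "\<lambda>N w. \<Sum>n<N. F n w"])
  show "(\<lambda>w. \<Sum>n<N. F n w) holomorphic_on H" for N by (intro holomorphic_intros FH)
  fix z assume "z \<in> H"
  then obtain d where d: "d > 0" "cball z d \<subseteq> H" using op open_contains_cball by blast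
  have "uniform_limit H (\<lambda>N w. \<Sum>n<N. F n w) Fs sequentially" unfolding Fs_def
  proof (rule Weierstrass_m_test[where M = "\<lambda>n. M / X ^ 4 * (1 / 2) ^ n"])
   fix n w assume w: "w \<in> H"
   have "X ^ 4 \<le> cmod w ^ 4" using w X complex_Re_le_cmod[of w] by (intro power_mono) (auto simp: H_def)
   then have "M * (1 / 2) ^ n / cmod w ^ 4 \<le> M * (1 / 2) ^ n / X ^ 4"
    using M X w by (intro divide_left_mono mult_pos_pos zero_less_power) (auto simp: H_def)
   then show "cmod (F n w) \<le> M / X ^ 4 * (1 / 2) ^ n" using Fb[OF w, of n] by simp
  qed (intro summable_mult summable_geometric, simp)
  then show "\<exists>d>0. cball z d \<subseteq> H \<and> uniform_limit (cball z d) (\<lambda>N w. \<Sum>n<N. F n w) Fs sequentially"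
   using d uniform_limit_on_subset by blast
 qed
 define D where "D = fst (T Fs)"
 define E where "E = snd (T Fs)"
 have J: "jost_pair c X Fs D E" unfolding D_def E_def by (rule T[where M' = "2 * M", OF hFs sumF(2)]) (auto simp: M)
 have Jn: "jost_pair c X (F n) (fst (T (F n))) (snd (T (F n)))" for n using Fb FH M by (intro T[of _ "M * (1 / 2) ^ n"]) auto
 have eq: "Fs w = r w + \<kappa> / w^2 * D w" if w: "w \<in> H" for w
 proof -
  \<comment> \<open>Subtracting the pairs of the first \<open>N\<close> terms from the pair of the
    full sum leaves a decaying pair forced by the tail. The a priori bound thus carries convergence
    from the forcings to the solutions.\<close>
  have "cmod (D w - (\<Sum>n<N. fst (T (F n)) w)) \<le> 4 * M / cmod w ^ 3 * (1 / 2) ^ N" for N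
  proof -
   have JS: "jost_pair c X (\<lambda>w. \<Sum>n<N. F n w) (\<lambda>w. \<Sum>n<N. fst (T (F n)) w) (\<lambda>w. \<Sum>n<N. snd (T (F n)) w)"
    by (rule jost_pair_sum, rule Jn)
   have MN: "0 \<le> 2 * M * (1 / 2) ^ N" using M by simp
   have wX: "Re w > X" using w by (simp add: H_def)
   have t: "cmod (Fs w - (\<Sum>n<N. F n w)) \<le> 2 * M * (1 / 2) ^ N / cmod w ^ 4" if "Re w > X" for w using that by (intro tail) (simp add: H_def)
   have "cmod (D w - (\<Sum>n<N. fst (T (F n)) w)) \<le> 2 * (2 * M * (1 / 2) ^ N) / cmod w ^ 3"
    using jost_pair_bound(1)[OF c X0 MN jost_pair_diff[OF J JS] t wX] .
   then show ?thesis by simp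
  qed
  then have ev: "\<forall>\<^sub>F N in sequentially. cmod (D w - (\<Sum>n<N. fst (T (F n)) w)) \<le> 4 * M / cmod w ^ 3 * (1 / 2) ^ N"
   by (rule always_eventually[OF allI])
  have "(\<lambda>N. 4 * M / cmod w ^ 3 * (1 / 2) ^ N) \<longlonglongrightarrow> 0" by (rule tendsto_mult_right_zero, rule LIMSEQ_power_zero, simp)
  with ev have "(\<lambda>N. D w - (\<Sum>n<N. fst (T (F n)) w)) \<longlonglongrightarrow> 0" by (rule Lim_null_comparison)
  from tendsto_diff[OF tendsto_const[of "D w"] this]
  have "(\<lambda>n. fst (T (F n)) w) sums D w" by (simp add: sums_def)
  from sums_mult[OF this, of "\<kappa> / w^2"] have "(\<lambda>n. F (Suc n) w) sums (\<kappa> / w^2 * D w)" by (simp add: FS)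
  then have "(\<lambda>n. F n w) sums (\<kappa> / w^2 * D w + F 0 w)" by (rule sums_Suc)
  then show ?thesis using sums_unique2[OF sumF(1)[OF w]] by (simp add: F0)
 qed
 show ?thesis
 proof (rule exI[of _ D], rule exI[of _ E], intro allI impI conjI)
  fix w assume w: "Re w > X"
  then have wH: "w \<in> H" by (simp add: H_def)
  note Jw = J[unfolded jost_pair_def, rule_format, OF w]
  show "(D has_field_derivative E w) (at w)" using Jw by simp
  show "(E has_field_derivative r w + \<kappa> / w^2 * D w - c * E w) (at w)" using Jw eq[OF wH] by simp
  have "cmod (D w) \<le> 2 * (2 * M) / cmod w ^ 3" "cmod (E w) \<le> 2 * (2 * M) / cmod w ^ 3"
  proof -
   have M2: "0 \<le> 2 * M" using M by simp
   have s: "cmod (Fs w) \<le> 2 * M / cmod w ^ 4" if "Re w > X" for w using that by (intro sumF(2)) (simp add: H_def)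
   show "cmod (D w) \<le> 2 * (2 * M) / cmod w ^ 3" "cmod (E w) \<le> 2 * (2 * M) / cmod w ^ 3"
    by (rule jost_pair_bound(1)[OF c X0 M2 J s w] jost_pair_bound(2)[OF c X0 M2 J s w]; assumption)+
  qed
  then show "cmod (D w) \<le> 4 * M / cmod w ^ 3" "cmod (E w) \<le> 4 * M / cmod w ^ 3" by simp_all
 qed
qed

text \<open>The formal expansion 1 + p1 / w + p2 / w^2 is carried so far that its defect is of order
  w^-4, the size accepted by \<open>jost_fixed_point\<close>; the correction \<open>D\<close> is
  then O(w^-3).\<close>

theorem jost_solution:
 assumes c: "Re c = 0" "cmod c = 2"
 obtains X K g g' where "X > 0" "K \<ge> 0"
  "\<And>w. Re w > X \<Longrightarrow> (g has_field_derivative g' w) (at w)"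
  "\<And>w. Re w > X \<Longrightarrow> (g' has_field_derivative \<kappa> / w^2 * g w - c * g' w) (at w)"
  "\<And>w. Re w > X \<Longrightarrow> cmod (g w - 1) \<le> K / cmod w"
  "\<And>w. Re w > X \<Longrightarrow> cmod (g' w - \<kappa> / (c * w^2)) \<le> K / cmod w ^ 3"
proof -
 have c0: "c \<noteq> 0" using c by auto
 define X where "X = 4 * cmod \<kappa> + 1"
 have X: "X > 0" "X \<ge> 4 * cmod \<kappa>" "X \<ge> 1" by (auto simp: X_def add_nonneg_pos)
 \<comment> \<open>\<open>p1\<close> and \<open>p2\<close> cancel the coefficients of w^-2 and w^-3
   in g'' + c g' - \<kappa> g / w^2, and \<open>m\<close> is minus the coefficient left at
   w^-4.\<close>
 define p1 where "p1 = - \<kappa> / c"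
 define p2 where "p2 = (2 - \<kappa>) * p1 / (2 * c)"
 define m where "m = (\<kappa> - 6) * p2"
 have p1: "c * p1 = - \<kappa>" using c0 by (simp add: p1_def)
 have p2: "2 * c * p2 = (2 - \<kappa>) * p1" using c0 by (simp add: p2_def)
 have nz: "w \<noteq> 0" if "Re w > X" for w using that X by auto
 define r where "r = (\<lambda>w. m * inverse w ^ 4)"
 have "\<exists>D E. (\<forall>w. Re w > X \<longrightarrow>
   (D has_field_derivative E w) (at w) \<and>
   (E has_field_derivative r w + \<kappa> / w^2 * D w - c * E w) (at w) \<and>
   cmod (D w) \<le> 4 * cmod m / cmod w ^ 3 \<and> cmod (E w) \<le> 4 * cmod m / cmod w ^ 3)"
 proof (rule jost_fixed_point[OF c X(1,2)])
  show "r holomorphic_on {w. Re w > X}" unfolding r_def using nz by (intro holomorphic_intros) auto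
 qed (auto simp: r_def norm_mult norm_power norm_inverse divide_inverse power_inverse)
 then obtain D E where DE: "\<And>w. Re w > X \<Longrightarrow> (D has_field_derivative E w) (at w)"
   "\<And>w. Re w > X \<Longrightarrow> (E has_field_derivative r w + \<kappa> / w^2 * D w - c * E w) (at w)"
   "\<And>w. Re w > X \<Longrightarrow> cmod (D w) \<le> 4 * cmod m / cmod w ^ 3"
   "\<And>w. Re w > X \<Longrightarrow> cmod (E w) \<le> 4 * cmod m / cmod w ^ 3" by blast
 define g where "g = (\<lambda>w. 1 + p1 * inverse w + p2 * inverse w ^ 2 + D w)"
 define g' where "g' = (\<lambda>w. - p1 * inverse w ^ 2 - 2 * p2 * inverse w ^ 3 + E w)"
 define K where "K = cmod p1 + cmod p2 + 4 * cmod m + 2 * cmod p2"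
 have inv: "(inverse has_field_derivative - (inverse w * 1 * inverse w)) (at w)" if "Re w > X" for w :: complex
  using DERIV_inverse'[OF DERIV_ident nz[OF that]] .
 show ?thesis
 proof
  show "X > 0" by (rule X)
  show "K \<ge> 0" by (simp add: K_def)
  fix w assume w: "Re w > X"
  define v where "v = inverse w"
  note iv = inv[OF w]
  have "(g has_field_derivative 0 + p1 * (- (v * 1 * v)) + p2 * (of_nat 2 * (- (v * 1 * v) * v ^ (2 - Suc 0))) + E w) (at w)"
   unfolding g_def v_def by (intro DERIV_add DERIV_const DERIV_cmult DERIV_power iv DE w)
  moreover have "0 + p1 * (- (v * 1 * v)) + p2 * (of_nat 2 * (- (v * 1 * v) * v ^ (2 - Suc 0))) + E w = g' w"
   by (simp add: g'_def v_def[symmetric] power2_eq_square power3_eq_cube)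
  ultimately show "(g has_field_derivative g' w) (at w)" by simp
  have "(g' has_field_derivative - p1 * (of_nat 2 * (- (v * 1 * v) * v ^ (2 - Suc 0)))
     - 2 * p2 * (of_nat 3 * (- (v * 1 * v) * v ^ (3 - Suc 0))) + (r w + \<kappa> / w^2 * D w - c * E w)) (at w)"
   unfolding g'_def v_def by (intro DERIV_add Deriv.field_differentiable_diff DERIV_cmult DERIV_power iv DE w)
  moreover have "- p1 * (of_nat 2 * (- (v * 1 * v) * v ^ (2 - Suc 0)))
     - 2 * p2 * (of_nat 3 * (- (v * 1 * v) * v ^ (3 - Suc 0))) + (r w + \<kappa> / w^2 * D w - c * E w)
    = \<kappa> / w^2 * g w - c * g' w"
  proof -
   have s: "(3::nat) - Suc 0 = 2" "(2::nat) - Suc 0 = 1" by auto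
   have k: "\<kappa> / w^2 = \<kappa> * (v * v)" by (simp add: v_def divide_inverse power2_eq_square)
   have r': "r w = m * (v * v * v * v)" by (simp add: r_def v_def power4_eq_xxxx)
   have gw: "g w = 1 + p1 * v + p2 * (v * v) + D w" by (simp add: g_def v_def power2_eq_square)
   have gw': "g' w = - p1 * (v * v) - 2 * p2 * (v * v * v) + E w" by (simp add: g'_def v_def power2_eq_square power3_eq_cube)
   have m: "m = (\<kappa> - 6) * p2" by (fact m_def)
   show ?thesis unfolding s k r' gw gw' m power_one_right of_nat_numeral unfolding power2_eq_square using p1 p2 by algebra
  qed
  ultimately show "(g' has_field_derivative \<kappa> / w^2 * g w - c * g' w) (at w)" by simp
  define R where "R = cmod w"
  have R: "R \<ge> 1" using w X complex_Re_le_cmod[of w] by (simp add: R_def)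
  have R3: "1 / R ^ 3 \<le> 1 / R" "1 / R^2 \<le> 1 / R" using R by (auto intro!: divide_left_mono self_le_power simp: power2_eq_square)
  have "g w - 1 = p1 * inverse w + p2 * inverse w ^ 2 + D w" by (simp add: g_def)
  then have "cmod (g w - 1) \<le> cmod (p1 * inverse w) + cmod (p2 * inverse w ^ 2) + cmod (D w)"
   by (metis norm_triangle_ineq norm_triangle_le order_refl add_mono)
  also have "\<dots> \<le> cmod p1 * (1 / R) + cmod p2 * (1 / R) + 4 * cmod m * (1 / R)"
  proof (intro add_mono)
   show "cmod (p1 * inverse w) \<le> cmod p1 * (1 / R)" by (simp add: norm_mult norm_inverse R_def divide_inverse)
   show "cmod (p2 * inverse w ^ 2) \<le> cmod p2 * (1 / R)" using mult_left_mono[OF R3(2), of "cmod p2"]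
    by (simp add: norm_mult norm_inverse norm_power R_def divide_inverse power_inverse)
   show "cmod (D w) \<le> 4 * cmod m * (1 / R)" using mult_left_mono[OF R3(1), of "4 * cmod m"] DE(3)[OF w] by (simp add: R_def)
  qed
  also have "\<dots> = (cmod p1 + cmod p2 + 4 * cmod m) / R" by (simp add: add_divide_distrib)
  also have "\<dots> \<le> K / R" using R by (intro divide_right_mono) (auto simp: K_def)
  finally show "cmod (g w - 1) \<le> K / cmod w" by (simp add: R_def)
  have "g' w - \<kappa> / (c * w^2) = - (2 * p2 * inverse w ^ 3) + E w" using c0 by (simp add: g'_def p1_def divide_inverse power_inverse)
  then have "cmod (g' w - \<kappa> / (c * w^2)) \<le> cmod (2 * p2 * inverse w ^ 3) + cmod (E w)" by (metis norm_minus_cancel norm_triangle_ineq)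
  also have "\<dots> \<le> 2 * cmod p2 / R ^ 3 + 4 * cmod m / R ^ 3"
   using DE(4)[OF w] by (intro add_mono) (simp_all add: norm_mult norm_inverse norm_power R_def divide_inverse power_inverse)
  also have "\<dots> = (2 * cmod p2 + 4 * cmod m) / R ^ 3" by (simp add: add_divide_distrib)
  also have "\<dots> \<le> K / R ^ 3" using R by (intro divide_right_mono) (auto simp: K_def)
  finally show "cmod (g' w - \<kappa> / (c * w^2)) \<le> K / cmod w ^ 3" by (simp add: R_def)
 qed
qed

section \<open>Counting the solutions of a transcendental equation\<close>

lemma ln_sublinear_ex:
 fixes A C :: real
 shows "\<exists>P>0. \<forall>p\<ge>P. A * ln (2 * p) + C \<le> p / 2"
proof -
 have "eventually (\<lambda>p::real. A * ln (2 * p) + C \<le> p / 2) at_top" by real_asymp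
 then obtain P where P: "\<And>p. p \<ge> P \<Longrightarrow> A * ln (2 * p) + C \<le> p / 2" by (auto simp: eventually_at_top_linorder)
 show ?thesis
 proof (rule exI[of _ "max P 1"], intro conjI allI impI)
  fix p assume "max P 1 \<le> p"
  then show "A * ln (2 * p) + C \<le> p / 2" using P[of p] by linarith
 qed simp
qed

text \<open>Equality of two exponentials leaves a multiple of 2 pi i undetermined; this integer
  becomes the index of the zeros.\<close>

lemma exp_eq_power_iff:
 fixes z C0 \<epsilon> :: complex and a :: real and j :: nat
 assumes "z \<noteq> 0" "C0 \<noteq> 0" "1 + \<epsilon> \<noteq> 0" "a \<noteq> 0"
 shows "exp (2 * \<i> * z / of_real a) = C0 * z ^ j * (1 + \<epsilon>) \<longleftrightarrow>
  (\<exists>n::int. z + \<i> * of_real (real j * a / 2) * Ln z + (\<i> * of_real (a / 2) * Ln C0 + \<i> * of_real (a / 2) * Ln (1 + \<epsilon>))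
    = of_real (pi * a * of_int n))"
proof -
 define S where "S = Ln C0 + of_nat j * Ln z + Ln (1 + \<epsilon>)"
 have "C0 * z ^ j * (1 + \<epsilon>) = exp S" using assms by (simp add: S_def exp_add exp_of_nat_mult)
 then have "exp (2 * \<i> * z / of_real a) = C0 * z ^ j * (1 + \<epsilon>) \<longleftrightarrow>
   (\<exists>n::int. 2 * \<i> * z / of_real a = S + of_int (2 * n) * pi * \<i>)" by (simp add: exp_eq)
 also have "\<dots> \<longleftrightarrow> (\<exists>n::int. z + \<i> * of_real (real j * a / 2) * Ln z + (\<i> * of_real (a / 2) * Ln C0 + \<i> * of_real (a / 2) * Ln (1 + \<epsilon>))
    = of_real (pi * a * of_int n))"
 proof (rule arg_cong[where f = Ex], rule ext)
  fix n :: int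
  define \<alpha> where "\<alpha> = (of_real a :: complex)"
  define \<pi> where "\<pi> = (of_real pi :: complex)"
  define N where "N = (of_int n :: complex)"
  have \<alpha>: "\<alpha> \<noteq> 0" using assms by (simp add: \<alpha>_def)
  have "2 * \<i> * z / \<alpha> = S + (2 * N) * \<pi> * \<i> \<longleftrightarrow> 2 * \<i> * z = (S + (2 * N) * \<pi> * \<i>) * \<alpha>"
   using \<alpha> by (simp add: nonzero_divide_eq_eq)
  also have "\<dots> \<longleftrightarrow> (- \<i> / 2) * (2 * \<i> * z) = (- \<i> / 2) * ((S + (2 * N) * \<pi> * \<i>) * \<alpha>)"
   by (rule mult_left_cancel[symmetric]) simp
  also have "\<dots> \<longleftrightarrow> z + \<i> * (\<alpha> / 2) * S = \<pi> * \<alpha> * N" by (simp add: algebra_simps add_eq_0_iff)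
  also have "z + \<i> * (\<alpha> / 2) * S = z + \<i> * (of_nat j * \<alpha> / 2) * Ln z + (\<i> * (\<alpha> / 2) * Ln C0 + \<i> * (\<alpha> / 2) * Ln (1 + \<epsilon>))"
   by (simp add: S_def algebra_simps)
  finally show "2 * \<i> * z / of_real a = S + of_int (2 * n) * pi * \<i> \<longleftrightarrow>
    z + \<i> * of_real (real j * a / 2) * Ln z + (\<i> * of_real (a / 2) * Ln C0 + \<i> * of_real (a / 2) * Ln (1 + \<epsilon>))
    = of_real (pi * a * of_int n)" by (simp add: \<alpha>_def \<pi>_def N_def)
 qed
 finally show ?thesis .
qed

text \<open>In logarithmic form the equation is z + h(z) = pi a n, where \<open>h\<close> has
  Lipschitz constant 1/4 and grows only logarithmically. Hence each large n has exactly one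
  solution, and the real parts of solutions are ordered like n. \<open>B\<close> is a prescribed
  lower bound for the threshold.\<close>

lemma zero_sequence_asymptotics:
 fixes Zr :: "complex \<Rightarrow> bool" and \<epsilon> :: "complex \<Rightarrow> complex" and a L B :: real and j :: nat
 assumes a: "a > 0" and L: "L > 0" and C0: "C0 \<noteq> 0"
  and h\<epsilon>: "\<epsilon> holomorphic_on {z. Re z > L}"
  and b\<epsilon>: "\<And>z. Re z > L \<Longrightarrow> cmod (\<epsilon> z) < 1 / 2"
  and Z: "\<And>z. Re z > L \<Longrightarrow> Zr z \<longleftrightarrow> exp (2 * \<i> * z / of_real a) = C0 * z ^ j * (1 + \<epsilon> z)"
 shows "\<exists>(lam\<^sub>0 :: real) (k\<^sub>0 :: nat) (lam :: nat \<Rightarrow> complex). lam\<^sub>0 > B \<and> lam\<^sub>0 > L \<and>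
  bij_betw lam {k\<^sub>0..} {z. Zr z \<and> Re z \<ge> lam\<^sub>0} \<and>
  (\<lambda>k. lam k - (of_real (pi * a * real k) - \<i> * of_real (real j * a / 2 * ln (real k)))) \<in> O(\<lambda>_. 1)"
proof -
 define c where "c = \<i> * of_real (a / 2) * Ln C0"
 define e where "e = (\<lambda>z. \<i> * of_real (a / 2) * Ln (1 + \<epsilon> z))"
 define A where "A = real j * a / 2"
 define l where "l = (\<lambda>z. \<i> * of_real A * Ln z)"
 define h where "h = (\<lambda>z. l z + (c + e z))"
 have A: "A \<ge> 0" using a by (simp add: A_def)
 have Re1: "Re (1 + \<epsilon> z) > 0" if "Re z > L" for z using b\<epsilon>[OF that] abs_Re_le_cmod[of "\<epsilon> z"] by simp
 have n1: "1 + \<epsilon> z \<notin> \<real>\<^sub>\<le>\<^sub>0" "1 + \<epsilon> z \<noteq> 0" if "Re z > L" for z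
 proof -
  show "1 + \<epsilon> z \<notin> \<real>\<^sub>\<le>\<^sub>0" using Re1[OF that] by (simp add: complex_nonpos_Reals_iff)
  then show "1 + \<epsilon> z \<noteq> 0" by (metis nonpos_Reals_zero_I)
 qed
 have Zh: "Zr z \<longleftrightarrow> (\<exists>n::int. z + h z = of_real (pi * a * of_int n))" if z: "Re z > L" for z
 proof -
  have "z \<noteq> 0" "a \<noteq> 0" using z L a by auto
  from exp_eq_power_iff[OF this(1) C0 n1(2)[OF z] this(2), of j] Z[OF z]
  show ?thesis by (simp add: h_def l_def c_def e_def A_def add.assoc)
 qed
 have he: "e holomorphic_on {z. Re z > L}" unfolding e_def using n1 by (intro holomorphic_intros h\<epsilon>) auto
 have be: "cmod (e z) \<le> a / 2" if "Re z > L" for z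
 proof -
  have "cmod (Ln (1 + \<epsilon> z)) \<le> 2 * cmod (\<epsilon> z)" by (rule norm_Ln_le[OF b\<epsilon>[OF that]])
  also have "\<dots> \<le> 1" using b\<epsilon>[OF that] by simp
  finally have "cmod (Ln (1 + \<epsilon> z)) \<le> 1" .
  then have "(a / 2) * cmod (Ln (1 + \<epsilon> z)) \<le> (a / 2) * 1" using a by (intro mult_left_mono) auto
  then show ?thesis using a by (simp add: e_def norm_mult)
 qed
 \<comment> \<open>The summand 4 a makes room for Cauchy's estimate on discs of radius 4 a, which
   yields |e'| \<le> 1/8 from |e| \<le> a / 2; the summand 8 A gives |A / z| \<le> 1/8.\<close>
 define L1 where "L1 = L + 4 * a + 8 * A"
 have L1: "L1 > L" "L1 > 0" "L1 \<ge> L + 4 * a" "L1 \<ge> 8 * A" using a A L by (auto simp: L1_def)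
 define H where "H = {z. Re z > L1}"
 have He: "\<exists>d. (e has_field_derivative d) (at z) \<and> cmod d \<le> 1 / 8" if z: "z \<in> H" for z
 proof -
  have sub: "cball z (4 * a) \<subseteq> {z. Re z > L}"
  proof
   fix w assume "w \<in> cball z (4 * a)"
   then have "cmod (z - w) \<le> 4 * a" by (simp add: dist_norm)
   then have "Re z - Re w \<le> 4 * a" using complex_Re_le_cmod[of "z - w"] by simp
   then show "w \<in> {z. Re z > L}" using z L1 by (simp add: H_def)
  qed
  have "cmod ((deriv ^^ 1) e z) \<le> fact 1 * (a / 2) / (4 * a) ^ 1"
  proof (rule Cauchy_inequality)
   show "e holomorphic_on ball z (4 * a)" using he sub by (meson ball_subset_cball holomorphic_on_subset order_trans)
   show "continuous_on (cball z (4 * a)) e" using he sub holomorphic_on_imp_continuous_on continuous_on_subset by blast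
   show "0 < 4 * a" using a by simp
   fix x assume "cmod (z - x) = 4 * a"
   then have "x \<in> cball z (4 * a)" by (simp add: dist_norm)
   then show "cmod (e x) \<le> a / 2" using sub by (intro be) auto
  qed
  then have "cmod (deriv e z) \<le> 1 / 8" using a by simp
  moreover have "(e has_field_derivative deriv e z) (at z)" using holomorphic_derivI[OF he open_halfspace_Re_gt] z L1 by (simp add: H_def)
  ultimately show ?thesis by blast
 qed
 have Hl: "(l has_field_derivative \<i> * of_real A * inverse z) (at z)" "cmod (\<i> * of_real A * inverse z) \<le> 1 / 8" if z: "z \<in> H" for z
 proof -
  have "z \<notin> \<real>\<^sub>\<le>\<^sub>0" using z L1 by (auto simp: H_def complex_nonpos_Reals_iff)
  from DERIV_cmult[OF has_field_derivative_Ln[OF this], of "\<i> * of_real A"]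
  show "(l has_field_derivative \<i> * of_real A * inverse z) (at z)" unfolding l_def .
  have "8 * A \<le> cmod z" "cmod z > 0" using z L1 complex_Re_le_cmod[of z] by (auto simp: H_def)
  then have 1: "A / cmod z \<le> 1 / 8" by (simp add: field_simps)
  have 2: "cmod (\<i> * of_real A * inverse z) = A / cmod z" using A by (simp add: norm_mult norm_inverse divide_inverse)
  show "cmod (\<i> * of_real A * inverse z) \<le> 1 / 8" unfolding 2 by (rule 1)
 qed
 have Hh: "\<exists>d. (h has_field_derivative d) (at z) \<and> cmod d \<le> 1 / 4" if z: "z \<in> H" for z
 proof -
  obtain d where d: "(e has_field_derivative d) (at z)" "cmod d \<le> 1 / 8" using He[OF z] by blast
  have "(h has_field_derivative \<i> * of_real A * inverse z + (0 + d)) (at z)" unfolding h_def by (intro DERIV_add DERIV_const Hl(1)[OF z] d(1))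
  moreover have "cmod (\<i> * of_real A * inverse z + (0 + d)) \<le> 1 / 4"
   using norm_triangle_ineq[of "\<i> * of_real A * inverse z" "0 + d"] Hl(2)[OF z] d(2) by simp
  ultimately show ?thesis by blast
 qed
 then obtain h' where h': "\<And>z. z \<in> H \<Longrightarrow> (h has_field_derivative h' z) (at z)" "\<And>z. z \<in> H \<Longrightarrow> cmod (h' z) \<le> 1 / 4"
  by metis
 have lip: "cmod (h z - h w) \<le> 1 / 4 * cmod (z - w)" if "z \<in> H" "w \<in> H" for z w by (rule field_differentiable_bound[of H h h' "1 / 4"])
    (use that h' in \<open>auto simp: H_def convex_halfspace_Re_gt intro: has_field_derivative_at_within\<close>)
 \<comment> \<open>The difference of the two solutions deviates from t - s by at most a quarter of
   its own modulus, so its real part is positive.\<close>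
 have mono: "Re z < Re w" if zw: "z \<in> H" "w \<in> H" "z + h z = of_real s" "w + h w = of_real t" "s < t" for z w s t
 proof -
  define D where "D = w - z"
  have "of_real (t - s) - D = h w - h z" unfolding of_real_diff zw(3,4)[symmetric] D_def by simp
  then have 1: "cmod (of_real (t - s) - D) \<le> 1 / 4 * cmod D" using lip[OF zw(2,1)] by (simp add: D_def)
  have "cmod D \<le> cmod (of_real (t - s)) + cmod (of_real (t - s) - D)"
   using norm_triangle_ineq4[of "of_real (t - s)" "of_real (t - s) - D"] by simp
  also have "cmod (of_real (t - s) :: complex) = t - s" using zw(5) by (simp only: norm_of_real)
  finally have 2: "cmod D \<le> (t - s) + 1 / 4 * cmod D" using 1 by linarith
  have "(t - s) - Re D \<le> cmod (of_real (t - s) - D)" using complex_Re_le_cmod[of "of_real (t - s) - D"] by simp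
  then have "Re D > 0" using 1 2 zw(5) by linarith
  then show ?thesis by (simp add: D_def)
 qed
 have inj: "z = w" if zw: "z \<in> H" "w \<in> H" "z + h z = w + h w" for z w
 proof -
  have "z - w = h w - h z" using zw(3) by (simp add: algebra_simps)
  then have "cmod (z - w) \<le> 1 / 4 * cmod (w - z)" using lip[OF zw(2,1)] by simp
  then show ?thesis by (simp add: norm_minus_commute)
 qed
 obtain P where P: "P > 0" "\<And>p. p \<ge> P \<Longrightarrow> A * ln (2 * p) + (A * pi + cmod c + a / 2) \<le> p / 2"
  using ln_sublinear_ex[of A "A * pi + cmod c + a / 2"] by blast
 \<comment> \<open>For p at least this large, the disc of radius p / 2 about p lies in
   \<open>H\<close>, \<open>h\<close> is at most p / 2 on it, and on it |z| \<ge> 1 and Re z >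
   B.\<close>
 define P' where "P' = Max {P, 2 * L1 + 1, 2, 2 * \<bar>B\<bar> + 1}"
 have P': "P' \<ge> P" "P' \<ge> 2 * L1 + 1" "P' \<ge> 2" "P' \<ge> 2 * \<bar>B\<bar> + 1" by (auto simp: P'_def)
 have sol: "\<exists>z \<in> cball (of_real p) (p / 2). z + h z = of_real p" if p: "p \<ge> P'" for p
 proof -
  let ?S = "cball (of_real p :: complex) (p / 2)"
  have S: "Re z \<ge> p / 2" "cmod z \<le> 2 * p" "cmod z \<ge> 1" "z \<in> H" if z: "z \<in> ?S" for z
  proof -
   have d: "cmod (of_real p - z) \<le> p / 2" using z by (simp add: dist_norm)
   then show 1: "Re z \<ge> p / 2" using complex_Re_le_cmod[of "of_real p - z"] by simp
   show "cmod z \<le> 2 * p" using norm_triangle_ineq4[of "of_real p" "of_real p - z"] d p P' by simp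
   show "cmod z \<ge> 1" using 1 complex_Re_le_cmod[of z] p P' by linarith
   show "z \<in> H" using 1 p P' by (simp add: H_def)
  qed
  have hb: "cmod (h z) \<le> p / 2" if z: "z \<in> ?S" for z
  proof -
   have z0: "z \<noteq> 0" using S(3)[OF z] by auto
   have "cmod (Ln z) \<le> \<bar>Re (Ln z)\<bar> + \<bar>Im (Ln z)\<bar>" by (rule cmod_le)
   also have "\<bar>Im (Ln z)\<bar> \<le> pi" using mpi_less_Im_Ln[OF z0] Im_Ln_le_pi[OF z0] by linarith
   also have "\<bar>Re (Ln z)\<bar> = ln (cmod z)" using S(3)[OF z] z0 by simp
   also have "\<dots> \<le> ln (2 * p)" using S(2,3)[OF z] by (intro ln_mono) auto
   finally have "cmod (Ln z) \<le> ln (2 * p) + pi" by simp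
   then have "A * cmod (Ln z) \<le> A * (ln (2 * p) + pi)" using A by (intro mult_left_mono)
   then have "cmod (l z) \<le> A * ln (2 * p) + A * pi" using A by (simp add: l_def norm_mult algebra_simps)
   moreover have "cmod (e z) \<le> a / 2" using S(4)[OF z] L1 by (intro be) (simp add: H_def)
   moreover have "cmod (h z) \<le> cmod (l z) + (cmod c + cmod (e z))"
    unfolding h_def using norm_triangle_ineq[of "l z" "c + e z"] norm_triangle_ineq[of c "e z"] by linarith
   ultimately show ?thesis using P(2)[of p] p P' by linarith
  qed
  have "\<exists>!z\<in>?S. of_real p - h z = z"
  proof (rule Banach_fix)
   show "complete ?S" by (intro compact_imp_complete compact_cball)
   show "?S \<noteq> {}" using p P' by (auto simp: cball_eq_empty)
   show "(0::real) \<le> 1 / 4" "(1::real) / 4 < 1" by auto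
   show "(\<lambda>z. of_real p - h z) ` ?S \<subseteq> ?S" using hb by (auto simp: dist_norm)
   show "dist (of_real p - h z) (of_real p - h w) \<le> 1 / 4 * dist z w" if "z \<in> ?S" "w \<in> ?S" for z w
    using lip[OF S(4)[OF that(2)] S(4)[OF that(1)]] by (simp add: dist_norm norm_minus_commute)
  qed
  then obtain z where "z \<in> ?S" "of_real p - h z = z" by blast
  then show ?thesis by (intro bexI[of _ z]) (simp_all add: algebra_simps)
 qed
 obtain k0 :: nat where k0: "P' \<le> pi * a * real k0"
 proof -
  obtain n :: nat where "P' / (pi * a) \<le> real n" using real_arch_simple by blast
  then show ?thesis using that[of n] a by (simp add: field_simps)
 qed
 have k0': "P' \<le> pi * a * real k" if "k \<ge> k0" for k
  using k0 a that by (meson mult_left_mono of_nat_le_iff order_trans mult_nonneg_nonneg pi_ge_zero less_imp_le)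
 have k0pos: "k0 > 0" using k0 P' by (cases k0) auto
 define lam where "lam = (\<lambda>k. SOME z. z \<in> cball (of_real (pi * a * real k)) (pi * a * real k / 2) \<and> z + h z = of_real (pi * a * real k))"
 have lam: "lam k \<in> cball (of_real (pi * a * real k)) (pi * a * real k / 2)" "lam k + h (lam k) = of_real (pi * a * real k)"
  if "k \<ge> k0" for k using someI_ex[OF sol[OF k0'[OF that], unfolded Bex_def]] unfolding lam_def by blast+
 have lamRe: "Re (lam k) \<ge> pi * a * real k / 2" if "k \<ge> k0" for k
 proof -
  have "cmod (of_real (pi * a * real k) - lam k) \<le> pi * a * real k / 2" using lam(1)[OF that] by (simp only: mem_cball dist_norm)
  then show ?thesis using complex_Re_le_cmod[of "of_real (pi * a * real k) - lam k"] by simp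
 qed
 have lamH: "lam k \<in> H" "Re (lam k) > B" if "k \<ge> k0" for k using lamRe[OF that] k0'[OF that] P' by (auto simp: H_def)
 \<comment> \<open>With the real part of the first zero as threshold, monotonicity makes the
   half-plane contain exactly the zeros of index at least \<open>k0\<close>.\<close>
 define lam0 where "lam0 = Re (lam k0)"
 have lam0: "lam0 > B" "lam0 > L1" using lamH[of k0] by (auto simp: lam0_def H_def)
 have ltpi: "pi * a * x < pi * a * y \<longleftrightarrow> x < y" for x y :: real using a by (simp add: mult_less_cancel_left_pos)
 have "bij_betw lam {k0..} {z. Zr z \<and> Re z \<ge> lam0}"
 proof (rule bij_betwI')
  fix k k' assume k: "k \<in> {k0..}" "k' \<in> {k0..}"
  show "lam k = lam k' \<longleftrightarrow> k = k'"
  proof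
   assume "lam k = lam k'"
   then have "lam k + h (lam k) = lam k' + h (lam k')" by simp
   also have "lam k' + h (lam k') = of_real (pi * a * real k')" using k by (intro lam(2)) simp
   also have "lam k + h (lam k) = of_real (pi * a * real k)" using k by (intro lam(2)) simp
   finally have "pi * a * real k = pi * a * real k'" by (simp only: of_real_eq_iff)
   then show "k = k'" using a by simp
  qed auto
 next
  fix k assume k: "k \<in> {k0..}"
  have "Re (lam k) > L" using lamH(1)[of k] k L1 by (simp add: H_def)
  moreover have "lam k + h (lam k) = of_real (pi * a * of_int (int k))" using lam(2)[of k] k by simp
  ultimately have "Zr (lam k)" using Zh by blast
  moreover have "Re (lam k) \<ge> lam0"
  proof (cases "k = k0")
   case False
   then have "Re (lam k0) < Re (lam k)" using k a by (intro mono[OF lamH(1) lamH(1) lam(2) lam(2)]) auto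
   then show ?thesis by (simp add: lam0_def)
  qed (simp add: lam0_def)
  ultimately show "lam k \<in> {z. Zr z \<and> Re z \<ge> lam0}" by simp
 next
  fix z assume z: "z \<in> {z. Zr z \<and> Re z \<ge> lam0}"
  then have zH: "z \<in> H" "Re z > L" using lam0 L1 by (auto simp: H_def)
  then obtain n :: int where n: "z + h z = of_real (pi * a * of_int n)" using Zh z by blast
  \<comment> \<open>A zero beyond the threshold could a priori carry a small or negative integer;
    monotonicity excludes this.\<close>
  have nk: "n \<ge> int k0"
  proof (rule ccontr)
   assume "\<not> n \<ge> int k0"
   then have "real_of_int n < real k0" by linarith
   then have "pi * a * of_int n < pi * a * real k0" by (simp only: ltpi)
   from mono[OF zH(1) lamH(1)[OF order_refl] n lam(2)[OF order_refl] this] z show False by (simp add: lam0_def)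
  qed
  then have nn: "n = int (nat n)" "nat n \<ge> k0" by auto
  have "z = lam (nat n)"
  proof (rule inj[OF zH(1) lamH(1)[OF nn(2)]])
   show "z + h z = lam (nat n) + h (lam (nat n))" unfolding n lam(2)[OF nn(2)] using nn(1) by (metis of_int_of_nat_eq)
  qed
  then show "\<exists>k\<in>{k0..}. z = lam k" using nn by auto
 qed
 moreover have "(\<lambda>k. lam k - (of_real (pi * a * real k) - \<i> * of_real (real j * a / 2 * ln (real k)))) \<in> O(\<lambda>_. 1)"
 \<comment> \<open>The terms bound the logarithm of |lam k| / k, which lies between those of pi a /
   2 and 2 pi a, the argument of \<open>lam k\<close>, and the bounded functions \<open>c\<close>
   and \<open>e\<close>.\<close>
 proof (rule bigoI[where c = "A * (\<bar>ln (pi * a / 2)\<bar> + \<bar>ln (2 * (pi * a))\<bar> + pi) + cmod c + a / 2"])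
  show "\<forall>\<^sub>F k in sequentially. norm (lam k - (of_real (pi * a * real k) - \<i> * of_real (real j * a / 2 * ln (real k))))
    \<le> (A * (\<bar>ln (pi * a / 2)\<bar> + \<bar>ln (2 * (pi * a))\<bar> + pi) + cmod c + a / 2) * norm (1 :: complex)"
  proof (rule eventually_sequentiallyI[of k0])
   fix k assume k: "k \<ge> k0"
   define z where "z = lam k"
   define x where "x = pi * a"
   have x: "x > 0" using a by (simp add: x_def)
   have kpos: "real k > 0" using k k0pos by simp
   have zR: "Re z \<ge> x * real k / 2" using lamRe[OF k] by (simp add: z_def x_def)
   have z1: "cmod z \<ge> (x / 2) * real k" using zR complex_Re_le_cmod[of z] by simp
   define y where "y = (of_real (x * real k) :: complex)"
   have y: "cmod y = x * real k" unfolding y_def norm_of_real using x by simp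
   have "cmod (y - z) \<le> x * real k / 2" using lam(1)[OF k] by (simp only: mem_cball dist_norm z_def x_def y_def)
   then have z2: "cmod z \<le> (2 * x) * real k" using norm_triangle_ineq4[of y "y - z"] y mult_pos_pos[OF x kpos] by simp
   have zpos: "cmod z > 0" using z1 x kpos by (smt (verit) mult_pos_pos half_gt_zero)
   then have z0: "z \<noteq> 0" by auto
   have l1: "ln (cmod z) \<ge> ln (x / 2) + ln (real k)" using z1 x kpos zpos by (subst ln_mult_pos[symmetric]) auto
   have l2: "ln (cmod z) \<le> ln (2 * x) + ln (real k)" using z2 x kpos zpos by (subst ln_mult_pos[symmetric]) auto
   have "cmod (Ln z - of_real (ln (real k))) \<le> \<bar>Re (Ln z - of_real (ln (real k)))\<bar> + \<bar>Im (Ln z - of_real (ln (real k)))\<bar>"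
    by (rule cmod_le)
   also have "\<bar>Im (Ln z - of_real (ln (real k)))\<bar> \<le> pi" using mpi_less_Im_Ln[OF z0] Im_Ln_le_pi[OF z0] by simp
   also have "\<bar>Re (Ln z - of_real (ln (real k)))\<bar> \<le> \<bar>ln (x / 2)\<bar> + \<bar>ln (2 * x)\<bar>" using l1 l2 z0 by simp
   finally have q: "cmod (Ln z - of_real (ln (real k))) \<le> \<bar>ln (x / 2)\<bar> + \<bar>ln (2 * x)\<bar> + pi" by simp
   have ez: "cmod (e z) \<le> a / 2" using lamH(1)[OF k] L1 by (intro be) (simp add: H_def z_def)
   have "z + h z = of_real (pi * a * real k)" using lam(2)[OF k] by (simp add: z_def)
   then have "z - (of_real (pi * a * real k) - \<i> * of_real (A * ln (real k))) =
     \<i> * of_real (A * ln (real k)) - h z" by (simp add: algebra_simps)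
   also have "\<dots> = - (\<i> * of_real A * (Ln z - of_real (ln (real k)))) - c - e z" by (simp add: h_def l_def algebra_simps)
   finally have "cmod (z - (of_real (pi * a * real k) - \<i> * of_real (A * ln (real k))))
     \<le> cmod (\<i> * of_real A * (Ln z - of_real (ln (real k)))) + cmod c + cmod (e z)"
    using norm_triangle_ineq4[of "- (\<i> * of_real A * (Ln z - of_real (ln (real k)))) - c" "e z"]
     norm_triangle_ineq4[of "- (\<i> * of_real A * (Ln z - of_real (ln (real k))))" c] by simp
   also have "cmod (\<i> * of_real A * (Ln z - of_real (ln (real k)))) = A * cmod (Ln z - of_real (ln (real k)))" using A by (simp add: norm_mult)
   also have "\<dots> \<le> A * (\<bar>ln (x / 2)\<bar> + \<bar>ln (2 * x)\<bar> + pi)" using q A by (rule mult_left_mono)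
   finally have "cmod (z - (of_real (pi * a * real k) - \<i> * of_real (A * ln (real k)))) \<le> A * (\<bar>ln (x / 2)\<bar> + \<bar>ln (2 * x)\<bar> + pi) + cmod c + a / 2"
    using ez by linarith
   then show "norm (lam k - (of_real (pi * a * real k) - \<i> * of_real (real j * a / 2 * ln (real k))))
    \<le> (A * (\<bar>ln (pi * a / 2)\<bar> + \<bar>ln (2 * (pi * a))\<bar> + pi) + cmod c + a / 2) * norm (1 :: complex)"
    unfolding z_def x_def A_def by simp
  qed
 qed
 ultimately show ?thesis using lam0 L1 by (intro exI[of _ lam0], intro exI[of _ k0], intro exI[of _ lam]) auto
qed

section \<open>Square integrable functions and nonnegative forms\<close>

definition sqn :: "'a measure \<Rightarrow> ('a \<Rightarrow> complex) \<Rightarrow> real" where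
 "sqn M u = (\<integral>x. (cmod (u x))^2 \<partial>M)"

lemma sqn_nonneg: "sqn M u \<ge> 0" unfolding sqn_def by (rule integral_nonneg_AE) simp

lemma L2_spaceD:
 assumes "u \<in> L2_space M"
 shows "u \<in> borel_measurable M" "integrable M (\<lambda>x. (cmod (u x))^2)" using assms by (auto simp: L2_space_def)

lemma L2_spaceI:
 assumes "u \<in> borel_measurable M" "integrable M (\<lambda>x. (cmod (u x))^2)"
 shows "u \<in> L2_space M" using assms by (auto simp: L2_space_def)

lemma cmod_add_square_le: "(cmod (x + y))^2 \<le> 2 * (cmod x)^2 + 2 * (cmod y)^2"
proof -
 have "(cmod (x + y))^2 \<le> (cmod x + cmod y)^2" by (intro power_mono norm_triangle_ineq) auto
 also have "\<dots> \<le> 2 * (cmod x)^2 + 2 * (cmod y)^2" using sum_squares_bound[of "cmod x" "cmod y"] by (simp add: power2_sum)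
 finally show ?thesis .
qed

lemma cmod_diff_square_le: "(cmod (x - y))^2 \<le> 2 * (cmod x)^2 + 2 * (cmod y)^2" using cmod_add_square_le[of x "- y"] by simp

lemma L2_space_scale: "u \<in> L2_space M \<Longrightarrow> (\<lambda>x. c * u x) \<in> L2_space M"
 by (auto simp: L2_space_def norm_mult power_mult_distrib)

lemma L2_space_diff:
 assumes "u \<in> L2_space M" "v \<in> L2_space M"
 shows "(\<lambda>x. u x - v x) \<in> L2_space M"
proof (rule L2_spaceI)
 note [measurable] = L2_spaceD(1)[OF assms(1)] L2_spaceD(1)[OF assms(2)]
 show "(\<lambda>x. u x - v x) \<in> borel_measurable M" by measurable
 show "integrable M (\<lambda>x. (cmod (u x - v x))^2)"
 proof (rule Bochner_Integration.integrable_bound)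
  show "integrable M (\<lambda>x. 2 * (cmod (u x))^2 + 2 * (cmod (v x))^2)"
   using assms by (intro Bochner_Integration.integrable_add integrable_mult_right) (auto simp: L2_space_def)
  show "AE x in M. norm ((cmod (u x - v x))^2) \<le> norm (2 * (cmod (u x))^2 + 2 * (cmod (v x))^2)" using cmod_diff_square_le by auto
 qed measurable
qed

lemma L2_space_add:
 assumes "u \<in> L2_space M" "v \<in> L2_space M"
 shows "(\<lambda>x. u x + v x) \<in> L2_space M" using L2_space_diff[OF assms(1) L2_space_scale[OF assms(2), of "- 1"]] by simp

lemma sqn_diff_le:
 assumes "u \<in> L2_space M" "v \<in> L2_space M"
 shows "sqn M (\<lambda>x. u x - v x) \<le> 2 * sqn M u + 2 * sqn M v"
proof -
 have "sqn M (\<lambda>x. u x - v x) \<le> (\<integral>x. 2 * (cmod (u x))^2 + 2 * (cmod (v x))^2 \<partial>M)" unfolding sqn_def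
  using L2_spaceD[OF L2_space_diff[OF assms]] L2_spaceD[OF assms(1)] L2_spaceD[OF assms(2)]
  by (intro integral_mono cmod_diff_square_le Bochner_Integration.integrable_add integrable_mult_right) auto
 also have "\<dots> = 2 * sqn M u + 2 * sqn M v" unfolding sqn_def using L2_spaceD[OF assms(1)] L2_spaceD[OF assms(2)] by simp
 finally show ?thesis .
qed

lemma integrable_L2_inner:
 assumes "u \<in> L2_space M" "v \<in> L2_space M"
 shows "integrable M (\<lambda>x. u x * cnj (v x))"
proof (rule Bochner_Integration.integrable_bound)
 note [measurable] = L2_spaceD(1)[OF assms(1)] L2_spaceD(1)[OF assms(2)]
 show "integrable M (\<lambda>x. (cmod (u x))^2 + (cmod (v x))^2)" using assms by (intro Bochner_Integration.integrable_add) (auto simp: L2_space_def)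
 have [measurable]: "(\<lambda>x. cnj (v x)) \<in> borel_measurable M"
  by (rule measurable_compose[OF L2_spaceD(1)[OF assms(2)] borel_measurable_continuous_onI]) (intro continuous_intros)
 show "(\<lambda>x. u x * cnj (v x)) \<in> borel_measurable M" by measurable
 show "AE x in M. norm (u x * cnj (v x)) \<le> norm ((cmod (u x))^2 + (cmod (v x))^2)"
 proof (rule AE_I2)
  fix x
  define t where "t = cmod (u x) * cmod (v x)"
  have "2 * t \<le> (cmod (u x))^2 + (cmod (v x))^2" "0 \<le> t" using sum_squares_bound[of "cmod (u x)" "cmod (v x)"] by (simp_all add: t_def)
  then have "t \<le> (cmod (u x))^2 + (cmod (v x))^2" by linarith
  then show "norm (u x * cnj (v x)) \<le> norm ((cmod (u x))^2 + (cmod (v x))^2)" by (simp add: norm_mult t_def)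
 qed
qed

lemma L2_inner_diff_left:
 assumes "u \<in> L2_space M" "v \<in> L2_space M" "w \<in> L2_space M"
 shows "L2_inner M (\<lambda>x. u x - v x) w = L2_inner M u w - L2_inner M v w" unfolding L2_inner_def left_diff_distrib
 by (rule Bochner_Integration.integral_diff) (intro integrable_L2_inner assms)+

lemma L2_inner_diff_right:
 assumes "u \<in> L2_space M" "v \<in> L2_space M" "w \<in> L2_space M"
 shows "L2_inner M w (\<lambda>x. u x - v x) = L2_inner M w u - L2_inner M w v" unfolding L2_inner_def complex_cnj_diff right_diff_distrib
 by (rule Bochner_Integration.integral_diff) (intro integrable_L2_inner assms)+

lemma L2_inner_scale_left: "L2_inner M (\<lambda>x. c * u x) v = c * L2_inner M u v" by (simp add: L2_inner_def mult.assoc)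

lemma L2_inner_scale_right: "L2_inner M u (\<lambda>x. c * v x) = cnj c * L2_inner M u v"
proof -
 have "L2_inner M u (\<lambda>x. c * v x) = (\<integral>x. cnj c * (u x * cnj (v x)) \<partial>M)" by (simp add: L2_inner_def mult_ac)
 then show ?thesis by (simp add: L2_inner_def)
qed

lemma L2_inner_commute: "L2_inner M u v = cnj (L2_inner M v u)"
proof -
 have eq: "(\<lambda>x. u x * cnj (v x)) = (\<lambda>x. cnj (v x * cnj (u x)))" by (simp add: mult.commute)
 show ?thesis unfolding L2_inner_def eq by (rule Bochner_Integration.integral_cnj)
qed

lemma L2_inner_self: "L2_inner M u u = of_real (sqn M u)" by (simp only: L2_inner_def sqn_def integral_complex_of_real[symmetric] complex_norm_square)

text \<open>The best weight is sqrt B / sqrt A; the shift \<open>d\<close> keeps it positive and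
  finite when \<open>A\<close> or \<open>B\<close> vanishes. The Cauchy-Schwarz inequalities for the
  inner product and for the form both come from here.\<close>

lemma le_sqrt_mult_of_weighted:
 fixes x A B :: real
 assumes A: "A \<ge> 0" and B: "B \<ge> 0" and t: "\<And>t. t > 0 \<Longrightarrow> 2 * x \<le> t * A + B / t"
 shows "x \<le> sqrt A * sqrt B"
proof (rule field_le_epsilon)
 fix e :: real assume e: "e > 0"
 define p where "p = sqrt A"
 define q where "q = sqrt B"
 have p: "p \<ge> 0" "q \<ge> 0" "A = p * p" "B = q * q" using A B by (auto simp: p_def q_def)
 define d where "d = min 1 (e / (p + q + 1))"
 have d: "d > 0" "d \<le> 1" "d * (p + q + 1) \<le> e"
 proof -
  have pq: "p + q + 1 > 0" using p by simp
  then show "d > 0" using e by (simp add: d_def)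
  show "d \<le> 1" by (simp add: d_def)
  have "d \<le> e / (p + q + 1)" by (simp add: d_def)
  then show "d * (p + q + 1) \<le> e" using pq by (simp add: pos_le_divide_eq)
 qed
 have pd: "p + d > 0" "q + d > 0" using p d by auto
 have "2 * x \<le> (q + d) / (p + d) * A + B / ((q + d) / (p + d))" using pd by (intro t) simp
 also have "(q + d) / (p + d) * A \<le> (q + d) * p"
 proof -
  have "A / (p + d) \<le> p" using p d pd by (simp add: pos_divide_le_eq mult_left_mono)
  then have "(q + d) * (A / (p + d)) \<le> (q + d) * p" using pd by (intro mult_left_mono) auto
  then show ?thesis by simp
 qed
 also have "B / ((q + d) / (p + d)) \<le> (p + d) * q"
 proof -
  have "B / (q + d) \<le> q" using p d pd by (simp add: pos_divide_le_eq mult_left_mono)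
  then have "(p + d) * (B / (q + d)) \<le> (p + d) * q" using pd by (intro mult_left_mono) auto
  then show ?thesis by (simp add: mult.commute)
 qed
 finally have 1: "2 * x \<le> 2 * (p * q) + d * (p + q)" by (simp add: algebra_simps)
 have "d * (p + q) \<le> d * (p + q + 1)" using d by (intro mult_left_mono) auto
 then show "x \<le> sqrt A * sqrt B + e" using 1 d e unfolding p_def[symmetric] q_def[symmetric] by linarith
qed

lemma L2_Cauchy_Schwarz:
 assumes "u \<in> L2_space M" "v \<in> L2_space M"
 shows "cmod (L2_inner M u v) \<le> sqrt (sqn M u) * sqrt (sqn M v)"
proof (rule le_sqrt_mult_of_weighted)
 show "0 \<le> sqn M u" "0 \<le> sqn M v" by (rule sqn_nonneg)+
 fix t :: real assume t: "t > 0"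
 have iu: "integrable M (\<lambda>x. t * (cmod (u x))^2)" and iv: "integrable M (\<lambda>x. (cmod (v x))^2 / t)"
  using assms by (auto simp: L2_space_def)
 have "cmod (L2_inner M u v) \<le> (\<integral>x. cmod (u x * cnj (v x)) \<partial>M)" unfolding L2_inner_def by (rule integral_norm_bound)
 also have "2 * \<dots> = (\<integral>x. 2 * cmod (u x * cnj (v x)) \<partial>M)" by simp
 also have "\<dots> \<le> (\<integral>x. t * (cmod (u x))^2 + (cmod (v x))^2 / t \<partial>M)"
 proof (intro integral_mono)
  show "integrable M (\<lambda>x. 2 * cmod (u x * cnj (v x)))" by (intro integrable_mult_right integrable_norm integrable_L2_inner assms)
  show "integrable M (\<lambda>x. t * (cmod (u x))^2 + (cmod (v x))^2 / t)" using iu iv by (rule Bochner_Integration.integrable_add)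
  fix x
  define p where "p = sqrt t * cmod (u x)"
  define q where "q = cmod (v x) / sqrt t"
  have "2 * p * q \<le> p^2 + q^2" by (rule sum_squares_bound)
  moreover have "p * q = cmod (u x) * cmod (v x)" using t by (simp add: p_def q_def)
  moreover have "p^2 = t * (cmod (u x))^2" "q^2 = (cmod (v x))^2 / t" using t by (simp_all add: p_def q_def power_mult_distrib power_divide)
  ultimately show "2 * cmod (u x * cnj (v x)) \<le> t * (cmod (u x))^2 + (cmod (v x))^2 / t" by (simp add: norm_mult)
 qed
 also have "\<dots> = t * sqn M u + sqn M v / t" unfolding sqn_def using iu iv by (simp add: Bochner_Integration.integral_add)
 finally show "2 * cmod (L2_inner M u v) \<le> t * sqn M u + sqn M v / t" by simp
qed

lemma L2_inner_tendsto_left: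
 assumes "\<And>n. \<phi> n \<in> L2_space M" "u \<in> L2_space M" "v \<in> L2_space M"
  and lim: "(\<lambda>n. sqn M (\<lambda>x. \<phi> n x - u x)) \<longlonglongrightarrow> 0"
 shows "(\<lambda>n. L2_inner M (\<phi> n) v) \<longlonglongrightarrow> L2_inner M u v"
proof (rule LIM_zero_cancel)
 have b: "cmod (L2_inner M (\<phi> n) v - L2_inner M u v) \<le> sqrt (sqn M (\<lambda>x. \<phi> n x - u x)) * sqrt (sqn M v)" for n
  using L2_Cauchy_Schwarz[OF L2_space_diff[OF assms(1)[of n] assms(2)] assms(3)] by (simp add: L2_inner_diff_left assms)
 have "(\<lambda>n. sqrt (sqn M (\<lambda>x. \<phi> n x - u x)) * sqrt (sqn M v)) \<longlonglongrightarrow> sqrt 0 * sqrt (sqn M v)"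
  by (intro tendsto_intros lim)
 then have l: "(\<lambda>n. sqrt (sqn M (\<lambda>x. \<phi> n x - u x)) * sqrt (sqn M v)) \<longlonglongrightarrow> 0" by simp
 show "(\<lambda>n. L2_inner M (\<phi> n) v - L2_inner M u v) \<longlonglongrightarrow> 0"
  by (rule Lim_null_comparison[OF always_eventually[OF allI[OF b]] l])
qed

lemma L2_inner_tendsto_right:
 assumes "\<And>n. \<phi> n \<in> L2_space M" "u \<in> L2_space M" "v \<in> L2_space M"
  and lim: "(\<lambda>n. sqn M (\<lambda>x. \<phi> n x - u x)) \<longlonglongrightarrow> 0"
 shows "(\<lambda>n. L2_inner M v (\<phi> n)) \<longlonglongrightarrow> L2_inner M v u"
 using tendsto_cnj[OF L2_inner_tendsto_left[OF assms]] L2_inner_commute[of M v] by simp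

section \<open>The Friedrichs extension of an abstract nonnegative operator\<close>

locale nonneg_form =
 fixes M :: "'a measure" and D :: "('a \<Rightarrow> complex) set" and T :: "('a \<Rightarrow> complex) \<Rightarrow> 'a \<Rightarrow> complex"
 assumes D_L2: "\<phi> \<in> D \<Longrightarrow> \<phi> \<in> L2_space M" and T_L2: "\<phi> \<in> D \<Longrightarrow> T \<phi> \<in> L2_space M"
  and D_diff: "\<phi> \<in> D \<Longrightarrow> \<psi> \<in> D \<Longrightarrow> (\<lambda>x. \<phi> x - \<psi> x) \<in> D"
  and D_scale: "\<phi> \<in> D \<Longrightarrow> (\<lambda>x. c * \<phi> x) \<in> D"
  and T_diff: "\<phi> \<in> D \<Longrightarrow> \<psi> \<in> D \<Longrightarrow> T (\<lambda>x. \<phi> x - \<psi> x) = (\<lambda>x. T \<phi> x - T \<psi> x)"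
  and T_scale: "\<phi> \<in> D \<Longrightarrow> T (\<lambda>x. c * \<phi> x) = (\<lambda>x. c * T \<phi> x)"
  and T_herm: "\<phi> \<in> D \<Longrightarrow> \<psi> \<in> D \<Longrightarrow> L2_inner M (T \<phi>) \<psi> = cnj (L2_inner M (T \<psi>) \<phi>)"
  and T_nonneg: "\<phi> \<in> D \<Longrightarrow> Re (L2_inner M (T \<phi>) \<phi>) \<ge> 0"
begin

definition Q :: "('a \<Rightarrow> complex) \<Rightarrow> ('a \<Rightarrow> complex) \<Rightarrow> complex" where
 "Q \<phi> \<psi> = L2_inner M (T \<phi>) \<psi>"

lemma Q_diff_left: "\<phi> \<in> D \<Longrightarrow> \<psi> \<in> D \<Longrightarrow> \<eta> \<in> D \<Longrightarrow> Q (\<lambda>x. \<phi> x - \<psi> x) \<eta> = Q \<phi> \<eta> - Q \<psi> \<eta>"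
 unfolding Q_def by (simp add: T_diff L2_inner_diff_left T_L2 D_L2)

lemma Q_diff_right: "\<phi> \<in> D \<Longrightarrow> \<psi> \<in> D \<Longrightarrow> \<eta> \<in> D \<Longrightarrow> Q \<eta> (\<lambda>x. \<phi> x - \<psi> x) = Q \<eta> \<phi> - Q \<eta> \<psi>"
 unfolding Q_def by (simp add: L2_inner_diff_right T_L2 D_L2)

lemma Q_scale: "\<phi> \<in> D \<Longrightarrow> Q (\<lambda>x. c * \<phi> x) \<psi> = c * Q \<phi> \<psi>" "Q \<phi> (\<lambda>x. c * \<psi> x) = cnj c * Q \<phi> \<psi>"
 unfolding Q_def by (simp_all add: T_scale L2_inner_scale_left L2_inner_scale_right)

lemma Q_herm: "\<phi> \<in> D \<Longrightarrow> \<psi> \<in> D \<Longrightarrow> Q \<phi> \<psi> = cnj (Q \<psi> \<phi>)"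
 unfolding Q_def by (rule T_herm)

lemma Q_nonneg: "\<phi> \<in> D \<Longrightarrow> Re (Q \<phi> \<phi>) \<ge> 0" unfolding Q_def by (rule T_nonneg)

lemma Q_real: "\<phi> \<in> D \<Longrightarrow> Im (Q \<phi> \<phi>) = 0" using Q_herm[of \<phi> \<phi>] by (metis Reals_cnj_iff complex_is_Real_iff)

lemma Q_diff_expand:
 assumes "\<phi> \<in> D" "\<psi> \<in> D"
 shows "Re (Q (\<lambda>x. \<phi> x - \<psi> x) (\<lambda>x. \<phi> x - \<psi> x)) = Re (Q \<phi> \<phi>) + Re (Q \<psi> \<psi>) - 2 * Re (Q \<phi> \<psi>)"
 using assms Q_herm[OF assms] by (simp add: Q_diff_left Q_diff_right D_diff)

lemma Q_Cauchy_Schwarz: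
 assumes "\<phi> \<in> D" "\<psi> \<in> D"
 shows "cmod (Q \<phi> \<psi>) \<le> sqrt (Re (Q \<phi> \<phi>)) * sqrt (Re (Q \<psi> \<psi>))"
proof (rule le_sqrt_mult_of_weighted)
 show "0 \<le> Re (Q \<phi> \<phi>)" "0 \<le> Re (Q \<psi> \<psi>)" using assms Q_nonneg by auto
 fix t :: real assume t: "t > 0"
 define s where "s = sqrt t"
 have s: "s > 0" "s * s = t" using t by (auto simp: s_def)
 \<comment> \<open>A phase that turns \<open>Q \<phi> \<psi>\<close> into its modulus.\<close>
 define e where "e = (if Q \<phi> \<psi> = 0 then 1 else cnj (Q \<phi> \<psi>) / of_real (cmod (Q \<phi> \<psi>)))"
 have e: "cmod e = 1" "e * Q \<phi> \<psi> = of_real (cmod (Q \<phi> \<psi>))"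
 proof -
  show "cmod e = 1" by (auto simp: e_def norm_divide)
  have "cnj (Q \<phi> \<psi>) * Q \<phi> \<psi> = of_real (cmod (Q \<phi> \<psi>)) * of_real (cmod (Q \<phi> \<psi>))"
   by (metis complex_norm_square mult.commute power2_eq_square of_real_mult)
  then show "e * Q \<phi> \<psi> = of_real (cmod (Q \<phi> \<psi>))" by (auto simp: e_def)
 qed
 have ee: "e * cnj e = 1" using e(1) complex_norm_square[of e] by simp
 define f where "f = (\<lambda>x. (e * of_real s) * \<phi> x)"
 define \<sigma> where "\<sigma> = (of_real (1 / s) :: complex)"
 have \<sigma>: "cnj \<sigma> = \<sigma>" "of_real s * \<sigma> = 1" "\<sigma> * \<sigma> = of_real (1 / t)"
  using s(1) by (simp_all add: \<sigma>_def flip: s(2))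
 define g where "g = (\<lambda>x. \<sigma> * \<psi> x)"
 have fD: "f \<in> D" "g \<in> D" unfolding f_def g_def using assms D_scale by auto
 have "0 \<le> Re (Q (\<lambda>x. f x - g x) (\<lambda>x. f x - g x))" by (rule Q_nonneg[OF D_diff[OF fD]])
 also have "\<dots> = Re (Q f f) + Re (Q g g) - 2 * Re (Q f g)" by (rule Q_diff_expand[OF fD])
 also have "Q f f = of_real t * Q \<phi> \<phi>"
 proof -
  have "Q f f = (e * cnj e) * (of_real (s * s)) * Q \<phi> \<phi>" unfolding f_def using assms by (simp add: Q_scale D_scale mult_ac)
  then show ?thesis by (simp add: ee s(2) del: of_real_mult)
 qed
 also have "Q g g = of_real (1 / t) * Q \<psi> \<psi>" unfolding \<sigma>(3)[symmetric] g_def using assms by (simp add: Q_scale D_scale \<sigma>(1))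
 also have "Q f g = of_real (cmod (Q \<phi> \<psi>))"
 proof -
  have "Q f g = (of_real s * \<sigma>) * (e * Q \<phi> \<psi>)" unfolding f_def g_def using assms by (simp add: Q_scale D_scale \<sigma>(1) mult_ac)
  then show ?thesis using \<sigma>(2) e(2) by simp
 qed
 finally show "2 * cmod (Q \<phi> \<psi>) \<le> t * Re (Q \<phi> \<phi>) + Re (Q \<psi> \<psi>) / t" by simp
qed

text \<open>This is nonnegativity of the form at \<phi> + \<psi>.\<close>

lemma Q_diff_le:
 assumes "\<phi> \<in> D" "\<psi> \<in> D"
 shows "Re (Q (\<lambda>x. \<phi> x - \<psi> x) (\<lambda>x. \<phi> x - \<psi> x)) \<le> 2 * Re (Q \<phi> \<phi>) + 2 * Re (Q \<psi> \<psi>)"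
proof -
 have m: "(\<lambda>x. (-1) * \<psi> x) \<in> D" by (rule D_scale[OF assms(2)])
 have "0 \<le> Re (Q (\<lambda>x. \<phi> x - (-1) * \<psi> x) (\<lambda>x. \<phi> x - (-1) * \<psi> x))" by (rule Q_nonneg[OF D_diff[OF assms(1) m]])
 also have "\<dots> = Re (Q \<phi> \<phi>) + Re (Q (\<lambda>x. (-1) * \<psi> x) (\<lambda>x. (-1) * \<psi> x)) - 2 * Re (Q \<phi> (\<lambda>x. (-1) * \<psi> x))"
  by (rule Q_diff_expand[OF assms(1) m])
 also have "\<dots> = Re (Q \<phi> \<phi>) + Re (Q \<psi> \<psi>) + 2 * Re (Q \<phi> \<psi>)" unfolding Q_scale(1)[OF assms(2)] Q_scale(2) by simp
 finally show ?thesis using Q_diff_expand[OF assms] by simp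
qed

lemma form_domain_iff:
 "u \<in> form_domain M D T \<longleftrightarrow> u \<in> L2_space M \<and> (\<exists>\<phi> :: nat \<Rightarrow> 'a \<Rightarrow> complex. (\<forall>n. \<phi> n \<in> D) \<and>
   (\<lambda>n. sqn M (\<lambda>x. \<phi> n x - u x)) \<longlonglongrightarrow> 0 \<and>
   (\<forall>e>0. \<exists>N. \<forall>j\<ge>N. \<forall>k\<ge>N. Re (Q (\<lambda>x. \<phi> j x - \<phi> k x) (\<lambda>x. \<phi> j x - \<phi> k x)) < e))"
 unfolding form_domain_def Q_def sqn_def by blast

text \<open>For uniqueness of the kernel: the difference of two solutions for the same right side
  must again lie in the graph, where it is an eigenfunction.\<close>

lemma friedrichs_diff:
 assumes "friedrichs_graph M D T u w" "friedrichs_graph M D T u' w'"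
 shows "friedrichs_graph M D T (\<lambda>x. u x - u' x) (\<lambda>x. w x - w' x)" unfolding friedrichs_graph_def
proof
 have uw: "u \<in> L2_space M" "w \<in> L2_space M" "u' \<in> L2_space M" "w' \<in> L2_space M"
  and adj: "\<And>\<phi>. \<phi> \<in> D \<Longrightarrow> L2_inner M u (T \<phi>) = L2_inner M w \<phi>" "\<And>\<phi>. \<phi> \<in> D \<Longrightarrow> L2_inner M u' (T \<phi>) = L2_inner M w' \<phi>"
  using assms unfolding friedrichs_graph_def adjoint_graph_def by auto
 show "adjoint_graph M D T (\<lambda>x. u x - u' x) (\<lambda>x. w x - w' x)" unfolding adjoint_graph_def using uw adj
  by (simp add: L2_space_diff L2_inner_diff_left T_L2 D_L2)
 obtain \<phi> where p: "\<And>n. \<phi> n \<in> D" "(\<lambda>n. sqn M (\<lambda>x. \<phi> n x - u x)) \<longlonglongrightarrow> 0"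
   "\<And>e. e > 0 \<Longrightarrow> \<exists>N. \<forall>j\<ge>N. \<forall>k\<ge>N. Re (Q (\<lambda>x. \<phi> j x - \<phi> k x) (\<lambda>x. \<phi> j x - \<phi> k x)) < e"
  using assms(1) unfolding friedrichs_graph_def form_domain_iff by blast
 obtain \<psi> where q: "\<And>n. \<psi> n \<in> D" "(\<lambda>n. sqn M (\<lambda>x. \<psi> n x - u' x)) \<longlonglongrightarrow> 0"
   "\<And>e. e > 0 \<Longrightarrow> \<exists>N. \<forall>j\<ge>N. \<forall>k\<ge>N. Re (Q (\<lambda>x. \<psi> j x - \<psi> k x) (\<lambda>x. \<psi> j x - \<psi> k x)) < e"
  using assms(2) unfolding friedrichs_graph_def form_domain_iff by blast
 show "(\<lambda>x. u x - u' x) \<in> form_domain M D T" unfolding form_domain_iff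
 proof (intro conjI exI[of _ "\<lambda>n x. \<phi> n x - \<psi> n x"] allI impI)
  show "(\<lambda>x. u x - u' x) \<in> L2_space M" by (intro L2_space_diff uw)
  show "(\<lambda>x. \<phi> n x - \<psi> n x) \<in> D" for n by (intro D_diff p q)
  have "(\<lambda>n. 2 * sqn M (\<lambda>x. \<phi> n x - u x) + 2 * sqn M (\<lambda>x. \<psi> n x - u' x)) \<longlonglongrightarrow> 2 * 0 + 2 * 0"
   by (intro tendsto_intros p q)
  then have l: "(\<lambda>n. 2 * sqn M (\<lambda>x. \<phi> n x - u x) + 2 * sqn M (\<lambda>x. \<psi> n x - u' x)) \<longlonglongrightarrow> 0" by simp
  have b: "norm (sqn M (\<lambda>x. \<phi> n x - \<psi> n x - (u x - u' x))) \<le> 2 * sqn M (\<lambda>x. \<phi> n x - u x) + 2 * sqn M (\<lambda>x. \<psi> n x - u' x)" for n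
  proof -
   have eq: "(\<lambda>x. \<phi> n x - \<psi> n x - (u x - u' x)) = (\<lambda>x. (\<phi> n x - u x) - (\<psi> n x - u' x))" by (simp add: algebra_simps)
   show ?thesis unfolding eq real_norm_def abs_of_nonneg[OF sqn_nonneg]
    by (rule sqn_diff_le[OF L2_space_diff[OF D_L2[OF p(1)] uw(1)] L2_space_diff[OF D_L2[OF q(1)] uw(3)]])
  qed
  show "(\<lambda>n. sqn M (\<lambda>x. \<phi> n x - \<psi> n x - (u x - u' x))) \<longlonglongrightarrow> 0"
   by (rule Lim_null_comparison[OF always_eventually[OF allI[OF b]] l])
  fix e :: real assume e: "e > 0"
  obtain N1 where N1: "\<And>j k. j \<ge> N1 \<Longrightarrow> k \<ge> N1 \<Longrightarrow> Re (Q (\<lambda>x. \<phi> j x - \<phi> k x) (\<lambda>x. \<phi> j x - \<phi> k x)) < e / 4"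
   using p(3)[of "e / 4"] e by auto
  obtain N2 where N2: "\<And>j k. j \<ge> N2 \<Longrightarrow> k \<ge> N2 \<Longrightarrow> Re (Q (\<lambda>x. \<psi> j x - \<psi> k x) (\<lambda>x. \<psi> j x - \<psi> k x)) < e / 4"
   using q(3)[of "e / 4"] e by auto
  show "\<exists>N. \<forall>j\<ge>N. \<forall>k\<ge>N. Re (Q (\<lambda>x. \<phi> j x - \<psi> j x - (\<phi> k x - \<psi> k x)) (\<lambda>x. \<phi> j x - \<psi> j x - (\<phi> k x - \<psi> k x))) < e"
  proof (intro exI[of _ "max N1 N2"] allI impI)
   fix j k assume jk: "j \<ge> max N1 N2" "k \<ge> max N1 N2"
   have eq: "(\<lambda>x. \<phi> j x - \<psi> j x - (\<phi> k x - \<psi> k x)) = (\<lambda>x. (\<phi> j x - \<phi> k x) - (\<psi> j x - \<psi> k x))" by (simp add: algebra_simps)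
   show "Re (Q (\<lambda>x. \<phi> j x - \<psi> j x - (\<phi> k x - \<psi> k x)) (\<lambda>x. \<phi> j x - \<psi> j x - (\<phi> k x - \<psi> k x))) < e"
    unfolding eq using Q_diff_le[OF D_diff[OF p(1) p(1)] D_diff[OF q(1) q(1)], of j k j k] N1[of j k] N2[of j k] jk by simp
  qed
 qed
qed

text \<open>The value <w, u> is the limit of Q(\<phi>_k, \<phi>_k) along an approximating sequence.
  Indeed <w, \<phi>_k> is the limit of Q(\<phi>_n, \<phi>_k) as n grows, and it is close to
  Q(\<phi>_k, \<phi>_k) by Cauchy-Schwarz, since the sequence is Cauchy for the form and hence
  bounded in it.\<close>

lemma friedrichs_nonneg:
 assumes "friedrichs_graph M D T u w"
 shows "Im (L2_inner M w u) = 0" (is ?A) "Re (L2_inner M w u) \<ge> 0"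
proof -
 have uw: "u \<in> L2_space M" "w \<in> L2_space M"
  and adj: "\<And>\<phi>. \<phi> \<in> D \<Longrightarrow> L2_inner M u (T \<phi>) = L2_inner M w \<phi>"
  using assms unfolding friedrichs_graph_def adjoint_graph_def by auto
 obtain \<phi> where p: "\<And>n. \<phi> n \<in> D" "(\<lambda>n. sqn M (\<lambda>x. \<phi> n x - u x)) \<longlonglongrightarrow> 0"
   "\<And>e. e > 0 \<Longrightarrow> \<exists>N. \<forall>j\<ge>N. \<forall>k\<ge>N. Re (Q (\<lambda>x. \<phi> j x - \<phi> k x) (\<lambda>x. \<phi> j x - \<phi> k x)) < e"
  using assms(1) unfolding friedrichs_graph_def form_domain_iff by blast
 obtain N0 where N0: "\<And>j k. j \<ge> N0 \<Longrightarrow> k \<ge> N0 \<Longrightarrow> Re (Q (\<lambda>x. \<phi> j x - \<phi> k x) (\<lambda>x. \<phi> j x - \<phi> k x)) < 1"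
  using p(3)[of 1] by auto
 define C where "C = 2 * 1 + 2 * Re (Q (\<phi> N0) (\<phi> N0))"
 have C: "Re (Q (\<phi> k) (\<phi> k)) \<le> C" if k: "k \<ge> N0" for k
 proof -
  have m: "(\<lambda>x. (-1) * \<phi> N0 x) \<in> D" by (rule D_scale[OF p(1)])
  have "Re (Q (\<lambda>x. (\<phi> k x - \<phi> N0 x) - (-1) * \<phi> N0 x) (\<lambda>x. (\<phi> k x - \<phi> N0 x) - (-1) * \<phi> N0 x))
    \<le> 2 * Re (Q (\<lambda>x. \<phi> k x - \<phi> N0 x) (\<lambda>x. \<phi> k x - \<phi> N0 x)) + 2 * Re (Q (\<lambda>x. (-1) * \<phi> N0 x) (\<lambda>x. (-1) * \<phi> N0 x))"
   by (rule Q_diff_le[OF D_diff[OF p(1) p(1)] m])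
  moreover have "(\<lambda>x. (\<phi> k x - \<phi> N0 x) - (-1) * \<phi> N0 x) = \<phi> k" by simp
  moreover have "Q (\<lambda>x. (-1) * \<phi> N0 x) (\<lambda>x. (-1) * \<phi> N0 x) = Q (\<phi> N0) (\<phi> N0)"
   unfolding Q_scale(1)[OF p(1)] Q_scale(2) by simp
  ultimately show ?thesis using N0[of k N0] k by (simp add: C_def)
 qed
 have C0: "C \<ge> 0" using Q_nonneg[OF p(1)[of N0]] by (simp add: C_def)
 have close: "\<exists>N. \<forall>k\<ge>N. cmod (L2_inner M w (\<phi> k) - Q (\<phi> k) (\<phi> k)) \<le> e" if e: "e > 0" for e
 proof -
  \<comment> \<open>Chosen so that sqrt d * sqrt C \<le> e; the summand 1 avoids division by
    0.\<close>
  define d where "d = (e / (sqrt C + 1))^2"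
  have sc: "sqrt C + 1 > 0" using C0 by (simp add: add_nonneg_pos)
  have d: "d > 0" "sqrt d = e / (sqrt C + 1)" using e sc by (auto simp: d_def)
  obtain N1 where N1: "\<And>j k. j \<ge> N1 \<Longrightarrow> k \<ge> N1 \<Longrightarrow> Re (Q (\<lambda>x. \<phi> j x - \<phi> k x) (\<lambda>x. \<phi> j x - \<phi> k x)) < d"
   using p(3)[OF d(1)] by auto
  have "cmod (L2_inner M w (\<phi> k) - Q (\<phi> k) (\<phi> k)) \<le> e" if k: "k \<ge> max N0 N1" for k
  proof -
   have "(\<lambda>n. L2_inner M (\<phi> n) (T (\<phi> k))) \<longlonglongrightarrow> L2_inner M u (T (\<phi> k))"
    by (rule L2_inner_tendsto_left[OF D_L2[OF p(1)] uw(1) T_L2[OF p(1)] p(2)])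
   also have "L2_inner M u (T (\<phi> k)) = L2_inner M w (\<phi> k)" by (rule adj[OF p(1)])
   also have "(\<lambda>n. L2_inner M (\<phi> n) (T (\<phi> k))) = (\<lambda>n. Q (\<phi> n) (\<phi> k))"
    using Q_herm[OF p(1) p(1)] L2_inner_commute by (metis Q_def)
   finally have "(\<lambda>n. cmod (Q (\<phi> n) (\<phi> k) - Q (\<phi> k) (\<phi> k))) \<longlonglongrightarrow> cmod (L2_inner M w (\<phi> k) - Q (\<phi> k) (\<phi> k))"
    by (intro tendsto_intros)
   moreover have "cmod (Q (\<phi> n) (\<phi> k) - Q (\<phi> k) (\<phi> k)) \<le> e" if n: "n \<ge> N1" for n
   proof -
    have "cmod (Q (\<phi> n) (\<phi> k) - Q (\<phi> k) (\<phi> k)) = cmod (Q (\<lambda>x. \<phi> n x - \<phi> k x) (\<phi> k))"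
     by (simp add: Q_diff_left p)
    also have "\<dots> \<le> sqrt (Re (Q (\<lambda>x. \<phi> n x - \<phi> k x) (\<lambda>x. \<phi> n x - \<phi> k x))) * sqrt (Re (Q (\<phi> k) (\<phi> k)))"
     by (rule Q_Cauchy_Schwarz[OF D_diff[OF p(1) p(1)] p(1)])
    also have "\<dots> \<le> sqrt d * sqrt C" using N1[of n k] C[of k] k n Q_nonneg[OF p(1)] d(1)
     by (intro mult_mono real_sqrt_le_mono) (auto intro: less_imp_le)
    also have "\<dots> = e * (sqrt C / (sqrt C + 1))" by (simp add: d(2))
    also have "\<dots> \<le> e * 1" using e sc by (intro mult_left_mono) auto
    finally show ?thesis by simp
   qed
   ultimately show ?thesis by (intro tendsto_upperbound[of _ _ sequentially]) (auto simp: eventually_sequentially)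
  qed
  then show ?thesis by blast
 qed
 have lim: "(\<lambda>k. L2_inner M w (\<phi> k)) \<longlonglongrightarrow> L2_inner M w u" by (rule L2_inner_tendsto_right[OF D_L2[OF p(1)] uw p(2)])
 have lim2: "(\<lambda>k. L2_inner M w (\<phi> k) - Q (\<phi> k) (\<phi> k)) \<longlonglongrightarrow> 0" unfolding lim_sequentially dist_norm
 proof (intro allI impI)
  fix r :: real assume "r > 0"
  then obtain N where "\<forall>k\<ge>N. cmod (L2_inner M w (\<phi> k) - Q (\<phi> k) (\<phi> k)) \<le> r / 2" using close[of "r / 2"] by auto
  then show "\<exists>N. \<forall>k\<ge>N. cmod (L2_inner M w (\<phi> k) - Q (\<phi> k) (\<phi> k) - 0) < r" using \<open>r > 0\<close>
   by (intro exI[of _ N]) (auto intro: le_less_trans)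
 qed
 have "(\<lambda>k. Q (\<phi> k) (\<phi> k)) \<longlonglongrightarrow> L2_inner M w u" using tendsto_diff[OF lim lim2] by simp
 then have "(\<lambda>k. Im (Q (\<phi> k) (\<phi> k))) \<longlonglongrightarrow> Im (L2_inner M w u)" "(\<lambda>k. Re (Q (\<phi> k) (\<phi> k))) \<longlonglongrightarrow> Re (L2_inner M w u)"
  by (auto intro: tendsto_Im tendsto_Re)
 then show ?A "Re (L2_inner M w u) \<ge> 0"
  using Q_real[OF p(1)] Q_nonneg[OF p(1)] by (auto simp: LIMSEQ_const_iff intro: tendsto_lowerbound)
qed

text \<open>For Im z > 0 the number z^2 is never a nonnegative real, whereas <w, u> = z^2 |u|^2
  would have to be one.\<close>

lemma friedrichs_eigen_zero:
 assumes F: "friedrichs_graph M D T u (\<lambda>x. z^2 * u x)" and z: "Im z > 0"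
 shows "AE x in M. u x = 0"
proof -
 have u: "u \<in> L2_space M" using F unfolding friedrichs_graph_def adjoint_graph_def by auto
 have e: "L2_inner M (\<lambda>x. z^2 * u x) u = z^2 * of_real (sqn M u)" by (simp add: L2_inner_scale_left L2_inner_self)
 note n = friedrichs_nonneg[OF F, unfolded e]
 have "sqn M u = 0"
 proof (rule ccontr)
  assume "sqn M u \<noteq> 0"
  then have s: "sqn M u > 0" using sqn_nonneg[of M u] by linarith
  have "Im (z^2) = 0" using n(1) s by simp
  then have "Re z = 0" using z by (simp add: power2_eq_square)
  then have "Re (z^2) < 0" using z by (simp add: power2_eq_square)
  then have "Re (z^2 * of_real (sqn M u)) < 0" using s by (simp add: mult_neg_pos)
  then show False using n(2) by simp
 qed
 then have "AE x in M. (cmod (u x))^2 = 0" unfolding sqn_def by (subst (asm) integral_nonneg_eq_0_iff_AE) (use L2_spaceD[OF u] in auto)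
 then show ?thesis by simp
qed

end

section \<open>Smooth test functions\<close>

text \<open>The powers of 1 / t are carried along because differentiation produces them: the linear
  span of this family over \<open>k\<close> is closed under derivatives.\<close>

definition flat_exp :: "nat \<Rightarrow> real \<Rightarrow> real" where
 "flat_exp k t = (if t \<le> 0 then 0 else inverse t ^ k * exp (- inverse t))"

lemma power_le_fact_exp:
 assumes "x \<ge> (0::real)"
 shows "x ^ n \<le> fact n * exp x"
proof -
 have s: "(\<lambda>k. x ^ k /\<^sub>R fact k) sums exp x" by (rule exp_converges)
 have "sum (\<lambda>k. x ^ k /\<^sub>R fact k) {n} \<le> (\<Sum>k. x ^ k /\<^sub>R fact k)"
  using assms by (intro sum_le_suminf sums_summable[OF s]) auto
 then have "x ^ n / fact n \<le> exp x" using sums_unique[OF s] by (simp add: divide_inverse mult.commute)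
 then show ?thesis by (simp add: divide_le_eq mult.commute)
qed

text \<open>Quadratic vanishing at 0 makes the difference quotient there tend to 0.\<close>

lemma flat_exp_bound: "\<bar>flat_exp k h\<bar> \<le> fact (k + 2) * h^2"
proof (cases "h \<le> 0")
 case False
 define y where "y = inverse h"
 have y: "y > 0" "h = inverse y" using False by (auto simp: y_def)
 have "y ^ (k + 2) \<le> fact (k + 2) * exp y" using y by (intro power_le_fact_exp) auto
 then have "y ^ (k + 2) * exp (- y) \<le> fact (k + 2) * exp y * exp (- y)" by (intro mult_right_mono) auto
 also have "\<dots> = fact (k + 2)" by (simp only: mult.assoc exp_minus_inverse mult_1_right)
 finally have "y ^ k * y^2 * exp (- y) \<le> fact (k + 2)" by (simp only: power_add)
 then have "y ^ k * exp (- y) \<le> fact (k + 2) / y^2" using y by (simp add: pos_le_divide_eq mult_ac del: fact_Suc)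
 then show ?thesis using False y by (simp add: flat_exp_def y_def[symmetric] divide_inverse power_inverse del: fact_Suc)
qed (simp add: flat_exp_def)

lemma flat_exp_deriv:
 "(flat_exp k has_real_derivative flat_exp (k + 2) t - real k * flat_exp (k + 1) t) (at t)"
proof -
 consider "t < 0" | "t = 0" | "t > 0" by linarith
 then show ?thesis
 proof cases
  case 1
  have "((\<lambda>_. 0) has_real_derivative 0) (at t)" by simp
  then have "(flat_exp k has_real_derivative 0) (at t)"
   by (rule has_field_derivative_transform_within_open[where S = "{..<0}"]) (use 1 in \<open>auto simp: flat_exp_def\<close>)
  then show ?thesis using 1 by (simp add: flat_exp_def)
 next
  case 2
  have b: "norm (flat_exp k h / h) \<le> fact (k + 2) * \<bar>h\<bar>" for h
  proof (cases "h = 0")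
   case False
   then have "\<bar>flat_exp k h\<bar> / \<bar>h\<bar> \<le> fact (k + 2) * h^2 / \<bar>h\<bar>" by (intro divide_right_mono flat_exp_bound) auto
   also have "\<dots> = fact (k + 2) * \<bar>h\<bar>" using False by (simp add: power2_eq_square del: fact_Suc) (simp add: abs_if)
   finally show ?thesis by (simp add: abs_divide)
  qed simp
  have l: "((\<lambda>h::real. fact (k + 2) * \<bar>h\<bar>) \<longlongrightarrow> 0) (at 0)" by (rule tendsto_eq_intros refl)+ simp
  have "((\<lambda>h. flat_exp k h / h) \<longlongrightarrow> 0) (at 0)" by (rule Lim_null_comparison[OF always_eventually[OF allI[OF b]] l])
  then have "(flat_exp k has_real_derivative 0) (at 0)" by (simp add: DERIV_def flat_exp_def)
  then show ?thesis using 2 by (simp add: flat_exp_def)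
 next
  case 3
  have i: "(inverse has_real_derivative - (inverse t * 1 * inverse t)) (at t)" using DERIV_inverse'[OF DERIV_ident, of t] 3 by simp
  have "((\<lambda>t. inverse t ^ k * exp (- inverse t)) has_real_derivative
    (of_nat k * (- (inverse t * 1 * inverse t) * inverse t ^ (k - Suc 0))) * exp (- inverse t)
    + (exp (- inverse t) * (- (- (inverse t * 1 * inverse t)))) * inverse t ^ k) (at t)"
   by (intro DERIV_mult DERIV_power i DERIV_chain2[OF DERIV_exp] DERIV_minus)
  moreover have "(of_nat k * (- (inverse t * 1 * inverse t) * inverse t ^ (k - Suc 0))) * exp (- inverse t)
    + (exp (- inverse t) * (- (- (inverse t * 1 * inverse t)))) * inverse t ^ k
    = flat_exp (k + 2) t - real k * flat_exp (k + 1) t" using 3 by (cases k) (simp_all add: flat_exp_def algebra_simps)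
  ultimately have D: "((\<lambda>t. inverse t ^ k * exp (- inverse t)) has_real_derivative flat_exp (k + 2) t - real k * flat_exp (k + 1) t) (at t)"
   by (simp only:)
  show ?thesis by (rule has_field_derivative_transform_within_open[OF D, where S = "{0<..}"]) (use 3 in \<open>auto simp: flat_exp_def\<close>)
 qed
qed

lemma flat_exp_nonneg: "flat_exp k t \<ge> 0" by (simp add: flat_exp_def)

lemma flat_exp_pos: "t > 0 \<Longrightarrow> flat_exp k t > 0" by (simp add: flat_exp_def)

definition smooth_step :: "real \<Rightarrow> real" where
 "smooth_step t = flat_exp 0 t * inverse (flat_exp 0 t + flat_exp 0 (1 - t))"

lemma smooth_step_denom_pos: "flat_exp 0 t + flat_exp 0 (1 - t) > 0"
 using flat_exp_pos[of t 0] flat_exp_pos[of "1 - t" 0] flat_exp_nonneg[of 0 t] flat_exp_nonneg[of 0 "1 - t"] by (cases "t > 0") auto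

lemma smooth_step_values:
 "t \<le> 0 \<Longrightarrow> smooth_step t = 0" "t \<ge> 1 \<Longrightarrow> smooth_step t = 1" "0 \<le> smooth_step t" (is ?A) "smooth_step t \<le> 1" (is ?B)
proof -
 show "t \<le> 0 \<Longrightarrow> smooth_step t = 0" by (simp add: smooth_step_def flat_exp_def)
 show "t \<ge> 1 \<Longrightarrow> smooth_step t = 1" by (simp add: smooth_step_def flat_exp_def)
 show ?A using smooth_step_denom_pos[of t] by (simp add: smooth_step_def flat_exp_nonneg)
 show ?B using smooth_step_denom_pos[of t] flat_exp_nonneg[of 0 "1 - t"]
  by (simp add: smooth_step_def divide_inverse[symmetric] pos_divide_le_eq)
qed

lemma smooth_step_deriv:
 "\<exists>hd C. C \<ge> 0 \<and> (\<forall>t. (smooth_step has_real_derivative hd t) (at t)) \<and> (\<forall>t. \<bar>hd t\<bar> \<le> C) \<and>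
  (\<forall>t. t \<le> 0 \<or> t \<ge> 1 \<longrightarrow> hd t = 0) \<and> continuous_on UNIV hd"
proof -
 define e where "e = flat_exp 0"
 define e' where "e' = flat_exp 2"
 define s where "s = (\<lambda>t. e t + e (1 - t))"
 define s' where "s' = (\<lambda>t. e' t - e' (1 - t))"
 have e: "(e has_real_derivative e' t) (at t)" for t using flat_exp_deriv[of 0 t] by (simp add: e_def e'_def numeral_2_eq_2)
 have e1: "((\<lambda>t. e (1 - t)) has_real_derivative - e' (1 - t)) (at t)" for t
 proof -
  have "((\<lambda>t. 1 - t) has_real_derivative - 1) (at t)" by (auto intro!: derivative_eq_intros)
  from DERIV_chain2[OF e this] show ?thesis by simp
 qed
 have sp: "s t > 0" for t using smooth_step_denom_pos[of t] by (simp add: s_def e_def)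
 have s: "(s has_real_derivative s' t) (at t)" for t using DERIV_add[OF e e1] by (simp add: s_def s'_def)
 define hd where "hd = (\<lambda>t. e' t * inverse (s t) + - (inverse (s t) * s' t * inverse (s t)) * e t)"
 have D: "(smooth_step has_real_derivative hd t) (at t)" for t
 proof -
  have eq: "smooth_step = (\<lambda>t. e t * inverse (s t))" by (rule ext) (simp add: smooth_step_def e_def s_def)
  show ?thesis unfolding eq hd_def using sp[of t] by (intro DERIV_mult e DERIV_inverse' s) auto
 qed
 have z: "hd t = 0" if "t \<le> 0 \<or> t \<ge> 1" for t
 proof (cases "t \<le> 0")
  case False
  then have "e (1 - t) = 0" "e' (1 - t) = 0" using that by (auto simp: e_def e'_def flat_exp_def)
  then show ?thesis using sp[of t] by (simp add: hd_def s_def s'_def)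
 qed (simp add: hd_def e_def e'_def flat_exp_def)
 have ce: "continuous_on UNIV e" using e by (meson DERIV_continuous continuous_at_imp_continuous_on)
 have ce': "continuous_on UNIV e'" unfolding e'_def using flat_exp_deriv by (meson DERIV_continuous continuous_at_imp_continuous_on)
 have ch': "continuous_on UNIV hd" unfolding hd_def s_def s'_def
  using sp by (intro continuous_intros continuous_on_compose2[OF ce] continuous_on_compose2[OF ce'])
   (auto simp: s_def less_imp_neq[THEN not_sym])
 then have ch: "continuous_on {0..1} hd" by (rule continuous_on_subset) simp
 obtain C where C: "\<And>t. t \<in> {0..1} \<Longrightarrow> \<bar>hd t\<bar> \<le> C" using compact_continuous_image[OF ch] compact_imp_bounded
  by (metis bounded_real compact_Icc imageI)
 have "\<bar>hd t\<bar> \<le> max C 0" for t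
 proof (cases "t \<in> {0..1}")
  case True
  then show ?thesis using C[of t] by simp
 next
  case False
  then show ?thesis using z[of t] by auto
 qed
 then show ?thesis using D z ch' by (intro exI[of _ hd], intro exI[of _ "max C 0"]) auto
qed

text \<open>Membership in \<open>test_functions\<close> asks that every iterate of
  \<open>d_r\<close> be differentiable. An algebra closed under differentiation provides this
  without formulas for higher derivatives; polynomials are among its generators so that
  Stone-Weierstrass approximations are covered.\<close>

inductive smooth_alg :: "(real \<Rightarrow> complex) \<Rightarrow> bool" where
 poly: "polynomial_function p \<Longrightarrow> smooth_alg p"
| flat: "smooth_alg (\<lambda>r. of_real (flat_exp k (\<alpha> * r + \<gamma>)))"
| add: "smooth_alg f \<Longrightarrow> smooth_alg g \<Longrightarrow> smooth_alg (\<lambda>r. f r + g r)"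
| mult: "smooth_alg f \<Longrightarrow> smooth_alg g \<Longrightarrow> smooth_alg (\<lambda>r. f r * g r)"
| inv: "smooth_alg f \<Longrightarrow> (\<And>r. f r \<noteq> 0) \<Longrightarrow> smooth_alg (\<lambda>r. inverse (f r))"

lemma smooth_alg_const: "smooth_alg (\<lambda>r. c)" by (rule smooth_alg.poly) (rule polynomial_function_const)

lemma has_vector_derivative_inverse:
 fixes f :: "real \<Rightarrow> complex"
 assumes "(f has_vector_derivative f') (at r)" "f r \<noteq> 0"
 shows "((\<lambda>r. inverse (f r)) has_vector_derivative - (inverse (f r) * inverse (f r)) * f') (at r)"
 using field_vector_diff_chain_at[OF assms(1) DERIV_inverse[OF assms(2)]] by (simp add: o_def power2_eq_square numeral_2_eq_2 mult.commute)

lemma smooth_alg_deriv: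
 "smooth_alg f \<Longrightarrow> \<exists>f'. smooth_alg f' \<and> (\<forall>r. (f has_vector_derivative f' r) (at r))"
proof (induction rule: smooth_alg.induct)
 case (poly p)
 then obtain p' where "polynomial_function p'" "\<And>x. (p has_vector_derivative p' x) (at x)"
  using has_vector_derivative_polynomial_function by blast
 then show ?case using smooth_alg.poly by blast
next
 case (flat k \<alpha> \<gamma>)
 define F where "F = (\<lambda>n r. of_real (flat_exp n (\<alpha> * r + \<gamma>)) :: complex)"
 have F: "smooth_alg (F n)" for n unfolding F_def by (rule smooth_alg.flat)
 have "smooth_alg (\<lambda>r. of_real \<alpha> * (F (k + 2) r + (- of_nat k) * F (k + 1) r))"
  by (intro smooth_alg.mult smooth_alg.add smooth_alg_const F)
 moreover have "((\<lambda>r. of_real (flat_exp k (\<alpha> * r + \<gamma>)) :: complex) has_vector_derivative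
   of_real \<alpha> * (F (k + 2) r + (- of_nat k) * F (k + 1) r)) (at r)" for r
 proof -
  have "((\<lambda>r. \<alpha> * r + \<gamma>) has_real_derivative \<alpha>) (at r)" by (auto intro!: derivative_eq_intros)
  from DERIV_chain2[OF flat_exp_deriv this]
  have "((\<lambda>r. of_real (flat_exp k (\<alpha> * r + \<gamma>)) :: complex) has_vector_derivative
    of_real ((flat_exp (k + 2) (\<alpha> * r + \<gamma>) - real k * flat_exp (k + 1) (\<alpha> * r + \<gamma>)) * \<alpha>)) (at r)"
   by (intro has_vector_derivative_of_real) (simp only: has_real_derivative_iff_has_vector_derivative)
  moreover have "of_real ((flat_exp (k + 2) (\<alpha> * r + \<gamma>) - real k * flat_exp (k + 1) (\<alpha> * r + \<gamma>)) * \<alpha>)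
    = of_real \<alpha> * (F (k + 2) r + (- of_nat k) * F (k + 1) r)" by (simp add: F_def)
  ultimately show ?thesis by (simp only:)
 qed
 ultimately show ?case by blast
next
 case (add f g)
 then obtain f' g' where "smooth_alg f'" "\<And>r. (f has_vector_derivative f' r) (at r)"
  "smooth_alg g'" "\<And>r. (g has_vector_derivative g' r) (at r)" by blast
 then show ?case by (intro exI[of _ "\<lambda>r. f' r + g' r"]) (auto intro: smooth_alg.add has_vector_derivative_add)
next
 case (mult f g)
 then obtain f' g' where fg: "smooth_alg f'" "\<And>r. (f has_vector_derivative f' r) (at r)"
  "smooth_alg g'" "\<And>r. (g has_vector_derivative g' r) (at r)" by blast
 have "smooth_alg (\<lambda>r. f r * g' r + f' r * g r)" by (intro smooth_alg.add smooth_alg.mult mult.hyps fg)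
 moreover have "((\<lambda>r. f r * g r) has_vector_derivative f r * g' r + f' r * g r) (at r)" for r by (intro has_vector_derivative_mult fg)
 ultimately show ?case by blast
next
 case (inv f)
 then obtain f' where f: "smooth_alg f'" "\<And>r. (f has_vector_derivative f' r) (at r)" by blast
 have "smooth_alg (\<lambda>r. (- 1) * (inverse (f r) * inverse (f r)) * f' r)" by (intro smooth_alg.mult smooth_alg_const smooth_alg.inv inv.hyps f)
 moreover have "((\<lambda>r. inverse (f r)) has_vector_derivative (- 1) * (inverse (f r) * inverse (f r)) * f' r) (at r)" for r
  using has_vector_derivative_inverse[OF f(2) inv.hyps(2)] by simp
 ultimately show ?case by blast
qed

lemma d_r_eq: "(f has_vector_derivative f') (at r) \<Longrightarrow> d_r f r = f'" unfolding d_r_def by (rule vector_derivative_at)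

lemma smooth_alg_d_r: "smooth_alg f \<Longrightarrow> smooth_alg (d_r f)" using smooth_alg_deriv[of f] d_r_eq by (metis ext)

lemma smooth_alg_differentiable: "smooth_alg f \<Longrightarrow> ((d_r ^^ n) f) differentiable (at r)"
proof -
 assume f: "smooth_alg f"
 have "smooth_alg ((d_r ^^ n) f)" by (induction n) (auto intro: f smooth_alg_d_r)
 from smooth_alg_deriv[OF this] show ?thesis unfolding has_vector_derivative_def differentiable_def by blast
qed

lemma smooth_alg_smooth_step: "smooth_alg (\<lambda>r. of_real (smooth_step (\<alpha> * r + \<gamma>)))"
proof -
 have "smooth_alg (\<lambda>r. of_real (flat_exp 0 (\<alpha> * r + \<gamma>)) * inverse (of_real (flat_exp 0 (\<alpha> * r + \<gamma>)) + of_real (flat_exp 0 ((- \<alpha>) * r + (1 - \<gamma>)))))"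
 proof (intro smooth_alg.mult smooth_alg.inv smooth_alg.add smooth_alg.flat)
  fix r
  show "(of_real (flat_exp 0 (\<alpha> * r + \<gamma>)) + of_real (flat_exp 0 ((- \<alpha>) * r + (1 - \<gamma>))) :: complex) \<noteq> 0"
   using smooth_step_denom_pos[of "\<alpha> * r + \<gamma>"] by (simp only: of_real_add[symmetric] of_real_eq_0_iff) (simp add: algebra_simps)
 qed
 moreover have "(\<lambda>r. of_real (smooth_step (\<alpha> * r + \<gamma>)) :: complex) =
   (\<lambda>r. of_real (flat_exp 0 (\<alpha> * r + \<gamma>)) * inverse (of_real (flat_exp 0 (\<alpha> * r + \<gamma>)) + of_real (flat_exp 0 ((- \<alpha>) * r + (1 - \<gamma>)))))"
  by (rule ext) (simp add: smooth_step_def algebra_simps)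
 ultimately show ?thesis by (simp only:)
qed

text \<open>Lets a polynomial approximation of u' be integrated to one of u.\<close>

lemma polynomial_function_antiderivative:
 fixes p :: "real \<Rightarrow> complex"
 assumes "polynomial_function p"
 shows "\<exists>P. polynomial_function P \<and> (\<forall>r. (P has_vector_derivative p r) (at r))"
proof -
 have real_case: "\<exists>F. real_polynomial_function F \<and> (\<forall>r. (F has_real_derivative f r) (at r))"
  if f: "real_polynomial_function f" for f :: "real \<Rightarrow> real"
 proof -
  obtain c n where c: "f = (\<lambda>x. \<Sum>i\<le>n. c i * x ^ i)" using f real_polynomial_function_iff_sum by blast
  define F where "F = (\<lambda>x. \<Sum>i\<le>n. c i / real (Suc i) * x ^ Suc i)"
  have "real_polynomial_function F" unfolding F_def
   by (intro real_polynomial_function_sum real_polynomial_function.intros(4) real_polynomial_function_power) (auto intro: real_polynomial_function.intros)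
  moreover have "(F has_real_derivative f r) (at r)" for r unfolding F_def c
  proof (rule DERIV_sum)
   fix i
   have "((\<lambda>x. c i / real (Suc i) * x ^ Suc i) has_real_derivative c i / real (Suc i) * (of_nat (Suc i) * (1 * r ^ (Suc i - Suc 0)))) (at r)"
    by (intro DERIV_cmult DERIV_power DERIV_ident)
   then show "((\<lambda>x. c i / real (Suc i) * x ^ Suc i) has_real_derivative c i * r ^ i) (at r)" by (simp del: of_nat_Suc)
  qed
  ultimately show ?thesis by blast
 qed
 have "real_polynomial_function (\<lambda>r. Re (p r))" "real_polynomial_function (\<lambda>r. Im (p r))"
  using assms bounded_linear_Re bounded_linear_Im unfolding polynomial_function_def o_def by auto
 then obtain F G where F: "real_polynomial_function F" "\<And>r. (F has_real_derivative Re (p r)) (at r)"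
  and G: "real_polynomial_function G" "\<And>r. (G has_real_derivative Im (p r)) (at r)" using real_case by meson
 define P where "P = (\<lambda>r. F r *\<^sub>R (1::complex) + G r *\<^sub>R \<i>)"
 have "polynomial_function P" unfolding P_def using F(1) G(1)
  by (intro polynomial_function_add polynomial_function_mult polynomial_function_const) (auto simp: real_polynomial_function_eq)
 moreover have "(P has_vector_derivative p r) (at r)" for r
 proof -
  have "(P has_vector_derivative Re (p r) *\<^sub>R 1 + Im (p r) *\<^sub>R \<i>) (at r)"
   unfolding P_def using has_vector_derivative_scaleR[OF F(2) has_vector_derivative_const, of 1 r]
    has_vector_derivative_scaleR[OF G(2) has_vector_derivative_const, of \<i> r] by (intro has_vector_derivative_add) auto
  moreover have "Re (p r) *\<^sub>R 1 + Im (p r) *\<^sub>R \<i> = p r" by (simp add: complex_eq_iff)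
  ultimately show ?thesis by simp
 qed
 ultimately show ?thesis by blast
qed

section \<open>Test functions and cutoffs\<close>

lemma test_function_deriv:
 assumes "\<phi> \<in> test_functions a"
 shows "(((d_r ^^ n) \<phi>) has_vector_derivative (d_r ^^ Suc n) \<phi> r) (at r)"
proof -
 have "((d_r ^^ n) \<phi>) differentiable (at r)" using assms by (simp add: test_functions_def)
 then show ?thesis by (simp add: vector_derivative_works d_r_def)
qed

lemma test_functions_lincomb:
 assumes "\<phi> \<in> test_functions a" "\<psi> \<in> test_functions a"
 shows "(\<lambda>x. \<phi> x - \<psi> x) \<in> test_functions a" (is ?A) "(\<lambda>x. c * \<phi> x) \<in> test_functions a"
  "d_r (\<lambda>x. \<phi> x - \<psi> x) = (\<lambda>x. d_r \<phi> x - d_r \<psi> x)" (is ?B)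
  "d_r (d_r (\<lambda>x. \<phi> x - \<psi> x)) = (\<lambda>x. d_r (d_r \<phi>) x - d_r (d_r \<psi>) x)" (is ?C)
  "d_r (\<lambda>x. c * \<phi> x) = (\<lambda>x. c * d_r \<phi> x)" (is ?D)
  "d_r (d_r (\<lambda>x. c * \<phi> x)) = (\<lambda>x. c * d_r (d_r \<phi>) x)" (is ?E)
proof -
 have h1: "((\<lambda>x. (d_r ^^ n) \<phi> x - (d_r ^^ n) \<psi> x) has_vector_derivative (d_r ^^ Suc n) \<phi> r - (d_r ^^ Suc n) \<psi> r) (at r)" for n r
  by (intro has_vector_derivative_diff test_function_deriv[OF assms(1)] test_function_deriv[OF assms(2)])
 have h2: "((\<lambda>x. c * (d_r ^^ n) \<phi> x) has_vector_derivative c * (d_r ^^ Suc n) \<phi> r) (at r)" for n r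
  by (intro has_vector_derivative_mult_right test_function_deriv[OF assms(1)])
 have n1: "(d_r ^^ n) (\<lambda>x. \<phi> x - \<psi> x) = (\<lambda>x. (d_r ^^ n) \<phi> x - (d_r ^^ n) \<psi> x)" for n
 proof (induction n)
  case (Suc n)
  then show ?case using d_r_eq[OF h1[of n]] by auto
 qed simp
 have n2: "(d_r ^^ n) (\<lambda>x. c * \<phi> x) = (\<lambda>x. c * (d_r ^^ n) \<phi> x)" for n
 proof (induction n)
  case (Suc n)
  then show ?case using d_r_eq[OF h2[of n]] by auto
 qed simp
 show ?B using n1[of 1] by simp
 show ?C
  using n1[of 2] by (simp add: numeral_2_eq_2)
 show ?D using n2[of 1] by simp
 show ?E using n2[of 2] by (simp add: numeral_2_eq_2)
 obtain c1 d1 c2 d2 where s: "- 1 / a < c1" "\<And>r. r \<notin> {c1..d1} \<Longrightarrow> \<phi> r = 0" "- 1 / a < c2" "\<And>r. r \<notin> {c2..d2} \<Longrightarrow> \<psi> r = 0"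
  using assms by (auto simp: test_functions_def)
 have "\<exists>c d. - 1 / a < c \<and> (\<forall>r. r \<notin> {c..d} \<longrightarrow> \<phi> r - \<psi> r = 0)"
 proof (rule exI[of _ "min c1 c2"], rule exI[of _ "max d1 d2"], intro conjI allI impI)
  fix r assume "r \<notin> {min c1 c2..max d1 d2}"
  then have "r \<notin> {c1..d1}" "r \<notin> {c2..d2}" by auto
  then show "\<phi> r - \<psi> r = 0" using s(2,4) by simp
 qed (use s in auto)
 moreover have "\<exists>c' d. - 1 / a < c' \<and> (\<forall>r. r \<notin> {c'..d} \<longrightarrow> c * \<phi> r = 0)"
  using s by (intro exI[of _ c1] exI[of _ d1]) auto
 moreover have "(d_r ^^ n) (\<lambda>x. \<phi> x - \<psi> x) differentiable at r" "(d_r ^^ n) (\<lambda>x. c * \<phi> x) differentiable at r" for n r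
  unfolding n1 n2 using h1[of n r] h2[of n r] unfolding has_vector_derivative_def differentiable_def by blast+
 ultimately show ?A "(\<lambda>x. c * \<phi> x) \<in> test_functions a"
  by (auto simp: test_functions_def)
qed

text \<open>For large n, equal to 1 between -1/a + 2/n and n, and 0 outside the interval from -1/a +
  1/n to n + 1.\<close>

definition cutoff :: "real \<Rightarrow> nat \<Rightarrow> real \<Rightarrow> real" where
 "cutoff a n r = smooth_step (real n * (r + 1 / a) - 1) * smooth_step (real n + 1 - r)"

lemma cutoff_mult_test_function:
 assumes "smooth_alg P" "n > 0" "a > 0"
 shows "(\<lambda>r. of_real (cutoff a n r) * P r) \<in> test_functions a" (is ?A)
  and "r \<notin> {- 1 / a + 1 / real n .. real n + 1} \<Longrightarrow> cutoff a n r = 0"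
proof -
 have z: "cutoff a n r = 0" if "r \<notin> {- 1 / a + 1 / real n .. real n + 1}" for r
 proof (cases "r < - 1 / a + 1 / real n")
  case True
  then have "real n * (r + 1 / a) - 1 \<le> 0" using assms(2,3) by (simp add: field_simps)
  then show ?thesis by (simp add: cutoff_def smooth_step_values)
 next
  case False
  then have "real n + 1 - r \<le> 0" using that by auto
  then show ?thesis by (simp add: cutoff_def smooth_step_values)
 qed
 then show "r \<notin> {- 1 / a + 1 / real n .. real n + 1} \<Longrightarrow> cutoff a n r = 0" .
 have "smooth_alg (\<lambda>r. (of_real (smooth_step (real n * r + (real n / a - 1))) * of_real (smooth_step ((- 1) * r + (real n + 1)))) * P r)"
  by (intro smooth_alg.mult smooth_alg_smooth_step assms)
 moreover have "(\<lambda>r. (of_real (smooth_step (real n * r + (real n / a - 1))) * of_real (smooth_step ((- 1) * r + (real n + 1)))) * P r)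
   = (\<lambda>r. of_real (cutoff a n r) * P r)" by (rule ext) (simp add: cutoff_def algebra_simps)
 ultimately have "smooth_alg (\<lambda>r. of_real (cutoff a n r) * P r)" by simp
 then have "\<forall>k r. ((d_r ^^ k) (\<lambda>r. of_real (cutoff a n r) * P r)) differentiable (at r)" using smooth_alg_differentiable by blast
 moreover have "- 1 / a < - 1 / a + 1 / real n" using assms(2) by simp
 then have "\<exists>c d. - 1 / a < c \<and> (\<forall>r. r \<notin> {c..d} \<longrightarrow> of_real (cutoff a n r) * P r = 0)"
  using z by (intro exI[of _ "- 1 / a + 1 / real n"] exI[of _ "real n + 1"]) auto
 ultimately show ?A unfolding test_functions_def by blast
qed

text \<open>Near the cone point the derivative has size n, but only at distance at most 2/n from the
  tip. Its square is therefore at most a multiple of 1 / (r + 1/a)^2, uniformly in n, and this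
  weight is comparable to the potential m^2 / f^2.\<close>

lemma cutoff_properties:
 assumes a: "a > 0"
 obtains \<chi>' C where "C \<ge> 0" "\<And>n. continuous_on UNIV (\<chi>' n)" "\<And>n r. (cutoff a n has_real_derivative \<chi>' n r) (at r)"
  "\<And>n r. r > - 1 / a \<Longrightarrow> n > 0 \<Longrightarrow> (\<chi>' n r)^2 \<le> C * (1 / (r + 1 / a)^2 * indicator {..0} r + 1)"
  "\<And>r. r > - 1 / a \<Longrightarrow> eventually (\<lambda>n. cutoff a n r = 1 \<and> \<chi>' n r = 0) sequentially"
  "\<And>n r. 0 \<le> cutoff a n r \<and> cutoff a n r \<le> 1"
proof -
 obtain hd C where hC: "C \<ge> 0 \<and> (\<forall>t. (smooth_step has_real_derivative hd t) (at t)) \<and> (\<forall>t. \<bar>hd t\<bar> \<le> C) \<and>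
  (\<forall>t. t \<le> 0 \<or> t \<ge> 1 \<longrightarrow> hd t = 0) \<and> continuous_on UNIV hd" using smooth_step_deriv by blast
 then have h: "C \<ge> 0" "\<And>t. (smooth_step has_real_derivative hd t) (at t)" "\<And>t. \<bar>hd t\<bar> \<le> C"
  "\<And>t. t \<le> 0 \<or> t \<ge> 1 \<Longrightarrow> hd t = 0" "continuous_on UNIV hd" by auto
 define p where "p = (\<lambda>n r. real n * (r + 1 / a) - 1)"
 define q where "q = (\<lambda>n r. real n + 1 - r)"
 define \<chi>' where "\<chi>' = (\<lambda>n r. hd (p n r) * real n * smooth_step (q n r) + hd (q n r) * (- 1) * smooth_step (p n r))"
 have D: "(cutoff a n has_real_derivative \<chi>' n r) (at r)" for n r
 proof -
  have dp: "(p n has_real_derivative real n) (at r)" unfolding p_def by (rule derivative_eq_intros refl)+ simp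
  have dq: "(q n has_real_derivative - 1) (at r)" unfolding q_def by (rule derivative_eq_intros refl)+ simp
  have "((\<lambda>r. smooth_step (p n r) * smooth_step (q n r)) has_real_derivative \<chi>' n r) (at r)"
   unfolding \<chi>'_def by (intro DERIV_mult DERIV_chain2[OF h(2) dp] DERIV_chain2[OF h(2) dq])
  then show ?thesis by (simp add: cutoff_def[abs_def] p_def q_def)
 qed
 have s: "\<bar>smooth_step t\<bar> \<le> 1" for t using smooth_step_values(3,4)[of t] by simp
 define K where "K = 2 * C^2 * (4 + 4 * a^2) + 2 * C^2"
 have b: "(\<chi>' n r)^2 \<le> K * (1 / (r + 1 / a)^2 * indicator {..0} r + 1)" if r: "r > - 1 / a" and n: "n > 0" for n r
 proof -
  define x where "x = r + 1 / a"
  have x: "x > 0" using r by (simp add: x_def)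
  define A where "A = hd (p n r) * real n * smooth_step (q n r)"
  define B where "B = hd (q n r) * (- 1) * smooth_step (p n r)"
  have B: "B^2 \<le> C^2"
  proof -
   have "\<bar>B\<bar> = \<bar>hd (q n r)\<bar> * \<bar>smooth_step (p n r)\<bar>" by (simp add: B_def abs_mult)
   also have "\<dots> \<le> C * 1" using h(1,3) s by (intro mult_mono) auto
   finally show ?thesis using h(1) by (simp add: abs_le_square_iff[symmetric])
  qed
  have A: "A^2 \<le> C^2 * (4 + 4 * a^2) * (1 / x^2 * indicator {..0} r + 1)"
  proof (cases "p n r \<ge> 1")
   case True
   then show ?thesis using h(4)[of "p n r"] by (simp add: A_def)
  next
   case False
   \<comment> \<open>The step at the tip is incomplete only within distance 2/n of it, so n \<le> 2
     / x there.\<close>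
   then have nx: "real n * x \<le> 2" by (simp add: p_def x_def)
   have "\<bar>A\<bar> = \<bar>hd (p n r)\<bar> * real n * \<bar>smooth_step (q n r)\<bar>" by (simp add: A_def abs_mult)
   also have "\<dots> \<le> C * real n * 1" using h(1,3) s by (intro mult_mono) auto
   finally have An: "A^2 \<le> C^2 * (real n)^2" using h(1) by (simp add: abs_le_square_iff[symmetric] power_mult_distrib[symmetric])
   have n2: "real n \<le> 2 / x" using nx x by (simp add: field_simps)
   show ?thesis
   proof (cases "r \<le> 0")
    case True
    have "(real n)^2 \<le> (2 / x)^2" using n2 by (intro power_mono) auto
    also have "\<dots> = 4 * (1 / x^2)" by (simp add: power_divide)
    also have "\<dots> \<le> (4 + 4 * a^2) * (1 / x^2 + 1)" by (intro mult_mono) auto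
    finally have "C^2 * (real n)^2 \<le> C^2 * ((4 + 4 * a^2) * (1 / x^2 + 1))" by (intro mult_left_mono) auto
    then show ?thesis using An True by (simp add: mult.assoc)
   next
    case False
    then have "1 / a \<le> x" by (simp add: x_def)
    then have "2 / x \<le> 2 * a" using x a by (simp add: field_simps)
    then have "(real n)^2 \<le> (2 * a)^2" using n2 by (intro power_mono) auto
    also have "\<dots> \<le> 4 + 4 * a^2" by (simp add: power_mult_distrib)
    finally have "C^2 * (real n)^2 \<le> C^2 * (4 + 4 * a^2)" by (intro mult_left_mono) auto
    then show ?thesis using An False by simp
   qed
  qed
  have "(\<chi>' n r)^2 \<le> 2 * A^2 + 2 * B^2"
  proof -
   have "\<chi>' n r = A + B" by (simp add: \<chi>'_def A_def B_def)
   moreover have "(A + B)^2 \<le> 2 * A^2 + 2 * B^2" using sum_squares_bound[of A B] by (simp add: power2_sum)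
   ultimately show ?thesis by simp
  qed
  also have "\<dots> \<le> 2 * (C^2 * (4 + 4 * a^2) * (1 / x^2 * indicator {..0} r + 1)) + 2 * (C^2 * (1 / x^2 * indicator {..0} r + 1))"
  proof -
   have "(1::real) \<le> 1 / x^2 * indicator {..0} r + 1" by simp
   then have "C^2 * 1 \<le> C^2 * (1 / x^2 * indicator {..0} r + 1)" by (intro mult_left_mono) auto
   then show ?thesis using A B by linarith
  qed
  also have "\<dots> = K * (1 / x^2 * indicator {..0} r + 1)" by (simp add: K_def algebra_simps)
  finally show ?thesis by (simp add: x_def)
 qed
 have e: "eventually (\<lambda>n. cutoff a n r = 1 \<and> \<chi>' n r = 0) sequentially" if r: "r > - 1 / a" for r
 proof -
  have x: "r + 1 / a > 0" using r by simp
  obtain N :: nat where N: "2 / (r + 1 / a) + \<bar>r\<bar> \<le> real N" using real_arch_simple by blast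
  have "cutoff a n r = 1 \<and> \<chi>' n r = 0" if n: "n \<ge> N" for n
  proof -
   have nN: "real N \<le> real n" using n by simp
   have "2 / (r + 1 / a) \<le> real n" using N nN by linarith
   then have "2 \<le> real n * (r + 1 / a)" using x by (simp add: pos_divide_le_eq)
   then have p1: "p n r \<ge> 1" by (simp add: p_def)
   have "0 \<le> 2 / (r + 1 / a)" using x by simp
   then have q1: "q n r \<ge> 1" using N nN unfolding q_def by linarith
   have "cutoff a n r = smooth_step (p n r) * smooth_step (q n r)" by (simp add: cutoff_def p_def q_def)
   then show ?thesis using p1 q1 h(4) by (simp add: smooth_step_values \<chi>'_def)
  qed
  then show ?thesis by (auto simp: eventually_sequentially)
 qed
 have r: "0 \<le> cutoff a n r \<and> cutoff a n r \<le> 1" for n r using smooth_step_values(3,4) by (simp add: cutoff_def mult_le_one)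
 have "K \<ge> 0" using h(1) by (simp add: K_def)
 have cs: "continuous_on UNIV smooth_step" using h(2) by (meson DERIV_continuous continuous_at_imp_continuous_on)
 have cont: "continuous_on UNIV (\<chi>' n)" for n unfolding \<chi>'_def p_def q_def
  by (intro continuous_intros continuous_on_compose2[OF h(5)] continuous_on_compose2[OF cs]) auto
 show ?thesis using that[of K \<chi>', OF \<open>K \<ge> 0\<close> cont D b e r] by blast
qed

section \<open>Integration by parts for the radial operator\<close>

locale radial =
 fixes a b :: real and m :: int
 assumes a: "a > 0" and b: "b < 0" and m: "m > 0"
begin

abbreviation I :: "real set" where "I \<equiv> {- 1 / a<..}"
abbreviation f :: "real \<Rightarrow> real" where "f \<equiv> f1 a b"
abbreviation M :: "real measure" where "M \<equiv> radial_measure a b"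
abbreviation L :: "real measure" where "L \<equiv> restrict_space lborel I"
abbreviation m2 :: real where "m2 \<equiv> (real_of_int m)^2"
abbreviation pot :: "complex \<Rightarrow> real \<Rightarrow> complex" where "pot z r \<equiv> of_real (m2 / f r) - z^2 * of_real (f r)"
abbreviation vel :: "(real \<Rightarrow> complex) \<Rightarrow> real \<Rightarrow> complex" where "vel p \<equiv> (\<lambda>r. p r / of_real (f r))"
abbreviation intM where "intM \<equiv> integral\<^sup>L M"
abbreviation L2 :: "(real \<Rightarrow> complex) set" where "L2 \<equiv> L2_space M"
abbreviation TF :: "(real \<Rightarrow> complex) set" where "TF \<equiv> test_functions a"

definition f' :: "real \<Rightarrow> real" where "f' r = (if r < 0 then a else - b * exp (- b * r))"

text \<open>One expression for both sides makes continuity across 0 and measurability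
  immediate.\<close>

lemma f_eq: "f = (\<lambda>r. (1 + a * min r 0) * exp (- b * max r 0))" by (rule ext) (auto simp: f1_def min_def max_def)

lemma cont_f: "continuous_on S f" unfolding f_eq by (intro continuous_intros)

lemma f_pos: "r \<in> I \<Longrightarrow> f r > 0" using a by (auto simp: f1_def field_simps)

lemma f_nz: "r \<in> I \<Longrightarrow> f r \<noteq> 0" using f_pos by force

lemma meas_f [measurable]: "f \<in> borel_measurable borel" unfolding f_eq by measurable

lemma f_deriv:
 assumes "r \<noteq> 0"
 shows "(f has_real_derivative f' r) (at r)"
proof (cases "r < 0")
 case True
 have D: "((\<lambda>r. 1 + a * r) has_real_derivative a) (at r)" by (auto intro!: derivative_eq_intros)
 have "(f has_real_derivative a) (at r)"
  by (rule has_field_derivative_transform_within_open[OF D, where S = "{..<0}"]) (use True in \<open>auto simp: f1_def\<close>)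
 then show ?thesis using True by (simp add: f'_def)
next
 case False
 have D: "((\<lambda>r. exp (- b * r)) has_real_derivative - b * exp (- b * r)) (at r)" by (auto intro!: derivative_eq_intros)
 have "(f has_real_derivative - b * exp (- b * r)) (at r)"
  by (rule has_field_derivative_transform_within_open[OF D, where S = "{0<..}"]) (use False assms in \<open>auto simp: f1_def\<close>)
 then show ?thesis using False by (simp add: f'_def)
qed

lemma deriv_f: "deriv f r = (if r = 0 then deriv f 0 else f' r)" using DERIV_imp_deriv[OF f_deriv] by simp

lemma meas_deriv_f [measurable]: "deriv f \<in> borel_measurable borel"
proof -
 have "(\<lambda>r. if r = 0 then deriv f 0 else f' r) \<in> borel_measurable borel" unfolding f'_def by measurable
 moreover have "deriv f = (\<lambda>r. if r = 0 then deriv f 0 else f' r)" by (rule ext) (rule deriv_f)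
 ultimately show ?thesis by metis
qed

lemma space_M [simp]: "space M = I" by (simp add: radial_measure_def space_restrict_space)

lemma meas_M: "borel_measurable M = borel_measurable L" unfolding radial_measure_def by (rule measurable_cong_sets[OF sets_density refl])

lemma meas_M_cont:
 assumes "continuous_on I g"
 shows "g \<in> borel_measurable M"
proof -
 have "borel_measurable L = borel_measurable (restrict_space borel I)"
  by (rule measurable_cong_sets[OF sets_restrict_space_cong[OF sets_lborel] refl])
 then show ?thesis unfolding meas_M using borel_measurable_continuous_on_restrict[OF assms] by simp
qed

lemma meas_M_borel: "g \<in> borel_measurable borel \<Longrightarrow> g \<in> borel_measurable M"
 unfolding meas_M by (rule measurable_restrict_space1) simp

lemma integrable_M:
 fixes g :: "real \<Rightarrow> 'b::{banach, second_countable_topology}"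
 assumes [measurable]: "g \<in> borel_measurable M"
 shows "integrable M g \<longleftrightarrow> set_integrable lborel I (\<lambda>r. f r *\<^sub>R g r)"
proof -
 have "integrable M g \<longleftrightarrow> integrable L (\<lambda>r. f r *\<^sub>R g r)" unfolding radial_measure_def
 proof (rule integrable_density)
  show "g \<in> borel_measurable L" using assms unfolding meas_M .
  show "f \<in> borel_measurable L" by (rule measurable_restrict_space1) simp
  show "AE x in L. 0 \<le> f x" by (rule AE_I2) (simp add: space_restrict_space f_pos less_imp_le)
 qed
 also have "\<dots> \<longleftrightarrow> set_integrable lborel I (\<lambda>r. f r *\<^sub>R g r)"
  unfolding set_integrable_def by (rule integrable_restrict_space) simp
 finally show ?thesis .
qed

lemma integral_M:
 fixes g :: "real \<Rightarrow> 'b::{banach, second_countable_topology}"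
 assumes [measurable]: "g \<in> borel_measurable M"
 shows "intM g = (LBINT r:I. f r *\<^sub>R g r)"
proof -
 have "intM g = integral\<^sup>L L (\<lambda>r. f r *\<^sub>R g r)" unfolding radial_measure_def
 proof (rule integral_density)
  show "g \<in> borel_measurable L" using assms unfolding meas_M .
  show "f \<in> borel_measurable L" by (rule measurable_restrict_space1) simp
  show "AE x in L. 0 \<le> f x" by (rule AE_I2) (simp add: space_restrict_space f_pos less_imp_le)
 qed
 also have "\<dots> = (LBINT r:I. f r *\<^sub>R g r)" unfolding set_lebesgue_integral_def by (rule integral_restrict_space) simp
 finally show ?thesis .
qed

lemma compact_integrable:
 fixes h :: "real \<Rightarrow> 'b::{euclidean_space}"
 assumes c: "- 1 / a < c" and h: "h \<in> borel_measurable M" and B: "\<And>r. r \<in> {c..d} \<Longrightarrow> norm (h r) \<le> B"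
 shows "integrable M (\<lambda>r. indicator {c..d} r *\<^sub>R h r)" (is ?A)
  and "set_integrable lborel {c..d} (\<lambda>r. f r *\<^sub>R h r)" (is ?B)
  and "intM (\<lambda>r. indicator {c..d} r *\<^sub>R h r) = (LBINT r:{c..d}. f r *\<^sub>R h r)" (is ?C)
proof -
 have sub: "{c..d} \<subseteq> I" using c by auto
 have hm: "(\<lambda>r. indicator {c..d} r *\<^sub>R h r) \<in> borel_measurable M"
  using h meas_M_borel[of "indicator {c..d} :: real \<Rightarrow> real"] by (intro borel_measurable_scaleR) auto
 have "(\<lambda>r. indicator I r *\<^sub>R h r) \<in> borel_measurable lborel"
  using h unfolding meas_M by (subst (asm) borel_measurable_restrict_space_iff) auto
 then have "(\<lambda>r. indicator {c..d} r *\<^sub>R (f r *\<^sub>R (indicator I r *\<^sub>R h r))) \<in> borel_measurable lborel" by measurable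
 also have eq: "(\<lambda>r. indicator {c..d} r *\<^sub>R (f r *\<^sub>R (indicator I r *\<^sub>R h r))) = (\<lambda>r. indicator {c..d} r *\<^sub>R (f r *\<^sub>R h r))"
  using sub by (auto simp: indicator_def fun_eq_iff)
 finally have mm: "(\<lambda>r. indicator {c..d} r *\<^sub>R (f r *\<^sub>R h r)) \<in> borel_measurable lborel" .
 obtain F where F: "\<And>r. r \<in> {c..d} \<Longrightarrow> \<bar>f r\<bar> \<le> F"
  using compact_imp_bounded[OF compact_continuous_image[OF cont_f compact_Icc[of c d]]] by (metis bounded_real imageI)
 show si: ?B unfolding set_integrable_def
 proof (rule Bochner_Integration.integrable_bound[where f = "\<lambda>r. indicator {c..d} r *\<^sub>R (\<bar>F\<bar> * \<bar>B\<bar>)"])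
  show "integrable lborel (\<lambda>r. indicator {c..d} r *\<^sub>R (\<bar>F\<bar> * \<bar>B\<bar>))"
   by (rule integrable_scaleR_left) (simp add: integrable_indicator_iff emeasure_lborel_Icc_eq)
  show "AE r in lborel. norm (indicator {c..d} r *\<^sub>R (f r *\<^sub>R h r)) \<le> norm (indicator {c..d} r *\<^sub>R (\<bar>F\<bar> * \<bar>B\<bar>))"
  proof (rule AE_I2)
   fix r :: real
   show "norm (indicator {c..d} r *\<^sub>R (f r *\<^sub>R h r)) \<le> norm (indicator {c..d} r *\<^sub>R (\<bar>F\<bar> * \<bar>B\<bar>))"
   proof (cases "r \<in> {c..d}")
    case True
    then have "\<bar>f r\<bar> * norm (h r) \<le> \<bar>F\<bar> * \<bar>B\<bar>" using F[of r] B[of r] by (intro mult_mono) auto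
    then show ?thesis using True by simp
   qed simp
  qed
 qed (rule mm)
 have eq2: "(\<lambda>r. indicator I r *\<^sub>R (f r *\<^sub>R (indicator {c..d} r *\<^sub>R h r))) = (\<lambda>r. indicator {c..d} r *\<^sub>R (f r *\<^sub>R h r))"
  using sub by (auto simp: indicator_def fun_eq_iff)
 show ?A using si unfolding integrable_M[OF hm] set_integrable_def eq2 .
 show ?C
  unfolding integral_M[OF hm] set_lebesgue_integral_def eq2 ..
qed

text \<open>Differentiability is waived at 0, where \<open>f\<close> may have a kink; continuity of
  \<open>G\<close> there suffices.\<close>

lemma FTC_M:
 fixes h :: "real \<Rightarrow> 'b::{euclidean_space}"
 assumes c: "- 1 / a < c" "c \<le> d" and h: "h \<in> borel_measurable M" and B: "\<And>r. r \<in> {c..d} \<Longrightarrow> norm (h r) \<le> B"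
  and G: "continuous_on {c..d} G"
  and D: "\<And>r. r \<in> {c<..<d} \<Longrightarrow> r \<noteq> 0 \<Longrightarrow> (G has_vector_derivative (f r *\<^sub>R h r)) (at r)"
 shows "intM (\<lambda>r. indicator {c..d} r *\<^sub>R h r) = G d - G c"
proof -
 have "((\<lambda>r. f r *\<^sub>R h r) has_integral (G d - G c)) {c..d}"
  by (rule fundamental_theorem_of_calculus_interior_strong[of "{0}"]) (use c G D in auto)
 then show ?thesis using compact_integrable(3)[OF c(1) h B] set_borel_integral_eq_integral(2)[OF compact_integrable(2)[OF c(1) h B]]
  by (simp add: integral_unique)
qed

lemma compact_L2:
 assumes c: "- 1 / a < c" and h: "h \<in> borel_measurable M" and B: "\<And>r. r \<in> {c..d} \<Longrightarrow> cmod (h r) \<le> B"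
  and z: "\<And>r. r \<in> I \<Longrightarrow> r \<notin> {c..d} \<Longrightarrow> h r = 0"
 shows "h \<in> L2"
proof (rule L2_spaceI[OF h])
 have "integrable M (\<lambda>r. indicator {c..d} r *\<^sub>R (cmod (h r))^2)"
 proof (rule compact_integrable(1)[OF c, where B = "B^2"])
  show "(\<lambda>r. (cmod (h r))^2) \<in> borel_measurable M" using h by measurable
  show "norm ((cmod (h r))^2) \<le> B^2" if "r \<in> {c..d}" for r using B[OF that] by (simp add: power_mono)
 qed
 then show "integrable M (\<lambda>r. (cmod (h r))^2)"
  by (rule Bochner_Integration.integrable_cong[THEN iffD1, rotated -1]) (use z in \<open>auto simp: indicator_def\<close>)
qed

lemma integral_M_supp:
 fixes h :: "real \<Rightarrow> 'b::{banach, second_countable_topology}"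
 assumes "\<And>r. r \<in> I \<Longrightarrow> r \<notin> {c..d} \<Longrightarrow> h r = 0"
 shows "intM h = intM (\<lambda>r. indicator {c..d} r *\<^sub>R h r)"
 by (rule Bochner_Integration.integral_cong) (use assms in \<open>auto simp: indicator_def\<close>)

text \<open>\<open>u\<close> and \<open>p = f u'\<close> solve \<open>(P - z\<^sup>2) u = v\<close> as a first order system. The coefficient \<open>f'\<close>,
 which jumps at \<open>0\<close>, does not occur in it.\<close>

definition system :: "complex \<Rightarrow> (real \<Rightarrow> complex) \<Rightarrow> (real \<Rightarrow> complex) \<Rightarrow> (real \<Rightarrow> complex) \<Rightarrow> bool" where
 "system z v u p \<longleftrightarrow> continuous_on I u \<and> continuous_on I p \<and>
   (\<forall>r\<in>I. r \<noteq> 0 \<longrightarrow> (u has_vector_derivative p r / of_real (f r)) (at r) \<and>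
    (p has_vector_derivative pot z r * u r - of_real (f r) * v r) (at r))"

lemma continuous_bounded_Icc:
 fixes g :: "real \<Rightarrow> 'b::real_normed_vector"
 assumes "continuous_on I g" "- 1 / a < c"
 obtains B where "\<And>r. r \<in> {c..d} \<Longrightarrow> norm (g r) \<le> B" "B \<ge> 0"
proof -
 have "continuous_on {c..d} g" using assms by (auto intro: continuous_on_subset)
 then have "bounded (g ` {c..d})" by (intro compact_imp_bounded compact_continuous_image) auto
 then obtain B where B: "\<forall>x\<in>g ` {c..d}. norm x \<le> B" unfolding bounded_iff by blast
 show ?thesis by (rule that[of "max B 0"]) (use B in force)+
qed

lemma test_support:
 assumes "\<phi> \<in> TF"
 obtains c d where "- 1 / a < c" "c \<le> d" "\<And>r. r \<notin> {c<..<d} \<Longrightarrow> \<phi> r = 0" "\<And>r. r \<notin> {c<..<d} \<Longrightarrow> d_r \<phi> r = 0"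
  "\<And>r. r \<notin> {c<..<d} \<Longrightarrow> d_r (d_r \<phi>) r = 0"
proof -
 obtain c d where cd: "- 1 / a < c" "\<And>r. r \<notin> {c..d} \<Longrightarrow> \<phi> r = 0" using assms by (auto simp: test_functions_def)
 have z1: "d_r g r = 0" if "\<And>r. r \<notin> {c..d} \<Longrightarrow> g r = 0" "r \<notin> {c..d}" for g r
 proof -
  have op: "open (- {c..d})" by (simp add: open_Compl)
  have "((\<lambda>_. 0 :: complex) has_vector_derivative 0) (at r)" by simp
  then have "(g has_vector_derivative 0) (at r)" by (rule has_vector_derivative_transform_within_open[OF _ op]) (use that in auto)
  then show ?thesis by (rule d_r_eq)
 qed
 have zz: "d_r \<phi> r = 0" if "r \<notin> {c..d}" for r by (rule z1[OF cd(2) that])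
 have z: "\<phi> r = 0" "d_r \<phi> r = 0" "d_r (d_r \<phi>) r = 0" if "r \<notin> {c..d}" for r
  by (rule cd(2)[OF that], rule zz[OF that], rule z1[OF zz that])
 define c' where "c' = (c + - 1 / a) / 2"
 define d' where "d' = max c d + 1"
 have "- 1 / a < c'" "c' < c" using cd(1) by (auto simp: c'_def field_simps)
 moreover have "c' \<le> d'" "{c..d} \<subseteq> {c'<..<d'}" using \<open>c' < c\<close> by (auto simp: d'_def)
 ultimately show ?thesis using z by (intro that[of c' d']) blast+
qed

lemma test_cont:
 assumes "\<phi> \<in> TF"
 shows "continuous_on S \<phi>" "continuous_on S (d_r \<phi>)" "continuous_on S (d_r (d_r \<phi>))"
 using test_function_deriv[OF assms, of 0] test_function_deriv[OF assms, of 1] test_function_deriv[OF assms, of 2]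
 by (auto intro!: continuous_at_imp_continuous_on has_vector_derivative_continuous simp: numeral_2_eq_2)

lemma P1_meas:
 assumes "\<phi> \<in> TF"
 shows "P1 a b m \<phi> \<in> borel_measurable M"
proof (rule meas_M_borel)
 have [measurable]: "\<phi> \<in> borel_measurable borel" "d_r \<phi> \<in> borel_measurable borel" "d_r (d_r \<phi>) \<in> borel_measurable borel"
  using test_cont[OF assms] by (auto intro: borel_measurable_continuous_onI)
 show "P1 a b m \<phi> \<in> borel_measurable borel" unfolding P1_def by measurable
qed

lemma P1_bounded:
 assumes t: "\<phi> \<in> TF" and c: "- 1 / a < c"
 obtains B where "\<And>r. r \<in> {c..d} \<Longrightarrow> cmod (P1 a b m \<phi> r) \<le> B"
proof -
 have cr: "continuous_on I (\<lambda>r. 1 / f r)" using f_nz by (intro continuous_intros cont_f) auto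
 obtain B0 where B0: "\<And>r. r \<in> {c..d} \<Longrightarrow> cmod (\<phi> r) \<le> B0" "B0 \<ge> 0" using continuous_bounded_Icc[OF test_cont(1)[OF t] c] by blast
 obtain B1 where B1: "\<And>r. r \<in> {c..d} \<Longrightarrow> cmod (d_r \<phi> r) \<le> B1" "B1 \<ge> 0" using continuous_bounded_Icc[OF test_cont(2)[OF t] c] by blast
 obtain B2 where B2: "\<And>r. r \<in> {c..d} \<Longrightarrow> cmod (d_r (d_r \<phi>) r) \<le> B2" "B2 \<ge> 0" using continuous_bounded_Icc[OF test_cont(3)[OF t] c] by blast
 obtain F where F: "\<And>r. r \<in> {c..d} \<Longrightarrow> norm (1 / f r) \<le> F" "F \<ge> 0" using continuous_bounded_Icc[OF cr c] by blast
 have ce: "continuous_on I (\<lambda>r. - b * exp (- b * r))" by (intro continuous_intros)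
 obtain E where E: "\<And>r. r \<in> {c..d} \<Longrightarrow> norm (- b * exp (- b * r)) \<le> E" "E \<ge> 0" using continuous_bounded_Icc[OF ce c] by blast
 define K where "K = \<bar>deriv f 0\<bar> + a + E"
 have K: "\<bar>deriv f r\<bar> \<le> K" if "r \<in> {c..d}" for r
 proof (cases "r = 0")
  case True then show ?thesis using a E by (simp add: K_def)
 next
  case False
  then have "deriv f r = f' r" by (simp add: deriv_f)
  then show ?thesis using E(1)[OF that] E(2) a by (auto simp: K_def f'_def)
 qed
 have "cmod (P1 a b m \<phi> r) \<le> B2 + K * F * B1 + m2 * (F * F) * B0" if r: "r \<in> {c..d}" for r
 proof -
  define u where "u = d_r (d_r \<phi>) r"
  define v where "v = of_real (deriv f r / f r) * d_r \<phi> r"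
  define w where "w = of_real (m2 / (f r)^2) * \<phi> r"
  have "cmod v = \<bar>deriv f r\<bar> * norm (1 / f r) * cmod (d_r \<phi> r)" unfolding v_def norm_mult norm_of_real by (simp add: abs_divide)
  also have "\<dots> \<le> K * F * B1" using K[OF r] F(1)[OF r] B1(1)[OF r] F(2) B1(2) by (intro mult_mono mult_nonneg_nonneg) auto
  finally have v: "cmod v \<le> K * F * B1" .
  have "cmod w = m2 * (norm (1 / f r) * norm (1 / f r)) * cmod (\<phi> r)"
   unfolding w_def norm_mult norm_of_real by (simp add: power2_eq_square abs_mult)
  also have "\<dots> \<le> m2 * (F * F) * B0" using F(1)[OF r] B0(1)[OF r] F(2) B0(2) by (intro mult_mono mult_nonneg_nonneg) auto
  finally have w: "cmod w \<le> m2 * (F * F) * B0" .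
  have "P1 a b m \<phi> r = (- u - v) + w" by (simp add: P1_def u_def v_def w_def)
  then have "cmod (P1 a b m \<phi> r) \<le> cmod u + cmod v + cmod w" using norm_triangle_ineq[of "- u - v" w] norm_triangle_ineq4[of "- u" v] by simp
  moreover have "cmod u \<le> B2" unfolding u_def by (rule B2(1)[OF r])
  ultimately show ?thesis using v w by linarith
 qed
 then show ?thesis using that by blast
qed

lemma test_L2:
 assumes "\<phi> \<in> TF"
 shows "\<phi> \<in> L2" "d_r \<phi> \<in> L2" "P1 a b m \<phi> \<in> L2" (is ?A)
proof -
 obtain c d where cd: "- 1 / a < c" "c \<le> d" "\<And>r. r \<notin> {c<..<d} \<Longrightarrow> \<phi> r = 0" "\<And>r. r \<notin> {c<..<d} \<Longrightarrow> d_r \<phi> r = 0"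
  "\<And>r. r \<notin> {c<..<d} \<Longrightarrow> d_r (d_r \<phi>) r = 0" using test_support[OF assms] by blast
 have out: "r \<notin> {c<..<d}" if "r \<notin> {c..d}" for r using that by auto
 obtain B0 where B0: "\<And>r. r \<in> {c..d} \<Longrightarrow> cmod (\<phi> r) \<le> B0" using continuous_bounded_Icc[OF test_cont(1)[OF assms] cd(1)] by blast
 obtain B1 where B1: "\<And>r. r \<in> {c..d} \<Longrightarrow> cmod (d_r \<phi> r) \<le> B1" using continuous_bounded_Icc[OF test_cont(2)[OF assms] cd(1)] by blast
 obtain B2 where B2: "\<And>r. r \<in> {c..d} \<Longrightarrow> cmod (P1 a b m \<phi> r) \<le> B2" using P1_bounded[OF assms cd(1)] by blast
 show "\<phi> \<in> L2" by (rule compact_L2[OF cd(1) meas_M_cont[OF test_cont(1)[OF assms]] B0]) (use cd(3) out in auto)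
 show "d_r \<phi> \<in> L2" by (rule compact_L2[OF cd(1) meas_M_cont[OF test_cont(2)[OF assms]] B1]) (use cd(4) out in auto)
 show ?A by (rule compact_L2[OF cd(1) P1_meas[OF assms] B2]) (use cd out in \<open>auto simp: P1_def\<close>)
qed

text \<open>Two integrations by parts move the operator onto the test function. Working with p = f
  u' lets the kink of \<open>f\<close> produce no boundary term at 0.\<close>

lemma green:
 assumes t: "\<phi> \<in> TF" and s: "system z v u p"
  and v: "continuous_on I v"
 shows "intM (\<lambda>r. u r * cnj (P1 a b m \<phi> r)) = intM (\<lambda>r. (v r + z^2 * u r) * cnj (\<phi> r))"
proof -
 obtain c d where cd: "- 1 / a < c" "c \<le> d" "\<And>r. r \<notin> {c<..<d} \<Longrightarrow> \<phi> r = 0" "\<And>r. r \<notin> {c<..<d} \<Longrightarrow> d_r \<phi> r = 0"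
  "\<And>r. r \<notin> {c<..<d} \<Longrightarrow> d_r (d_r \<phi>) r = 0" using test_support[OF t] by blast
 have out: "r \<notin> {c<..<d}" if "r \<notin> {c..d}" for r using that by auto
 have cu: "continuous_on I u" and cp: "continuous_on I p" using s by (auto simp: system_def)
 define h1 where "h1 = (\<lambda>r. u r * cnj (P1 a b m \<phi> r))"
 define h2 where "h2 = (\<lambda>r. (v r + z^2 * u r) * cnj (\<phi> r))"
 define h where "h = (\<lambda>r. h1 r - h2 r)"
 have [measurable]: "u \<in> borel_measurable M" "v \<in> borel_measurable M" "(\<lambda>r. cnj (\<phi> r)) \<in> borel_measurable M"
  by (intro meas_M_cont cu v continuous_intros test_cont[OF t])+
 have [measurable]: "(\<lambda>r. cnj (P1 a b m \<phi> r)) \<in> borel_measurable M"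
  by (rule measurable_compose[OF P1_meas[OF t] borel_measurable_continuous_onI]) (intro continuous_intros)
 have hm: "h1 \<in> borel_measurable M" "h2 \<in> borel_measurable M" "h \<in> borel_measurable M" unfolding h_def h1_def h2_def by measurable
 obtain B1 where B1: "\<And>r. r \<in> {c..d} \<Longrightarrow> cmod (P1 a b m \<phi> r) \<le> B1" using P1_bounded[OF t cd(1)] by blast
 obtain Bu where Bu: "\<And>r. r \<in> {c..d} \<Longrightarrow> cmod (u r) \<le> Bu" "Bu \<ge> 0" using continuous_bounded_Icc[OF cu cd(1)] by blast
 have "continuous_on I h2" unfolding h2_def by (intro continuous_intros v cu test_cont[OF t])
 then obtain B2 where B2: "\<And>r. r \<in> {c..d} \<Longrightarrow> cmod (h2 r) \<le> B2" using continuous_bounded_Icc[OF _ cd(1)] by blast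
 have Bh1: "cmod (h1 r) \<le> Bu * B1" if "r \<in> {c..d}" for r
  unfolding h1_def norm_mult complex_mod_cnj using B1[OF that] Bu(1)[OF that] Bu(2) by (intro mult_mono) auto
 have Bh: "cmod (h r) \<le> Bu * B1 + B2" if "r \<in> {c..d}" for r
  unfolding h_def using norm_triangle_ineq4[of "h1 r" "h2 r"] Bh1[OF that] B2[OF that] by linarith
 \<comment> \<open>The boundary expression f (u' cnj \<phi> - u cnj \<phi>'), which is continuous
   across 0 because \<open>u\<close> and \<open>p\<close> are; \<open>f h\<close> is its
   derivative.\<close>
 define G where "G = (\<lambda>r. p r * cnj (\<phi> r) - u r * (f r *\<^sub>R cnj (d_r \<phi> r)))"
 have "intM (\<lambda>r. indicator {c..d} r *\<^sub>R h r) = G d - G c"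
 proof (rule FTC_M[OF cd(1,2) hm(3) Bh])
  have sub: "{c..d} \<subseteq> I" using cd(1) by auto
  show "continuous_on {c..d} G" unfolding G_def
   by (intro continuous_intros continuous_on_subset[OF cp sub] continuous_on_subset[OF cu sub] test_cont[OF t] cont_f)
  fix r assume r: "r \<in> {c<..<d}" "r \<noteq> 0"
  then have rI: "r \<in> I" using cd(1) by auto
  define F where "F = (of_real (f r) :: complex)"
  have F: "F \<noteq> 0" using f_nz[OF rI] by (simp add: F_def)
  have du: "(u has_vector_derivative p r / F) (at r)"
   and dp: "(p has_vector_derivative (of_real (m2 / f r) - z^2 * F) * u r - F * v r) (at r)" using s r(2) rI by (auto simp: system_def F_def)
  have d0: "((\<lambda>r. cnj (\<phi> r)) has_vector_derivative cnj (d_r \<phi> r)) (at r)"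
   using has_vector_derivative_cnj[OF test_function_deriv[OF t, of 0 r]] by simp
  have d1: "((\<lambda>r. cnj (d_r \<phi> r)) has_vector_derivative cnj (d_r (d_r \<phi>) r)) (at r)"
   using has_vector_derivative_cnj[OF test_function_deriv[OF t, of 1 r]] by simp
  have dG: "(G has_vector_derivative (p r * cnj (d_r \<phi> r) + ((of_real (m2 / f r) - z^2 * F) * u r - F * v r) * cnj (\<phi> r))
    - (u r * (f r *\<^sub>R cnj (d_r (d_r \<phi>) r) + f' r *\<^sub>R cnj (d_r \<phi> r)) + (p r / F) * (f r *\<^sub>R cnj (d_r \<phi> r)))) (at r)"
   unfolding G_def by (intro has_vector_derivative_diff has_vector_derivative_mult has_vector_derivative_scaleR dp du d0 d1 f_deriv r)
  have "f r *\<^sub>R h r = F * (u r * cnj (P1 a b m \<phi> r) - (v r + z^2 * u r) * cnj (\<phi> r))"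
   by (simp add: h_def h1_def h2_def F_def scaleR_conv_of_real)
  also have "cnj (P1 a b m \<phi> r) = - cnj (d_r (d_r \<phi>) r) - of_real (f' r) / F * cnj (d_r \<phi> r) + (of_int m)^2 / F^2 * cnj (\<phi> r)"
   using r(2) deriv_f[of r] by (simp add: P1_def F_def)
  also have "F * (u r * (- cnj (d_r (d_r \<phi>) r) - of_real (f' r) / F * cnj (d_r \<phi> r) + (of_int m)^2 / F^2 * cnj (\<phi> r)) - (v r + z^2 * u r) * cnj (\<phi> r))
    = (p r * cnj (d_r \<phi> r) + ((of_real (m2 / f r) - z^2 * F) * u r - F * v r) * cnj (\<phi> r))
    - (u r * (f r *\<^sub>R cnj (d_r (d_r \<phi>) r) + f' r *\<^sub>R cnj (d_r \<phi> r)) + (p r / F) * (f r *\<^sub>R cnj (d_r \<phi> r)))"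
  proof -
   have e1: "f r *\<^sub>R x = F * x" for x :: complex by (simp add: F_def scaleR_conv_of_real)
   have e2: "of_real (m2 / f r) = (of_int m)^2 / F" by (simp add: F_def)
   show ?thesis unfolding e1 e2 unfolding scaleR_conv_of_real using F by (simp add: field_simps power2_eq_square)
  qed
  finally show "(G has_vector_derivative f r *\<^sub>R h r) (at r)" using dG by simp
 qed
 also have "\<dots> = 0" using cd(3)[of c] cd(3)[of d] cd(4)[of c] cd(4)[of d] by (simp add: G_def)
 also have "intM (\<lambda>r. indicator {c..d} r *\<^sub>R h r) =
   intM (\<lambda>r. indicator {c..d} r *\<^sub>R h1 r) - intM (\<lambda>r. indicator {c..d} r *\<^sub>R h2 r)"
  unfolding h_def scaleR_right_diff_distrib
  by (rule Bochner_Integration.integral_diff[OF compact_integrable(1)[OF cd(1) hm(1) Bh1] compact_integrable(1)[OF cd(1) hm(2) B2]])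
 finally have "intM (\<lambda>r. indicator {c..d} r *\<^sub>R h1 r) = intM (\<lambda>r. indicator {c..d} r *\<^sub>R h2 r)" by simp
 moreover have "intM h1 = intM (\<lambda>r. indicator {c..d} r *\<^sub>R h1 r)"
  by (rule integral_M_supp) (use cd out in \<open>auto simp: h1_def P1_def\<close>)
 moreover have "intM h2 = intM (\<lambda>r. indicator {c..d} r *\<^sub>R h2 r)"
  by (rule integral_M_supp) (use cd out in \<open>auto simp: h2_def\<close>)
 ultimately show ?thesis by (simp add: h1_def h2_def)
qed

text \<open>The Dirichlet form of the surface restricted to the angular mode
  \<open>m\<close>.\<close>

definition ff :: "(real \<Rightarrow> complex) \<Rightarrow> (real \<Rightarrow> complex) \<Rightarrow> complex" where
 "ff \<phi> \<psi> = intM (\<lambda>r. d_r \<phi> r * cnj (d_r \<psi> r) + of_real (m2 / (f r)^2) * (\<phi> r * cnj (\<psi> r)))"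

text \<open>One integration by parts with boundary expression f \<phi>' cnj \<psi>. It puts the form
  into a shape that is visibly Hermitian and nonnegative.\<close>

lemma P1_form:
 assumes t: "\<phi> \<in> TF" and s: "\<psi> \<in> TF"
 shows "L2_inner M (P1 a b m \<phi>) \<psi> = ff \<phi> \<psi>"
proof -
 obtain c d where cd: "- 1 / a < c" "c \<le> d" "\<And>r. r \<notin> {c<..<d} \<Longrightarrow> \<phi> r = 0" "\<And>r. r \<notin> {c<..<d} \<Longrightarrow> d_r \<phi> r = 0"
  "\<And>r. r \<notin> {c<..<d} \<Longrightarrow> d_r (d_r \<phi>) r = 0" using test_support[OF t] by blast
 have out: "r \<notin> {c<..<d}" if "r \<notin> {c..d}" for r using that by auto
 define h1 where "h1 = (\<lambda>r. d_r \<phi> r * cnj (d_r \<psi> r) + of_real (m2 / (f r)^2) * (\<phi> r * cnj (\<psi> r)))"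
 define h2 where "h2 = (\<lambda>r. P1 a b m \<phi> r * cnj (\<psi> r))"
 define h where "h = (\<lambda>r. h1 r - h2 r)"
 have ch1: "continuous_on I h1" unfolding h1_def using f_nz by (intro continuous_intros test_cont[OF t] test_cont[OF s] cont_f) auto
 have cs: "continuous_on I (\<lambda>r. cnj (\<psi> r))" by (intro continuous_intros test_cont[OF s])
 note [measurable] = P1_meas[OF t] meas_M_cont[OF cs] meas_M_cont[OF ch1]
 have hm: "h1 \<in> borel_measurable M" "h2 \<in> borel_measurable M" "h \<in> borel_measurable M" unfolding h_def h2_def by measurable
 obtain B1 where B1: "\<And>r. r \<in> {c..d} \<Longrightarrow> cmod (h1 r) \<le> B1" using continuous_bounded_Icc[OF ch1 cd(1)] by blast
 obtain BP where BP: "\<And>r. r \<in> {c..d} \<Longrightarrow> cmod (P1 a b m \<phi> r) \<le> BP" using P1_bounded[OF t cd(1)] by blast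
 obtain Bs where Bs: "\<And>r. r \<in> {c..d} \<Longrightarrow> cmod (\<psi> r) \<le> Bs" "Bs \<ge> 0" using continuous_bounded_Icc[OF test_cont(1)[OF s] cd(1)] by blast
 have B2: "cmod (h2 r) \<le> BP * Bs" if "r \<in> {c..d}" for r unfolding h2_def norm_mult complex_mod_cnj using BP[OF that] Bs(1)[OF that] Bs(2)
  by (intro mult_mono) (auto intro: order_trans[OF norm_ge_zero])
 have Bh: "cmod (h r) \<le> B1 + BP * Bs" if "r \<in> {c..d}" for r
  unfolding h_def using norm_triangle_ineq4[of "h1 r" "h2 r"] B1[OF that] B2[OF that] by linarith
 define G where "G = (\<lambda>r. (f r *\<^sub>R d_r \<phi> r) * cnj (\<psi> r))"
 have "intM (\<lambda>r. indicator {c..d} r *\<^sub>R h r) = G d - G c"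
 proof (rule FTC_M[OF cd(1,2) hm(3) Bh])
  show "continuous_on {c..d} G" unfolding G_def by (intro continuous_intros test_cont[OF t] test_cont[OF s] cont_f)
  fix r assume r: "r \<in> {c<..<d}" "r \<noteq> 0"
  then have rI: "r \<in> I" using cd(1) by auto
  define F where "F = (of_real (f r) :: complex)"
  have F: "F \<noteq> 0" using f_nz[OF rI] by (simp add: F_def)
  have d1: "(d_r \<phi> has_vector_derivative d_r (d_r \<phi>) r) (at r)" using test_function_deriv[OF t, of 1 r] by simp
  have d0: "((\<lambda>r. cnj (\<psi> r)) has_vector_derivative cnj (d_r \<psi> r)) (at r)"
   using has_vector_derivative_cnj[OF test_function_deriv[OF s, of 0 r]] by simp
  have dG: "(G has_vector_derivative (f r *\<^sub>R d_r \<phi> r) * cnj (d_r \<psi> r) + (f r *\<^sub>R d_r (d_r \<phi>) r + f' r *\<^sub>R d_r \<phi> r) * cnj (\<psi> r)) (at r)"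
   unfolding G_def by (intro has_vector_derivative_mult has_vector_derivative_scaleR d0 d1 f_deriv r)
  have e1: "f r *\<^sub>R x = F * x" for x :: complex by (simp add: F_def scaleR_conv_of_real)
  have P: "P1 a b m \<phi> r = - d_r (d_r \<phi>) r - of_real (f' r) / F * d_r \<phi> r + (of_int m)^2 / F^2 * \<phi> r"
   using r(2) deriv_f[of r] by (simp add: P1_def F_def)
  have h1r: "h1 r = d_r \<phi> r * cnj (d_r \<psi> r) + (of_int m)^2 / F^2 * (\<phi> r * cnj (\<psi> r))" by (simp add: h1_def F_def)
  have "f r *\<^sub>R h r = (f r *\<^sub>R d_r \<phi> r) * cnj (d_r \<psi> r) + (f r *\<^sub>R d_r (d_r \<phi>) r + f' r *\<^sub>R d_r \<phi> r) * cnj (\<psi> r)"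
   unfolding e1 h_def h2_def P h1r unfolding scaleR_conv_of_real using F by (simp add: field_simps)
  then show "(G has_vector_derivative f r *\<^sub>R h r) (at r)" using dG by simp
 qed
 also have "\<dots> = 0" using cd(4)[of c] cd(4)[of d] by (simp add: G_def)
 also have "intM (\<lambda>r. indicator {c..d} r *\<^sub>R h r) =
   intM (\<lambda>r. indicator {c..d} r *\<^sub>R h1 r) - intM (\<lambda>r. indicator {c..d} r *\<^sub>R h2 r)"
  unfolding h_def scaleR_right_diff_distrib
  by (rule Bochner_Integration.integral_diff[OF compact_integrable(1)[OF cd(1) hm(1) B1] compact_integrable(1)[OF cd(1) hm(2) B2]])
 finally have "intM (\<lambda>r. indicator {c..d} r *\<^sub>R h1 r) = intM (\<lambda>r. indicator {c..d} r *\<^sub>R h2 r)" by simp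
 moreover have "intM h1 = intM (\<lambda>r. indicator {c..d} r *\<^sub>R h1 r)"
  by (rule integral_M_supp) (use cd out in \<open>auto simp: h1_def\<close>)
 moreover have "intM h2 = intM (\<lambda>r. indicator {c..d} r *\<^sub>R h2 r)"
  by (rule integral_M_supp) (use cd out in \<open>auto simp: h2_def P1_def\<close>)
 ultimately show ?thesis by (simp add: h1_def h2_def ff_def L2_inner_def)
qed

lemma ff_self: "ff \<phi> \<phi> = of_real (intM (\<lambda>r. (cmod (d_r \<phi> r))^2 + m2 / (f r)^2 * (cmod (\<phi> r))^2))"
proof -
 have "(\<lambda>r. d_r \<phi> r * cnj (d_r \<phi> r) + of_real (m2 / (f r)^2) * (\<phi> r * cnj (\<phi> r)))
   = (\<lambda>r. of_real ((cmod (d_r \<phi> r))^2 + m2 / (f r)^2 * (cmod (\<phi> r))^2))" by (simp add: complex_norm_square[symmetric])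
 then show ?thesis unfolding ff_def by (simp only: integral_complex_of_real)
qed

lemma ff_herm: "ff \<phi> \<psi> = cnj (ff \<psi> \<phi>)"
proof -
 have "(\<lambda>r. d_r \<phi> r * cnj (d_r \<psi> r) + of_real (m2 / (f r)^2) * (\<phi> r * cnj (\<psi> r)))
  = (\<lambda>r. cnj (d_r \<psi> r * cnj (d_r \<phi> r) + of_real (m2 / (f r)^2) * (\<psi> r * cnj (\<phi> r))))" by (simp add: mult.commute)
 then show ?thesis unfolding ff_def by (simp only: Bochner_Integration.integral_cnj)
qed

sublocale nf: nonneg_form M "TF" "P1 a b m"
proof
 fix \<phi> \<psi> :: "real \<Rightarrow> complex" and c :: complex
 assume t: "\<phi> \<in> TF"
 show "\<phi> \<in> L2" "P1 a b m \<phi> \<in> L2" by (rule test_L2[OF t])+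
 show "(\<lambda>x. c * \<phi> x) \<in> TF" by (rule test_functions_lincomb(2)[OF t t])
 show "P1 a b m (\<lambda>x. c * \<phi> x) = (\<lambda>x. c * P1 a b m \<phi> x)"
  unfolding P1_def[abs_def] test_functions_lincomb(6)[OF t t] unfolding test_functions_lincomb(5)[OF t t] by (simp add: algebra_simps)
 show "0 \<le> Re (L2_inner M (P1 a b m \<phi>) \<phi>)" unfolding P1_form[OF t t] ff_self by (simp add: integral_nonneg_AE)
 assume s: "\<psi> \<in> TF"
 show "(\<lambda>x. \<phi> x - \<psi> x) \<in> TF" by (rule test_functions_lincomb(1)[OF t s])
 show "P1 a b m (\<lambda>x. \<phi> x - \<psi> x) = (\<lambda>x. P1 a b m \<phi> x - P1 a b m \<psi> x)"
  unfolding P1_def[abs_def] test_functions_lincomb(4)[OF t s] unfolding test_functions_lincomb(3)[OF t s]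
  by (simp add: algebra_simps diff_divide_distrib)
 show "L2_inner M (P1 a b m \<phi>) \<psi> = cnj (L2_inner M (P1 a b m \<psi>) \<phi>)" unfolding P1_form[OF t s] P1_form[OF s t] by (rule ff_herm)
qed

end

section \<open>Energy bounds, approximation by test functions, and density\<close>

lemma Fatou_real:
 fixes g :: "nat \<Rightarrow> 'a \<Rightarrow> real"
 assumes g: "\<And>n. integrable M (g n)" "\<And>n x. x \<in> space M \<Longrightarrow> g n x \<ge> 0"
  and h: "h \<in> borel_measurable M" "\<And>x. x \<in> space M \<Longrightarrow> h x \<ge> 0"
  and lim: "AE x in M. (\<lambda>n. g n x) \<longlonglongrightarrow> h x"
  and B: "\<And>n. integral\<^sup>L M (g n) \<le> B n" "B \<longlonglongrightarrow> B0"
 shows "integrable M h" "integral\<^sup>L M h \<le> B0"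
proof -
 have [measurable]: "g n \<in> borel_measurable M" for n using g(1) by (rule borel_measurable_integrable)
 have B0n: "0 \<le> B n" for n by (rule order_trans[OF _ B(1)]) (auto intro!: integral_nonneg_AE AE_I2 g(2))
 have B0: "0 \<le> B0" by (rule LIMSEQ_le_const[OF B(2)]) (use B0n in auto)
 have "(\<integral>\<^sup>+ x. ennreal (h x) \<partial>M) = (\<integral>\<^sup>+ x. liminf (\<lambda>n. ennreal (g n x)) \<partial>M)"
 proof (rule nn_integral_cong_AE)
  show "AE x in M. ennreal (h x) = liminf (\<lambda>n. ennreal (g n x))" using lim
  proof eventually_elim
   fix x assume "(\<lambda>n. g n x) \<longlonglongrightarrow> h x"
   then have "(\<lambda>n. ennreal (g n x)) \<longlonglongrightarrow> ennreal (h x)" by (rule tendsto_ennrealI)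
   then show "ennreal (h x) = liminf (\<lambda>n. ennreal (g n x))" by (rule lim_imp_Liminf[OF sequentially_bot, symmetric])
  qed
 qed
 also have "\<dots> \<le> liminf (\<lambda>n. \<integral>\<^sup>+ x. ennreal (g n x) \<partial>M)" by (rule nn_integral_liminf) measurable
 also have "\<dots> \<le> liminf (\<lambda>n. ennreal (B n))"
 proof (rule Liminf_mono, rule always_eventually, rule allI)
  fix n
  have "(\<integral>\<^sup>+ x. ennreal (g n x) \<partial>M) = ennreal (integral\<^sup>L M (g n))"
   by (rule nn_integral_eq_integral[OF g(1)]) (auto intro: AE_I2 g(2))
  also have "\<dots> \<le> ennreal (B n)" by (rule ennreal_leI[OF B(1)])
  finally show "(\<integral>\<^sup>+ x. ennreal (g n x) \<partial>M) \<le> ennreal (B n)" .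
 qed
 also have "liminf (\<lambda>n. ennreal (B n)) = ennreal B0" by (rule lim_imp_Liminf[OF sequentially_bot tendsto_ennrealI[OF B(2)]])
 finally have le: "(\<integral>\<^sup>+ x. ennreal (h x) \<partial>M) \<le> ennreal B0" .
 have hn: "AE x in M. 0 \<le> h x" by (rule AE_I2) (rule h(2))
 show i: "integrable M h" by (rule integrableI_nonneg[OF h(1) hn]) (use le in \<open>auto intro: le_less_trans\<close>)
 have "ennreal (integral\<^sup>L M h) \<le> ennreal B0" using le unfolding nn_integral_eq_integral[OF i hn] .
 then show "integral\<^sup>L M h \<le> B0" using B0 by (simp add: ennreal_le_iff)
qed

context radial
begin

text \<open>Pointwise density of the form plus the L2 norm squared. The derivative is a separate
  argument \<open>q\<close> so that p / f can be inserted, which is continuous also at 0.\<close>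

definition en :: "(real \<Rightarrow> complex) \<Rightarrow> (real \<Rightarrow> complex) \<Rightarrow> real \<Rightarrow> real" where
 "en g q r = (cmod (q r))^2 + (m2 / (f r)^2 + 1) * (cmod (g r))^2"

lemma en_nonneg: "en g q r \<ge> 0" by (simp add: en_def)

lemma en_ge: "(cmod (g r))^2 \<le> en g q r" "(cmod (q r))^2 + m2 / (f r)^2 * (cmod (g r))^2 \<le> en g q r" by (simp_all add: en_def algebra_simps)

lemma en_meas [measurable]:
 assumes "g \<in> borel_measurable M" "q \<in> borel_measurable M"
 shows "en g q \<in> borel_measurable M"
proof -
 note [measurable] = assms meas_M_borel[OF meas_f]
 show ?thesis unfolding en_def[abs_def] by measurable
qed

lemma en_add_le: "en (\<lambda>r. g r + g' r) (\<lambda>r. q r + q' r) r \<le> 2 * en g q r + 2 * en g' q' r"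
proof -
 define k where "k = m2 / (f r)^2 + 1"
 have k: "k \<ge> 0" by (simp add: k_def)
 have "k * (cmod (g r + g' r))^2 \<le> k * (2 * (cmod (g r))^2 + 2 * (cmod (g' r))^2)" by (rule mult_left_mono[OF cmod_add_square_le k])
 then show ?thesis using cmod_add_square_le[of "q r" "q' r"] unfolding en_def k_def[symmetric] by (simp add: algebra_simps)
qed

lemma exhaustion:
 assumes "r \<in> I"
 shows "eventually (\<lambda>n. r \<in> {- 1 / a + 1 / (real n + 1)..real n + 1}) sequentially"
proof -
 have x: "r + 1 / a > 0" using assms by auto
 obtain N :: nat where N: "1 / (r + 1 / a) + \<bar>r\<bar> \<le> real N" using real_arch_simple by blast
 have "r \<in> {- 1 / a + 1 / (real n + 1)..real n + 1}" if n: "n \<ge> N" for n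
 proof -
  have nN: "real N \<le> real n" using n by simp
  have "0 \<le> 1 / (r + 1 / a)" using x by simp
  then have r: "r \<le> real n + 1" using N nN by linarith
  have "1 / (r + 1 / a) \<le> real n + 1" using N nN by linarith
  then have "1 \<le> (real n + 1) * (r + 1 / a)" using x by (simp add: pos_divide_le_eq)
  then have "1 / (real n + 1) \<le> r + 1 / a" by (simp add: pos_divide_le_eq mult.commute)
  then show ?thesis using r by simp
 qed
 then show ?thesis by (auto simp: eventually_sequentially)
qed

text \<open>Multiplied by \<open>\<i> / z\<close>, the form identity for the first order system has coefficients
 \<open>Re (\<i> / z) > 0\<close> at the Dirichlet form and \<open>Im z > 0\<close> at \<open>|u|\<^sup>2\<close>.\<close>

lemma energy_estimate:
 assumes z: "Im z > 0"
 shows "\<exists>K\<ge>0. \<forall>v u p. continuous_on I v \<and> v \<in> L2 \<and> system z v u p \<and>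
   ((\<lambda>r. p r * cnj (u r)) \<longlongrightarrow> 0) (at_right (- 1 / a)) \<and> ((\<lambda>r. p r * cnj (u r)) \<longlongrightarrow> 0) at_top \<longrightarrow>
   integrable M (en u (vel p)) \<and> intM (en u (vel p)) \<le> K * sqn M v"
proof -
 define e where "e = \<i> / z"
 have z0: "z \<noteq> 0" using z by auto
 have "e = \<i> * cnj z / of_real ((cmod z)^2)" using z0 by (simp only: e_def complex_div_cnj[of \<i> z])
 then have "Re e = Im z / (cmod z)^2" by (simp add: Re_divide_of_real)
 then have e: "Re e > 0" using z z0 by simp
 have ez: "e * z^2 = \<i> * z" using z0 by (simp add: e_def power2_eq_square)
 define \<kappa> where "\<kappa> = min (Re e) (Im z)"
 have \<kappa>: "\<kappa> > 0" "\<kappa> \<le> Re e" "\<kappa> \<le> Im z" using e z by (auto simp: \<kappa>_def)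
 \<comment> \<open>From Young's inequality: the source term is at most half of \<kappa> |u|^2 plus C
   |v|^2, and the first part is absorbed.\<close>
 define C where "C = (cmod e)^2 / (2 * \<kappa>)"
 have C: "C \<ge> 0" using \<kappa> by (simp add: C_def)
 show ?thesis
 proof (rule exI[of _ "2 / \<kappa> * C"], intro conjI allI impI)
  show "0 \<le> 2 / \<kappa> * C" using \<kappa> C by simp
  fix v u p
  assume A: "continuous_on I v \<and> v \<in> L2 \<and> system z v u p \<and>
   ((\<lambda>r. p r * cnj (u r)) \<longlongrightarrow> 0) (at_right (- 1 / a)) \<and> ((\<lambda>r. p r * cnj (u r)) \<longlongrightarrow> 0) at_top"
  define w where "w = (vel p)"
  have cu: "continuous_on I u" and cp: "continuous_on I p" and cv: "continuous_on I v" and vL: "v \<in> L2" using A by (auto simp: system_def)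
  have cw: "continuous_on I w" unfolding w_def using f_nz by (intro continuous_intros cp cont_f) auto
  have em: "en u w \<in> borel_measurable M" by (intro en_meas meas_M_cont cu cw)
  \<comment> \<open>The boundary term of the rotated form identity; it vanishes in the limit at both
    ends by assumption.\<close>
  define G where "G = (\<lambda>r. Re (e * (p r * cnj (u r))))"
  have G1: "(G \<longlongrightarrow> 0) (at_right (- 1 / a))" and G2: "(G \<longlongrightarrow> 0) at_top"
  proof -
   have A1: "((\<lambda>r. p r * cnj (u r)) \<longlongrightarrow> 0) (at_right (- 1 / a))" "((\<lambda>r. p r * cnj (u r)) \<longlongrightarrow> 0) at_top"
    using A by auto
   show "(G \<longlongrightarrow> 0) (at_right (- 1 / a))" "(G \<longlongrightarrow> 0) at_top" unfolding G_def
    using tendsto_Re[OF tendsto_mult_right_zero[OF A1(1), of e]] tendsto_Re[OF tendsto_mult_right_zero[OF A1(2), of e]] unfolding zero_complex.sel .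
  qed
  define cs where "cs = (\<lambda>n. - 1 / a + 1 / (real n + 1))"
  define ds where "ds = (\<lambda>n. real n + 1)"
  have cd: "- 1 / a < cs n" "cs n \<le> ds n" for n
  proof -
   show "- 1 / a < cs n" by (simp add: cs_def)
   have "1 / (real n + 1) \<le> 1" by simp
   moreover have "- 1 / a \<le> 0" using a by simp
   ultimately show "cs n \<le> ds n" unfolding cs_def ds_def by linarith
  qed
  have dslim: "filterlim ds at_top sequentially"
  proof -
   have "filterlim (\<lambda>n. 1 + real n) at_top sequentially" by (rule filterlim_tendsto_add_at_top[OF tendsto_const filterlim_real_sequentially])
   then show ?thesis by (simp only: ds_def add.commute)
  qed
  have cslim: "filterlim cs (at_right (- 1 / a)) sequentially" unfolding filterlim_at
  proof
   show "\<forall>\<^sub>F n in sequentially. cs n \<in> {- 1 / a<..} \<and> cs n \<noteq> - 1 / a"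
    using cd(1) by (intro always_eventually allI) (metis greaterThan_iff less_irrefl)
   have "(\<lambda>n. - 1 / a + 1 / real (Suc n)) \<longlonglongrightarrow> - 1 / a + 0"
    by (intro tendsto_intros) (rule LIMSEQ_inverse_real_of_nat[unfolded inverse_eq_divide])
   then show "cs \<longlonglongrightarrow> - 1 / a" by (simp add: cs_def add.commute)
  qed
  have Glim: "(\<lambda>n. G (ds n)) \<longlonglongrightarrow> 0" "(\<lambda>n. G (cs n)) \<longlonglongrightarrow> 0"
   by (rule filterlim_compose[OF G2 dslim], rule filterlim_compose[OF G1 cslim])
  \<comment> \<open>Chosen so that \<open>f h\<close> is the derivative of \<open>G\<close>; all its
    terms except the one with \<open>v\<close> are nonnegative.\<close>
  define h where "h = (\<lambda>r. Re e * ((cmod (w r))^2 + m2 / (f r)^2 * (cmod (u r))^2) + Im z * (cmod (u r))^2 - Re (e * (v r * cnj (u r))))"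
  have ch: "continuous_on I h" unfolding h_def using f_nz by (intro continuous_intros cw cu cv cont_f) auto
  have hen: "\<kappa> / 2 * en u w r \<le> h r + C * (cmod (v r))^2" for r
  proof -
   define U where "U = cmod (u r)"
   define V where "V = cmod (v r)"
   define N where "N = (cmod (w r))^2 + m2 / (f r)^2 * U^2"
   have N: "N \<ge> 0" by (simp add: N_def)
   have en: "en u w r = N + U^2" by (simp add: en_def N_def U_def algebra_simps)
   have "Re (e * (v r * cnj (u r))) \<le> cmod e * (V * U)" using complex_Re_le_cmod[of "e * (v r * cnj (u r))"] by (simp add: norm_mult U_def V_def)
   also have "cmod e * (V * U) \<le> \<kappa> / 2 * U^2 + C * V^2"
   proof -
    define s where "s = sqrt \<kappa>"
    have s: "s > 0" "s * s = \<kappa>" using \<kappa> by (auto simp: s_def)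
    have "2 * (s * U) * (cmod e * V / s) \<le> (s * U)^2 + (cmod e * V / s)^2" by (rule sum_squares_bound)
    moreover have "2 * (s * U) * (cmod e * V / s) = 2 * (cmod e * (V * U))" using s by simp
    moreover have "(s * U)^2 = \<kappa> * U^2" using s by (simp add: power2_eq_square mult_ac)
    moreover have "(cmod e * V / s)^2 = 2 * (C * V^2)" using s \<kappa> by (simp add: C_def power2_eq_square)
    ultimately show ?thesis by linarith
   qed
   finally have 1: "Re (e * (v r * cnj (u r))) \<le> \<kappa> / 2 * U^2 + C * V^2" .
   have 2: "\<kappa> * N \<le> Re e * N" "\<kappa> * U^2 \<le> Im z * U^2" using \<kappa> N by (auto intro!: mult_right_mono)
   have 3: "0 \<le> \<kappa> * N" using \<kappa> N by simp
   have "h r = Re e * N + Im z * U^2 - Re (e * (v r * cnj (u r)))" by (simp add: h_def N_def U_def)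
   then show ?thesis using 1 2 3 unfolding en V_def[symmetric] by (simp add: algebra_simps)
  qed
  have I1: "integrable M (\<lambda>r. indicator {cs n..ds n} r *\<^sub>R en u w r)" for n
  proof -
   have "continuous_on I (en u w)" unfolding en_def[abs_def] using f_nz by (intro continuous_intros cw cu cont_f) auto
   then obtain B where "\<And>r. r \<in> {cs n..ds n} \<Longrightarrow> norm (en u w r) \<le> B" using continuous_bounded_Icc[OF _ cd(1)] by blast
   then show ?thesis by (rule compact_integrable(1)[OF cd(1) em])
  qed
  have bnd: "intM (\<lambda>r. indicator {cs n..ds n} r *\<^sub>R en u w r) \<le> 2 / \<kappa> * (G (ds n) - G (cs n) + C * sqn M v)" for n
  proof -
   obtain B where B: "\<And>r. r \<in> {cs n..ds n} \<Longrightarrow> norm (h r) \<le> B" using continuous_bounded_Icc[OF ch cd(1)] by blast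
   have hm: "h \<in> borel_measurable M" by (rule meas_M_cont[OF ch])
   have ih: "integrable M (\<lambda>r. indicator {cs n..ds n} r *\<^sub>R h r)" by (rule compact_integrable(1)[OF cd(1) hm B])
   have iv: "integrable M (\<lambda>r. C * (cmod (v r))^2)" using L2_spaceD(2)[OF vL] by simp
   have sub: "{cs n..ds n} \<subseteq> I" using cd(1)[of n] by auto
   have "intM (\<lambda>r. indicator {cs n..ds n} r *\<^sub>R h r) = G (ds n) - G (cs n)"
   proof (rule FTC_M[OF cd hm B])
    show "continuous_on {cs n..ds n} G" unfolding G_def by (intro continuous_intros continuous_on_subset[OF cp sub] continuous_on_subset[OF cu sub])
    fix r assume r: "r \<in> {cs n<..<ds n}" "r \<noteq> 0"
    then have rI: "r \<in> I" using cd(1)[of n] by auto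
    define F where "F = (of_real (f r) :: complex)"
    have F: "F \<noteq> 0" "cnj F = F" using f_nz[OF rI] by (auto simp: F_def)
    have du: "(u has_vector_derivative w r) (at r)"
     and dp: "(p has_vector_derivative (of_real (m2 / f r) - z^2 * F) * u r - F * v r) (at r)" using A r(2) rI by (auto simp: system_def F_def w_def)
    have pw: "p r = F * w r" using F by (simp add: w_def F_def)
    have dc: "((\<lambda>r. e * (p r * cnj (u r))) has_vector_derivative
      e * (p r * cnj (w r) + ((of_real (m2 / f r) - z^2 * F) * u r - F * v r) * cnj (u r))) (at r)"
     by (intro has_vector_derivative_mult_right has_vector_derivative_mult has_vector_derivative_cnj du dp)
    have "(G has_vector_derivative Re (e * (p r * cnj (w r) + ((of_real (m2 / f r) - z^2 * F) * u r - F * v r) * cnj (u r)))) (at r)"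
     unfolding G_def using bounded_linear.has_vector_derivative[OF bounded_linear_Re dc] .
    moreover have "Re (e * (p r * cnj (w r) + ((of_real (m2 / f r) - z^2 * F) * u r - F * v r) * cnj (u r))) = f r *\<^sub>R h r"
    proof -
     define k where "k = m2 / (f r)^2"
     have mk: "of_real (m2 / f r) = F * of_real k" using f_nz[OF rI] by (simp add: F_def k_def power2_eq_square)
     have "e * (p r * cnj (w r) + ((of_real (m2 / f r) - z^2 * F) * u r - F * v r) * cnj (u r))
       = F * (e * (w r * cnj (w r) + of_real k * (u r * cnj (u r))) - (e * z^2) * (u r * cnj (u r)) - e * (v r * cnj (u r)))"
      unfolding mk pw by (simp add: algebra_simps)
     also have "\<dots> = F * (e * of_real ((cmod (w r))^2 + k * (cmod (u r))^2) - (\<i> * z) * of_real ((cmod (u r))^2) - e * (v r * cnj (u r)))"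
      unfolding ez by (simp add: complex_norm_square[symmetric])
     finally have E: "e * (p r * cnj (w r) + ((of_real (m2 / f r) - z^2 * F) * u r - F * v r) * cnj (u r))
      = F * (e * of_real ((cmod (w r))^2 + k * (cmod (u r))^2) - (\<i> * z) * of_real ((cmod (u r))^2) - e * (v r * cnj (u r)))" .
     have R: "Re (F * (e * of_real t - (\<i> * z) * of_real s - y)) = f r * (Re e * t + Im z * s - Re y)" for t s y by (simp add: F_def)
     show ?thesis unfolding E R h_def k_def real_scaleR_def ..
    qed
    ultimately show "(G has_vector_derivative f r *\<^sub>R h r) (at r)" by simp
   qed
   have "\<kappa> / 2 * intM (\<lambda>r. indicator {cs n..ds n} r *\<^sub>R en u w r) = intM (\<lambda>r. \<kappa> / 2 * (indicator {cs n..ds n} r *\<^sub>R en u w r))"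
    by simp
   also have "\<dots> \<le> intM (\<lambda>r. indicator {cs n..ds n} r *\<^sub>R h r + C * (cmod (v r))^2)"
   proof (rule integral_mono)
    show "integrable M (\<lambda>r. \<kappa> / 2 * (indicator {cs n..ds n} r *\<^sub>R en u w r))" using I1 by (rule integrable_mult_right)
    show "integrable M (\<lambda>r. indicator {cs n..ds n} r *\<^sub>R h r + C * (cmod (v r))^2)"
     using ih iv by (rule Bochner_Integration.integrable_add)
    fix r
    show "\<kappa> / 2 * (indicator {cs n..ds n} r *\<^sub>R en u w r) \<le> indicator {cs n..ds n} r *\<^sub>R h r + C * (cmod (v r))^2"
     using hen[of r] C by (cases "r \<in> {cs n..ds n}") auto
   qed
   also have "\<dots> = (G (ds n) - G (cs n)) + C * sqn M v" unfolding Bochner_Integration.integral_add[OF ih iv] sqn_def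
    using \<open>intM (\<lambda>r. indicator {cs n..ds n} r *\<^sub>R h r) = G (ds n) - G (cs n)\<close> by simp
   finally show ?thesis using \<kappa>(1) by (simp add: field_simps)
  qed
  have lim: "AE r in M. (\<lambda>n. indicator {cs n..ds n} r *\<^sub>R en u w r) \<longlonglongrightarrow> en u w r"
  proof (rule AE_I2)
   fix r assume "r \<in> space M"
   then have "eventually (\<lambda>n. r \<in> {cs n..ds n}) sequentially" unfolding cs_def ds_def by (intro exhaustion) simp
   then have "eventually (\<lambda>n. indicator {cs n..ds n} r *\<^sub>R en u w r = en u w r) sequentially" by eventually_elim simp
   then show "(\<lambda>n. indicator {cs n..ds n} r *\<^sub>R en u w r) \<longlonglongrightarrow> en u w r" by (rule tendsto_eventually)
  qed
  have Bl: "(\<lambda>n. 2 / \<kappa> * (G (ds n) - G (cs n) + C * sqn M v)) \<longlonglongrightarrow> 2 / \<kappa> * (0 - 0 + C * sqn M v)"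
   by (intro tendsto_intros Glim)
  \<comment> \<open>The estimate holds on an exhausting sequence of compact intervals up to boundary
    terms that tend to 0; Fatou's lemma passes it to all of \<open>I\<close>.\<close>
  note FF = Fatou_real[OF I1 _ em en_nonneg lim bnd Bl]
  show "integrable M (en u (vel p))" using FF(1) en_nonneg unfolding w_def by simp
  show "intM (en u (vel p)) \<le> 2 / \<kappa> * C * sqn M v" using FF(2) en_nonneg unfolding w_def by simp
 qed
qed

text \<open>The function is cut off near both ends, its derivative is approximated uniformly by a
  polynomial on the support of the cutoff, and the integrated polynomial times the cutoff is the
  test function. The first error tends to 0 by dominated convergence, the second is made small
  afterwards with the cutoff fixed.\<close>

lemma form_approx:
 assumes cu: "continuous_on I u" and cw: "continuous_on I w"
  and du: "\<And>r. r \<in> I \<Longrightarrow> r \<noteq> 0 \<Longrightarrow> (u has_vector_derivative w r) (at r)"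
  and ie: "integrable M (en u w)" and \<epsilon>: "\<epsilon> > 0"
 shows "\<exists>\<phi>\<in>TF. integrable M (en (\<lambda>r. \<phi> r - u r) (\<lambda>r. d_r \<phi> r - w r)) \<and>
   intM (en (\<lambda>r. \<phi> r - u r) (\<lambda>r. d_r \<phi> r - w r)) \<le> \<epsilon>"
proof -
 obtain \<chi>' C where X: "C \<ge> 0" "\<And>n. continuous_on UNIV (\<chi>' n)" "\<And>n r. (cutoff a n has_real_derivative \<chi>' n r) (at r)"
  "\<And>n r. r > - 1 / a \<Longrightarrow> n > 0 \<Longrightarrow> (\<chi>' n r)^2 \<le> C * (1 / (r + 1 / a)^2 * indicator {..0} r + 1)"
  "\<And>r. r > - 1 / a \<Longrightarrow> eventually (\<lambda>n. cutoff a n r = 1 \<and> \<chi>' n r = 0) sequentially"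
  "\<And>n r. 0 \<le> cutoff a n r \<and> cutoff a n r \<le> 1" by (rule cutoff_properties[OF a]) (rule that)
 have cc: "continuous_on S (cutoff a n)" for S n using X(3) by (meson DERIV_continuous continuous_at_imp_continuous_on)
 have cc': "continuous_on S (\<chi>' n)" for S n by (rule continuous_on_subset[OF X(2)]) simp
 define A where "A = (\<lambda>n r. of_real (cutoff a n r - 1) * u r)"
 define B where "B = (\<lambda>n r. of_real (cutoff a n r - 1) * w r + of_real (\<chi>' n r) * u r)"
 have cA: "continuous_on I (A n)" and cB: "continuous_on I (B n)" for n unfolding A_def B_def by (intro continuous_intros cc cc' cu cw)+
 \<comment> \<open>A domination constant independent of n: the squared derivative of the cutoff is
   at most C (a^2 + 1) times the weight m^2 / f^2 + 1, because m^2 \<ge> 1.\<close>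
 define K0 where "K0 = 3 + 2 * C * (a^2 + 1)"
 have dom: "en (A n) (B n) r \<le> K0 * en u w r" if r: "r \<in> I" and n: "n > 0" for n r
 proof -
  define k where "k = m2 / (f r)^2 + 1"
  define U where "U = (cmod (u r))^2"
  define V where "V = (cmod (w r))^2"
  have k: "k \<ge> 1" by (simp add: k_def)
  have UV: "U \<ge> 0" "V \<ge> 0" by (auto simp: U_def V_def)
  have m1: "m2 \<ge> 1" using m by (simp add: one_le_power)
  have x2: "1 / (r + 1 / a)^2 * indicator {..0} r + 1 \<le> (a^2 + 1) * k"
  proof (cases "r \<le> 0")
   case True
   have "r + 1 / a = f r / a" using True a by (simp add: f1_def field_simps)
   then have "1 / (r + 1 / a)^2 = a^2 * (1 / (f r)^2)" by (simp add: power_divide)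
   also have "\<dots> \<le> a^2 * (m2 / (f r)^2)" using m1 by (intro mult_left_mono divide_right_mono) auto
   also have "\<dots> \<le> a^2 * k" by (intro mult_left_mono) (auto simp: k_def)
   finally have "1 / (r + 1 / a)^2 \<le> a^2 * k" .
   then show ?thesis using True k by (simp add: distrib_right)
  next
   case False
   have "1 * 1 \<le> (a^2 + 1) * k" using k by (intro mult_mono) auto
   then show ?thesis using False by simp
  qed
  have c1: "\<bar>cutoff a n r - 1\<bar> \<le> 1" using X(6)[of n r] by auto
  then have c2: "(cutoff a n r - 1)^2 \<le> 1" by (simp add: abs_square_le_1)
  have ch2: "(\<chi>' n r)^2 \<le> C * ((a^2 + 1) * k)" by (rule order_trans[OF X(4)[OF _ n] mult_left_mono[OF x2 X(1)]]) (use r in auto)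
  have "(cmod (A n r))^2 = (cutoff a n r - 1)^2 * U" unfolding A_def norm_mult norm_of_real power_mult_distrib U_def by simp
  also have "\<dots> \<le> 1 * U" using c2 UV by (intro mult_right_mono)
  finally have "(cmod (A n r))^2 \<le> U" by simp
  then have Ab: "k * (cmod (A n r))^2 \<le> k * U" using k by (intro mult_left_mono) auto
  have "(cmod (B n r))^2 \<le> 2 * (cmod (of_real (cutoff a n r - 1) * w r))^2 + 2 * (cmod (of_real (\<chi>' n r) * u r))^2"
   unfolding B_def by (rule cmod_add_square_le)
  also have "\<dots> = 2 * ((cutoff a n r - 1)^2 * V) + 2 * ((\<chi>' n r)^2 * U)"
   unfolding norm_mult norm_of_real power_mult_distrib U_def V_def by simp
  also have "\<dots> \<le> 2 * (1 * V) + 2 * (C * ((a^2 + 1) * k) * U)" using mult_right_mono[OF c2 UV(2)] mult_right_mono[OF ch2 UV(1)] by linarith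
  finally have Bb: "(cmod (B n r))^2 \<le> 2 * V + 2 * C * (a^2 + 1) * (k * U)" by (simp add: mult_ac)
  have kU: "k * U \<ge> 0" using k UV by simp
  have CV: "0 \<le> 2 * C * (a^2 + 1) * V" using X(1) UV by simp
  have "en (A n) (B n) r \<le> 2 * V + 2 * C * (a^2 + 1) * (k * U) + k * U" using Ab Bb unfolding en_def k_def[symmetric] by linarith
  also have "\<dots> \<le> K0 * (V + k * U)" using kU UV CV by (simp add: K0_def algebra_simps)
  finally show ?thesis unfolding en_def k_def U_def V_def by simp
 qed
 have enm: "en (A n) (B n) \<in> borel_measurable M" for n by (intro en_meas meas_M_cont cA cB)
 have enAB: "integrable M (en (A n) (B n))" if "n > 0" for n
 proof (rule Bochner_Integration.integrable_bound[OF integrable_mult_right[OF ie, of K0] enm])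
  show "AE r in M. norm (en (A n) (B n) r) \<le> norm (K0 * en u w r)"
  proof (rule AE_I2)
   fix r assume "r \<in> space M"
   then show "norm (en (A n) (B n) r) \<le> norm (K0 * en u w r)" using dom[OF _ that, of r] en_nonneg[of "A n" "B n" r] by simp
  qed
 qed
 have l1: "(\<lambda>n. intM (en (A (Suc n)) (B (Suc n)))) \<longlonglongrightarrow> intM (\<lambda>r. 0)"
 proof (rule integral_dominated_convergence[where w = "\<lambda>r. K0 * en u w r"])
  show "integrable M (\<lambda>r. K0 * en u w r)" using ie by simp
  show "AE r in M. (\<lambda>n. en (A (Suc n)) (B (Suc n)) r) \<longlonglongrightarrow> 0"
  proof (rule AE_I2)
   fix r assume "r \<in> space M"
   then have r: "r > - 1 / a" by simp
   have "eventually (\<lambda>n. en (A n) (B n) r = 0) sequentially" using X(5)[OF r] by eventually_elim (simp add: en_def A_def B_def)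
   then have "(\<lambda>n. en (A n) (B n) r) \<longlonglongrightarrow> 0" by (rule tendsto_eventually)
   then show "(\<lambda>n. en (A (Suc n)) (B (Suc n)) r) \<longlonglongrightarrow> 0" by (rule LIMSEQ_Suc)
  qed
  show "AE r in M. norm (en (A (Suc n)) (B (Suc n)) r) \<le> K0 * en u w r" for n
  proof (rule AE_I2)
   fix r assume "r \<in> space M"
   then show "norm (en (A (Suc n)) (B (Suc n)) r) \<le> K0 * en u w r" using dom[of r "Suc n"] en_nonneg[of "A (Suc n)" "B (Suc n)" r] by simp
  qed
 qed (use enm in simp_all)
 then obtain n where n: "n > 0" "intM (en (A n) (B n)) < \<epsilon> / 4"
  using order_tendstoD(2)[OF l1, of "\<epsilon> / 4"] \<epsilon> by (auto simp: eventually_sequentially)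
 define c where "c = - 1 / a + 1 / real n"
 define d where "d = real n + 1"
 have "1 / real n \<le> 1" "- 1 / a < 0" using n(1) a by auto
 then have cd: "- 1 / a < c" "c \<le> d" using n(1) unfolding c_def d_def by (simp, linarith)
 have sub: "{c..d} \<subseteq> I" using cd(1) by auto
 have cz: "cutoff a n r = 0" if "r \<notin> {c..d}" for r
  using cutoff_mult_test_function(2)[OF smooth_alg_const n(1) a] that by (simp add: c_def d_def)
 have cz': "\<chi>' n r = 0" if r: "r \<notin> {c..d}" for r
 proof -
  have op: "open (- {c..d})" by (simp add: open_Compl)
  have "((\<lambda>_. 0) has_real_derivative 0) (at r)" by simp
  then have "(cutoff a n has_real_derivative 0) (at r)" by (rule has_field_derivative_transform_within_open[OF _ op]) (use r cz in auto)
  then show ?thesis using DERIV_unique X(3) by blast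
 qed
 obtain X1 where X1: "\<And>r. r \<in> {c..d} \<Longrightarrow> norm (\<chi>' n r) \<le> X1" "X1 \<ge> 0" using continuous_bounded_Icc[OF cc' cd(1)] by blast
 have "continuous_on I (\<lambda>r. m2 / (f r)^2 + 1)" using f_nz by (intro continuous_intros cont_f) auto
 then obtain K1 where K1: "\<And>r. r \<in> {c..d} \<Longrightarrow> norm (m2 / (f r)^2 + 1) \<le> K1" "K1 \<ge> 0" using continuous_bounded_Icc[OF _ cd(1)] by blast
 \<comment> \<open>Collects the effect of an error \<eta> in the derivative on the support: the
   first two summands come from |F|^2, the last from the weighted |E|^2.\<close>
 define K2 where "K2 = 2 * (X1^2 * (d - c)^2) + 2 + K1 * (d - c)^2"
 have K2: "K2 \<ge> 0" using K1(2) by (simp add: K2_def)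
 define \<mu> where "\<mu> = intM (\<lambda>r. indicator {c..d} r *\<^sub>R (1::real))"
 have \<mu>i: "integrable M (\<lambda>r. indicator {c..d} r *\<^sub>R (1::real))" by (rule compact_integrable(1)[OF cd(1), of _ _ 1]) auto
 have \<mu>: "\<mu> \<ge> 0" unfolding \<mu>_def by (rule integral_nonneg_AE) (auto intro: AE_I2)
 define \<eta> where "\<eta> = sqrt (\<epsilon> / (4 * (K2 * \<mu> + 1)))"
 have K\<mu>: "K2 * \<mu> + 1 > 0" using K2 \<mu> by (simp add: add_nonneg_pos)
 have \<eta>: "\<eta> > 0" "\<eta>^2 * K2 * \<mu> \<le> \<epsilon> / 4"
 proof -
  show "\<eta> > 0" using \<epsilon> K\<mu> by (simp add: \<eta>_def)
  have "\<eta>^2 = \<epsilon> / (4 * (K2 * \<mu> + 1))" using \<epsilon> K\<mu> by (simp add: \<eta>_def)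
  then have "\<eta>^2 * (K2 * \<mu>) = \<epsilon> / 4 * (K2 * \<mu> / (K2 * \<mu> + 1))" by simp
  also have "\<dots> \<le> \<epsilon> / 4 * 1" using \<epsilon> K\<mu> K2 \<mu> by (intro mult_left_mono) auto
  finally show "\<eta>^2 * K2 * \<mu> \<le> \<epsilon> / 4" by (simp add: mult.assoc)
 qed
 obtain g where g: "polynomial_function g" "\<And>r. r \<in> {c..d} \<Longrightarrow> norm (w r - g r) < \<eta>"
  using Stone_Weierstrass_polynomial_function[OF compact_Icc continuous_on_subset[OF cw sub] \<eta>(1)] by blast
 obtain P0 where P0: "polynomial_function P0" "\<And>r. (P0 has_vector_derivative g r) (at r)"
  using polynomial_function_antiderivative[OF g(1)] by blast
 \<comment> \<open>The antiderivative that agrees with \<open>u\<close> at the left end, so that P -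
   u is the integral of g - w.\<close>
 define P where "P = (\<lambda>r. P0 r + (u c - P0 c))"
 have P: "smooth_alg P" unfolding P_def by (intro smooth_alg.add smooth_alg.poly[OF P0(1)] smooth_alg_const)
 have dP: "(P has_vector_derivative g r) (at r)" for r unfolding P_def using has_vector_derivative_add[OF P0(2) has_vector_derivative_const] by simp
 have cP: "continuous_on S P" for S by (rule continuous_at_imp_continuous_on) (use dP has_vector_derivative_continuous in blast)
 have cg: "continuous_on S g" for S using g(1) by (rule continuous_on_polymonial_function)
 have Pu: "cmod (P r - u r) \<le> \<eta> * (d - c)" if r: "r \<in> {c..d}" for r
 proof -
  have hi: "((\<lambda>r. g r - w r) has_integral ((P r - u r) - (P c - u c))) {c..r}"
  proof (rule fundamental_theorem_of_calculus_interior_strong[of "{0}"])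
   show "continuous_on {c..r} (\<lambda>r. P r - u r)" using r cd(1) by (intro continuous_intros cP continuous_on_subset[OF cu]) auto
   show "((\<lambda>r. P r - u r) has_vector_derivative g x - w x) (at x)" if "x \<in> {c<..<r} - {0}" for x
    using that r cd(1) by (intro has_vector_derivative_diff dP du) auto
  qed (use r in auto)
  have "norm ((P r - u r) - (P c - u c)) \<le> \<eta> * measure lborel {c..r}"
  proof (rule has_integral_bound_real[OF _ _ hi])
   show "norm (g x - w x) \<le> \<eta>" if "x \<in> {c..r} - {}" for x using g(2)[of x] that r by (simp add: norm_minus_commute less_imp_le)
  qed (use \<eta> in auto)
  also have "\<dots> \<le> \<eta> * (d - c)" using r \<eta> by (simp add: mult_left_mono)
  finally show ?thesis by (simp add: P_def)
 qed
 define \<phi> where "\<phi> = (\<lambda>r. of_real (cutoff a n r) * P r)"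
 have t: "\<phi> \<in> TF" unfolding \<phi>_def by (rule cutoff_mult_test_function(1)[OF P n(1) a])
 have dc: "((\<lambda>r. of_real (cutoff a n r) :: complex) has_vector_derivative of_real (\<chi>' n r)) (at r)" for r
  using X(3)[of n r] by (intro has_vector_derivative_of_real) (simp only: has_real_derivative_iff_has_vector_derivative)
 have d\<phi>: "d_r \<phi> r = of_real (cutoff a n r) * g r + of_real (\<chi>' n r) * P r" for r
  unfolding \<phi>_def by (rule d_r_eq) (intro has_vector_derivative_mult dc dP)
 define E where "E = (\<lambda>r. of_real (cutoff a n r) * (P r - u r))"
 define F where "F = (\<lambda>r. of_real (cutoff a n r) * (g r - w r) + of_real (\<chi>' n r) * (P r - u r))"
 have cE: "continuous_on I E" and cF: "continuous_on I F" unfolding E_def F_def by (intro continuous_intros cc cc' cP cg cu cw)+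
 have bEF: "en E F r \<le> indicator {c..d} r *\<^sub>R (\<eta>^2 * K2)" for r
 proof (cases "r \<in> {c..d}")
  case True
  define k where "k = m2 / (f r)^2 + 1"
  have k: "k \<ge> 0" "k \<le> K1" using K1(1)[OF True] by (auto simp: k_def)
  have Q: "(cmod (P r - u r))^2 \<le> \<eta>^2 * (d - c)^2" using power_mono[OF Pu[OF True], of 2] by (simp add: power_mult_distrib)
  have c0: "0 \<le> cutoff a n r" "(cutoff a n r)^2 \<le> 1" using X(6)[of n r] by (auto simp: power_le_one)
  have "(cmod (E r))^2 = (cutoff a n r)^2 * (cmod (P r - u r))^2" unfolding E_def norm_mult norm_of_real power_mult_distrib by simp
  also have "\<dots> \<le> 1 * (\<eta>^2 * (d - c)^2)" using c0 Q by (intro mult_mono) auto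
  finally have 1: "k * (cmod (E r))^2 \<le> K1 * (\<eta>^2 * (d - c)^2)" using k K1(2) by (intro mult_mono) auto
  have gw: "(cmod (g r - w r))^2 \<le> \<eta>^2" using g(2)[OF True] by (intro power_mono) (auto simp: norm_minus_commute)
  have x1: "(\<chi>' n r)^2 \<le> X1^2" using X1(1)[OF True] X1(2) by (simp add: abs_le_square_iff[symmetric])
  have "(cmod (F r))^2 \<le> 2 * (cmod (of_real (cutoff a n r) * (g r - w r)))^2 + 2 * (cmod (of_real (\<chi>' n r) * (P r - u r)))^2"
   unfolding F_def by (rule cmod_add_square_le)
  also have "\<dots> = 2 * ((cutoff a n r)^2 * (cmod (g r - w r))^2) + 2 * ((\<chi>' n r)^2 * (cmod (P r - u r))^2)"
   unfolding norm_mult norm_of_real power_mult_distrib by simp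
  also have "\<dots> \<le> 2 * (1 * \<eta>^2) + 2 * (X1^2 * (\<eta>^2 * (d - c)^2))"
   using c0 gw x1 Q by (intro add_mono mult_left_mono mult_mono) auto
  finally have 2: "(cmod (F r))^2 \<le> 2 * (1 * \<eta>^2) + 2 * (X1^2 * (\<eta>^2 * (d - c)^2))" .
  have "en E F r \<le> 2 * (1 * \<eta>^2) + 2 * (X1^2 * (\<eta>^2 * (d - c)^2)) + K1 * (\<eta>^2 * (d - c)^2)"
   using 1 2 unfolding en_def k_def[symmetric] by linarith
  also have "\<dots> = \<eta>^2 * K2" by (simp add: K2_def algebra_simps)
  finally show ?thesis using True by simp
 next
  case False
  then show ?thesis by (simp add: en_def E_def F_def cz cz')
 qed
 have iEF: "integrable M (en E F)" "intM (en E F) \<le> \<epsilon> / 4"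
 proof -
  have i1: "integrable M (\<lambda>r. indicator {c..d} r *\<^sub>R (\<eta>^2 * K2))" using integrable_mult_left[OF \<mu>i, of "\<eta>^2 * K2"] by simp
  show i2: "integrable M (en E F)"
  proof (rule Bochner_Integration.integrable_bound[OF i1 en_meas[OF meas_M_cont[OF cE] meas_M_cont[OF cF]]], rule AE_I2)
   show "norm (en E F r) \<le> norm (indicator {c..d} r *\<^sub>R (\<eta>^2 * K2))" for r using bEF[of r] en_nonneg[of E F r] by simp
  qed
  have "intM (en E F) \<le> intM (\<lambda>r. indicator {c..d} r *\<^sub>R (\<eta>^2 * K2))" by (rule integral_mono[OF i2 i1]) (rule bEF)
  also have "\<dots> = \<mu> * (\<eta>^2 * K2)" unfolding \<mu>_def by simp
  finally show "intM (en E F) \<le> \<epsilon> / 4" using \<eta>(2) by (simp add: mult_ac)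
 qed
 have s1: "(\<lambda>r. \<phi> r - u r) = (\<lambda>r. E r + A n r)" by (rule ext) (simp add: \<phi>_def E_def A_def algebra_simps)
 have s2: "(\<lambda>r. d_r \<phi> r - w r) = (\<lambda>r. F r + B n r)" unfolding d\<phi> by (rule ext) (simp add: F_def B_def algebra_simps)
 have i3: "integrable M (\<lambda>r. 2 * en E F r + 2 * en (A n) (B n) r)" using iEF(1) enAB[OF n(1)] by simp
 have i4: "integrable M (en (\<lambda>r. E r + A n r) (\<lambda>r. F r + B n r))"
 proof (rule Bochner_Integration.integrable_bound[OF i3], rule en_meas)
  show "(\<lambda>r. E r + A n r) \<in> borel_measurable M" "(\<lambda>r. F r + B n r) \<in> borel_measurable M"
   by (intro meas_M_cont continuous_intros cE cF cA cB)+
  show "AE r in M. norm (en (\<lambda>r. E r + A n r) (\<lambda>r. F r + B n r) r) \<le> norm (2 * en E F r + 2 * en (A n) (B n) r)"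
  proof (rule AE_I2)
   show "norm (en (\<lambda>r. E r + A n r) (\<lambda>r. F r + B n r) r) \<le> norm (2 * en E F r + 2 * en (A n) (B n) r)" for r
    using en_add_le[of E "A n" F "B n" r] en_nonneg[of "\<lambda>r. E r + A n r" "\<lambda>r. F r + B n r" r] by simp
  qed
 qed
 have "intM (en (\<lambda>r. E r + A n r) (\<lambda>r. F r + B n r)) \<le> intM (\<lambda>r. 2 * en E F r + 2 * en (A n) (B n) r)"
  by (rule integral_mono[OF i4 i3]) (rule en_add_le)
 also have "\<dots> = 2 * intM (en E F) + 2 * intM (en (A n) (B n))" using iEF(1) enAB[OF n(1)] by simp
 also have "\<dots> \<le> \<epsilon>" using iEF(2) n(2) by linarith
 finally show ?thesis using t i4 by (intro bexI[of _ \<phi>]) (simp_all add: s1 s2)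
qed

lemma AE_M:
 assumes "AE r in lborel. P r"
 shows "AE r in M. P r"
proof -
 have "AE r in L. P r" using assms by (subst AE_restrict_space_iff) auto
 moreover have "(\<lambda>r. ennreal (f r)) \<in> borel_measurable L" by (rule measurable_restrict_space1) simp
 ultimately show ?thesis unfolding radial_measure_def by (subst AE_density) auto
qed

text \<open>Truncate in size and in space, write the truncation as an almost everywhere limit of
  continuous functions, then clip and cut these off so that dominated convergence applies.\<close>

lemma density_Cc:
 assumes v: "v \<in> L2" and \<epsilon>: "\<epsilon> > 0"
 shows "\<exists>v' c d. continuous_on UNIV v' \<and> - 1 / a < c \<and> c \<le> d \<and> (\<forall>r. r \<notin> {c..d} \<longrightarrow> v' r = 0) \<and>
   v' \<in> L2 \<and> sqn M (\<lambda>r. v' r - v r) < \<epsilon>"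
proof -
 note vm = L2_spaceD(1)[OF v] and vi = L2_spaceD(2)[OF v]
 define S where "S = (\<lambda>n. {- 1 / a + 1 / (real n + 1)..real n + 1})"
 define T where "T = (\<lambda>n r. if cmod (v r) \<le> real n \<and> r \<in> S n then v r else 0)"
 have Sm: "(\<lambda>r. indicator (S n) r :: real) \<in> borel_measurable M" for n unfolding S_def by (rule meas_M_borel) simp
 have Teq: "T n = (\<lambda>r. if cmod (v r) \<le> real n then indicator (S n) r *\<^sub>R v r else 0)" for n by (auto simp: T_def fun_eq_iff)
 have Tm: "T n \<in> borel_measurable M" for n unfolding Teq using vm Sm by measurable
 have "(\<lambda>n. intM (\<lambda>r. (cmod (T n r - v r))^2)) \<longlonglongrightarrow> intM (\<lambda>r. 0)"
 proof (rule integral_dominated_convergence[where w = "\<lambda>r. (cmod (v r))^2"])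
  show "(\<lambda>r. (cmod (T n r - v r))^2) \<in> borel_measurable M" for n using Tm vm by measurable
  show "AE r in M. (\<lambda>n. (cmod (T n r - v r))^2) \<longlonglongrightarrow> 0"
  proof (rule AE_I2)
   fix r assume r: "r \<in> space M"
   obtain N :: nat where N: "cmod (v r) \<le> real N" using real_arch_simple by blast
   have "eventually (\<lambda>n. cmod (v r) \<le> real n) sequentially" by (rule eventually_sequentiallyI[of N]) (use N in auto)
   moreover have "eventually (\<lambda>n. r \<in> S n) sequentially" unfolding S_def using exhaustion r by simp
   ultimately have "eventually (\<lambda>n. (cmod (T n r - v r))^2 = 0) sequentially" by eventually_elim (simp add: T_def)
   then show "(\<lambda>n. (cmod (T n r - v r))^2) \<longlonglongrightarrow> 0" by (rule tendsto_eventually)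
  qed
  show "AE r in M. norm ((cmod (T n r - v r))^2) \<le> (cmod (v r))^2" for n by (rule AE_I2) (simp add: T_def)
 qed (use vi in auto)
 then have "eventually (\<lambda>n. intM (\<lambda>r. (cmod (T n r - v r))^2) < \<epsilon> / 4) sequentially"
  using \<epsilon> by (intro order_tendstoD(2)) auto
 then obtain n where n: "sqn M (\<lambda>r. T n r - v r) < \<epsilon> / 4" "n \<ge> 1"
  unfolding sqn_def eventually_sequentially by (metis le_add1 le_add2)
 define V where "V = (\<lambda>r. indicator I r *\<^sub>R T n r)"
 have "V \<in> borel_measurable lborel" unfolding V_def using Tm[of n] unfolding meas_M by (subst (asm) borel_measurable_restrict_space_iff) auto
 then have "V \<in> borel_measurable lebesgue" by (rule measurable_completion)
 then have "V measurable_on UNIV" by (subst measurable_on_iff_borel_measurable) auto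
 then obtain N g where N: "negligible N" "\<And>k. continuous_on UNIV (g k)" "\<And>r. r \<notin> N \<Longrightarrow> (\<lambda>k. g k r) \<longlonglongrightarrow> V r"
  unfolding measurable_on_def by auto
 have "AE r in lebesgue. r \<notin> N" using N(1) unfolding negligible_iff_null_sets by (rule AE_not_in)
 then have AN: "AE r in M. r \<notin> N" by (intro AE_M) (simp add: AE_completion_iff)
 \<comment> \<open>Radial projection onto the disc of radius n: it bounds the continuous
   approximants and fixes the values of \<open>T n\<close>.\<close>
 define clip where "clip = (\<lambda>w::complex. of_real (real n / max (real n) (cmod w)) * w)"
 have cclip: "continuous_on UNIV clip" unfolding clip_def using n(2) by (intro continuous_intros) (auto simp: max_def)
 have clip_b: "cmod (clip w) \<le> real n" for w
 proof -
  have "cmod (clip w) = real n * (cmod w / max (real n) (cmod w))" unfolding clip_def norm_mult norm_of_real using n(2) by simp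
  also have "\<dots> \<le> real n * 1" using n(2) by (intro mult_left_mono) (auto simp: max_def divide_le_eq)
  finally show ?thesis by simp
 qed
 have clip_id: "clip w = w" if "cmod w \<le> real n" for w using that n(2) by (simp add: clip_def max_def)
 \<comment> \<open>Makes the cutoff equal to 1 on \<open>S n\<close>, which stays at distance 1 / (n
   + 1) = 2 / q from the tip.\<close>
 define q where "q = 2 * (n + 1)"
 define c where "c = - 1 / a + 1 / real q"
 define d where "d = real q + 1"
 have q: "q > 0" by (simp add: q_def)
 have "1 / real q \<le> 1" "- 1 / a < 0" using q a by auto
 then have cd: "- 1 / a < c" "c \<le> d" using q unfolding c_def d_def by (simp, linarith)
 have cz: "cutoff a q r = 0" if "r \<notin> {c..d}" for r using cutoff_mult_test_function(2)[OF smooth_alg_const q a] that by (simp add: c_def d_def)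
 have c01: "0 \<le> cutoff a q r" "cutoff a q r \<le> 1" for r using smooth_step_values(3,4) by (auto simp: cutoff_def mult_le_one)
 have c1: "cutoff a q r = 1" if "r \<in> S n" for r
 proof -
  have "1 / (real n + 1) \<le> r + 1 / a" "r \<le> real n + 1" using that by (auto simp: S_def)
  then have "real q * (1 / (real n + 1)) \<le> real q * (r + 1 / a)" by (intro mult_left_mono) auto
  moreover have "real q * (1 / (real n + 1)) = 2" by (simp add: q_def field_simps)
  ultimately show ?thesis using \<open>r \<le> real n + 1\<close> by (simp add: cutoff_def smooth_step_values q_def)
 qed
 have cc: "continuous_on UNIV (cutoff a q)" using cutoff_properties[OF a] by (metis DERIV_continuous continuous_at_imp_continuous_on)
 define H where "H = (\<lambda>k r. of_real (cutoff a q r) * clip (g k r))"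
 have cH: "continuous_on UNIV (H k)" for k unfolding H_def by (intro continuous_intros cc continuous_on_compose2[OF cclip N(2)]) auto
 have Hz: "H k r = 0" if "r \<notin> {c..d}" for k r using cz[OF that] by (simp add: H_def)
 have Hb: "cmod (H k r) \<le> real n" for k r
 proof -
  have "cmod (H k r) = cutoff a q r * cmod (clip (g k r))" unfolding H_def norm_mult norm_of_real using c01 by simp
  also have "\<dots> \<le> 1 * real n" using c01 clip_b by (intro mult_mono) auto
  finally show ?thesis by simp
 qed
 have Hm: "H k \<in> borel_measurable M" for k by (rule meas_M_borel) (rule borel_measurable_continuous_onI[OF cH])
 have HL: "H k \<in> L2" for k by (rule compact_L2[OF cd(1) Hm Hb Hz])
 have TS: "T n r = 0" if "r \<notin> {c..d}" for r using c1[of r] cz[OF that] by (auto simp: T_def)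
 have Tb: "cmod (T n r) \<le> real n" for r by (simp add: T_def)
 have TL: "T n \<in> L2" by (rule compact_L2[OF cd(1) Tm Tb TS])
 have "(\<lambda>k. intM (\<lambda>r. (cmod (H k r - T n r))^2)) \<longlonglongrightarrow> intM (\<lambda>r. 0)"
 proof (rule integral_dominated_convergence[where w = "\<lambda>r. indicator {c..d} r *\<^sub>R (2 * real n)^2"])
  show "(\<lambda>r. (cmod (H k r - T n r))^2) \<in> borel_measurable M" for k using Tm Hm by measurable
  show "integrable M (\<lambda>r. indicator {c..d} r *\<^sub>R (2 * real n)^2)"
   by (rule compact_integrable(1)[OF cd(1), where B = "(2 * real n)^2"]) auto
  show "AE r in M. (\<lambda>k. (cmod (H k r - T n r))^2) \<longlonglongrightarrow> 0" using AN AE_space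
  proof eventually_elim
   fix r assume r: "r \<notin> N" "r \<in> space M"
   have "(\<lambda>k. clip (g k r)) \<longlonglongrightarrow> clip (V r)" using continuous_on_tendsto_compose[OF cclip N(3)[OF r(1)]] by simp
   then have "(\<lambda>k. H k r) \<longlonglongrightarrow> of_real (cutoff a q r) * clip (V r)" unfolding H_def by (intro tendsto_mult tendsto_const)
   also have "V r = T n r" using r(2) by (simp add: V_def)
   also have "clip (T n r) = T n r" by (rule clip_id[OF Tb])
   also have "of_real (cutoff a q r) * T n r = T n r" using c1[of r] by (auto simp: T_def)
   finally have "(\<lambda>k. (cmod (H k r - T n r))^2) \<longlonglongrightarrow> (cmod (T n r - T n r))^2" by (intro tendsto_intros)
   then show "(\<lambda>k. (cmod (H k r - T n r))^2) \<longlonglongrightarrow> 0" by simp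
  qed
  show "AE r in M. norm ((cmod (H k r - T n r))^2) \<le> indicator {c..d} r *\<^sub>R (2 * real n)^2" for k
  proof (rule AE_I2)
   fix r
   have "cmod (H k r - T n r) \<le> 2 * real n" using norm_triangle_ineq4[of "H k r" "T n r"] Hb[of k r] Tb[of r] by linarith
   then have "(cmod (H k r - T n r))^2 \<le> (2 * real n)^2" by (intro power_mono) auto
   then show "norm ((cmod (H k r - T n r))^2) \<le> indicator {c..d} r *\<^sub>R (2 * real n)^2"
    using Hz[of r k] TS[of r] by (cases "r \<in> {c..d}") auto
  qed
 qed auto
 then have "eventually (\<lambda>k. sqn M (\<lambda>r. H k r - T n r) < \<epsilon> / 4) sequentially"
  unfolding sqn_def using \<epsilon> by (intro order_tendstoD(2)) auto
 then obtain k where k: "sqn M (\<lambda>r. H k r - T n r) < \<epsilon> / 4" by (auto simp: eventually_sequentially)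
 have "sqn M (\<lambda>r. (H k r - T n r) - (v r - T n r)) \<le> 2 * sqn M (\<lambda>r. H k r - T n r) + 2 * sqn M (\<lambda>r. v r - T n r)"
  by (rule sqn_diff_le[OF L2_space_diff[OF HL TL] L2_space_diff[OF v TL]])
 moreover have "sqn M (\<lambda>r. v r - T n r) = sqn M (\<lambda>r. T n r - v r)" by (simp add: sqn_def norm_minus_commute)
 moreover have "(\<lambda>r. (H k r - T n r) - (v r - T n r)) = (\<lambda>r. H k r - v r)" by (simp add: algebra_simps)
 ultimately have "sqn M (\<lambda>r. H k r - v r) < \<epsilon>" using k n(1) by simp
 then show ?thesis using cH[of k] cd Hz HL by (intro exI[of _ "H k"] exI[of _ c] exI[of _ d]) auto
qed

end

context radial
begin

section \<open>Construction and uniqueness of the resolvent kernel\<close>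

lemma nonneg_I: "0 \<le> r \<Longrightarrow> r \<in> I"
proof -
 assume r: "0 \<le> r"
 have "- 1 / a < 0" using a by simp
 then show "r \<in> I" using r unfolding greaterThan_iff by linarith
qed

text \<open>The density \<open>f\<close> is positive on \<open>I\<close>, so no interval in
  \<open>I\<close> is a null set.\<close>

lemma AE_M_interval:
 assumes P: "AE r in M. P r" and cd: "- 1 / a \<le> c" "c < d"
 shows "\<exists>r\<in>{c<..<d}. P r"
proof (rule ccontr)
 assume np: "\<not> (\<exists>r\<in>{c<..<d}. P r)"
 have fm: "(\<lambda>r. ennreal (f r)) \<in> borel_measurable L" by (rule measurable_restrict_space1) simp
 have "AE r in L. 0 < ennreal (f r) \<longrightarrow> P r" using P unfolding radial_measure_def by (subst (asm) AE_density[OF fm])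
 then have "AE r in lborel. r \<in> I \<longrightarrow> 0 < ennreal (f r) \<longrightarrow> P r" by (subst (asm) AE_restrict_space_iff) auto
 then have "AE r in lborel. r \<notin> {c<..<d}"
 proof eventually_elim
  fix r assume h: "r \<in> I \<longrightarrow> 0 < ennreal (f r) \<longrightarrow> P r"
  show "r \<notin> {c<..<d}"
  proof
   assume r: "r \<in> {c<..<d}"
   then have "r \<in> I" using cd by auto
   then have "P r" using h f_pos by (simp add: ennreal_less_zero_iff)
   then show False using np r by blast
  qed
 qed
 then have "emeasure lborel {c<..<d} = 0" by (subst (asm) AE_iff_measurable[where N = "{c<..<d}"]) auto
 then show False using cd by simp
qed

lemma continuous_AE_zero:
 assumes u: "continuous_on I u" and z: "AE r in M. u r = (0::complex)" and r: "r \<in> I"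
 shows "u r = 0"
proof (rule ccontr)
 assume n: "u r \<noteq> 0"
 have "open (I \<inter> u -` (- {0}))" by (rule continuous_open_preimage[OF u]) auto
 moreover have "r \<in> I \<inter> u -` (- {0})" using n r by simp
 ultimately obtain e where e: "e > 0" "ball r e \<subseteq> I \<inter> u -` (- {0})" by (meson open_contains_ball)
 have "{max (- 1 / a) (r - e)<..<r + e} \<subseteq> ball r e" by (auto simp: dist_real_def)
 moreover obtain s where "s \<in> {max (- 1 / a) (r - e)<..<r + e}" "u s = 0"
  using AE_M_interval[OF z, of "max (- 1 / a) (r - e)" "r + e"] e(1) r by fastforce
 ultimately show False using e(2) by blast
qed

text \<open>The base point \<open>c0\<close> will lie to the left of the support of
  \<open>g\<close>. For r < c0 the interval is empty and the integral 0, so this is a primitive of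
  \<open>g\<close> on all of \<open>I\<close>.\<close>

definition J :: "real \<Rightarrow> (real \<Rightarrow> complex) \<Rightarrow> real \<Rightarrow> complex" where
 "J c0 g r = integral {c0..r} g"

lemma J_deriv:
 assumes g: "continuous_on I g" and z: "\<And>s. s \<in> I \<Longrightarrow> s < c \<Longrightarrow> g s = 0" and c: "- 1 / a < c0" "c0 < c" and r: "r \<in> I"
 shows "(J c0 g has_vector_derivative g r) (at r)"
proof (cases "r < c")
 case True
 have J0: "J c0 g s = 0" if "s < c" for s unfolding J_def using c z that by (intro integral_unique has_integral_is_0) auto
 have "((\<lambda>_. 0::complex) has_vector_derivative 0) (at r)" by simp
 then have "(J c0 g has_vector_derivative 0) (at r)" by (rule has_vector_derivative_transform_within_open[where S = "{..<c}"]) (use True J0 in auto)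
 then show ?thesis using z[OF r True] by simp
next
 case False
 have "continuous_on {c0..r + 1} g" using c by (intro continuous_on_subset[OF g]) auto
 then have "((\<lambda>u. integral {c0..u} g) has_vector_derivative g r) (at r within {c0..r + 1})"
  using False c by (intro integral_has_vector_derivative) auto
 moreover have "at r within {c0..r + 1} = at r" using False c by (intro at_within_interior) auto
 ultimately show ?thesis by (simp add: J_def[abs_def])
qed

lemma J_split:
 assumes g: "continuous_on I g" and z: "\<And>s. s \<in> I \<Longrightarrow> s \<notin> {c..d} \<Longrightarrow> g s = 0"
  and c: "- 1 / a < c0" "c0 < c" "c \<le> d" and r: "r \<in> I"
 shows "integral {min c0 r..r} g = J c0 g r" (is ?A) "integral {r..max d r} g = J c0 g d - J c0 g r" (is ?B)
  "d \<le> r \<Longrightarrow> J c0 g r = J c0 g d" "r < c \<Longrightarrow> J c0 g r = 0"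
proof -
 have io: "g integrable_on {x..y}" if "x \<in> I" for x y using that by (intro integrable_continuous_real continuous_on_subset[OF g]) auto
 have zero: "integral {x..y} g = 0" if "x \<in> I" "y \<le> c0 \<or> y < c \<or> x \<ge> d" for x y
 proof (cases "x \<ge> d")
  case False
  then show ?thesis using that c z by (intro integral_unique has_integral_is_0) auto
 next
  case True
  have "integral {x..y} g = integral {x..y} (\<lambda>_. 0)" by (rule integral_spike[of "{d}"]) (use True that c z in auto)
  then show ?thesis by simp
 qed
 show ?A by (cases "r < c0") (auto simp: J_def min_def zero r)
 have dd: "J c0 g y = J c0 g d" if "d \<le> y" for y
 proof -
  have "integral {c0..d} g + integral {d..y} g = integral {c0..y} g" using c that by (intro Henstock_Kurzweil_Integration.integral_combine io) auto
  then show ?thesis using zero[of d y] c by (simp add: J_def)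
 qed
 then show "d \<le> r \<Longrightarrow> J c0 g r = J c0 g d" .
 show "r < c \<Longrightarrow> J c0 g r = 0" unfolding J_def using zero[of c0 r] c by auto
 show ?B
 proof (cases "r < c0")
  case True
  have "integral {r..c0} g + integral {c0..d} g = integral {r..d} g" using c True r by (intro Henstock_Kurzweil_Integration.integral_combine io) auto
  then show ?thesis using True c zero[of r c0] r by (simp add: J_def max_def)
 next
  case False
  have "integral {c0..r} g + integral {r..max d r} g = integral {c0..max d r} g"
   using False r c by (intro Henstock_Kurzweil_Integration.integral_combine io) auto
  then show ?thesis using dd[of "max d r"] by (simp add: J_def algebra_simps)
 qed
qed

text \<open>Formed with f times the derivatives, which makes it constant in r for two solutions of
  the homogeneous system.\<close>

definition wronskian :: "(real \<Rightarrow> complex) \<Rightarrow> (real \<Rightarrow> complex) \<Rightarrow> (real \<Rightarrow> complex) \<Rightarrow> (real \<Rightarrow> complex) \<Rightarrow> real \<Rightarrow> complex" where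
 "wronskian \<phi> p\<phi> \<psi> p\<psi> r = p\<phi> r * \<psi> r - \<phi> r * p\<psi> r"

lemma wronskian_const:
 assumes s1: "system z (\<lambda>_. 0) \<phi> p\<phi>" and s2: "system z (\<lambda>_. 0) \<psi> p\<psi>" and r: "r \<in> I" "s \<in> I"
 shows "wronskian \<phi> p\<phi> \<psi> p\<psi> r = wronskian \<phi> p\<phi> \<psi> p\<psi> s"
proof -
 have *: "wronskian \<phi> p\<phi> \<psi> p\<psi> r = wronskian \<phi> p\<phi> \<psi> p\<psi> s" if rs: "r \<in> I" "r \<le> s" for r s
 proof -
  have c: "continuous_on {r..s} \<phi>" "continuous_on {r..s} p\<phi>" "continuous_on {r..s} \<psi>" "continuous_on {r..s} p\<psi>"
   using s1 s2 rs unfolding system_def by (auto intro: continuous_on_subset)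
  define D where "D = wronskian \<phi> p\<phi> \<psi> p\<psi> s - wronskian \<phi> p\<phi> \<psi> p\<psi> r"
  have hi: "((\<lambda>_. 0::complex) has_integral D) {r..s}" unfolding D_def
  proof (rule fundamental_theorem_of_calculus_interior_strong[of "{0}"])
   show "continuous_on {r..s} (wronskian \<phi> p\<phi> \<psi> p\<psi>)" unfolding wronskian_def[abs_def] by (intro continuous_intros c)
   fix x assume x: "x \<in> {r<..<s} - {0}"
   then have xI: "x \<in> I" "x \<noteq> 0" using rs by auto
   define k where "k = pot z x"
   have d: "(\<phi> has_vector_derivative p\<phi> x / of_real (f x)) (at x)" "(p\<phi> has_vector_derivative k * \<phi> x) (at x)"
    "(\<psi> has_vector_derivative p\<psi> x / of_real (f x)) (at x)" "(p\<psi> has_vector_derivative k * \<psi> x) (at x)"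
    using s1 s2 xI unfolding system_def k_def by auto
   have "(wronskian \<phi> p\<phi> \<psi> p\<psi> has_vector_derivative (p\<phi> x * (p\<psi> x / of_real (f x)) + k * \<phi> x * \<psi> x) - (\<phi> x * (k * \<psi> x) + p\<phi> x / of_real (f x) * p\<psi> x)) (at x)"
    unfolding wronskian_def[abs_def] by (intro has_vector_derivative_diff has_vector_derivative_mult d)
   moreover have "(p\<phi> x * (p\<psi> x / of_real (f x)) + k * \<phi> x * \<psi> x) - (\<phi> x * (k * \<psi> x) + p\<phi> x / of_real (f x) * p\<psi> x) = 0"
    by (simp add: mult_ac)
   ultimately show "(wronskian \<phi> p\<phi> \<psi> p\<psi> has_vector_derivative 0) (at x)" by simp
  qed (use rs in auto)
  have "D = 0" by (rule has_integral_unique[OF hi has_integral_0])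
  then show ?thesis by (simp only: D_def right_minus_eq)
 qed
 show ?thesis
 proof (cases "r \<le> s")
  case True then show ?thesis by (rule *[OF r(1)])
 next
  case False
  then have "s \<le> r" by simp
  from *[OF r(2) this] show ?thesis by (rule sym)
 qed
qed

text \<open>Solutions found separately on the cone and on the funnel may be joined at 0 once u and f
  u' agree there; a jump of f' does no harm.\<close>

lemma system_glue:
 assumes c: "continuous_on I u1" "continuous_on I p1" "continuous_on I u2" "continuous_on I p2"
  and e: "u1 0 = u2 0" "p1 0 = p2 0"
  and d1: "\<And>r. r \<in> I \<Longrightarrow> r < 0 \<Longrightarrow> (u1 has_vector_derivative p1 r / of_real (f r)) (at r) \<and>
   (p1 has_vector_derivative pot z r * u1 r) (at r)"
  and d2: "\<And>r. r \<in> I \<Longrightarrow> r > 0 \<Longrightarrow> (u2 has_vector_derivative p2 r / of_real (f r)) (at r) \<and>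
   (p2 has_vector_derivative pot z r * u2 r) (at r)"
 shows "system z (\<lambda>_. 0) (\<lambda>r. if r \<le> 0 then u1 r else u2 r) (\<lambda>r. if r \<le> 0 then p1 r else p2 r)"
proof -
 have cont_if: "continuous_on I (\<lambda>r. if r \<le> 0 then g r else h r)"
  if "continuous_on I g" "continuous_on I h" "g 0 = h 0" for g h :: "real \<Rightarrow> complex"
 proof -
  have I: "I = {- 1 / a<..0} \<union> {0..}"
  proof (intro equalityI subsetI)
   show "x \<in> {- 1 / a<..0} \<union> {0..}" if "x \<in> I" for x using that by (cases "x \<le> 0") auto
   show "x \<in> I" if "x \<in> {- 1 / a<..0} \<union> {0..}" for x using that nonneg_I[of x] by auto
  qed
  have "continuous_on ({- 1 / a<..0} \<union> {0..}) (\<lambda>r. if r \<le> 0 then g r else h r)"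
  proof (rule continuous_on_cases_local)
   show "closedin (top_of_set ({- 1 / a<..0} \<union> {0..})) {- 1 / a<..0}"
    unfolding I[symmetric] closedin_closed by (rule exI[of _ "{..0}"]) (auto simp: nonneg_I)
   show "closedin (top_of_set ({- 1 / a<..0} \<union> {0..})) {0..}"
    unfolding I[symmetric] closedin_closed by (rule exI[of _ "{0..}"]) (use nonneg_I in auto)
   show "continuous_on {- 1 / a<..0} g" by (rule continuous_on_subset[OF that(1)]) auto
   show "continuous_on {0..} h" by (rule continuous_on_subset[OF that(2)]) (use nonneg_I in auto)
  qed (use that in auto)
  then show ?thesis using I by simp
 qed
 have der: "((\<lambda>r. if r \<le> 0 then g r else h r) has_vector_derivative (if r \<le> 0 then D1 else D2)) (at r)"
  if "r \<noteq> 0" "r < 0 \<Longrightarrow> (g has_vector_derivative D1) (at r)" "r > 0 \<Longrightarrow> (h has_vector_derivative D2) (at r)"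
  for g h :: "real \<Rightarrow> complex" and r D1 D2
 proof (cases "r < 0")
  case True
  show ?thesis by (rule has_vector_derivative_transform_within_open[where f = g and S = "{..<0}"]) (use True that(2) in simp_all)
 next
  case False
  then have pos: "r > 0" using that(1) by simp
  have "((\<lambda>r. if r \<le> 0 then g r else h r) has_vector_derivative D2) (at r)"
   by (rule has_vector_derivative_transform_within_open[OF that(3)[OF pos], where S = "{0<..}"]) (use pos in simp_all)
  then show ?thesis using pos by simp
 qed
 show ?thesis unfolding system_def
 proof (intro conjI ballI impI cont_if c e)
  fix r assume r: "r \<in> I" "r \<noteq> 0"
  show "((\<lambda>r. if r \<le> 0 then u1 r else u2 r) has_vector_derivative (if r \<le> 0 then p1 r else p2 r) / of_real (f r)) (at r)"
   unfolding if_distrib[of "\<lambda>x. x / of_real (f r)"] by (rule der) (use r d1 d2 in auto)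
  show "((\<lambda>r. if r \<le> 0 then p1 r else p2 r) has_vector_derivative
    pot z r * (if r \<le> 0 then u1 r else u2 r) - of_real (f r) * 0) (at r)"
   unfolding mult_zero_right diff_zero if_distrib[of "\<lambda>x. pot z r * x"] by (rule der) (use r d1 d2 in auto)
 qed
qed

end

section \<open>Green's kernel for z in the upper half-plane\<close>

locale resolvent = radial +
 fixes z :: complex and \<phi> p\<phi> \<psi> p\<psi> :: "real \<Rightarrow> complex"
 assumes z: "Im z > 0"
  and s\<phi>: "system z (\<lambda>_. 0) \<phi> p\<phi>" and s\<psi>: "system z (\<lambda>_. 0) \<psi> p\<psi>"
  and b\<phi>: "((\<lambda>r. p\<phi> r * cnj (\<phi> r)) \<longlongrightarrow> 0) (at_right (- 1 / a))"
  and b\<psi>: "((\<lambda>r. p\<psi> r * cnj (\<psi> r)) \<longlongrightarrow> 0) at_top"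
  and L\<phi>: "(\<lambda>r. indicator {..0} r * \<phi> r) \<in> L2" and L\<psi>: "(\<lambda>r. indicator {0..} r * \<psi> r) \<in> L2"
  and n\<phi>: "\<exists>r\<in>I. r < 0 \<and> \<phi> r \<noteq> 0" and n\<psi>: "\<exists>r>0. \<psi> r \<noteq> 0"
begin

abbreviation W :: complex where "W \<equiv> wronskian \<phi> p\<phi> \<psi> p\<psi> 0"

lemma cont: "continuous_on I \<phi>" "continuous_on I p\<phi>" "continuous_on I \<psi>" "continuous_on I p\<psi>"
 using s\<phi> s\<psi> by (auto simp: system_def)

lemma zero_I: "0 \<in> I" using a by simp

lemma W_eq: "r \<in> I \<Longrightarrow> p\<phi> r * \<psi> r - \<phi> r * p\<psi> r = W"
 using wronskian_const[OF s\<phi> s\<psi> _ zero_I, of r] by (simp add: wronskian_def)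

text \<open>Were it 0, multiples of the two recessive solutions would join at 0 to one homogeneous
  solution whose boundary terms vanish at both ends. The energy estimate with right side 0 makes
  this solution vanish, so both multipliers are 0.\<close>

lemma W_nonzero: "W \<noteq> 0"
proof
 assume "W = 0"
 then have w: "p\<phi> 0 * \<psi> 0 = \<phi> 0 * p\<psi> 0" by (simp add: wronskian_def)
 \<comment> \<open>The Cauchy data at 0 are linearly dependent; the cases find coefficients that are
   not both 0.\<close>
 obtain \<alpha> \<beta> where ab: "\<alpha> * \<phi> 0 = \<beta> * \<psi> 0" "\<alpha> * p\<phi> 0 = \<beta> * p\<psi> 0" "\<alpha> \<noteq> 0 \<or> \<beta> \<noteq> 0"
 proof (cases "\<psi> 0 = 0 \<and> p\<psi> 0 = 0")
  case True then show ?thesis using that[of 0 1] by auto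
 next
  case False
  show ?thesis
  proof (cases "\<psi> 0 = 0")
   case True
   then have p: "p\<psi> 0 \<noteq> 0" using False by auto
   then show ?thesis using that[of "p\<psi> 0" "p\<phi> 0"] w True by (auto simp: mult.commute)
  next
   case False
   then show ?thesis using that[of "\<psi> 0" "\<phi> 0"] w by (auto simp: mult.commute)
  qed
 qed
 define u where "u = (\<lambda>r. if r \<le> 0 then \<alpha> * \<phi> r else \<beta> * \<psi> r)"
 define p where "p = (\<lambda>r. if r \<le> 0 then \<alpha> * p\<phi> r else \<beta> * p\<psi> r)"
 have sys: "system z (\<lambda>_. 0) u p" unfolding u_def p_def
 proof (rule system_glue)
  show "(\<lambda>r. \<alpha> * \<phi> r) 0 = (\<lambda>r. \<beta> * \<psi> r) 0" "(\<lambda>r. \<alpha> * p\<phi> r) 0 = (\<lambda>r. \<beta> * p\<psi> r) 0" using ab by simp_all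
  fix r assume r: "r \<in> I"
  define k where "k = pot z r"
  have d: "(\<phi> has_vector_derivative p\<phi> r / of_real (f r)) (at r)" "(p\<phi> has_vector_derivative k * \<phi> r) (at r)"
   "(\<psi> has_vector_derivative p\<psi> r / of_real (f r)) (at r)" "(p\<psi> has_vector_derivative k * \<psi> r) (at r)" if "r \<noteq> 0"
   using s\<phi> s\<psi> r that unfolding system_def k_def by auto
  have "((\<lambda>r. \<alpha> * \<phi> r) has_vector_derivative \<alpha> * (p\<phi> r / of_real (f r))) (at r)"
    "((\<lambda>r. \<alpha> * p\<phi> r) has_vector_derivative \<alpha> * (k * \<phi> r)) (at r)"
    "((\<lambda>r. \<beta> * \<psi> r) has_vector_derivative \<beta> * (p\<psi> r / of_real (f r))) (at r)"
    "((\<lambda>r. \<beta> * p\<psi> r) has_vector_derivative \<beta> * (k * \<psi> r)) (at r)" if "r \<noteq> 0"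
   by (intro has_vector_derivative_mult_right d that)+
  note d' = this[unfolded k_def]
  show "((\<lambda>r. \<alpha> * \<phi> r) has_vector_derivative \<alpha> * p\<phi> r / of_real (f r)) (at r) \<and>
   ((\<lambda>r. \<alpha> * p\<phi> r) has_vector_derivative pot z r * (\<alpha> * \<phi> r)) (at r)" if "r < 0"
   using d'(1,2) that by (simp add: mult_ac)
  show "((\<lambda>r. \<beta> * \<psi> r) has_vector_derivative \<beta> * p\<psi> r / of_real (f r)) (at r) \<and>
   ((\<lambda>r. \<beta> * p\<psi> r) has_vector_derivative pot z r * (\<beta> * \<psi> r)) (at r)" if "r > 0"
   using d'(3,4) that by (simp add: mult_ac)
 qed (intro continuous_intros cont)+
 then have cu: "continuous_on I u" "continuous_on I p" by (simp_all add: system_def)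
 have l1: "((\<lambda>r. p r * cnj (u r)) \<longlongrightarrow> 0) (at_right (- 1 / a))"
 proof -
  have "((\<lambda>r. (\<alpha> * cnj \<alpha>) * (p\<phi> r * cnj (\<phi> r))) \<longlongrightarrow> 0) (at_right (- 1 / a))" by (rule tendsto_mult_right_zero[OF b\<phi>])
  moreover have "eventually (\<lambda>r. (\<alpha> * cnj \<alpha>) * (p\<phi> r * cnj (\<phi> r)) = p r * cnj (u r)) (at_right (- 1 / a))"
   using eventually_at_right_less[of "- 1 / a"] eventually_at_right_field[of "\<lambda>r. r < 0" "- 1 / a"] a
   by (auto simp: eventually_at_right_field u_def p_def intro!: exI[of _ 0])
  ultimately show ?thesis by (rule Lim_transform_eventually)
 qed
 have l2: "((\<lambda>r. p r * cnj (u r)) \<longlongrightarrow> 0) at_top"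
 proof -
  have "((\<lambda>r. (\<beta> * cnj \<beta>) * (p\<psi> r * cnj (\<psi> r))) \<longlongrightarrow> 0) at_top" by (rule tendsto_mult_right_zero[OF b\<psi>])
  moreover have "eventually (\<lambda>r. (\<beta> * cnj \<beta>) * (p\<psi> r * cnj (\<psi> r)) = p r * cnj (u r)) at_top"
   using eventually_gt_at_top[of 0] by eventually_elim (simp add: u_def p_def)
  ultimately show ?thesis by (rule Lim_transform_eventually)
 qed
 define w where "w = (vel p)"
 obtain K where K: "\<forall>v u p. continuous_on I v \<and> v \<in> L2 \<and> system z v u p \<and>
   ((\<lambda>r. p r * cnj (u r)) \<longlongrightarrow> 0) (at_right (- 1 / a)) \<and> ((\<lambda>r. p r * cnj (u r)) \<longlongrightarrow> 0) at_top \<longrightarrow>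
   integrable M (en u (vel p)) \<and> intM (en u (vel p)) \<le> K * sqn M v" using energy_estimate[OF z] by blast
 have L0: "(\<lambda>_. 0::complex) \<in> L2" by (simp add: L2_space_def)
 have pre: "continuous_on I (\<lambda>_. 0::complex) \<and> (\<lambda>_. 0::complex) \<in> L2 \<and> system z (\<lambda>_. 0) u p \<and>
   ((\<lambda>r. p r * cnj (u r)) \<longlongrightarrow> 0) (at_right (- 1 / a)) \<and> ((\<lambda>r. p r * cnj (u r)) \<longlongrightarrow> 0) at_top"
  by (intro conjI continuous_on_const L0 sys l1 l2)
 have e: "integrable M (en u w)" "intM (en u w) \<le> K * sqn M (\<lambda>_. 0)" using K[rule_format, OF pre] unfolding w_def by auto
 have "intM (en u w) = 0"
 proof (rule antisym)
  show "intM (en u w) \<le> 0" using e(2) by (simp add: sqn_def)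
  show "0 \<le> intM (en u w)" by (rule integral_nonneg_AE) (auto intro: AE_I2 en_nonneg)
 qed
 then have "AE r in M. en u w r = 0" by (subst (asm) integral_nonneg_eq_0_iff_AE[OF e(1)]) (auto intro: AE_I2 en_nonneg)
 then have "AE r in M. u r = 0"
 proof eventually_elim
  fix r assume "en u w r = 0"
  then have "(cmod (u r))^2 \<le> 0" using en_ge(1)[of u r w] by simp
  then show "u r = 0" by simp
 qed
 from continuous_AE_zero[OF cu(1) this] have u0: "u r = 0" if "r \<in> I" for r using that .
 have "\<alpha> = 0" using n\<phi> u0 by (force simp: u_def)
 moreover have "\<beta> = 0"
 proof -
  obtain r where "r > 0" "\<psi> r \<noteq> 0" using n\<psi> by blast
  moreover have "r \<in> I" using \<open>r > 0\<close> nonneg_I by simp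
  ultimately show ?thesis using u0[of r] by (simp add: u_def)
 qed
 ultimately show False using ab(3) by simp
qed

definition G :: "real \<Rightarrow> real \<Rightarrow> complex" where
 "G r s = \<phi> (min r s) * \<psi> (max r s) / W"

text \<open>The factor \<open>f s\<close> converts from the measure f ds, with respect to which
  Green's function is symmetric, to the measure ds of \<open>is_resolvent_kernel\<close>.\<close>

definition R :: "real \<Rightarrow> real \<Rightarrow> complex" where
 "R r s = of_real (f s) * G r s"

lemma cont_G2: "continuous_on (I \<times> I) (\<lambda>(r, s). G r s)" unfolding G_def case_prod_unfold using W_nonzero
 by (intro continuous_intros continuous_on_compose2[OF cont(1)] continuous_on_compose2[OF cont(3)])
   (auto simp: min_def max_def)

lemma cont_R: "continuous_on (I \<times> I) (\<lambda>(r, s). R r s)"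
proof -
 have "continuous_on (I \<times> I) (\<lambda>x. of_real (f (snd x)) * (case x of (r, s) \<Rightarrow> G r s))"
  by (intro continuous_intros cont_G2 continuous_on_compose2[OF cont_f[of UNIV]]) auto
 then show ?thesis by (simp add: R_def case_prod_unfold)
qed

lemma cont_G: "r \<in> I \<Longrightarrow> continuous_on I (G r)"
proof -
 assume r: "r \<in> I"
 have c: "continuous_on I (\<lambda>s. (r, s))" by (intro continuous_intros)
 have "continuous_on I (\<lambda>s. case (r, s) of (r, s) \<Rightarrow> G r s)" by (rule continuous_on_compose2[OF cont_G2 c]) (use r in auto)
 then show "continuous_on I (G r)" by simp
qed

text \<open>Between r and 0 the function is continuous on a compact interval; outside it is a
  multiple of the solution that is square integrable at that end.\<close>

lemma G_L2:
 assumes r: "r \<in> I"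
 shows "G r \<in> L2"
proof (rule L2_spaceI)
 show m: "G r \<in> borel_measurable M" by (rule meas_M_cont[OF cont_G[OF r]])
 define c where "c = min r 0"
 define d where "d = max r 0"
 have cI: "- 1 / a < c" using r zero_I by (auto simp: c_def)
 obtain B where B: "\<And>s. s \<in> {c..d} \<Longrightarrow> norm ((cmod (G r s))^2) \<le> B"
  using continuous_bounded_Icc[OF _ cI, of "\<lambda>s. (cmod (G r s))^2"] cont_G[OF r] by (metis continuous_on_norm continuous_on_power)
 have i1: "integrable M (\<lambda>s. indicator {c..d} s *\<^sub>R (cmod (G r s))^2)" by (rule compact_integrable(1)[OF cI _ B]) (use m in measurable)
 define \<Phi> where "\<Phi> = (\<lambda>s. \<psi> r / W * (indicator {..0} s * \<phi> s))"
 define \<Psi> where "\<Psi> = (\<lambda>s. \<phi> r / W * (indicator {0..} s * \<psi> s))"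
 have i2: "integrable M (\<lambda>s. (cmod (\<Phi> s))^2)" "integrable M (\<lambda>s. (cmod (\<Psi> s))^2)"
  unfolding \<Phi>_def \<Psi>_def by (rule L2_spaceD(2)[OF L2_space_scale[OF L\<phi>]], rule L2_spaceD(2)[OF L2_space_scale[OF L\<psi>]])
 show "integrable M (\<lambda>s. (cmod (G r s))^2)"
 proof (rule Bochner_Integration.integrable_bound)
  show "integrable M (\<lambda>s. indicator {c..d} s *\<^sub>R (cmod (G r s))^2 + (cmod (\<Phi> s))^2 + (cmod (\<Psi> s))^2)"
   by (intro Bochner_Integration.integrable_add i1 i2)
  show "(\<lambda>s. (cmod (G r s))^2) \<in> borel_measurable M" using m by measurable
  show "AE s in M. norm ((cmod (G r s))^2) \<le> norm (indicator {c..d} s *\<^sub>R (cmod (G r s))^2 + (cmod (\<Phi> s))^2 + (cmod (\<Psi> s))^2)"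
  proof (rule AE_I2)
   fix s
   have n: "0 \<le> (cmod (\<Phi> s))^2" "0 \<le> (cmod (\<Psi> s))^2" "0 \<le> indicator {c..d} s *\<^sub>R (cmod (G r s))^2" by auto
   consider "s \<in> {c..d}" | "s < c" | "s > d" by force
   then have "(cmod (G r s))^2 \<le> indicator {c..d} s *\<^sub>R (cmod (G r s))^2 + (cmod (\<Phi> s))^2 + (cmod (\<Psi> s))^2"
   proof cases
    case 1 then show ?thesis using n by simp
   next
    case 2
    then have "s < r" "s < 0" by (auto simp: c_def)
    then have "G r s = \<Phi> s" by (simp add: G_def \<Phi>_def)
    then show ?thesis using n by simp
   next
    case 3
    then have "s > r" "s > 0" by (auto simp: d_def)
    then have "G r s = \<Psi> s" by (simp add: G_def \<Psi>_def)
    then show ?thesis using n by simp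
   qed
   then show "norm ((cmod (G r s))^2) \<le> norm (indicator {c..d} s *\<^sub>R (cmod (G r s))^2 + (cmod (\<Phi> s))^2 + (cmod (\<Psi> s))^2)"
    using n by simp
  qed
 qed
qed

definition U :: "(real \<Rightarrow> complex) \<Rightarrow> real \<Rightarrow> complex" where
 "U v r = intM (\<lambda>s. G r s * v s)"

lemma cnj_L2: "v \<in> L2 \<Longrightarrow> (\<lambda>s. cnj (v s)) \<in> L2" using measurable_compose[OF _ borel_measurable_continuous_onI[of cnj]]
 by (auto simp: L2_space_def intro!: continuous_intros)

lemma U_inner: "U v r = L2_inner M (G r) (\<lambda>s. cnj (v s))" by (simp add: U_def L2_inner_def)

lemma integrable_Gv: "r \<in> I \<Longrightarrow> v \<in> L2 \<Longrightarrow> integrable M (\<lambda>s. G r s * v s)"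
 using integrable_L2_inner[OF G_L2 cnj_L2, of r v] by simp

lemma U_LBINT:
 assumes r: "r \<in> I" and v: "v \<in> L2"
 shows "set_integrable lborel I (\<lambda>s. R r s * v s)" (is ?A) "(LBINT s:I. R r s * v s) = U v r" (is ?B)
proof -
 have m: "(\<lambda>s. G r s * v s) \<in> borel_measurable M" using integrable_Gv[OF r v] by (rule borel_measurable_integrable)
 have eq: "(\<lambda>s. f s *\<^sub>R (G r s * v s)) = (\<lambda>s. R r s * v s)" by (simp add: R_def scaleR_conv_of_real mult.assoc)
 show ?A using integrable_Gv[OF r v] unfolding integrable_M[OF m] eq .
 show ?B unfolding U_def integral_M[OF m] eq ..
qed

text \<open>Variation of parameters. To the left and to the right of the support of \<open>v\<close>
  the result is a constant multiple of \<open>\<phi>\<close> and of \<open>\<psi>\<close>, and so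
  inherits their boundary behaviour.\<close>

lemma U_system:
 assumes v: "continuous_on UNIV v" "- 1 / a < c" "c \<le> d" "\<And>r. r \<notin> {c..d} \<Longrightarrow> v r = 0"
 shows "\<exists>p. system z v (U v) p \<and> ((\<lambda>r. p r * cnj (U v r)) \<longlongrightarrow> 0) (at_right (- 1 / a)) \<and>
   ((\<lambda>r. p r * cnj (U v r)) \<longlongrightarrow> 0) at_top"
proof -
 obtain c0 where c0: "- 1 / a < c0" "c0 < c" using v(2) dense by blast
 note W0 = W_nonzero
 have cv: "continuous_on S v" for S by (rule continuous_on_subset[OF v(1)]) simp
 define g1 where "g1 = (\<lambda>s. of_real (f s) * \<phi> s * v s)"
 define g2 where "g2 = (\<lambda>s. of_real (f s) * \<psi> s * v s)"
 have cg: "continuous_on I g1" "continuous_on I g2" unfolding g1_def g2_def by (intro continuous_intros cont cont_f cv)+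
 have zg: "g1 s = 0" "g2 s = 0" if "s \<notin> {c..d}" for s using v(4)[OF that] by (auto simp: g1_def g2_def)
 define A where "A = J c0 g1"
 define B where "B = J c0 g2"
 \<comment> \<open>\<open>A r\<close> integrates against \<open>\<phi>\<close> up to r, and
   \<open>B d - B r\<close> integrates against \<open>\<psi>\<close> beyond r: the two halves of
   Green's kernel.\<close>
 define u where "u = (\<lambda>r. (\<psi> r * A r + \<phi> r * (B d - B r)) / W)"
 define p where "p = (\<lambda>r. (p\<psi> r * A r + p\<phi> r * (B d - B r)) / W)"
 have dA: "(A has_vector_derivative g1 r) (at r)" and dB: "(B has_vector_derivative g2 r) (at r)" if "r \<in> I" for r
  unfolding A_def B_def by (rule J_deriv[OF cg(1) _ c0 that], use zg in force) (rule J_deriv[OF cg(2) _ c0 that], use zg in force)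
 note JA = J_split[OF cg(1) _ c0 v(3), folded A_def]
 note JB = J_split[OF cg(2) _ c0 v(3), folded B_def]
 have Uu: "U v r = u r" if r: "r \<in> I" for r
 proof -
  define c1 where "c1 = min c0 r"
  define d1 where "d1 = max d r"
  have cd1: "- 1 / a < c1" "c1 \<le> r" "r \<le> d1" "{c..d} \<subseteq> {c1..d1}" using c0 r v(3) by (auto simp: c1_def d1_def)
  have cGv: "continuous_on I (\<lambda>s. G r s * v s)" by (intro continuous_intros cont_G[OF r] cv)
  obtain K where K: "\<And>s. s \<in> {c1..d1} \<Longrightarrow> norm (G r s * v s) \<le> K" using continuous_bounded_Icc[OF cGv cd1(1)] by blast
  have "U v r = intM (\<lambda>s. indicator {c1..d1} s *\<^sub>R (G r s * v s))" unfolding U_def by (rule integral_M_supp) (use v(4) cd1(4) in auto)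
  also have "\<dots> = (LBINT s:{c1..d1}. f s *\<^sub>R (G r s * v s))" by (rule compact_integrable(3)[OF cd1(1) meas_M_cont[OF cGv] K])
  also have "\<dots> = integral {c1..d1} (\<lambda>s. f s *\<^sub>R (G r s * v s))"
   by (rule set_borel_integral_eq_integral(2)[OF compact_integrable(2)[OF cd1(1) meas_M_cont[OF cGv] K]])
  also have "\<dots> = integral {c1..r} (\<lambda>s. f s *\<^sub>R (G r s * v s)) + integral {r..d1} (\<lambda>s. f s *\<^sub>R (G r s * v s))"
  proof (rule Henstock_Kurzweil_Integration.integral_combine[symmetric, OF cd1(2,3)])
   show "(\<lambda>s. f s *\<^sub>R (G r s * v s)) integrable_on {c1..d1}"
    using cd1(1) by (intro integrable_continuous_real continuous_intros cont_f continuous_on_subset[OF cGv]) auto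
  qed
  also have "integral {c1..r} (\<lambda>s. f s *\<^sub>R (G r s * v s)) = integral {c1..r} (\<lambda>s. (\<psi> r / W) * g1 s)"
  proof (rule integral_cong)
   fix s assume "s \<in> {c1..r}"
   then have "min r s = s" "max r s = r" by auto
   then show "f s *\<^sub>R (G r s * v s) = (\<psi> r / W) * g1 s" by (simp add: G_def g1_def scaleR_conv_of_real)
  qed
  also have "\<dots> = \<psi> r / W * A r" using JA(1)[OF _ r] zg by (simp add: c1_def)
  also have "integral {r..d1} (\<lambda>s. f s *\<^sub>R (G r s * v s)) = integral {r..d1} (\<lambda>s. (\<phi> r / W) * g2 s)"
  proof (rule integral_cong)
   fix s assume "s \<in> {r..d1}"
   then have "min r s = r" "max r s = s" by auto
   then show "f s *\<^sub>R (G r s * v s) = (\<phi> r / W) * g2 s" by (simp add: G_def g2_def scaleR_conv_of_real)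
  qed
  also have "\<dots> = \<phi> r / W * (B d - B r)" using JB(2)[OF _ r] zg by (simp add: d1_def)
  finally show ?thesis by (simp add: u_def add_divide_distrib)
 qed
 have cA: "continuous_on I A" "continuous_on I B" using dA dB by (auto intro!: continuous_at_imp_continuous_on has_vector_derivative_continuous)
 have cu: "continuous_on I u" "continuous_on I p" unfolding u_def p_def using W0 by (intro continuous_intros cont cA; simp)+
 have sys: "system z v (U v) p" unfolding system_def
 proof (intro conjI ballI impI)
  show "continuous_on I (U v)" by (rule continuous_on_eq[OF cu(1)]) (rule Uu[symmetric])
  show "continuous_on I p" by (rule cu)
  fix r assume r: "r \<in> I" "r \<noteq> 0"
  define F where "F = (of_real (f r) :: complex)"
  have F: "F \<noteq> 0" using f_nz[OF r(1)] by (simp add: F_def)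
  define k where "k = (of_real (m2 / f r) - z^2 * F)"
  have d: "(\<phi> has_vector_derivative p\<phi> r / F) (at r)" "(p\<phi> has_vector_derivative k * \<phi> r) (at r)"
   "(\<psi> has_vector_derivative p\<psi> r / F) (at r)" "(p\<psi> has_vector_derivative k * \<psi> r) (at r)"
   using s\<phi> s\<psi> r unfolding system_def k_def F_def by auto
  have dBd: "((\<lambda>r. B d - B r) has_vector_derivative 0 - g2 r) (at r)" by (intro has_vector_derivative_diff has_vector_derivative_const dB r)
  have D1: "((\<lambda>r. \<psi> r * A r + \<phi> r * (B d - B r)) has_vector_derivative
    (\<psi> r * g1 r + p\<psi> r / F * A r) + (\<phi> r * (0 - g2 r) + p\<phi> r / F * (B d - B r))) (at r)"
   by (intro has_vector_derivative_add has_vector_derivative_mult d dA dBd r)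
  have D2: "((\<lambda>r. p\<psi> r * A r + p\<phi> r * (B d - B r)) has_vector_derivative
    (p\<psi> r * g1 r + k * \<psi> r * A r) + (p\<phi> r * (0 - g2 r) + k * \<phi> r * (B d - B r))) (at r)"
   by (intro has_vector_derivative_add has_vector_derivative_mult d dA dBd r)
  have g: "g1 r = F * \<phi> r * v r" "g2 r = F * \<psi> r * v r" by (simp_all add: g1_def g2_def F_def)
  have "(u has_vector_derivative ((\<psi> r * g1 r + p\<psi> r / F * A r) + (\<phi> r * (0 - g2 r) + p\<phi> r / F * (B d - B r))) * inverse W) (at r)"
   unfolding u_def divide_inverse by (rule has_vector_derivative_mult_left[OF D1[unfolded divide_inverse]])
  also have "((\<psi> r * g1 r + p\<psi> r / F * A r) + (\<phi> r * (0 - g2 r) + p\<phi> r / F * (B d - B r))) * inverse W = p r / F"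
   unfolding g p_def using F W0 by (simp add: field_simps)
  finally have du: "(u has_vector_derivative p r / F) (at r)" .
  show "(U v has_vector_derivative p r / complex_of_real (f r)) (at r)"
   by (rule has_vector_derivative_transform_within_open[OF du[unfolded F_def], of I]) (use r Uu in auto)
  have "(p has_vector_derivative ((p\<psi> r * g1 r + k * \<psi> r * A r) + (p\<phi> r * (0 - g2 r) + k * \<phi> r * (B d - B r))) * inverse W) (at r)"
   unfolding p_def divide_inverse by (rule has_vector_derivative_mult_left[OF D2])
  moreover have "((p\<psi> r * g1 r + k * \<psi> r * A r) + (p\<phi> r * (0 - g2 r) + k * \<phi> r * (B d - B r))) * inverse W = k * u r - F * v r"
  proof -
   have "((p\<psi> r * g1 r + k * \<psi> r * A r) + (p\<phi> r * (0 - g2 r) + k * \<phi> r * (B d - B r)))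
    = k * (\<psi> r * A r + \<phi> r * (B d - B r)) - F * v r * (p\<phi> r * \<psi> r - \<phi> r * p\<psi> r)"
    unfolding g by (simp add: algebra_simps)
   also have "\<dots> = k * (\<psi> r * A r + \<phi> r * (B d - B r)) - F * v r * W" using W_eq[OF r(1)] by simp
   finally show ?thesis using W0 by (simp add: u_def field_simps)
  qed
  ultimately show "(p has_vector_derivative pot z r * U v r - of_real (f r) * v r) (at r)" using Uu[OF r(1)] by (simp add: k_def F_def)
 qed
 have l1: "((\<lambda>r. p r * cnj (U v r)) \<longlongrightarrow> 0) (at_right (- 1 / a))"
 proof -
  define C where "C = B d / W"
  have "((\<lambda>r. (C * cnj C) * (p\<phi> r * cnj (\<phi> r))) \<longlongrightarrow> 0) (at_right (- 1 / a))" by (rule tendsto_mult_right_zero[OF b\<phi>])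
  moreover have "eventually (\<lambda>r. (C * cnj C) * (p\<phi> r * cnj (\<phi> r)) = p r * cnj (U v r)) (at_right (- 1 / a))"
   unfolding eventually_at_right_field
  proof (intro exI[of _ c] conjI allI impI v(2))
   fix r assume r: "- 1 / a < r" "r < c"
   then have "A r = 0" "B r = 0" using JA(4)[of r] JB(4)[of r] zg by auto
   then show "(C * cnj C) * (p\<phi> r * cnj (\<phi> r)) = p r * cnj (U v r)" using Uu[of r] r by (simp add: u_def p_def C_def)
  qed
  ultimately show ?thesis by (rule Lim_transform_eventually)
 qed
 have l2: "((\<lambda>r. p r * cnj (U v r)) \<longlongrightarrow> 0) at_top"
 proof -
  define C where "C = A d / W"
  have "((\<lambda>r. (C * cnj C) * (p\<psi> r * cnj (\<psi> r))) \<longlongrightarrow> 0) at_top" by (rule tendsto_mult_right_zero[OF b\<psi>])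
  moreover have "eventually (\<lambda>r. (C * cnj C) * (p\<psi> r * cnj (\<psi> r)) = p r * cnj (U v r)) at_top" using eventually_ge_at_top[of d]
  proof eventually_elim
   fix r assume r: "d \<le> r"
   then have rI: "r \<in> I" using v(2,3) by auto
   have "A r = A d" "B r = B d" using JA(3)[OF _ rI r] JB(3)[OF _ rI r] zg by auto
   then show "(C * cnj C) * (p\<psi> r * cnj (\<psi> r)) = p r * cnj (U v r)" using Uu[OF rI] by (simp add: u_def p_def C_def)
  qed
  ultimately show ?thesis by (rule Lim_transform_eventually)
 qed
 show ?thesis using sys l1 l2 by blast
qed

end

context resolvent
begin

lemma U_diff:
 assumes "r \<in> I" "v \<in> L2" "w \<in> L2"
 shows "U (\<lambda>s. v s - w s) r = U v r - U w r" unfolding U_def right_diff_distrib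
 by (rule Bochner_Integration.integral_diff) (intro integrable_Gv assms)+

lemma U_bound:
 assumes r: "r \<in> I" and v: "v \<in> L2"
 shows "cmod (U v r) \<le> sqrt (sqn M (G r)) * sqrt (sqn M v)"
proof -
 have "sqn M (\<lambda>s. cnj (v s)) = sqn M v" by (simp add: sqn_def)
 then show ?thesis unfolding U_inner using L2_Cauchy_Schwarz[OF G_L2[OF r] cnj_L2[OF v]] by simp
qed

definition Cc :: "(real \<Rightarrow> complex) \<Rightarrow> bool" where
 "Cc v \<longleftrightarrow> continuous_on UNIV v \<and> (\<exists>c d. - 1 / a < c \<and> c \<le> d \<and> (\<forall>r. r \<notin> {c..d} \<longrightarrow> v r = 0))"

lemma Cc_diff: "Cc v \<Longrightarrow> Cc w \<Longrightarrow> Cc (\<lambda>r. v r - w r)"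
proof -
 assume "Cc v" "Cc w"
 then obtain c d c' d' where h: "continuous_on UNIV v" "- 1 / a < c" "c \<le> d" "\<And>r. r \<notin> {c..d} \<Longrightarrow> v r = 0"
  "continuous_on UNIV w" "- 1 / a < c'" "c' \<le> d'" "\<And>r. r \<notin> {c'..d'} \<Longrightarrow> w r = 0" unfolding Cc_def by metis
 have "v r - w r = 0" if "r \<notin> {min c c'..max d d'}" for r
 proof -
  have "r \<notin> {c..d}" "r \<notin> {c'..d'}" using that by auto
  then show ?thesis using h(4) h(8) by simp
 qed
 then show "Cc (\<lambda>r. v r - w r)" unfolding Cc_def using h by (intro conjI continuous_intros exI[of _ "min c c'"] exI[of _ "max d d'"]) auto
qed

lemma Cc_L2: "Cc v \<Longrightarrow> v \<in> L2"
proof -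
 assume "Cc v"
 then obtain c d where h: "continuous_on UNIV v" "- 1 / a < c" "c \<le> d" "\<And>r. r \<notin> {c..d} \<Longrightarrow> v r = 0"
  unfolding Cc_def by metis
 have cv: "continuous_on I v" by (rule continuous_on_subset[OF h(1)]) simp
 obtain B where "\<And>r. r \<in> {c..d} \<Longrightarrow> norm (v r) \<le> B" using continuous_bounded_Icc[OF cv h(2)] by blast
 then show "v \<in> L2" by (rule compact_L2[OF h(2) meas_M_cont[OF cv]]) (use h(4) in auto)
qed

text \<open>One constant \<open>K\<close> for all data of compact support; applied to differences of
  data, it drives the limit in \<open>U_graph\<close>.\<close>

lemma U_Cc:
 "\<exists>K\<ge>0. \<forall>v. Cc v \<longrightarrow> (\<exists>p. system z v (U v) p \<and>
   integrable M (en (U v) (vel p)) \<and> intM (en (U v) (vel p)) \<le> K * sqn M v)"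
proof -
 obtain K where K: "K \<ge> 0" "\<And>v u p. continuous_on I v \<and> v \<in> L2 \<and> system z v u p \<and>
   ((\<lambda>r. p r * cnj (u r)) \<longlongrightarrow> 0) (at_right (- 1 / a)) \<and> ((\<lambda>r. p r * cnj (u r)) \<longlongrightarrow> 0) at_top \<Longrightarrow>
   integrable M (en u (vel p)) \<and> intM (en u (vel p)) \<le> K * sqn M v" using energy_estimate[OF z] by blast
 have "\<exists>p. system z v (U v) p \<and>
   integrable M (en (U v) (vel p)) \<and> intM (en (U v) (vel p)) \<le> K * sqn M v"
  if v: "Cc v" for v
 proof -
  obtain c d where h: "continuous_on UNIV v" "- 1 / a < c" "c \<le> d" "\<And>r. r \<notin> {c..d} \<Longrightarrow> v r = 0"
   using v unfolding Cc_def by metis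
  obtain p where p: "system z v (U v) p" "((\<lambda>r. p r * cnj (U v r)) \<longlongrightarrow> 0) (at_right (- 1 / a))"
   "((\<lambda>r. p r * cnj (U v r)) \<longlongrightarrow> 0) at_top" using U_system[OF h(1-3)] h(4) by blast
  have "continuous_on I v" by (rule continuous_on_subset[OF h(1)]) simp
  then show ?thesis using K(2)[of v "U v" p] p Cc_L2[OF v] by blast
 qed
 then show ?thesis using K(1) by blast
qed

lemma system_cont: "system z v u p \<Longrightarrow> continuous_on I u" "system z v u p \<Longrightarrow> continuous_on I (vel p)"
 using f_nz by (auto simp: system_def intro!: continuous_intros cont_f)

text \<open>Let data v_n of compact support tend to v. By the uniform energy bound their solutions
  are Cauchy in the energy norm, so test functions close to them are a sequence of the kind that the
  form domain asks for. The adjoint relation holds for v_n by \<open>green\<close> and passes to the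
  limit.\<close>

lemma U_graph:
 assumes v: "v \<in> L2"
 shows "P1_graph a b m (U v) (\<lambda>r. v r + z^2 * U v r)"
proof -
 obtain K where K: "K \<ge> 0" "\<And>v. Cc v \<Longrightarrow> \<exists>p. system z v (U v) p \<and>
   integrable M (en (U v) (vel p)) \<and> intM (en (U v) (vel p)) \<le> K * sqn M v" using U_Cc by blast
 have "\<exists>v'. Cc v' \<and> sqn M (\<lambda>r. v' r - v r) < 1 / (real n + 1)" for n
  using density_Cc[OF v, of "1 / (real n + 1)"] unfolding Cc_def by (auto simp: add_nonneg_pos)
 then obtain vn where vn: "\<And>n. Cc (vn n)" "\<And>n. sqn M (\<lambda>r. vn n r - v r) < 1 / (real n + 1)" by metis
 have vL: "vn n \<in> L2" for n by (rule Cc_L2[OF vn(1)])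
 define \<delta> where "\<delta> = (\<lambda>n. sqn M (\<lambda>r. vn n r - v r))"
 have inv0: "(\<lambda>n. 1 / (real n + 1)) \<longlonglongrightarrow> 0" using LIMSEQ_inverse_real_of_nat by (simp add: inverse_eq_divide add.commute)
 have \<delta>: "\<delta> \<longlonglongrightarrow> 0"
 proof (rule Lim_null_comparison[OF always_eventually[OF allI] inv0])
  show "norm (\<delta> n) \<le> 1 / (real n + 1)" for n using vn(2)[of n] sqn_nonneg[of M "\<lambda>r. vn n r - v r"] by (simp add: \<delta>_def)
 qed
 have \<delta>0: "\<delta> n \<ge> 0" for n unfolding \<delta>_def by (rule sqn_nonneg)
 have vdiff: "sqn M (\<lambda>r. vn j r - vn k r) \<le> 2 * \<delta> j + 2 * \<delta> k" for j k
  using sqn_diff_le[OF L2_space_diff[OF vL[of j] v] L2_space_diff[OF vL[of k] v]] by (simp add: \<delta>_def)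
 have CcL: "sqn M (U w) \<le> K * sqn M w \<and> U w \<in> L2" if w: "Cc w" for w
 proof -
  obtain p where p: "system z w (U w) p" "integrable M (en (U w) (vel p))"
   "intM (en (U w) (vel p)) \<le> K * sqn M w" using K(2)[OF w] by blast
  have m: "U w \<in> borel_measurable M" by (rule meas_M_cont[OF system_cont(1)[OF p(1)]])
  have i: "integrable M (\<lambda>r. (cmod (U w r))^2)"
  proof (rule Bochner_Integration.integrable_bound[OF p(2)])
   show "(\<lambda>r. (cmod (U w r))^2) \<in> borel_measurable M" using m by measurable
   show "AE r in M. norm ((cmod (U w r))^2) \<le> norm (en (U w) (vel p) r)"
    by (rule AE_I2) (use en_ge(1)[of "U w"] in \<open>simp add: abs_of_nonneg[OF en_nonneg]\<close>)
  qed
  have "sqn M (U w) \<le> intM (en (U w) (vel p))" unfolding sqn_def by (rule integral_mono[OF i p(2)]) (rule en_ge(1))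
  then show ?thesis using p(3) L2_spaceI[OF m i] by simp
 qed
 define un where "un = (\<lambda>n. U (vn n))"
 have uL: "un n \<in> L2" for n using CcL[OF vn(1)] by (simp add: un_def)
 have ptw: "(\<lambda>n. un n r) \<longlonglongrightarrow> U v r" if r: "r \<in> I" for r
 proof (rule LIM_zero_cancel, rule Lim_null_comparison[OF always_eventually[OF allI]])
  show "norm (un n r - U v r) \<le> sqrt (sqn M (G r)) * sqrt (\<delta> n)" for n
   using U_bound[OF r L2_space_diff[OF vL[of n] v]] U_diff[OF r vL[of n] v] by (simp add: un_def \<delta>_def)
  show "(\<lambda>n. sqrt (sqn M (G r)) * sqrt (\<delta> n)) \<longlonglongrightarrow> 0"
   using tendsto_mult_right_zero[OF tendsto_real_sqrt[OF \<delta>, simplified]] by simp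
 qed
 have um: "U v \<in> borel_measurable M" by (rule borel_measurable_LIMSEQ_metric[of un]) (use L2_spaceD(1)[OF uL] ptw in auto)
 have udk: "sqn M (\<lambda>r. un j r - un k r) \<le> K * (2 * \<delta> j + 2 * \<delta> k)" for j k
 proof -
  have "sqn M (\<lambda>r. un j r - un k r) = sqn M (U (\<lambda>s. vn j s - vn k s))"
   unfolding sqn_def un_def by (rule Bochner_Integration.integral_cong) (simp_all add: U_diff vL)
  also have "\<dots> \<le> K * sqn M (\<lambda>s. vn j s - vn k s)" using CcL[OF Cc_diff[OF vn(1) vn(1)]] by blast
  also have "\<dots> \<le> K * (2 * \<delta> j + 2 * \<delta> k)" using vdiff K(1) by (rule mult_left_mono)
  finally show ?thesis .
 qed
 \<comment> \<open>The Cauchy estimate in k, combined with pointwise convergence to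
   \<open>U v\<close>, gives convergence in L2 by Fatou's lemma.\<close>
 have fat: "integrable M (\<lambda>r. (cmod (un j r - U v r))^2) \<and> sqn M (\<lambda>r. un j r - U v r) \<le> K * (2 * \<delta> j + 2 * 0)" for j
 proof -
  have i: "integrable M (\<lambda>r. (cmod (un j r - un k r))^2)" for k by (rule L2_spaceD(2)[OF L2_space_diff[OF uL uL]])
  have l: "AE r in M. (\<lambda>k. (cmod (un j r - un k r))^2) \<longlonglongrightarrow> (cmod (un j r - U v r))^2"
   by (rule AE_I2) (use ptw in \<open>auto intro!: tendsto_intros\<close>)
  have m: "(\<lambda>r. (cmod (un j r - U v r))^2) \<in> borel_measurable M" using um L2_spaceD(1)[OF uL[of j]] by measurable
  have B: "(\<lambda>k. K * (2 * \<delta> j + 2 * \<delta> k)) \<longlonglongrightarrow> K * (2 * \<delta> j + 2 * 0)" by (intro tendsto_intros \<delta>)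
  have b: "intM (\<lambda>r. (cmod (un j r - un k r))^2) \<le> K * (2 * \<delta> j + 2 * \<delta> k)" for k using udk[of j k] by (simp add: sqn_def)
  have p1: "(cmod (un j r - un k r))^2 \<ge> 0" "(cmod (un j r - U v r))^2 \<ge> 0" for k r by (rule zero_le_power2)+
  show ?thesis unfolding sqn_def by (rule conjI[OF Fatou_real[OF i p1(1) m p1(2) l b B]])
 qed
 have UL: "U v \<in> L2"
 proof -
  have "(\<lambda>r. un 0 r - U v r) \<in> L2" using fat[of 0] um L2_spaceD(1)[OF uL[of 0]] by (intro L2_spaceI) auto
  from L2_space_diff[OF uL[of 0] this] show ?thesis by simp
 qed
 have ulim: "(\<lambda>n. sqn M (\<lambda>r. un n r - U v r)) \<longlonglongrightarrow> 0"
 proof (rule Lim_null_comparison[OF always_eventually[OF allI]])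
  show "norm (sqn M (\<lambda>r. un n r - U v r)) \<le> 2 * K * \<delta> n" for n
   using fat[of n] sqn_nonneg[of M "\<lambda>r. un n r - U v r"] by simp
  show "(\<lambda>n. 2 * K * \<delta> n) \<longlonglongrightarrow> 0" by (rule tendsto_mult_right_zero[OF \<delta>])
 qed
 obtain pn where pn: "\<And>n. system z (vn n) (un n) (pn n)" "\<And>n. integrable M (en (un n) (\<lambda>r. pn n r / of_real (f r)))"
  using K(2)[OF vn(1)] unfolding un_def by metis
 define wn where "wn = (\<lambda>n r. pn n r / of_real (f r))"
 have cu: "continuous_on I (un n)" "continuous_on I (wn n)" for n unfolding wn_def by (rule system_cont[OF pn(1)])+
 have du: "(un n has_vector_derivative wn n r) (at r)" if "r \<in> I" "r \<noteq> 0" for n r using pn(1)[of n] that by (simp add: system_def wn_def)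
 have "\<exists>\<phi>. \<phi> \<in> TF \<and> integrable M (en (\<lambda>r. \<phi> r - un n r) (\<lambda>r. d_r \<phi> r - wn n r)) \<and>
   intM (en (\<lambda>r. \<phi> r - un n r) (\<lambda>r. d_r \<phi> r - wn n r)) \<le> 1 / (real n + 1)" for n unfolding Bex_def[symmetric]
  by (rule form_approx[OF cu du]) (use pn(2) in \<open>auto simp: wn_def add_nonneg_pos\<close>)
 then have "\<exists>\<Phi>. \<forall>n. \<Phi> n \<in> TF \<and> integrable M (en (\<lambda>r. \<Phi> n r - un n r) (\<lambda>r. d_r (\<Phi> n) r - wn n r)) \<and>
   intM (en (\<lambda>r. \<Phi> n r - un n r) (\<lambda>r. d_r (\<Phi> n) r - wn n r)) \<le> 1 / (real n + 1)" by (intro choice allI)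
 then obtain \<Phi> where \<Phi>: "\<And>n. \<Phi> n \<in> TF" "\<And>n. integrable M (en (\<lambda>r. \<Phi> n r - un n r) (\<lambda>r. d_r (\<Phi> n) r - wn n r))"
   "\<And>n. intM (en (\<lambda>r. \<Phi> n r - un n r) (\<lambda>r. d_r (\<Phi> n) r - wn n r)) \<le> 1 / (real n + 1)" by blast
 have \<Phi>L: "\<Phi> n \<in> L2" for n by (rule test_L2(1)[OF \<Phi>(1)])
 have \<Phi>u: "sqn M (\<lambda>r. \<Phi> n r - un n r) \<le> 1 / (real n + 1)" for n
 proof -
  have "sqn M (\<lambda>r. \<Phi> n r - un n r) \<le> intM (en (\<lambda>r. \<Phi> n r - un n r) (\<lambda>r. d_r (\<Phi> n) r - wn n r))"
   unfolding sqn_def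
   by (rule integral_mono[OF L2_spaceD(2)[OF L2_space_diff[OF \<Phi>L uL]] \<Phi>(2)]) (rule en_ge(1)[of "\<lambda>r. \<Phi> n r - un n r"])
  then show ?thesis using \<Phi>(3)[of n] by linarith
 qed
 have \<Phi>lim: "(\<lambda>n. sqn M (\<lambda>r. \<Phi> n r - U v r)) \<longlonglongrightarrow> 0"
 proof (rule Lim_null_comparison[OF always_eventually[OF allI]])
  show "norm (sqn M (\<lambda>r. \<Phi> n r - U v r)) \<le> 2 * (1 / (real n + 1)) + 2 * sqn M (\<lambda>r. un n r - U v r)" for n
  proof -
   have uvL: "(\<lambda>r. U v r - un n r) \<in> L2" by (rule L2_space_diff[OF UL uL])
   have "sqn M (\<lambda>r. (\<Phi> n r - un n r) - (U v r - un n r)) \<le> 2 * sqn M (\<lambda>r. \<Phi> n r - un n r) + 2 * sqn M (\<lambda>r. U v r - un n r)"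
    by (rule sqn_diff_le[OF L2_space_diff[OF \<Phi>L uL] uvL])
   moreover have "(\<lambda>r. (\<Phi> n r - un n r) - (U v r - un n r)) = (\<lambda>r. \<Phi> n r - U v r)" by simp
   moreover have "sqn M (\<lambda>r. U v r - un n r) = sqn M (\<lambda>r. un n r - U v r)" by (simp add: sqn_def norm_minus_commute)
   ultimately show ?thesis using \<Phi>u[of n] sqn_nonneg[of M "\<lambda>r. \<Phi> n r - U v r"] by simp
  qed
  have "(\<lambda>n. 2 * (1 / (real n + 1)) + 2 * sqn M (\<lambda>r. un n r - U v r)) \<longlonglongrightarrow> 2 * 0 + 2 * 0"
   by (intro tendsto_intros inv0 ulim)
  then show "(\<lambda>n. 2 * (1 / (real n + 1)) + 2 * sqn M (\<lambda>r. un n r - U v r)) \<longlonglongrightarrow> 0" by simp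
 qed
 \<comment> \<open>The difference of two test functions is split as (\<Phi>_j - u_j) + (u_j - u_k) -
   (\<Phi>_k - u_k); the middle part is the solution for the data v_j - v_k, to which the energy
   bound applies.\<close>
 have Qb: "Re (nf.Q (\<lambda>x. \<Phi> j x - \<Phi> k x) (\<lambda>x. \<Phi> j x - \<Phi> k x)) \<le> 2 * (1 / (real j + 1)) + 4 * (1 / (real k + 1)) + 4 * (K * (2 * \<delta> j + 2 * \<delta> k))" for j k
 proof -
  define \<eta> where "\<eta> = (\<lambda>x. \<Phi> j x - \<Phi> k x)"
  have t: "\<eta> \<in> TF" unfolding \<eta>_def by (rule test_functions_lincomb(1)[OF \<Phi>(1) \<Phi>(1)])
  have dt: "d_r \<eta> = (\<lambda>r. d_r (\<Phi> j) r - d_r (\<Phi> k) r)" unfolding \<eta>_def by (rule test_functions_lincomb(3)[OF \<Phi>(1) \<Phi>(1)])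
  obtain p where p: "system z (\<lambda>s. vn j s - vn k s) (U (\<lambda>s. vn j s - vn k s)) p"
   "integrable M (en (U (\<lambda>s. vn j s - vn k s)) (vel p))"
   "intM (en (U (\<lambda>s. vn j s - vn k s)) (vel p)) \<le> K * sqn M (\<lambda>s. vn j s - vn k s)" using K(2)[OF Cc_diff[OF vn(1) vn(1)]] by blast
  have Ueq: "U (\<lambda>s. vn j s - vn k s) r = un j r - un k r" if "r \<in> I" for r unfolding un_def by (rule U_diff[OF that vL vL])
  \<comment> \<open>The energy bound speaks of some \<open>p\<close> belonging to v_j - v_k;
    uniqueness of derivatives identifies p / f with the difference of the given derivatives.\<close>
  have weq: "p r / of_real (f r) = wn j r - wn k r" if r: "r \<in> I" "r \<noteq> 0" for r
  proof -
   have 1: "(U (\<lambda>s. vn j s - vn k s) has_vector_derivative p r / of_real (f r)) (at r)" using p(1) r by (simp add: system_def)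
   have "((\<lambda>r. un j r - un k r) has_vector_derivative p r / of_real (f r)) (at r)"
    by (rule has_vector_derivative_transform_within_open[OF 1, of I]) (use r Ueq in auto)
   moreover have "((\<lambda>r. un j r - un k r) has_vector_derivative wn j r - wn k r) (at r)" by (intro has_vector_derivative_diff du r)
   ultimately show ?thesis by (rule vector_derivative_unique_at)
  qed
  define e1 where "e1 = en (\<lambda>r. \<Phi> j r - un j r) (\<lambda>r. d_r (\<Phi> j) r - wn j r)"
  define e2 where "e2 = en (\<lambda>r. \<Phi> k r - un k r) (\<lambda>r. d_r (\<Phi> k) r - wn k r)"
  define e3 where "e3 = en (U (\<lambda>s. vn j s - vn k s)) (vel p)"
  have ie: "integrable M (\<lambda>r. 2 * e1 r + 4 * e2 r + 4 * e3 r)"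
   unfolding e1_def e2_def e3_def by (intro Bochner_Integration.integrable_add integrable_mult_right \<Phi> p)
  have le: "en \<eta> (d_r \<eta>) r \<le> 2 * e1 r + 4 * e2 r + 4 * e3 r" if r: "r \<in> I" "r \<noteq> 0" for r
  proof -
   define g where "g = (\<lambda>r. (un j r - un k r) + - (\<Phi> k r - un k r))"
   define q where "q = (\<lambda>r. (wn j r - wn k r) + - (d_r (\<Phi> k) r - wn k r))"
   have "\<eta> r = (\<Phi> j r - un j r) + g r" "d_r \<eta> r = (d_r (\<Phi> j) r - wn j r) + q r"
    unfolding dt by (simp_all add: \<eta>_def g_def q_def)
   then have eq: "en \<eta> (d_r \<eta>) r = en (\<lambda>r. (\<Phi> j r - un j r) + g r) (\<lambda>r. (d_r (\<Phi> j) r - wn j r) + q r) r"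
    by (simp only: en_def)
   have "en \<eta> (d_r \<eta>) r \<le> 2 * e1 r + 2 * en g q r" unfolding eq e1_def by (rule en_add_le)
   moreover have "en g q r \<le> 2 * en (\<lambda>r. un j r - un k r) (\<lambda>r. wn j r - wn k r) r
     + 2 * en (\<lambda>r. - (\<Phi> k r - un k r)) (\<lambda>r. - (d_r (\<Phi> k) r - wn k r)) r" unfolding g_def q_def by (rule en_add_le)
   moreover have "en (\<lambda>r. - (\<Phi> k r - un k r)) (\<lambda>r. - (d_r (\<Phi> k) r - wn k r)) r = e2 r"
    by (simp only: en_def e2_def norm_minus_cancel)
   moreover have "en (\<lambda>r. un j r - un k r) (\<lambda>r. wn j r - wn k r) r = e3 r" using Ueq[OF r(1)] weq[OF r] by (simp add: en_def e3_def)
   ultimately show ?thesis by linarith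
  qed
  have ge: "(cmod (d_r \<eta> r))^2 + m2 / (f r)^2 * (cmod (\<eta> r))^2 \<le> en \<eta> (d_r \<eta>) r" for r by (rule en_ge(2))
  have A0: "AE r in M. r \<noteq> 0" by (rule AE_M) (rule AE_lborel_singleton)
  have cm: "continuous_on I (\<lambda>r. (cmod (d_r \<eta> r))^2 + m2 / (f r)^2 * (cmod (\<eta> r))^2)"
   using f_nz by (intro continuous_intros test_cont[OF t] cont_f) auto
  have "Re (nf.Q \<eta> \<eta>) = intM (\<lambda>r. (cmod (d_r \<eta> r))^2 + m2 / (f r)^2 * (cmod (\<eta> r))^2)"
   unfolding nf.Q_def P1_form[OF t t] ff_self by simp
  also have "\<dots> \<le> intM (\<lambda>r. 2 * e1 r + 4 * e2 r + 4 * e3 r)"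
  proof (rule integral_mono_AE[OF _ ie])
   have AEle: "AE r in M. (cmod (d_r \<eta> r))^2 + m2 / (f r)^2 * (cmod (\<eta> r))^2 \<le> 2 * e1 r + 4 * e2 r + 4 * e3 r" using A0 AE_space
   proof eventually_elim
    fix r assume "r \<noteq> 0" "r \<in> space M"
    then show "(cmod (d_r \<eta> r))^2 + m2 / (f r)^2 * (cmod (\<eta> r))^2 \<le> 2 * e1 r + 4 * e2 r + 4 * e3 r" using le[of r] ge[of r] by simp
   qed
   then show "AE r in M. (cmod (d_r \<eta> r))^2 + m2 / (f r)^2 * (cmod (\<eta> r))^2 \<le> 2 * e1 r + 4 * e2 r + 4 * e3 r" .
   show "integrable M (\<lambda>r. (cmod (d_r \<eta> r))^2 + m2 / (f r)^2 * (cmod (\<eta> r))^2)"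
   proof (rule Bochner_Integration.integrable_bound[OF ie meas_M_cont[OF cm]])
    show "AE r in M. norm ((cmod (d_r \<eta> r))^2 + m2 / (f r)^2 * (cmod (\<eta> r))^2) \<le> norm (2 * e1 r + 4 * e2 r + 4 * e3 r)"
     using AEle by eventually_elim simp
   qed
  qed
  also have "\<dots> = 2 * intM e1 + 4 * intM e2 + 4 * intM e3" unfolding e1_def e2_def e3_def using \<Phi>(2)[of j] \<Phi>(2)[of k] p(2) by simp
  also have "\<dots> \<le> 2 * (1 / (real j + 1)) + 4 * (1 / (real k + 1)) + 4 * (K * (2 * \<delta> j + 2 * \<delta> k))"
   using \<Phi>(3)[of j] \<Phi>(3)[of k] order_trans[OF p(3) mult_left_mono[OF vdiff[of j k] K(1)]] unfolding e1_def e2_def e3_def by linarith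
  finally show ?thesis unfolding \<eta>_def .
 qed
 have form: "U v \<in> form_domain M (TF) (P1 a b m)" unfolding nf.form_domain_iff
 proof (intro conjI UL exI[of _ \<Phi>] allI impI \<Phi>(1) \<Phi>lim)
  fix e :: real assume e: "e > 0"
  have "(\<lambda>n. 4 * (1 / (real n + 1)) + 8 * K * \<delta> n) \<longlonglongrightarrow> 4 * 0 + 8 * K * 0" by (intro tendsto_intros inv0 \<delta>)
  then have "eventually (\<lambda>n. 4 * (1 / (real n + 1)) + 8 * K * \<delta> n < e / 2) sequentially" using e by (intro order_tendstoD(2)) auto
  then obtain N where N: "\<And>n. n \<ge> N \<Longrightarrow> 4 * (1 / (real n + 1)) + 8 * K * \<delta> n < e / 2" by (auto simp: eventually_sequentially)
  show "\<exists>N. \<forall>j\<ge>N. \<forall>k\<ge>N. Re (nf.Q (\<lambda>x. \<Phi> j x - \<Phi> k x) (\<lambda>x. \<Phi> j x - \<Phi> k x)) < e"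
  proof (intro exI[of _ N] allI impI)
   fix j k assume jk: "N \<le> j" "N \<le> k"
   have zz: "0 \<le> 1 / (real j + 1)" for j :: nat by simp
   have x4: "4 * (K * (2 * \<delta> j + 2 * \<delta> k)) = 8 * K * \<delta> j + 8 * K * \<delta> k" for j k by (simp add: algebra_simps)
   show "Re (nf.Q (\<lambda>x. \<Phi> j x - \<Phi> k x) (\<lambda>x. \<Phi> j x - \<Phi> k x)) < e"
    using Qb[of j k] N[OF jk(1)] N[OF jk(2)] x4[of j k] zz[of j] by linarith
  qed
 qed
 have adj: "adjoint_graph M (TF) (P1 a b m) (U v) (\<lambda>r. v r + z^2 * U v r)" unfolding adjoint_graph_def
 proof (intro conjI UL ballI)
  show "(\<lambda>r. v r + z^2 * U v r) \<in> L2" by (intro L2_space_add v L2_space_scale UL)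
  fix \<theta> assume t: "\<theta> \<in> TF"
  have \<theta>L: "\<theta> \<in> L2" "P1 a b m \<theta> \<in> L2" by (rule test_L2[OF t])+
  have add: "L2_inner M (\<lambda>r. v r + z^2 * u r) \<theta> = L2_inner M v \<theta> + z^2 * L2_inner M u \<theta>"
   if "v \<in> L2" "u \<in> L2" for u v
  proof -
   have "L2_inner M (\<lambda>r. v r + z^2 * u r) \<theta> = L2_inner M (\<lambda>r. v r - (- z\<^sup>2) * u r) \<theta>" by simp
   also have "\<dots> = L2_inner M v \<theta> - (- z\<^sup>2) * L2_inner M u \<theta>"
    unfolding L2_inner_diff_left[OF that(1) L2_space_scale[OF that(2)] \<theta>L(1)] L2_inner_scale_left ..
   finally show ?thesis by simp
  qed
  have "L2_inner M (un n) (P1 a b m \<theta>) = L2_inner M (vn n) \<theta> + z^2 * L2_inner M (un n) \<theta>" for n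
  proof -
   have "continuous_on I (vn n)" using vn(1)[of n] unfolding Cc_def by (auto intro: continuous_on_subset)
   from green[OF t pn(1) this] show ?thesis unfolding add[OF vL uL, symmetric] by (simp add: L2_inner_def)
  qed
  moreover have "(\<lambda>n. L2_inner M (un n) (P1 a b m \<theta>)) \<longlonglongrightarrow> L2_inner M (U v) (P1 a b m \<theta>)"
   by (rule L2_inner_tendsto_left[OF uL UL \<theta>L(2) ulim])
  moreover have "(\<lambda>n. L2_inner M (vn n) \<theta> + z^2 * L2_inner M (un n) \<theta>) \<longlonglongrightarrow> L2_inner M v \<theta> + z^2 * L2_inner M (U v) \<theta>"
   by (intro tendsto_add tendsto_mult tendsto_const L2_inner_tendsto_left[OF vL v \<theta>L(1) \<delta>[unfolded \<delta>_def]] L2_inner_tendsto_left[OF uL UL \<theta>L(1) ulim])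
  ultimately have "L2_inner M (U v) (P1 a b m \<theta>) = L2_inner M v \<theta> + z^2 * L2_inner M (U v) \<theta>" using LIMSEQ_unique by (simp only:)
  then show "L2_inner M (U v) (P1 a b m \<theta>) = L2_inner M (\<lambda>r. v r + z^2 * U v r) \<theta>" unfolding add[OF v UL] .
 qed
 show ?thesis unfolding P1_graph_def friedrichs_graph_def using form adj by simp
qed

end

section \<open>Existence and uniqueness of the resolvent kernel\<close>

context radial
begin

lemma inner_cong:
 assumes "\<And>r. r \<in> I \<Longrightarrow> u r = u' r"
 shows "L2_inner M u g = L2_inner M u' g" (is ?A) "sqn M (\<lambda>x. h x - u x) = sqn M (\<lambda>x. h x - u' x)" (is ?B)
  "u \<in> L2 \<longleftrightarrow> u' \<in> L2" (is ?C)
proof -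
 show ?A unfolding L2_inner_def by (rule Bochner_Integration.integral_cong) (use assms in auto)
 show ?B unfolding sqn_def by (rule Bochner_Integration.integral_cong) (use assms in auto)
 have "u \<in> borel_measurable M \<longleftrightarrow> u' \<in> borel_measurable M" by (rule measurable_cong) (use assms in auto)
 moreover have "integrable M (\<lambda>x. (cmod (u x))^2) \<longleftrightarrow> integrable M (\<lambda>x. (cmod (u' x))^2)"
  by (rule Bochner_Integration.integrable_cong) (use assms in auto)
 ultimately show ?C by (auto simp: L2_space_def)
qed

text \<open>\<open>U v\<close> and the integral against the kernel are compared on \<open>I\<close>
  only; the graph depends on nothing else.\<close>

lemma P1_graph_cong:
 assumes u: "\<And>r. r \<in> I \<Longrightarrow> u r = u' r" and w: "\<And>r. r \<in> I \<Longrightarrow> w r = w' r" and g: "P1_graph a b m u w"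
 shows "P1_graph a b m u' w'"
proof -
 have 1: "L2_inner M u h = L2_inner M u' h" "L2_inner M w h = L2_inner M w' h" "sqn M (\<lambda>x. h x - u x) = sqn M (\<lambda>x. h x - u' x)"
  "u \<in> L2 \<longleftrightarrow> u' \<in> L2" "w \<in> L2 \<longleftrightarrow> w' \<in> L2" for h
  by (rule inner_cong, rule u, assumption) (rule inner_cong, rule w, assumption, (rule inner_cong, rule u, assumption)+, rule inner_cong, rule w)
 show ?thesis using g unfolding P1_graph_def friedrichs_graph_def nf.form_domain_iff adjoint_graph_def 1 .
qed

end

context resolvent
begin

theorem resolvent_kernel: "is_resolvent_kernel a b m z R" unfolding is_resolvent_kernel_def Let_def
proof (intro conjI ballI allI impI)
 show "continuous_on (I \<times> I) (\<lambda>(r, r'). R r r')" by (rule cont_R)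
 fix v assume v: "v \<in> L2"
 show "set_integrable lborel I (\<lambda>r'. R r r' * v r')" if "- 1 / a < r" for r using U_LBINT(1)[OF _ v, of r] that by simp
 show "P1_graph a b m (\<lambda>r. LBINT r':I. R r r' * v r') (\<lambda>r. v r + z^2 * (LBINT r':I. R r r' * v r'))"
 proof (rule P1_graph_cong[OF _ _ U_graph[OF v]])
  show e: "U v r = (LBINT r':I. R r r' * v r')" if "r \<in> I" for r using U_LBINT(2)[OF that v] by (rule sym)
  show "v r + z^2 * U v r = v r + z^2 * (LBINT r':I. R r r' * v r')" if "r \<in> I" for r unfolding e[OF that] ..
 qed
qed

end

context radial
begin

text \<open>If two kernels differ at a point, then on a product of small intervals their difference
  has, after a rotation, real part bounded below. Applied to the indicator of the second interval
  they give solutions that differ on the whole first interval, while the difference is an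
  eigenfunction and so vanishes almost everywhere.\<close>

theorem resolvent_kernel_unique:
 assumes z: "Im z > 0" and k1: "is_resolvent_kernel a b m z R1" and k2: "is_resolvent_kernel a b m z R2"
  and rs: "r0 \<in> I" "s0 \<in> I"
 shows "R1 r0 s0 = R2 r0 s0"
proof (rule ccontr)
 assume ne: "R1 r0 s0 \<noteq> R2 r0 s0"
 define D where "D = (\<lambda>r s. R1 r s - R2 r s)"
 define D0 where "D0 = D r0 s0"
 have D0: "D0 \<noteq> 0" using ne by (simp add: D0_def D_def)
 have c1: "continuous_on (I \<times> I) (\<lambda>(r, s). R1 r s)" and c2: "continuous_on (I \<times> I) (\<lambda>(r, s). R2 r s)"
  using k1 k2 unfolding is_resolvent_kernel_def by auto
 \<comment> \<open>Rotated so that the value at the given point is |D0|^2; continuity keeps it above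
   half of that nearby.\<close>
 define H where "H = (\<lambda>x. Re (cnj D0 * ((case x of (r, s) \<Rightarrow> R1 r s) - (case x of (r, s) \<Rightarrow> R2 r s))))"
 have cH: "continuous_on (I \<times> I) H" unfolding H_def by (intro continuous_intros c1 c2)
 define \<eta> where "\<eta> = (cmod D0)^2 / 2"
 have \<eta>: "\<eta> > 0" using D0 by (simp add: \<eta>_def)
 have H0: "H (r0, s0) = (cmod D0)^2"
 proof -
  have e: "R1 r0 s0 - R2 r0 s0 = D0" by (simp add: D0_def D_def)
  have "H (r0, s0) = (Re D0)^2 + (Im D0)^2" by (simp add: H_def e power2_eq_square)
  then show ?thesis by (simp only: cmod_power2)
 qed
 have oS: "open ((I \<times> I) \<inter> H -` {\<eta><..})" by (rule continuous_open_preimage[OF cH]) (auto intro: open_Times)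
 have xS: "(r0, s0) \<in> (I \<times> I) \<inter> H -` {\<eta><..}" using rs H0 \<eta> by (simp add: \<eta>_def)
 obtain A B where AB: "open A" "open B" "(r0, s0) \<in> A \<times> B" "A \<times> B \<subseteq> (I \<times> I) \<inter> H -` {\<eta><..}"
  using oS[unfolded open_prod_def, THEN bspec, OF xS] by (elim exE conjE) (rule that)
 from AB(3) have "r0 \<in> A" "s0 \<in> B" by auto
 then obtain e1 e2 where e1: "e1 > 0" "cball r0 e1 \<subseteq> A" and e2: "e2 > 0" "cball s0 e2 \<subseteq> B"
  using open_contains_cball[THEN iffD1, OF AB(1), rule_format] open_contains_cball[THEN iffD1, OF AB(2), rule_format] by blast
 have sub: "H (r, s) > \<eta>" "r \<in> I" "s \<in> I" if "r \<in> {r0 - e1..r0 + e1}" "s \<in> {s0 - e2..s0 + e2}" for r s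
 proof -
  have "r \<in> cball r0 e1" "s \<in> cball s0 e2" using that by (auto simp: dist_real_def)
  then have "(r, s) \<in> A \<times> B" using e1 e2 by auto
  then show "H (r, s) > \<eta>" "r \<in> I" "s \<in> I" using AB(4) by auto
 qed
 define c where "c = s0 - e2"
 define d where "d = s0 + e2"
 have cd: "- 1 / a < c" "c < d" using sub(3)[of r0 c] e1(1) e2(1) by (auto simp: c_def d_def)
 define v where "v = (\<lambda>s. indicator {c..d} s :: complex)"
 have vL: "v \<in> L2"
 proof (rule compact_L2[OF cd(1), where B = 1 and d = d])
  show "v \<in> borel_measurable M" unfolding v_def by (rule meas_M_borel) simp
 qed (auto simp: v_def)
 define u1 where "u1 = (\<lambda>r. LBINT r':I. R1 r r' * v r')"
 define u2 where "u2 = (\<lambda>r. LBINT r':I. R2 r r' * v r')"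
 have i: "set_integrable lborel I (\<lambda>r'. R1 r r' * v r')" "set_integrable lborel I (\<lambda>r'. R2 r r' * v r')" if "r \<in> I" for r
  using k1 k2 vL that unfolding is_resolvent_kernel_def by auto
 have g: "P1_graph a b m u1 (\<lambda>r. v r + z^2 * u1 r)" "P1_graph a b m u2 (\<lambda>r. v r + z^2 * u2 r)"
  using k1 k2 vL unfolding is_resolvent_kernel_def Let_def u1_def u2_def by auto
 have eq: "(\<lambda>r. (v r + z^2 * u1 r) - (v r + z^2 * u2 r)) = (\<lambda>r. z^2 * (u1 r - u2 r))" by (simp add: algebra_simps)
 have "friedrichs_graph M (TF) (P1 a b m) (\<lambda>r. u1 r - u2 r) (\<lambda>r. z^2 * (u1 r - u2 r))"
  using nf.friedrichs_diff[OF g[unfolded P1_graph_def]] unfolding eq .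
 from nf.friedrichs_eigen_zero[OF this z] have AE0: "AE r in M. u1 r - u2 r = 0" .
 have "- 1 / a \<le> r0 - e1" using sub(2)[of "r0 - e1" s0] e1(1) e2(1) by auto
 \<comment> \<open>The two solutions agree almost everywhere, hence at some point of the interval,
   and one such point is enough.\<close>
 then obtain r where r: "r \<in> {r0 - e1<..<r0 + e1}" "u1 r - u2 r = 0" using AE_M_interval[OF AE0, of "r0 - e1" "r0 + e1"] e1(1) by auto
 have rI: "r \<in> I" using sub(2)[of r s0] r(1) e2(1) by auto
 have si: "set_integrable lborel I (\<lambda>s. R1 r s * v s - R2 r s * v s)" by (rule set_integral_diff(1)[OF i[OF rI]])
 have "u1 r - u2 r = (LBINT s:I. R1 r s * v s - R2 r s * v s)" unfolding u1_def u2_def by (rule set_integral_diff(2)[OF i[OF rI], symmetric])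
 then have "(LBINT s:I. R1 r s * v s - R2 r s * v s) = 0" using r(2) by simp
 then have z0: "Re (cnj D0 * (LBINT s:I. R1 r s * v s - R2 r s * v s)) = 0" by simp
 have ptw: "indicator {c..d} s * \<eta> \<le> Re (cnj D0 * (indicator I s *\<^sub>R (R1 r s * v s - R2 r s * v s)))" for s
 proof (cases "s \<in> {c..d}")
  case True
  then have "H (r, s) > \<eta>" "s \<in> I" using sub[of r s] r(1) by (auto simp: c_def d_def)
  then show ?thesis using True by (simp add: H_def v_def)
 qed (simp add: v_def)
 have ii: "integrable lborel (\<lambda>s. cnj D0 * (indicator I s *\<^sub>R (R1 r s * v s - R2 r s * v s)))"
  using si unfolding set_integrable_def by (rule integrable_mult_right)
 have "\<eta> * (d - c) = (\<integral>s. indicator {c..d} s * \<eta> \<partial>lborel)" using cd by (simp add: mult.commute)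
 also have "\<dots> \<le> (\<integral>s. Re (cnj D0 * (indicator I s *\<^sub>R (R1 r s * v s - R2 r s * v s))) \<partial>lborel)"
 proof (rule integral_mono)
  show "integrable lborel (\<lambda>s. indicator {c..d} s * \<eta>)"
   by (rule integrable_mult_left) (simp add: integrable_indicator_iff emeasure_lborel_Icc_eq)
  show "integrable lborel (\<lambda>s. Re (cnj D0 * (indicator I s *\<^sub>R (R1 r s * v s - R2 r s * v s))))" using ii by (rule integrable_Re)
 qed (rule ptw)
 also have "\<dots> = Re (cnj D0 * (LBINT s:I. R1 r s * v s - R2 r s * v s))"
  unfolding set_lebesgue_integral_def integral_Re[OF ii] by (simp only: integral_mult_right_zero)
 finally have "\<eta> * (d - c) \<le> 0" using z0 by simp
 moreover have "\<eta> * (d - c) > 0" using \<eta> cd by simp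
 ultimately show False by linarith
qed

end

section \<open>Solutions recessive at the two ends\<close>

lemma bounded_of_tendsto_at_top:
 fixes g :: "real \<Rightarrow> complex"
 assumes c: "continuous_on {0..} g" and l: "(g \<longlongrightarrow> l) at_top"
 obtains C where "C \<ge> 0" "\<And>t. t \<ge> 0 \<Longrightarrow> cmod (g t) \<le> C"
proof -
 have "eventually (\<lambda>t. dist (g t) l < 1) at_top" using l by (rule tendstoD) simp
 then obtain T where T: "\<And>t. t \<ge> T \<Longrightarrow> dist (g t) l < 1" by (auto simp: eventually_at_top_linorder)
 have "compact (g ` {0..T})" by (intro compact_continuous_image continuous_on_subset[OF c]) auto
 from compact_imp_bounded[OF this] obtain B where "\<forall>x\<in>g ` {0..T}. cmod x \<le> B" unfolding bounded_iff by blast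
 then have B: "cmod (g t) \<le> B" if "t \<in> {0..T}" for t using that by blast
 show ?thesis
 proof (rule that[of "max B (cmod l + 1)"])
  show "0 \<le> max B (cmod l + 1)" using norm_ge_zero[of l] by linarith
  fix t :: real assume "t \<ge> 0"
  show "cmod (g t) \<le> max B (cmod l + 1)"
  proof (cases "t \<le> T")
   case False
   have "cmod (g t) \<le> cmod l + dist (g t) l" unfolding dist_norm by (rule norm_triangle_sub)
   then show ?thesis using T[of t] False by simp
  qed (use B[of t] \<open>t \<ge> 0\<close> in auto)
 qed
qed

lemma exp_decay_at_top:
 assumes "Re \<rho> > 0"
 shows "((\<lambda>t::real. exp (- \<rho> * of_real t)) \<longlongrightarrow> 0) at_top"
proof (rule tendsto_norm_zero_cancel)
 have "((\<lambda>t::real. exp (- (Re \<rho> * t))) \<longlongrightarrow> 0) at_top" using assms by real_asymp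
 then show "((\<lambda>t::real. cmod (exp (- \<rho> * of_real t))) \<longlongrightarrow> 0) at_top" by simp
qed

lemma hyp01_0 [simp]: "hyp01 B 0 = 1" by (simp add: hyp01_def eval_fps_at_0 hyp01_fps_def)

text \<open>The argument of 0F1 tends to 0 as t grows, and the series equals 1 there.\<close>

lemma dec_sol_limit:
 fixes c :: real
 assumes d: "\<And>k. cmod (2 * \<rho> / of_real c + 1 + of_nat k) \<ge> d" "d > 0" and c: "c > 0"
 shows "((\<lambda>t::real. exp (\<rho> * of_real t) * dec_sol \<rho> B (of_real c) (of_real t)) \<longlongrightarrow> 1) at_top" (is ?A)
  and "((\<lambda>t::real. exp (\<rho> * of_real t) * dec_sol' \<rho> B (of_real c) (of_real t)) \<longlongrightarrow> - \<rho>) at_top" (is ?B)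
proof -
 define q where "q = 2 * \<rho> / of_real c + 1"
 have dq: "\<And>k. cmod (q + of_nat k) \<ge> d" using d(1) by (simp add: q_def)
 define E where "E = (\<lambda>t::real. exp (- of_real c * of_real t) :: complex)"
 have E: "(E \<longlongrightarrow> 0) at_top" unfolding E_def by (rule exp_decay_at_top) (use c in simp)
 have X: "((\<lambda>t. B / (of_real c)^2 * E t) \<longlongrightarrow> 0) at_top" by (rule tendsto_mult_right_zero[OF E])
 have h: "((\<lambda>t. hyp01 b (B / (of_real c)^2 * E t)) \<longlongrightarrow> 1) at_top" if "\<And>k. cmod (b + of_nat k) \<ge> d" for b
  using isCont_tendsto_compose[OF DERIV_isCont[OF hyp01_deriv[OF that d(2)]] X] by simp
 have q2: "2 * \<rho> / of_real c + 2 = q + 1" by (simp add: q_def)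
 have ee: "exp (\<rho> * of_real t) * (exp (- \<rho> * of_real t) * x) = x" for t x by (simp add: exp_minus field_simps)
 show ?A
  unfolding dec_sol_def ee using h[OF dq] unfolding E_def q_def .
 have "((\<lambda>t. - \<rho> * hyp01 q (B / (of_real c)^2 * E t) - B / of_real c * E t / q * hyp01 (q + 1) (B / (of_real c)^2 * E t)) \<longlongrightarrow>
   - \<rho> * 1 - 0 / q * 1) at_top" using dq[of 0] d(2)
  by (intro tendsto_diff tendsto_mult tendsto_divide tendsto_const h dq shift_norm_ge(1)[OF dq] tendsto_mult_right_zero[OF E]) auto
 then show ?B
  unfolding dec_sol'_def ee q2 by (simp add: E_def q_def)
qed

lemma dec_sol_holomorphic:
 assumes U: "open U" and h: "\<rho> holomorphic_on U" "B holomorphic_on U" and c: "c \<noteq> 0"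
  and d: "\<And>z. z \<in> U \<Longrightarrow> \<exists>V d. open V \<and> z \<in> V \<and> d > 0 \<and> (\<forall>w\<in>V. \<forall>k. cmod (2 * \<rho> w / c + 1 + of_nat k) \<ge> d)"
 shows "(\<lambda>z. dec_sol (\<rho> z) (B z) c t) holomorphic_on U" (is ?A) "(\<lambda>z. dec_sol' (\<rho> z) (B z) c t) holomorphic_on U" (is ?B)
proof -
 have nz: "2 * \<rho> z / c + 1 \<noteq> 0" if z: "z \<in> U" for z
 proof -
  obtain V d where "z \<in> V" "d > 0" "\<forall>w\<in>V. \<forall>k. cmod (2 * \<rho> w / c + 1 + of_nat k) \<ge> d" using d[OF z] by blast
  then have "cmod (2 * \<rho> z / c + 1) \<ge> d" "d > 0" by (auto dest!: bspec[of _ _ z] spec[of _ 0])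
  then show ?thesis by auto
 qed
 have d2: "\<exists>V d. open V \<and> z \<in> V \<and> d > 0 \<and> (\<forall>w\<in>V. \<forall>k. cmod (2 * \<rho> w / c + 2 + of_nat k) \<ge> d)" if z: "z \<in> U" for z
 proof -
  obtain V d where V: "open V" "z \<in> V" "d > 0" "\<And>w k. w \<in> V \<Longrightarrow> cmod (2 * \<rho> w / c + 1 + of_nat k) \<ge> d" using d[OF z] by blast
  have "cmod (2 * \<rho> w / c + 2 + of_nat k) \<ge> d" if "w \<in> V" for w k using V(4)[OF that, of "Suc k"] by (simp add: algebra_simps)
  then show ?thesis using V(1-3) by blast
 qed
 have h1: "(\<lambda>z. hyp01 (2 * \<rho> z / c + 1) (B z / c^2 * exp (- c * t))) holomorphic_on U"
  by (rule hyp01_holomorphic[OF U _ _ d]) (use c in \<open>auto intro!: holomorphic_intros h\<close>)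
 have h2: "(\<lambda>z. hyp01 (2 * \<rho> z / c + 2) (B z / c^2 * exp (- c * t))) holomorphic_on U"
  by (rule hyp01_holomorphic[OF U _ _ d2]) (use c in \<open>auto intro!: holomorphic_intros h\<close>)
 show ?A unfolding dec_sol_def by (intro holomorphic_intros h h1)
 show ?B unfolding dec_sol'_def by (intro holomorphic_intros h h1 h2 nz) (use c in auto)
qed

context radial
begin

definition \<beta> :: real where "\<beta> = - b"
definition \<nu> :: real where "\<nu> = real_of_int m / a"

lemma \<beta>\<nu>: "\<beta> > 0" "\<nu> > 0" using a b m by (simp_all add: \<beta>_def \<nu>_def)

text \<open>In the variable t = - ln (1 + a r) the cone point lies at infinity, and Bessel's
  equation turns into one with an exponential potential.\<close>

definition tl :: "real \<Rightarrow> complex" where "tl r = of_real (- ln (1 + a * r))"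

lemma x_pos: "r \<in> I \<Longrightarrow> 1 + a * r > 0" using a by (simp add: field_simps)

lemma left_ode:
 assumes Y: "\<And>t. (Y has_field_derivative Y' t) (at t)"
  and Y': "\<And>t. (Y' has_field_derivative (of_real (\<nu>^2) + - (z / of_real a)\<^sup>2 * exp (- 2 * t)) * Y t) (at t)"
  and r: "r \<in> I"
 shows "((\<lambda>r. Y (tl r)) has_vector_derivative - of_real a * Y' (tl r) / of_real (1 + a * r)) (at r)" (is ?A)
  and "((\<lambda>r. - of_real a * Y' (tl r)) has_vector_derivative
   (of_real (m2 / (1 + a * r)) - z^2 * of_real (1 + a * r)) * Y (tl r)) (at r)" (is ?B)
proof -
 define x where "x = 1 + a * r"
 have x: "x > 0" using x_pos[OF r] by (simp add: x_def)
 have "((\<lambda>r. - ln (1 + a * r)) has_real_derivative - (a / x)) (at r)" using x by (auto simp: x_def intro!: derivative_eq_intros)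
 then have T: "(tl has_vector_derivative of_real (- (a / x))) (at r)" unfolding tl_def[abs_def] by (rule has_vector_derivative_of_real)
 have "((Y \<circ> tl) has_vector_derivative of_real (- (a / x)) * Y' (tl r)) (at r)" by (rule field_vector_diff_chain_at[OF T Y])
 moreover have "of_real (- (a / x)) * Y' (tl r) = - of_real a * Y' (tl r) / of_real x" by simp
 ultimately show ?A by (simp only: o_def x_def)
 have "- 2 * tl r = of_real (2 * ln x)" by (simp add: tl_def x_def)
 also have "2 * ln x = ln (x^2)" using x by (simp add: ln_realpow)
 finally have "exp (- 2 * tl r) = of_real (x^2)" using x by (simp only: exp_of_real) simp
 note D = field_vector_diff_chain_at[OF T Y', unfolded this]
 have "((\<lambda>r. - of_real a * (Y' \<circ> tl) r) has_vector_derivative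
   - of_real a * (of_real (- (a / x)) * ((of_real (\<nu>^2) + - (z / of_real a)\<^sup>2 * of_real (x^2)) * Y (tl r)))) (at r)"
  by (intro has_vector_derivative_mult_right D)
 moreover have "- of_real a * (of_real (- (a / x)) * ((of_real (\<nu>^2) + - (z / of_real a)\<^sup>2 * of_real (x^2)) * Y (tl r)))
   = (of_real (m2 / x) - z^2 * of_real x) * Y (tl r)"
 proof -
  define A X N :: complex where "A = of_real a" and "X = of_real x" and "N = of_int m"
  have nz: "A \<noteq> 0" "X \<noteq> 0" using a x by (auto simp: A_def X_def)
  have "- A * (- (A / X) * (((N / A)^2 + - (z / A)\<^sup>2 * X^2) * Y (tl r))) = (N^2 / X - z^2 * X) * Y (tl r)"
   using nz by (simp add: field_simps power2_eq_square)
  then show ?thesis by (simp add: A_def X_def N_def \<nu>_def power_divide)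
 qed
 ultimately show ?B by (simp only: o_def x_def)
qed

text \<open>Conjugation by f^(1/2) = exp (\<beta> r / 2) removes the first-order term on the funnel
  at the price of the constant \<beta>^2 / 4 in the potential.\<close>

lemma right_ode:
 fixes r :: real
 defines "H \<equiv> of_real (\<beta> / 2) :: complex"
 assumes Y: "\<And>t. (Y has_field_derivative Y' t) (at t)"
  and Y': "\<And>t. (Y' has_field_derivative (of_real (\<beta>^2 / 4) - z^2 + (of_int m)^2 * exp (- (2 * of_real \<beta>) * t)) * Y t) (at t)"
 shows "((\<lambda>r. exp (- H * of_real r) * Y (of_real r)) has_vector_derivative
   exp (H * of_real r) * (Y' (of_real r) - H * Y (of_real r)) / of_real (exp (\<beta> * r))) (at r)" (is ?A)
  and "((\<lambda>r. exp (H * of_real r) * (Y' (of_real r) - H * Y (of_real r))) has_vector_derivative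
   (of_real (m2 / exp (\<beta> * r)) - z^2 * of_real (exp (\<beta> * r))) * (exp (- H * of_real r) * Y (of_real r))) (at r)" (is ?B)
proof -
 define R :: complex where "R = of_real r"
 define E where "E = exp (H * R)"
 define K where "K = exp (- H * R)"
 have EK: "K = inverse E" "E \<noteq> 0" by (simp_all add: E_def K_def exp_minus)
 have "H * R + H * R = of_real (\<beta> * r)" by (simp add: H_def R_def)
 then have fE: "of_real (exp (\<beta> * r)) = E * E" unfolding exp_of_real[symmetric] E_def exp_add[symmetric] by simp
 have e4: "exp (- (2 * of_real \<beta>) * R) = K * K * K * K" unfolding K_def exp_add[symmetric] by (simp add: H_def algebra_simps)
 define y y' where "y = Y R" and "y' = Y' R"
 have "((\<lambda>w. exp (- H * w) * Y w) has_field_derivative (exp (- H * R) * - H) * Y R + exp (- H * R) * Y' R) (at R)"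
  by (auto intro!: derivative_eq_intros Y)
 moreover have "(exp (- H * R) * - H) * Y R + exp (- H * R) * Y' R = E * (y' - H * y) / (E * E)"
  unfolding K_def[symmetric] y_def[symmetric] y'_def[symmetric] EK(1) using EK(2) by (simp add: field_simps)
 ultimately have "((\<lambda>w. exp (- H * w) * Y w) has_field_derivative E * (y' - H * y) / of_real (exp (\<beta> * r))) (at R)" by (simp only: fE)
 from has_vector_derivative_real_field[OF this[unfolded R_def]]
 show ?A by (simp only: E_def y_def y'_def R_def)
 define Y2 where "Y2 = (of_real (\<beta>^2 / 4) - z^2 + (of_int m)^2 * exp (- (2 * of_real \<beta>) * R)) * Y R"
 have H2: "of_real (\<beta>^2 / 4) = H * H" by (simp add: H_def power2_eq_square)
 have "((\<lambda>w. exp (H * w) * (Y' w - H * Y w)) has_field_derivative (exp (H * R) * H) * (Y' R - H * Y R) + exp (H * R) * (Y2 - H * Y' R)) (at R)"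
  unfolding Y2_def by (rule derivative_eq_intros Y Y' refl)+ simp
 moreover have "(exp (H * R) * H) * (Y' R - H * Y R) + exp (H * R) * (Y2 - H * Y' R)
   = ((of_int m)^2 / (E * E) - z^2 * (E * E)) * (K * y)" unfolding Y2_def H2 e4 E_def[symmetric] y_def[symmetric] y'_def[symmetric] EK(1) using EK(2)
  by (simp add: divide_simps power2_eq_square) (simp add: algebra_simps)
 ultimately have "((\<lambda>w. exp (H * w) * (Y' w - H * Y w)) has_field_derivative
   (of_real (m2 / exp (\<beta> * r)) - z^2 * of_real (exp (\<beta> * r))) * (K * y)) (at R)"
  by (simp only: fE of_real_divide of_real_power of_real_of_int_eq)
 from has_vector_derivative_real_field[OF this[unfolded R_def]]
 show ?B
  by (simp only: K_def y_def R_def)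
qed

lemma system_left_right:
 assumes Y: "\<And>t. (Y has_field_derivative Y' t) (at t)"
  "\<And>t. (Y' has_field_derivative (of_real (\<nu>^2) + - (z / of_real a)\<^sup>2 * exp (- 2 * t)) * Y t) (at t)"
  and V: "\<And>t. (V has_field_derivative V' t) (at t)"
  "\<And>t. (V' has_field_derivative (of_real (\<beta>^2 / 4) - z^2 + (of_int m)^2 * exp (- (2 * of_real \<beta>) * t)) * V t) (at t)"
  and e: "Y 0 = V 0" "- of_real a * Y' 0 = V' 0 - of_real (\<beta> / 2) * V 0"
 shows "system z (\<lambda>_. 0) (\<lambda>r. if r \<le> 0 then Y (tl r) else exp (- of_real (\<beta> / 2) * of_real r) * V (of_real r))
   (\<lambda>r. if r \<le> 0 then - of_real a * Y' (tl r) else exp (of_real (\<beta> / 2) * of_real r) * (V' (of_real r) - of_real (\<beta> / 2) * V (of_real r)))"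
proof (rule system_glue)
 note L = left_ode[OF Y] and R = right_ode[OF V]
 show "continuous_on I (\<lambda>r. Y (tl r))" "continuous_on I (\<lambda>r. - of_real a * Y' (tl r))"
  by (rule continuous_at_imp_continuous_on, rule ballI, rule has_vector_derivative_continuous[OF L(1)], assumption)
   (rule continuous_at_imp_continuous_on, rule ballI, rule has_vector_derivative_continuous[OF L(2)], assumption)
 show "continuous_on I (\<lambda>r. exp (- of_real (\<beta> / 2) * of_real r) * V (of_real r))"
  "continuous_on I (\<lambda>r. exp (of_real (\<beta> / 2) * of_real r) * (V' (of_real r) - of_real (\<beta> / 2) * V (of_real r)))"
  by (rule continuous_at_imp_continuous_on, rule ballI, rule has_vector_derivative_continuous[OF R(1)])
   (rule continuous_at_imp_continuous_on, rule ballI, rule has_vector_derivative_continuous[OF R(2)])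
 show "Y (tl 0) = exp (- of_real (\<beta> / 2) * of_real 0) * V (of_real 0)"
  "- of_real a * Y' (tl 0) = exp (of_real (\<beta> / 2) * of_real 0) * (V' (of_real 0) - of_real (\<beta> / 2) * V (of_real 0))"
  using e by (simp_all add: tl_def)
 fix r assume r: "r \<in> I"
 show "((\<lambda>r. Y (tl r)) has_vector_derivative - of_real a * Y' (tl r) / of_real (f r)) (at r) \<and>
   ((\<lambda>r. - of_real a * Y' (tl r)) has_vector_derivative
   pot z r * Y (tl r)) (at r)" if "r < 0"
 proof -
  have "f r = 1 + a * r" using that by (simp add: f1_def)
  then show ?thesis using L[OF r] by simp
 qed
 show "((\<lambda>r. exp (- of_real (\<beta> / 2) * of_real r) * V (of_real r)) has_vector_derivative
    exp (of_real (\<beta> / 2) * of_real r) * (V' (of_real r) - of_real (\<beta> / 2) * V (of_real r)) / of_real (f r)) (at r) \<and>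
   ((\<lambda>r. exp (of_real (\<beta> / 2) * of_real r) * (V' (of_real r) - of_real (\<beta> / 2) * V (of_real r))) has_vector_derivative
   pot z r * (exp (- of_real (\<beta> / 2) * of_real r) * V (of_real r))) (at r)" if "r > 0"
 proof -
  have "f r = exp (\<beta> * r)" using that by (simp add: f1_def \<beta>_def)
  then show ?thesis using R[of r] by (simp only: simp_thms)
 qed
qed

end

lemma dec_sol_tendsto_0:
 fixes c :: real
 assumes d: "\<And>k. cmod (2 * \<rho> / of_real c + 1 + of_nat k) \<ge> d" "d > 0" and c: "c > 0" and \<rho>: "Re \<rho> > 0"
 shows "((\<lambda>t::real. dec_sol \<rho> B (of_real c) (of_real t)) \<longlongrightarrow> 0) at_top" (is ?A)
  and "((\<lambda>t::real. dec_sol' \<rho> B (of_real c) (of_real t)) \<longlongrightarrow> 0) at_top" (is ?B)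
proof -
 have e: "exp (- \<rho> * of_real t) * (exp (\<rho> * of_real t) * x) = x" for t x by (simp add: exp_minus field_simps)
 show ?A
  using tendsto_mult[OF exp_decay_at_top[OF \<rho>] dec_sol_limit(1)[OF d c]] unfolding e by simp
 show ?B
  using tendsto_mult[OF exp_decay_at_top[OF \<rho>] dec_sol_limit(2)[OF d c]] unfolding e by simp
qed

lemma dec_sol_nonzero:
 fixes c :: real
 assumes d: "\<And>k. cmod (2 * \<rho> / of_real c + 1 + of_nat k) \<ge> d" "d > 0" and c: "c > 0"
 shows "\<exists>t>0. dec_sol \<rho> B (of_real c) (of_real t) \<noteq> 0"
proof -
 have "eventually (\<lambda>t::real. exp (\<rho> * of_real t) * dec_sol \<rho> B (of_real c) (of_real t) \<noteq> 0) at_top"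
  using dec_sol_limit(1)[OF d c] by (rule tendsto_imp_eventually_ne) simp
 then have "eventually (\<lambda>t::real. t > 0 \<and> exp (\<rho> * of_real t) * dec_sol \<rho> B (of_real c) (of_real t) \<noteq> 0) at_top"
  using eventually_gt_at_top[of "0::real"] by eventually_elim simp
 then obtain t :: real where "t > 0 \<and> exp (\<rho> * of_real t) * dec_sol \<rho> B (of_real c) (of_real t) \<noteq> 0"
  using eventually_happens'[OF trivial_limit_at_top_linorder] by blast
 then show ?thesis by auto
qed

lemma Re_csqrt_pos: "w \<notin> \<real>\<^sub>\<le>\<^sub>0 \<Longrightarrow> Re (csqrt w) > 0"
proof -
 assume w: "w \<notin> \<real>\<^sub>\<le>\<^sub>0"
 have "Re (csqrt w) \<noteq> 0"
 proof
  assume 0: "Re (csqrt w) = 0"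
  have "Re ((csqrt w)^2) \<le> 0" "Im ((csqrt w)^2) = 0" unfolding Re_power2 Im_power2 0 by simp_all
  then show False using w by (simp add: complex_nonpos_Reals_iff)
 qed
 then show ?thesis using csqrt_principal[of w] by auto
qed

section \<open>The two recessive solutions and their dependence on z\<close>

context radial
begin

definition \<Omega> :: "complex set" where "\<Omega> = {z. Im z > 0 \<or> Re z > \<beta> / 2}"

lemma \<Omega>_eq: "\<Omega> = {z. Im z > 0} \<union> {z. Re z > \<beta> / 2}" by (auto simp: \<Omega>_def)

lemma open_\<Omega>: "open \<Omega>" unfolding \<Omega>_eq by (intro open_Un open_halfspace_Im_gt open_halfspace_Re_gt)

lemma connected_\<Omega>: "connected \<Omega>"
proof -
 have "Complex \<beta> 1 \<in> {z. Im z > 0} \<inter> {z. Re z > \<beta> / 2}" using \<beta>\<nu> by simp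
 then have "{z. Im z > 0} \<inter> {z. Re z > \<beta> / 2} \<noteq> {}" by blast
 then show ?thesis unfolding \<Omega>_eq by (intro connected_Un convex_connected convex_halfspace_Im_gt convex_halfspace_Re_gt)
qed

text \<open>The branch of \<open>sqrt (z\<^sup>2 - \<beta>\<^sup>2 / 4)\<close> for which \<open>exp (\<i> * \<sigma> z * r)\<close> decays when \<open>Im z > 0\<close>.\<close>

definition \<sigma> :: "complex \<Rightarrow> complex" where
 "\<sigma> z = (if Im z > 0 then \<i> * csqrt (of_real (\<beta>^2 / 4) - z^2) else csqrt (z^2 - of_real (\<beta>^2 / 4)))"

lemma \<sigma>_square: "(\<sigma> z)^2 = z^2 - of_real (\<beta>^2 / 4)" by (simp add: \<sigma>_def power_mult_distrib)

text \<open>Keeps each square root off its cut on the half-plane where it is used; the branch point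
  \<beta> / 2 of the second one is the boundary of the region of continuation.\<close>

lemma radicand:
 shows "Im z > 0 \<Longrightarrow> of_real (\<beta>^2 / 4) - z^2 \<notin> \<real>\<^sub>\<le>\<^sub>0"
  and "Re z > \<beta> / 2 \<Longrightarrow> z^2 - of_real (\<beta>^2 / 4) \<notin> \<real>\<^sub>\<le>\<^sub>0"
proof -
 assume z: "Im z > 0"
 show "of_real (\<beta>^2 / 4) - z^2 \<notin> \<real>\<^sub>\<le>\<^sub>0"
 proof
  assume "of_real (\<beta>^2 / 4) - z^2 \<in> \<real>\<^sub>\<le>\<^sub>0"
  then have h: "Re (of_real (\<beta>^2 / 4) - z^2) \<le> 0" "Im (of_real (\<beta>^2 / 4) - z^2) = 0" by (simp_all only: complex_nonpos_Reals_iff)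
  from h(2) have x: "Re z = 0" using z by (simp add: Im_power2)
  from h(1) have "\<beta>^2 / 4 + (Im z)^2 \<le> 0" by (simp add: Re_power2 x)
  moreover have "(Im z)^2 > 0" "\<beta>^2 / 4 \<ge> 0" using z by simp_all
  ultimately show False by linarith
 qed
next
 assume z: "Re z > \<beta> / 2"
 show "z^2 - of_real (\<beta>^2 / 4) \<notin> \<real>\<^sub>\<le>\<^sub>0"
 proof
  assume "z^2 - of_real (\<beta>^2 / 4) \<in> \<real>\<^sub>\<le>\<^sub>0"
  then have h: "Re (z^2 - of_real (\<beta>^2 / 4)) \<le> 0" "Im (z^2 - of_real (\<beta>^2 / 4)) = 0" by (simp_all only: complex_nonpos_Reals_iff)
  from h(2) have y: "Im z = 0" using z \<beta>\<nu> by (simp add: Im_power2)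
  from h(1) have "(Re z)^2 \<le> (\<beta> / 2)^2" by (simp add: Re_power2 y power_divide)
  moreover have "(\<beta> / 2)^2 < (Re z)^2" using z \<beta>\<nu> by (intro power_strict_mono) auto
  ultimately show False by linarith
 qed
qed

text \<open>Both branches have the same square, so they agree up to sign. Where both half-planes
  overlap both have positive imaginary part, so their sum is not 0 and they coincide.\<close>

lemma \<sigma>_right:
 assumes z: "Re z > \<beta> / 2"
 shows "\<sigma> z = csqrt (z^2 - of_real (\<beta>^2 / 4))" (is ?A) "Re (\<sigma> z) > 0"
proof -
 show eq: ?A
 proof (cases "Im z > 0")
  case True
  define s where "s = csqrt (z^2 - of_real (\<beta>^2 / 4))"
  have s2: "s^2 = z^2 - of_real (\<beta>^2 / 4)" by (simp add: s_def)
  have rs: "Re s > 0" unfolding s_def by (rule Re_csqrt_pos[OF radicand(2)[OF z]])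
  have "Im (s^2) > 0" unfolding s2 using True z \<beta>\<nu> by (simp add: Im_power2)
  then have "Im s > 0" using rs by (simp add: Im_power2 zero_less_mult_iff)
  moreover have "Im (\<sigma> z) > 0" using True Re_csqrt_pos[OF radicand(1)[OF True]] by (simp add: \<sigma>_def)
  ultimately have im: "Im (\<sigma> z + s) > 0" by simp
  have ne: "\<sigma> z + s \<noteq> 0"
  proof
   assume "\<sigma> z + s = 0"
   with im show False by (simp only: zero_complex.sel less_irrefl)
  qed
  have "(\<sigma> z - s) * (\<sigma> z + s) = (\<sigma> z)^2 - s^2" by (simp add: power2_eq_square algebra_simps)
  also have "\<dots> = 0" by (simp only: \<sigma>_square s2) simp
  finally show ?thesis using ne by (simp add: s_def)
 qed (simp add: \<sigma>_def)
 show "Re (\<sigma> z) > 0" unfolding eq by (rule Re_csqrt_pos[OF radicand(2)[OF z]])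
qed

lemma \<sigma>_upper: "Im z > 0 \<Longrightarrow> Im (\<sigma> z) > 0" using Re_csqrt_pos[OF radicand(1)[of z]] by (simp add: \<sigma>_def)

lemma \<sigma>_holomorphic: "\<sigma> holomorphic_on \<Omega>" unfolding \<Omega>_eq
proof (rule holomorphic_on_Un[OF _ _ open_halfspace_Im_gt open_halfspace_Re_gt])
 have "(\<lambda>z. \<i> * csqrt (of_real (\<beta>^2 / 4) - z^2)) holomorphic_on {z. Im z > 0}"
  by (intro holomorphic_intros) (use radicand(1) in auto)
 then show "\<sigma> holomorphic_on {z. Im z > 0}" by (rule holomorphic_transform) (simp add: \<sigma>_def)
 have "(\<lambda>z. csqrt (z^2 - of_real (\<beta>^2 / 4))) holomorphic_on {z. Re z > \<beta> / 2}"
  by (intro holomorphic_intros) (use radicand(2) in auto)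
 then show "\<sigma> holomorphic_on {z. Re z > \<beta> / 2}" by (rule holomorphic_transform) (simp add: \<sigma>_right(1))
qed

lemma left_shift: "cmod (2 * of_real \<nu> / of_real 2 + 1 + of_nat k) \<ge> 1"
proof -
 have "2 * of_real \<nu> / of_real 2 + 1 + of_nat k = (of_real (\<nu> + 1 + real k) :: complex)" by simp
 then have "cmod (2 * of_real \<nu> / of_real 2 + 1 + of_nat k) = \<bar>\<nu> + 1 + real k\<bar>" by (simp only: norm_of_real)
 then show ?thesis using \<beta>\<nu>(2) by simp
qed

text \<open>The parameter is 1 - i \<sigma> / \<beta>. In the upper half-plane its real part keeps
  it away from 0, -1, -2, ..., in the right half-plane its imaginary part does.\<close>

lemma right_shift:
 shows "Im z > 0 \<Longrightarrow> cmod (2 * (- \<i> * \<sigma> z) / of_real (2 * \<beta>) + 1 + of_nat k) \<ge> 1"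
  and "Re z > \<beta> / 2 \<Longrightarrow> cmod (2 * (- \<i> * \<sigma> z) / of_real (2 * \<beta>) + 1 + of_nat k) \<ge> Re (\<sigma> z) / \<beta>"
proof -
 have e: "2 * (- \<i> * \<sigma> z) / of_real (2 * \<beta>) + 1 + of_nat k = Complex (1 + real k + Im (\<sigma> z) / \<beta>) (- (Re (\<sigma> z) / \<beta>))"
  by (simp add: complex_eq_iff Re_divide Im_divide power2_eq_square)
 show "cmod (2 * (- \<i> * \<sigma> z) / of_real (2 * \<beta>) + 1 + of_nat k) \<ge> 1" if "Im z > 0"
 proof -
  have "Im (\<sigma> z) / \<beta> > 0" using \<sigma>_upper[OF that] \<beta>\<nu> by simp
  then show ?thesis unfolding e using complex_Re_le_cmod[of "Complex (1 + real k + Im (\<sigma> z) / \<beta>) (- (Re (\<sigma> z) / \<beta>))"] by simp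
 qed
 show "cmod (2 * (- \<i> * \<sigma> z) / of_real (2 * \<beta>) + 1 + of_nat k) \<ge> Re (\<sigma> z) / \<beta>" if "Re z > \<beta> / 2"
 proof -
  have "\<bar>- (Re (\<sigma> z) / \<beta>)\<bar> \<le> cmod (Complex (1 + real k + Im (\<sigma> z) / \<beta>) (- (Re (\<sigma> z) / \<beta>)))"
   using abs_Im_le_cmod[of "Complex (1 + real k + Im (\<sigma> z) / \<beta>) (- (Re (\<sigma> z) / \<beta>))"] by (simp only: complex.sel)
  then show ?thesis unfolding e abs_minus_cancel using abs_ge_self[of "Re (\<sigma> z) / \<beta>"] by (rule order_trans[rotated])
 qed
qed

lemma right_shift_local:
 assumes "z \<in> \<Omega>"
 shows "\<exists>V d. open V \<and> z \<in> V \<and> d > 0 \<and> (\<forall>w\<in>V. \<forall>k. cmod (2 * (- \<i> * \<sigma> w) / of_real (2 * \<beta>) + 1 + of_nat k) \<ge> d)"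
proof (cases "Im z > 0")
 case True
 show ?thesis by (rule exI[of _ "{z. Im z > 0}"], rule exI[of _ 1]) (use True right_shift(1) open_halfspace_Im_gt in auto)
next
 case False
 then have z: "Re z > \<beta> / 2" using assms by (simp add: \<Omega>_def)
 have c: "continuous_on \<Omega> (\<lambda>w. Re (\<sigma> w))" by (intro continuous_intros holomorphic_on_imp_continuous_on \<sigma>_holomorphic)
 define V where "V = {w. Re w > \<beta> / 2} \<inter> (\<Omega> \<inter> (\<lambda>w. Re (\<sigma> w)) -` {Re (\<sigma> z) / 2<..})"
 have "open V" unfolding V_def by (intro open_Int open_halfspace_Re_gt continuous_open_preimage[OF c open_\<Omega>]) simp
 moreover have "z \<in> V" using z assms \<sigma>_right(2)[OF z] by (simp add: V_def)
 moreover have "Re (\<sigma> z) / 2 / \<beta> > 0" using \<sigma>_right(2)[OF z] \<beta>\<nu> by simp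
 moreover have "cmod (2 * (- \<i> * \<sigma> w) / of_real (2 * \<beta>) + 1 + of_nat k) \<ge> Re (\<sigma> z) / 2 / \<beta>" if "w \<in> V" for w k
 proof -
  have "Re (\<sigma> z) / 2 / \<beta> \<le> Re (\<sigma> w) / \<beta>" using that \<beta>\<nu> by (intro divide_right_mono) (auto simp: V_def)
  then show ?thesis using right_shift(2)[of w k] that by (simp add: V_def)
 qed
 ultimately show ?thesis by blast
qed

lemma right_shift_ex:
 assumes "z \<in> \<Omega>"
 obtains d where "d > 0" "\<And>k. cmod (2 * (- \<i> * \<sigma> z) / of_real (2 * \<beta>) + 1 + of_nat k) \<ge> d"
 using right_shift_local[OF assms] by blast

text \<open>\<open>FL\<close> is the solution recessive at the cone point, in the variable of
  \<open>tl\<close>; \<open>FR\<close> is the one recessive on the funnel, before conjugation by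
  f^(1/2). \<open>GL\<close> and \<open>GR\<close> continue them across r = 0.\<close>

definition FL :: "complex \<Rightarrow> complex \<Rightarrow> complex" where "FL z = dec_sol (of_real \<nu>) (- (z / of_real a)\<^sup>2) (of_real 2)"
definition FL' :: "complex \<Rightarrow> complex \<Rightarrow> complex" where "FL' z = dec_sol' (of_real \<nu>) (- (z / of_real a)\<^sup>2) (of_real 2)"
definition FR :: "complex \<Rightarrow> complex \<Rightarrow> complex" where "FR z = dec_sol (- \<i> * \<sigma> z) ((of_int m)^2) (of_real (2 * \<beta>))"
definition FR' :: "complex \<Rightarrow> complex \<Rightarrow> complex" where "FR' z = dec_sol' (- \<i> * \<sigma> z) ((of_int m)^2) (of_real (2 * \<beta>))"

text \<open>The Cauchy data come from continuity of u and f u' at 0, written in the unknown of the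
  other side: the change of variable on the cone contributes the factor - a, the conjugation on the
  funnel the shift by \<beta> / 2.\<close>

definition GL :: "complex \<Rightarrow> complex \<Rightarrow> complex" where
 "GL z = ivp_sol (of_real (\<beta>^2 / 4) - z^2) ((of_int m)^2) (2 * of_real \<beta>) (FL z 0) (- of_real a * FL' z 0 + of_real (\<beta> / 2) * FL z 0)"
definition GL' :: "complex \<Rightarrow> complex \<Rightarrow> complex" where
 "GL' z = ivp_sol' (of_real (\<beta>^2 / 4) - z^2) ((of_int m)^2) (2 * of_real \<beta>) (FL z 0) (- of_real a * FL' z 0 + of_real (\<beta> / 2) * FL z 0)"
definition GR :: "complex \<Rightarrow> complex \<Rightarrow> complex" where
 "GR z = ivp_sol (of_real (\<nu>^2)) (- (z / of_real a)\<^sup>2) 2 (FR z 0) (- (FR' z 0 - of_real (\<beta> / 2) * FR z 0) / of_real a)"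
definition GR' :: "complex \<Rightarrow> complex \<Rightarrow> complex" where
 "GR' z = ivp_sol' (of_real (\<nu>^2)) (- (z / of_real a)\<^sup>2) 2 (FR z 0) (- (FR' z 0 - of_real (\<beta> / 2) * FR z 0) / of_real a)"

definition uL :: "complex \<Rightarrow> real \<Rightarrow> complex" where
 "uL z r = (if r \<le> 0 then FL z (tl r) else exp (- of_real (\<beta> / 2) * of_real r) * GL z (of_real r))"
definition pL :: "complex \<Rightarrow> real \<Rightarrow> complex" where
 "pL z r = (if r \<le> 0 then - of_real a * FL' z (tl r) else exp (of_real (\<beta> / 2) * of_real r) * (GL' z (of_real r) - of_real (\<beta> / 2) * GL z (of_real r)))"
definition uR :: "complex \<Rightarrow> real \<Rightarrow> complex" where
 "uR z r = (if r \<le> 0 then GR z (tl r) else exp (- of_real (\<beta> / 2) * of_real r) * FR z (of_real r))"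
definition pR :: "complex \<Rightarrow> real \<Rightarrow> complex" where
 "pR z r = (if r \<le> 0 then - of_real a * GR' z (tl r) else exp (of_real (\<beta> / 2) * of_real r) * (FR' z (of_real r) - of_real (\<beta> / 2) * FR z (of_real r)))"

text \<open>The Wronskian of \<open>uL\<close> and \<open>uR\<close> evaluated at r = 0, where it
  involves only the explicit series \<open>FL\<close> and \<open>FR\<close> and not their
  continuations.\<close>

definition Wr :: "complex \<Rightarrow> complex" where
 "Wr z = - of_real a * FL' z 0 * FR z 0 - FL z 0 * (FR' z 0 - of_real (\<beta> / 2) * FR z 0)"

lemma tl_0 [simp]: "tl 0 = 0" by (simp add: tl_def)

lemma FL_deriv:
 "(FL z has_field_derivative FL' z t) (at t)" (is ?A)
 "(FL' z has_field_derivative (of_real (\<nu>^2) + - (z / of_real a)\<^sup>2 * exp (- 2 * t)) * FL z t) (at t)" (is ?B)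
proof -
 have 1: "(1::real) > 0" "(of_real 2 :: complex) \<noteq> 0" by simp_all
 note D = dec_sol_deriv[OF left_shift 1, where B = "- (z / of_real a)\<^sup>2" and t = t]
 show ?A unfolding FL_def FL'_def by (rule D(1))
 show ?B
  using D(2) unfolding FL_def FL'_def by simp
qed

lemma FR_deriv:
 assumes z: "z \<in> \<Omega>"
 shows "(FR z has_field_derivative FR' z t) (at t)" (is ?A)
 "(FR' z has_field_derivative (of_real (\<beta>^2 / 4) - z^2 + (of_int m)^2 * exp (- (2 * of_real \<beta>) * t)) * FR z t) (at t)" (is ?B)
proof -
 obtain d where d: "d > 0" "\<And>k. cmod (2 * (- \<i> * \<sigma> z) / of_real (2 * \<beta>) + 1 + of_nat k) \<ge> d"
  by (rule right_shift_ex[OF z], rule that)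
 have c: "(of_real (2 * \<beta>) :: complex) \<noteq> 0" using \<beta>\<nu> by simp
 note D = dec_sol_deriv[OF d(2,1) c, where B = "(of_int m)^2" and t = t]
 show ?A unfolding FR_def FR'_def by (rule D(1))
 have "(- \<i> * \<sigma> z)^2 = - ((\<sigma> z)^2)" by (simp add: power_mult_distrib)
 also have "\<dots> = of_real (\<beta>^2 / 4) - z^2" by (simp only: \<sigma>_square minus_diff_eq)
 finally have e: "(- \<i> * \<sigma> z)^2 = of_real (\<beta>^2 / 4) - z^2" .
 have e2: "- (2 * of_real \<beta>) = - (of_real (2 * \<beta>) :: complex)" by simp
 show ?B
  using D(2) unfolding e e2 FR_def FR'_def .
qed

lemma system_uL: "system z (\<lambda>_. 0) (uL z) (pL z)" unfolding uL_def[abs_def] pL_def[abs_def]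
proof (rule system_left_right[OF FL_deriv])
 show "(GL z has_field_derivative GL' z t) (at t)" for t unfolding GL_def GL'_def by (rule ivp_sol_deriv)
 show "(GL' z has_field_derivative (of_real (\<beta>^2 / 4) - z^2 + (of_int m)^2 * exp (- (2 * of_real \<beta>) * t)) * GL z t) (at t)" for t
  unfolding GL_def GL'_def by (rule ivp_sol'_deriv)
qed (simp_all add: GL_def GL'_def)

lemma system_uR:
 assumes "z \<in> \<Omega>" shows "system z (\<lambda>_. 0) (uR z) (pR z)" unfolding uR_def[abs_def] pR_def[abs_def]
proof (rule system_left_right[OF _ _ FR_deriv[OF assms]])
 show "(GR z has_field_derivative GR' z t) (at t)" for t unfolding GR_def GR'_def by (rule ivp_sol_deriv)
 show "(GR' z has_field_derivative (of_real (\<nu>^2) + - (z / of_real a)\<^sup>2 * exp (- 2 * t)) * GR z t) (at t)" for t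
  unfolding GR_def GR'_def by (rule ivp_sol'_deriv)
 show "GR z 0 = FR z 0" "- of_real a * GR' z 0 = FR' z 0 - of_real (\<beta> / 2) * FR z 0" using a by (simp_all add: GR_def GR'_def)
qed

lemma wronskian_uLR: "wronskian (uL z) (pL z) (uR z) (pR z) 0 = Wr z"
 using a by (simp add: wronskian_def uL_def pL_def uR_def pR_def GR_def GR'_def Wr_def)

lemma uL_nonzero: "\<exists>r\<in>I. r < 0 \<and> uL z r \<noteq> 0"
proof -
 have 1: "(1::real) > 0" "(2 :: real) > 0" by simp_all
 obtain t :: real where t: "t > 0" "FL z (of_real t) \<noteq> 0"
  using dec_sol_nonzero[OF left_shift 1, where B = "- (z / of_real a)\<^sup>2"] unfolding FL_def by blast
 \<comment> \<open>The point with \<open>tl r\<close> = t.\<close>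
 define r where "r = (exp (- t) - 1) / a"
 have e: "1 + a * r = exp (- t)" using a by (simp add: r_def)
 have "r < 0" using t a by (simp add: r_def divide_less_0_iff)
 moreover have "1 + a * r > 0" unfolding e by simp
 then have "r \<in> I" using a by (simp add: field_simps)
 moreover have "tl r = of_real t" unfolding tl_def e by simp
 ultimately show ?thesis using t by (intro bexI[of _ r]) (auto simp: uL_def)
qed

lemma uR_nonzero:
 assumes "z \<in> \<Omega>" shows "\<exists>r>0. uR z r \<noteq> 0"
proof -
 obtain d where d: "d > 0" "\<And>k. cmod (2 * (- \<i> * \<sigma> z) / of_real (2 * \<beta>) + 1 + of_nat k) \<ge> d"
  by (rule right_shift_ex[OF assms], rule that)
 have "2 * \<beta> > 0" using \<beta>\<nu> by simp
 from dec_sol_nonzero[OF d(2,1) this, where B = "(of_int m)^2"]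
 obtain t :: real where "t > 0" "FR z (of_real t) \<noteq> 0" unfolding FR_def by blast
 then show ?thesis by (intro exI[of _ t]) (simp add: uR_def)
qed

lemma L2_dominated:
 assumes h: "h \<in> borel_measurable M" and E: "integrable lborel E" and le: "\<And>r. r \<in> I \<Longrightarrow> f r * (cmod (h r))^2 \<le> E r"
 shows "h \<in> L2"
proof (rule L2_spaceI[OF h])
 have m: "(\<lambda>r. (cmod (h r))^2) \<in> borel_measurable M" using h by measurable
 have "(\<lambda>r. indicator I r *\<^sub>R (cmod (h r))^2) \<in> borel_measurable lborel"
  using m unfolding meas_M by (subst (asm) borel_measurable_restrict_space_iff) auto
 then have "(\<lambda>r. f r *\<^sub>R (indicator I r *\<^sub>R (cmod (h r))^2)) \<in> borel_measurable lborel" by measurable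
 then have mm: "(\<lambda>r. indicator I r *\<^sub>R (f r *\<^sub>R (cmod (h r))^2)) \<in> borel_measurable lborel" by (simp add: mult.left_commute)
 have "set_integrable lborel I (\<lambda>r. f r *\<^sub>R (cmod (h r))^2)" unfolding set_integrable_def
 proof (rule Bochner_Integration.integrable_bound[OF E mm], rule AE_I2)
  fix r :: real
  show "norm (indicator I r *\<^sub>R (f r *\<^sub>R (cmod (h r))^2)) \<le> norm (E r)"
  proof (cases "r \<in> I")
   case True
   have "0 \<le> f r * (cmod (h r))^2" using f_pos[OF True] by simp
   then show ?thesis using le[OF True] True by simp
  qed simp
 qed
 then show "integrable M (\<lambda>r. (cmod (h r))^2)" unfolding integrable_M[OF m] .
qed

lemma integrable_exp_decay: "\<tau> > 0 \<Longrightarrow> integrable lborel (\<lambda>r::real. indicator {0..} r * exp (- \<tau> * r))"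
proof -
 assume "\<tau> > 0"
 then have "(\<lambda>r::real. exp (- \<tau> * r)) absolutely_integrable_on {0..}"
  using integrable_on_exp_minus_to_infinity[of \<tau> 0] by (intro nonnegative_absolutely_integrable_1) auto
 then have "integrable lebesgue (\<lambda>r::real. indicator {0..} r *\<^sub>R exp (- \<tau> * r))" by (simp only: set_integrable_def)
 then show ?thesis by (subst (asm) integrable_completion) simp_all
qed

lemma tl_at_top: "filterlim (\<lambda>r. - ln (1 + a * r)) at_top (at_right (- 1 / a))"
proof -
 have "((\<lambda>r. 1 + a * r) \<longlongrightarrow> 1 + a * (- 1 / a)) (at_right (- 1 / a))" by (intro tendsto_intros)
 moreover have "1 + a * (- 1 / a) = 0" using a by simp
 moreover have "eventually (\<lambda>r. 1 + a * r \<in> {0<..} \<and> 1 + a * r \<noteq> 0) (at_right (- 1 / a))"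
  using eventually_at_right_less[of "- 1 / a"]
 proof eventually_elim
  case (elim r)
  then show ?case using x_pos[of r] by simp
 qed
 ultimately have "filterlim (\<lambda>r. 1 + a * r) (at_right 0) (at_right (- 1 / a))" by (auto simp: filterlim_at)
 from filterlim_compose[OF ln_at_0 this] show ?thesis by (simp add: filterlim_uminus_at_top)
qed

text \<open>In the upper half-plane the recessive solutions tend to 0 together with their
  derivatives, which gives both boundary conditions: on the funnel the factors exp (\<beta> r / 2)
  of p and exp (- \<beta> r / 2) of u cancel in the product.\<close>

theorem resolvent_uLR:
 assumes z: "Im z > 0"
 shows "resolvent a b m z (uL z) (pL z) (uR z) (pR z)"
proof
 have zO: "z \<in> \<Omega>" using z by (simp add: \<Omega>_def)
 show "Im z > 0" by (rule z)
 show sL: "system z (\<lambda>_. 0) (uL z) (pL z)" by (rule system_uL)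
 show sR: "system z (\<lambda>_. 0) (uR z) (pR z)" by (rule system_uR[OF zO])
 show "\<exists>r\<in>I. r < 0 \<and> uL z r \<noteq> 0" by (rule uL_nonzero)
 show "\<exists>r>0. uR z r \<noteq> 0" by (rule uR_nonzero[OF zO])
 have 1: "(1::real) > 0" "(2 :: real) > 0" "Re (of_real \<nu>) > 0" using \<beta>\<nu> by simp_all
 note l0 = dec_sol_tendsto_0[OF left_shift 1, where B = "- (z / of_real a)\<^sup>2", folded FL_def FL'_def]
 have b2: "2 * \<beta> > 0" and \<tau>: "Re (- \<i> * \<sigma> z) > 0" using \<beta>\<nu> \<sigma>_upper[OF z] by simp_all
 note r0 = dec_sol_tendsto_0[OF right_shift(1)[OF z] 1(1) b2 \<tau>, where B = "(of_int m)^2", folded FR_def FR'_def]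
 have "((\<lambda>t::real. (- of_real a * FL' z (of_real t)) * cnj (FL z (of_real t))) \<longlongrightarrow> (- of_real a * 0) * cnj 0) at_top"
  by (intro tendsto_intros l0)
 from filterlim_compose[OF this tl_at_top]
 have lim: "((\<lambda>r. (- of_real a * FL' z (tl r)) * cnj (FL z (tl r))) \<longlongrightarrow> 0) (at_right (- 1 / a))" by (simp add: tl_def)
 have "eventually (\<lambda>r. (- of_real a * FL' z (tl r)) * cnj (FL z (tl r)) = pL z r * cnj (uL z r)) (at_right (- 1 / a))"
  unfolding eventually_at_right_field by (rule exI[of _ 0]) (use a in \<open>simp add: pL_def uL_def\<close>)
 with lim show "((\<lambda>r. pL z r * cnj (uL z r)) \<longlongrightarrow> 0) (at_right (- 1 / a))" by (rule Lim_transform_eventually)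
 have lim: "((\<lambda>r::real. (FR' z (of_real r) - of_real (\<beta> / 2) * FR z (of_real r)) * cnj (FR z (of_real r))) \<longlongrightarrow>
   (0 - of_real (\<beta> / 2) * 0) * cnj 0) at_top" by (intro tendsto_intros r0)
 have "eventually (\<lambda>r. (FR' z (of_real r) - of_real (\<beta> / 2) * FR z (of_real r)) * cnj (FR z (of_real r)) = pR z r * cnj (uR z r)) at_top"
  using eventually_gt_at_top[of 0]
 proof eventually_elim
  case (elim r)
  define E where "E = exp (\<beta> / 2 * r)"
  have "exp (of_real (\<beta> / 2) * of_real r) = (of_real E :: complex)" "exp (- of_real (\<beta> / 2) * of_real r) = (of_real (inverse E) :: complex)"
   unfolding E_def exp_minus[symmetric] by (simp_all add: exp_of_real[symmetric])
  then show ?case using elim by (simp add: pR_def uR_def E_def)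
 qed
 with lim show "((\<lambda>r. pR z r * cnj (uR z r)) \<longlongrightarrow> 0) at_top" using Lim_transform_eventually by fastforce
 have cL: "continuous_on I (uL z)" and cR: "continuous_on I (uR z)" using sL sR by (simp_all add: system_def)
 show "(\<lambda>r. indicator {..0} r * uL z r) \<in> L2"
 proof -
  have "continuous_on {0..} (\<lambda>t::real. FL z (of_real t))"
   by (intro continuous_at_imp_continuous_on ballI isCont_o2[OF _ DERIV_isCont[OF FL_deriv(1)]]) simp
  then obtain C where C: "C \<ge> 0" "\<And>t::real. t \<ge> 0 \<Longrightarrow> cmod (FL z (of_real t)) \<le> C"
   by (rule bounded_of_tendsto_at_top[OF _ l0(1)]) (rule that)
  show ?thesis
  proof (rule L2_dominated)
   show "(\<lambda>r. indicator {..0} r * uL z r) \<in> borel_measurable M"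
    by (intro borel_measurable_times meas_M_cont[OF cL] meas_M_borel) measurable
   show "integrable lborel (\<lambda>r. indicator {- 1 / a..0} r * C^2)"
    by (rule integrable_mult_left) (simp add: integrable_indicator_iff emeasure_lborel_Icc_eq)
   fix r assume r: "r \<in> I"
   show "f r * (cmod (indicator {..0} r * uL z r))^2 \<le> indicator {- 1 / a..0} r * C^2"
   proof (cases "r \<le> 0")
    case True
    have ar: "a * r \<le> 0" using True a by (simp add: mult_nonneg_nonpos)
    have "- ln (1 + a * r) \<ge> 0" using x_pos[OF r] ar by (simp add: ln_le_zero_iff)
    from C(2)[OF this] have "cmod (uL z r) \<le> C" using True by (simp add: uL_def tl_def)
    then have "(cmod (uL z r))^2 \<le> C^2" by (rule power_mono) simp
    moreover have "f r \<le> 1" "f r \<ge> 0" using True ar f_pos[OF r] by (simp_all add: f1_def)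
    ultimately have "f r * (cmod (uL z r))^2 \<le> 1 * C^2" by (intro mult_mono) auto
    then show ?thesis using True r by simp
   qed simp
  qed
 qed
 show "(\<lambda>r. indicator {0..} r * uR z r) \<in> L2"
 proof -
  define \<rho> where "\<rho> = - \<i> * \<sigma> z"
  have "continuous_on {0..} (\<lambda>t::real. exp (\<rho> * of_real t) * FR z (of_real t))"
   by (intro continuous_intros continuous_at_imp_continuous_on ballI isCont_o2[OF _ DERIV_isCont[OF FR_deriv(1)[OF zO]]])
  then obtain C where C: "C \<ge> 0" "\<And>t::real. t \<ge> 0 \<Longrightarrow> cmod (exp (\<rho> * of_real t) * FR z (of_real t)) \<le> C"
   by (rule bounded_of_tendsto_at_top[OF _ dec_sol_limit(1)[OF right_shift(1)[OF z] 1(1) b2, where B = "(of_int m)^2", folded FR_def \<rho>_def]]) (rule that)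
  have \<tau>': "2 * Re \<rho> > 0" using \<tau> by (simp add: \<rho>_def)
  show ?thesis
  proof (rule L2_dominated)
   show "(\<lambda>r. indicator {0..} r * uR z r) \<in> borel_measurable M"
    by (intro borel_measurable_times meas_M_cont[OF cR] meas_M_borel) measurable
   show "integrable lborel (\<lambda>r. (indicator {0..} r * exp (- (2 * Re \<rho>) * r)) * C^2)"
    by (intro integrable_mult_left integrable_exp_decay[OF \<tau>'])
   fix r assume r: "r \<in> I"
   have key: "f r * (cmod (uR z r))^2 \<le> exp (- (2 * Re \<rho>) * r) * C^2" if r: "r \<ge> 0"
   proof -
    define E where "E = exp (\<beta> / 2 * r)"
    define D where "D = exp (Re \<rho> * r)"
    have pos: "E > 0" "D > 0" by (simp_all add: E_def D_def)
    \<comment> \<open>The weight \<open>f\<close> cancels against the square of exp (- \<beta> r /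
      2), so only the decay of \<open>FR\<close> itself matters for integrability.\<close>
    have fr: "f r = E * E" using r by (auto simp: f1_def E_def \<beta>_def exp_add[symmetric])
    have u: "cmod (uR z r) = inverse E * cmod (FR z (of_real r))"
    proof (cases "r = 0")
     case False
     have "cmod (exp (- of_real (\<beta> / 2) * of_real r)) = inverse E" unfolding E_def norm_exp_eq_Re exp_minus[symmetric] by simp
     then show ?thesis using r False by (simp add: uR_def norm_mult)
    qed (simp add: uR_def GR_def E_def)
    have "D * cmod (FR z (of_real r)) \<le> C" using C(2)[OF r] by (simp add: norm_mult D_def)
    then have c: "cmod (FR z (of_real r)) \<le> inverse D * C" using pos by (simp add: field_simps)
    have "f r * (cmod (uR z r))^2 = (cmod (FR z (of_real r)))^2" unfolding fr u using pos by (simp add: power2_eq_square field_simps)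
    also have "\<dots> \<le> (inverse D * C)^2" using c by (rule power_mono) simp
    also have "\<dots> = inverse D * inverse D * C^2" by (simp add: power2_eq_square)
    also have "inverse D * inverse D = exp (- (2 * Re \<rho>) * r)" unfolding D_def exp_minus[symmetric] exp_add[symmetric] by simp
    finally show ?thesis .
   qed
   show "f r * (cmod (indicator {0..} r * uR z r))^2 \<le> (indicator {0..} r * exp (- (2 * Re \<rho>) * r)) * C^2"
    using key by (cases "r \<ge> 0") simp_all
  qed
 qed
qed

end

section \<open>Resonances as zeros of the Wronskian\<close>

context radial
begin

lemma F_holomorphic:
 "(\<lambda>z. FL z t) holomorphic_on UNIV" (is ?A) "(\<lambda>z. FL' z t) holomorphic_on UNIV"
 "(\<lambda>z. FR z t) holomorphic_on \<Omega>" (is ?B) "(\<lambda>z. FR' z t) holomorphic_on \<Omega>"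
proof -
 have d: "\<exists>V d. open V \<and> z \<in> V \<and> d > 0 \<and> (\<forall>w\<in>V. \<forall>k. cmod (2 * of_real \<nu> / of_real 2 + 1 + of_nat k) \<ge> d)" for z :: complex
  by (rule exI[of _ UNIV], rule exI[of _ 1]) (use left_shift in auto)
 have h: "(\<lambda>z. of_real \<nu>) holomorphic_on UNIV" "(\<lambda>z. - (z / of_real a)\<^sup>2) holomorphic_on UNIV"
  using a by (auto intro!: holomorphic_intros)
 have c: "(of_real 2 :: complex) \<noteq> 0" "(of_real (2 * \<beta>) :: complex) \<noteq> 0" using \<beta>\<nu> by simp_all
 show ?A "(\<lambda>z. FL' z t) holomorphic_on UNIV"
  unfolding FL_def FL'_def by (rule dec_sol_holomorphic[OF open_UNIV h c(1) d])+
 have h: "(\<lambda>z. - \<i> * \<sigma> z) holomorphic_on \<Omega>" "(\<lambda>z. (of_int m)^2) holomorphic_on \<Omega>"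
  by (intro holomorphic_intros \<sigma>_holomorphic)+
 show ?B "(\<lambda>z. FR' z t) holomorphic_on \<Omega>" unfolding FR_def FR'_def
  by (rule dec_sol_holomorphic(1)[OF open_\<Omega> h c(2) right_shift_local], assumption)
   (rule dec_sol_holomorphic(2)[OF open_\<Omega> h c(2) right_shift_local], assumption)
qed

lemma u_holomorphic:
 "(\<lambda>z. uL z r) holomorphic_on \<Omega>" (is ?A) "(\<lambda>z. uR z r) holomorphic_on \<Omega>" "Wr holomorphic_on \<Omega>" (is ?B)
proof -
 have F: "(\<lambda>z. FL z t) holomorphic_on \<Omega>" "(\<lambda>z. FL' z t) holomorphic_on \<Omega>"
  "(\<lambda>z. FR z t) holomorphic_on \<Omega>" "(\<lambda>z. FR' z t) holomorphic_on \<Omega>" for t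
  using F_holomorphic holomorphic_on_subset by blast+
 have G: "(\<lambda>z. GL z t) holomorphic_on \<Omega>" "(\<lambda>z. GR z t) holomorphic_on \<Omega>" for t
  unfolding GL_def GR_def by (intro ivp_sol_holomorphic open_\<Omega> holomorphic_intros F; use a in simp)+
 show ?A "(\<lambda>z. uR z r) holomorphic_on \<Omega>"
  unfolding uL_def uR_def using F G by (cases "r \<le> 0"; simp; intro holomorphic_intros F G)+
 show ?B unfolding Wr_def[abs_def] by (intro holomorphic_intros F)
qed

definition Kr :: "complex \<Rightarrow> real \<Rightarrow> real \<Rightarrow> complex" where
 "Kr z r s = of_real (f s) * (uL z (min r s) * uR z (max r s) / Wr z)"

lemma Wr_nonzero: "Im z > 0 \<Longrightarrow> Wr z \<noteq> 0" using resolvent.W_nonzero[OF resolvent_uLR] unfolding wronskian_uLR by blast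

lemma Kr_resolvent_kernel:
 assumes z: "Im z > 0"
 shows "is_resolvent_kernel a b m z (Kr z)"
proof -
 interpret res: resolvent a b m z "uL z" "pL z" "uR z" "pR z" by (rule resolvent_uLR[OF z])
 have "res.R = Kr z" by (intro ext) (simp add: res.R_def res.G_def Kr_def wronskian_uLR)
 then show ?thesis using res.resolvent_kernel by simp
qed

lemma Kr_meromorphic: "(\<lambda>z. Kr z r s) meromorphic_on \<Omega>"
proof -
 have an: "h meromorphic_on \<Omega>" if "h holomorphic_on \<Omega>" for h
  using that open_\<Omega> by (intro analytic_on_imp_meromorphic_on) (simp add: analytic_on_open)
 show ?thesis unfolding Kr_def by (intro meromorphic_intros an u_holomorphic)
qed

lemma continued_kernel: "is_continued_resolvent_kernel a b m Kr"
proof -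
 have "{z. Im z > 0 \<or> Re z > \<bar>b\<bar> / 2} = \<Omega>" using b by (simp add: \<Omega>_def \<beta>_def)
 then show ?thesis unfolding is_continued_resolvent_kernel_def using Kr_resolvent_kernel Kr_meromorphic by auto
qed

text \<open>On the upper half-plane both are resolvent kernels and hence equal. With singularities
  removed, the difference vanishes on the connected set \<open>\<Omega>\<close>. A meromorphic
  function may take arbitrary values at isolated points, whence the punctured neighbourhood.\<close>

lemma continued_kernel_eq:
 assumes K: "is_continued_resolvent_kernel a b m K" and r: "r \<in> I" "s \<in> I" and z: "z \<in> \<Omega>"
 shows "eventually (\<lambda>w. K w r s = Kr w r s) (at z)"
proof -
 define h where "h = (\<lambda>w. K w r s - Kr w r s)"
 have "{z. Im z > 0 \<or> Re z > \<bar>b\<bar> / 2} = \<Omega>" using b by (simp add: \<Omega>_def \<beta>_def)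
 then have "(\<lambda>w. K w r s) meromorphic_on \<Omega>" using K r unfolding is_continued_resolvent_kernel_def by auto
 then have hm: "h meromorphic_on \<Omega>" unfolding h_def by (intro meromorphic_intros Kr_meromorphic)
 have h0: "h w = 0" if "Im w > 0" for w
 proof -
  have "is_resolvent_kernel a b m w (K w)" using K that unfolding is_continued_resolvent_kernel_def by blast
  then show ?thesis using resolvent_kernel_unique[OF that _ Kr_resolvent_kernel[OF that] r] by (simp add: h_def)
 qed
 define g where "g = remove_sings h"
 have gn: "g nicely_meromorphic_on \<Omega>" unfolding g_def by (rule remove_sings_nicely_meromorphic[OF hm])
 have i: "\<i> \<in> \<Omega>" by (simp add: \<Omega>_def)
 have "eventually (\<lambda>w. w \<in> {w. Im w > 0}) (nhds \<i>)" by (rule eventually_nhds_in_open) (simp_all add: open_halfspace_Im_gt)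
 then have "eventually (\<lambda>w. g w = 0) (nhds \<i>)"
 proof eventually_elim
  case (elim w)
  have "h analytic_on {w}"
  proof -
   have "h holomorphic_on {w. Im w > 0}" by (rule holomorphic_transform[OF holomorphic_on_const[of 0]]) (simp add: h0)
   then have "h analytic_on {w. Im w > 0}" by (simp add: analytic_on_open open_halfspace_Im_gt)
   then show ?thesis by (rule analytic_on_subset) (use elim in simp)
  qed
  then have "g w = h w" unfolding g_def by (rule remove_sings_at_analytic)
  then show ?case using h0 elim by simp
 qed
 then have "eventually (\<lambda>w. g w = 0) (at \<i>)" by (simp add: eventually_at_filter eventually_mono)
 then have "frequently (\<lambda>w. g w = 0) (at \<i>)" by (rule eventually_frequently[rotated]) simp
 from frequently_eq_meromorphic_imp_constant[OF this gn open_\<Omega> connected_\<Omega> i]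
 have g0: "g w = 0" if "w \<in> \<Omega>" for w using that .
 have "h meromorphic_on {z}" by (rule meromorphic_on_subset[OF hm]) (use z in simp)
 then have "eventually (\<lambda>w. g w = h w) (at z)" unfolding g_def by (intro eventually_remove_sings_eq_at meromorphic_on_isolated_singularity)
 moreover have "eventually (\<lambda>w. w \<in> \<Omega>) (at z)" by (rule eventually_at_in_open'[OF open_\<Omega> z])
 ultimately show ?thesis by eventually_elim (use g0 in \<open>simp add: h_def\<close>)
qed

text \<open>A zero of \<open>Wr\<close> might be cancelled by a zero of the numerator. For the poles
  one therefore takes r < 0 and s > 0 at which \<open>uL\<close> and \<open>uR\<close> do not
  vanish; such points exist because neither solution vanishes identically on its own side.\<close>

lemma resonances_iff: "resonances a b m = {z. Re z > \<beta> / 2 \<and> Wr z = 0}"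
proof (intro equalityI subsetI)
 fix z assume "z \<in> resonances a b m"
 then obtain K r s where z: "Re z > \<beta> / 2" and K: "is_continued_resolvent_kernel a b m K"
  and r: "r \<in> I" "s \<in> I" and p: "is_pole (\<lambda>w. K w r s) z" using b unfolding resonances_def \<beta>_def by auto
 have zO: "z \<in> \<Omega>" using z by (simp add: \<Omega>_def)
 have pole: "is_pole (\<lambda>w. Kr w r s) z" using p is_pole_cong[OF continued_kernel_eq[OF K r zO] refl] by simp
 have "Wr z = 0"
 proof (rule ccontr)
  assume "Wr z \<noteq> 0"
  have c: "continuous_on \<Omega> Wr" by (rule holomorphic_on_imp_continuous_on[OF u_holomorphic(3)])
  have o: "open (\<Omega> \<inter> Wr -` (- {0}))" by (rule continuous_open_preimage[OF c open_\<Omega>]) auto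
  have sub: "\<Omega> \<inter> Wr -` (- {0}) \<subseteq> \<Omega>" by blast
  have "(\<lambda>w. Kr w r s) holomorphic_on \<Omega> \<inter> Wr -` (- {0})"
   unfolding Kr_def by (intro holomorphic_intros holomorphic_on_subset[OF _ sub] u_holomorphic) auto
  from not_is_pole_holomorphic[OF o _ this] show False using pole zO \<open>Wr z \<noteq> 0\<close> by blast
 qed
 then show "z \<in> {z. Re z > \<beta> / 2 \<and> Wr z = 0}" using z by simp
next
 fix z assume "z \<in> {z. Re z > \<beta> / 2 \<and> Wr z = 0}"
 then have z: "Re z > \<beta> / 2" "Wr z = 0" by auto
 have zO: "z \<in> \<Omega>" using z by (simp add: \<Omega>_def)
 obtain r where r: "r \<in> I" "r < 0" "uL z r \<noteq> 0" using uL_nonzero by blast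
 obtain s where s: "s > 0" "uR z s \<noteq> 0" using uR_nonzero[OF zO] by blast
 have sI: "s \<in> I" using s nonneg_I by simp
 have ms: "min r s = r" "max r s = s" using r s by auto
 have hol: "(\<lambda>w. of_real (f s) * (uL w r * uR w s)) holomorphic_on \<Omega>" by (intro holomorphic_intros u_holomorphic)
 have cont: "isCont h z" if "h holomorphic_on \<Omega>" for h
  using holomorphic_on_imp_continuous_on[OF that] open_\<Omega> zO by (simp add: continuous_on_eq_continuous_at)
 have "Wr \<midarrow>z\<rightarrow> 0" using cont[OF u_holomorphic(3)] z(2) by (simp add: isCont_def)
 \<comment> \<open>\<open>Wr\<close> is not 0 at i and \<open>\<Omega>\<close> is connected, so its
   zeros are isolated.\<close>
 moreover have "eventually (\<lambda>w. Wr w \<noteq> 0) (at z)"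
  using non_zero_neighbour_alt[OF u_holomorphic(3) open_\<Omega> connected_\<Omega> zO, of \<i>] Wr_nonzero[of \<i>]
  by (auto simp: \<Omega>_def elim: eventually_mono)
 ultimately have "filterlim Wr (at 0) (at z)" by (simp add: filterlim_at)
 from is_pole_divide[OF cont[OF hol] this]
 have "is_pole (\<lambda>w. Kr w r s) z" using r s f_nz[OF sI] by (simp add: Kr_def ms)
 then show "z \<in> resonances a b m" unfolding resonances_def using z(1) continued_kernel r(1) sI b by (auto simp: \<beta>_def)
qed

end

section \<open>Connection formula for the Bessel equation\<close>

text \<open>Re z tends to infinity with Im z unrestricted, so limits along this filter are uniform
  on half-planes.\<close>

definition re_top :: "complex filter" where "re_top = filtercomap Re at_top"

lemma Re_at_re_top: "filterlim Re at_top re_top" unfolding re_top_def by (rule filterlim_filtercomap)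

lemma eventually_re_top_gt: "eventually (\<lambda>z. Re z > c) re_top" using filterlim_at_top_dense[THEN iffD1, OF Re_at_re_top] by blast

lemma eventually_re_topE:
 assumes "eventually P re_top"
 obtains X where "\<And>z. Re z > X \<Longrightarrow> P z" using assms unfolding re_top_def eventually_filtercomap_at_top_dense by blast

lemma re_top_neq_bot [simp]: "re_top \<noteq> bot"
proof
 assume "re_top = bot"
 then have "eventually (\<lambda>_. False) re_top" by simp
 then obtain X where "\<And>z. Re z > X \<Longrightarrow> False" by (rule eventually_re_topE) (rule that)
 from this[of "Complex (X + 1) 0"] show False by simp
qed

lemma inverse_re_top: "(inverse \<longlongrightarrow> 0) re_top"
proof (rule Lim_null_comparison)
 have "filterlim (\<lambda>z. Re z) at_infinity re_top" using Re_at_re_top by (rule filterlim_at_top_imp_at_infinity)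
 from tendsto_inverse_0[THEN filterlim_compose, OF this] show "((\<lambda>z. inverse (Re z)) \<longlongrightarrow> 0) re_top" .
 show "eventually (\<lambda>z. norm (inverse z) \<le> inverse (Re z)) re_top" using eventually_re_top_gt[of 0]
 proof eventually_elim
  case (elim z)
  have "Re z \<le> cmod z" by (rule complex_Re_le_cmod)
  then show ?case using elim unfolding norm_inverse by (rule le_imp_inverse_le)
 qed
qed

lemma scale_re_top:
 assumes "a > 0" shows "filterlim (\<lambda>z. z / of_real a) re_top re_top"
proof -
 have "filterlim (\<lambda>z. inverse a * Re z) at_top re_top"
  by (rule filterlim_tendsto_pos_mult_at_top[OF tendsto_const _ Re_at_re_top]) (use assms in simp)
 moreover have "Re (z / of_real a) = inverse a * Re z" for z by (simp add: Re_divide_of_real field_simps)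
 ultimately have "filterlim (\<lambda>z. Re (z / of_real a)) at_top re_top" by (simp only:)
 then show ?thesis unfolding re_top_def by (simp only: filterlim_filtercomap_iff o_def)
qed

lemma jost_limits:
 assumes c: "Re c = 0" "cmod c = 2"
 obtains X g g' where "X > 0"
  "\<And>w. Re w > X \<Longrightarrow> (g has_field_derivative g' w) (at w)"
  "\<And>w. Re w > X \<Longrightarrow> (g' has_field_derivative \<kappa> / w^2 * g w - c * g' w) (at w)"
  "(g \<longlongrightarrow> 1) re_top" "((\<lambda>w. w^2 * g' w) \<longlongrightarrow> \<kappa> / c) re_top"
proof -
 obtain X K g g' where h: "X > 0" "K \<ge> 0" "\<And>w. Re w > X \<Longrightarrow> (g has_field_derivative g' w) (at w)"
  "\<And>w. Re w > X \<Longrightarrow> (g' has_field_derivative \<kappa> / w^2 * g w - c * g' w) (at w)"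
  "\<And>w. Re w > X \<Longrightarrow> cmod (g w - 1) \<le> K / cmod w"
  "\<And>w. Re w > X \<Longrightarrow> cmod (g' w - \<kappa> / (c * w^2)) \<le> K / cmod w ^ 3" by (rule jost_solution[OF c]) (rule that)
 have lim: "((\<lambda>w. K * cmod (inverse w)) \<longlongrightarrow> 0) re_top" by (intro tendsto_mult_right_zero tendsto_norm_zero inverse_re_top)
 have "((\<lambda>w. g w - 1) \<longlongrightarrow> 0) re_top"
 proof (rule Lim_null_comparison[OF _ lim])
  show "eventually (\<lambda>w. norm (g w - 1) \<le> K * cmod (inverse w)) re_top"
   using eventually_re_top_gt[of X] by eventually_elim (use h(5) in \<open>simp only: norm_inverse divide_inverse\<close>)
 qed
 then have l1: "(g \<longlongrightarrow> 1) re_top" by (simp only: LIM_zero_iff)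
 have "((\<lambda>w. w^2 * g' w - \<kappa> / c) \<longlongrightarrow> 0) re_top"
 proof (rule Lim_null_comparison[OF _ lim])
  show "eventually (\<lambda>w. norm (w^2 * g' w - \<kappa> / c) \<le> K * cmod (inverse w)) re_top" using eventually_re_top_gt[of X]
  proof eventually_elim
   case (elim w)
   have w: "w \<noteq> 0" using elim h(1) by auto
   have n: "cmod w > 0" using w by simp
   have "w^2 * g' w - \<kappa> / c = w^2 * (g' w - \<kappa> / (c * w^2))" using w by (simp add: right_diff_distrib)
   then have "cmod (w^2 * g' w - \<kappa> / c) = (cmod w)^2 * cmod (g' w - \<kappa> / (c * w^2))" by (simp add: norm_mult norm_power)
   also have "\<dots> \<le> (cmod w)^2 * (K / cmod w ^ 3)" by (rule mult_left_mono[OF h(6)[OF elim]]) simp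
   also have "\<dots> = K * cmod (inverse w)" unfolding norm_inverse using n by (simp add: power2_eq_square power3_eq_cube divide_simps)
   finally show ?case .
  qed
 qed
 then have l2: "((\<lambda>w. w^2 * g' w) \<longlongrightarrow> \<kappa> / c) re_top" by (simp only: LIM_zero_iff)
 show ?thesis by (rule that[OF h(1,3,4) l1 l2])
qed

lemma tendsto_of_square_re_top:
 assumes "((\<lambda>w. w^2 * h w) \<longlongrightarrow> (l::complex)) re_top"
 shows "((\<lambda>w. w * h w) \<longlongrightarrow> 0) re_top" (is ?A) "(h \<longlongrightarrow> 0) re_top" (is ?B)
proof -
 have nz: "eventually (\<lambda>w. w \<noteq> 0) re_top" using eventually_re_top_gt[of 0] by eventually_elim auto
 have "((\<lambda>w. inverse w * (w^2 * h w)) \<longlongrightarrow> 0 * l) re_top" by (intro tendsto_mult inverse_re_top assms)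
 moreover have "eventually (\<lambda>w. inverse w * (w^2 * h w) = w * h w) re_top"
  using nz by eventually_elim (simp add: power2_eq_square field_simps)
 ultimately show 1: ?A using Lim_transform_eventually by fastforce
 have "((\<lambda>w. inverse w * (w * h w)) \<longlongrightarrow> 0 * 0) re_top" by (intro tendsto_mult inverse_re_top 1)
 moreover have "eventually (\<lambda>w. inverse w * (w * h w) = h w) re_top" using nz by eventually_elim (simp add: field_simps)
 ultimately show ?B using Lim_transform_eventually by fastforce
qed

lemma halfplane_wronskian_constant:
 assumes "\<And>s. Re s > X \<Longrightarrow> (u has_field_derivative u' s) (at s)" "\<And>s. Re s > X \<Longrightarrow> (u' has_field_derivative q s * u s) (at s)"
  and "\<And>s. Re s > X \<Longrightarrow> (v has_field_derivative v' s) (at s)" "\<And>s. Re s > X \<Longrightarrow> (v' has_field_derivative q s * v s) (at s)"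
 shows "\<exists>C. \<forall>s. Re s > X \<longrightarrow> u s * v' s - u' s * v s = C"
proof -
 have "((\<lambda>s. u s * v' s - u' s * v s) has_field_derivative 0) (at s within {s. Re s > X})" if "s \<in> {s. Re s > X}" for s
 proof (rule has_field_derivative_at_within)
  have s: "Re s > X" using that by simp
  have "((\<lambda>s. u s * v' s - u' s * v s) has_field_derivative
   (u' s * v' s + q s * v s * u s) - (q s * u s * v s + v' s * u' s)) (at s)" by (intro DERIV_diff DERIV_mult assms s)
  then show "((\<lambda>s. u s * v' s - u' s * v s) has_field_derivative 0) (at s)" by (simp add: mult_ac)
 qed
 from has_field_derivative_zero_constant[OF convex_halfspace_Re_gt this] show ?thesis by blast
qed

lemma hyp01_real:
 assumes "b > 0" shows "hyp01 (of_real b) (of_real x) \<in> \<real>"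
proof -
 have d: "cmod (of_real b + of_nat k) \<ge> b" for k
 proof -
  have "cmod (of_real b + of_nat k) = \<bar>b + real k\<bar>" unfolding norm_of_real[symmetric, where ?'a = complex] by simp
  then show ?thesis using assms by simp
 qed
 have t: "fps_nth (hyp01_fps (of_real b)) n * of_real x ^ n = of_real (1 / (fact n * pochhammer b n) * x ^ n)" for n
  by (simp add: hyp01_fps_def pochhammer_of_real)
 have "ereal (cmod (of_real x)) < fps_conv_radius (hyp01_fps (of_real b))" unfolding hyp01_conv_radius[OF d assms] by simp
 from summable_fps[OF this] have "Im (hyp01 (of_real b) (of_real x)) = (\<Sum>n. Im (fps_nth (hyp01_fps (of_real b)) n * of_real x ^ n))"
  unfolding hyp01_def eval_fps_def by (rule Im_suminf)
 also have "\<dots> = 0" unfolding t Im_complex_of_real by simp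
 finally show ?thesis by (simp add: complex_is_Real_iff)
qed

text \<open>Removing the phase exp (c s / 2), with c = 2 i or - 2 i, from a solution of y'' =
  (\<kappa> / s^2 - 1) y leaves the equation of \<open>jost_solution\<close>.\<close>

lemma jost_mode:
 assumes c: "c^2 = - 4" and s: "s \<noteq> 0"
  and g: "(g has_field_derivative g' s) (at s)" "(g' has_field_derivative \<kappa> / s^2 * g s - c * g' s) (at s)"
 shows "((\<lambda>s. exp (c / 2 * s) * g s) has_field_derivative exp (c / 2 * s) * (c / 2 * g s + g' s)) (at s)" (is ?A)
  and "((\<lambda>s. exp (c / 2 * s) * (c / 2 * g s + g' s)) has_field_derivative (\<kappa> / s^2 - 1) * (exp (c / 2 * s) * g s)) (at s)" (is ?B)
proof -
 have E: "((\<lambda>s. exp (c / 2 * s)) has_field_derivative exp (c / 2 * s) * (c / 2)) (at s)" by (auto intro!: derivative_eq_intros)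
 show ?A
  using DERIV_mult[OF E g(1)] by (simp add: algebra_simps)
 have D: "((\<lambda>s. exp (c / 2 * s) * (c / 2 * g s + g' s)) has_field_derivative
  exp (c / 2 * s) * (c / 2) * (c / 2 * g s + g' s) + (c / 2 * g' s + (\<kappa> / s^2 * g s - c * g' s)) * exp (c / 2 * s)) (at s)"
  by (intro DERIV_mult[OF E] DERIV_add DERIV_cmult g)
 define e where "e = exp (c / 2 * s)"
 define k where "k = \<kappa> / s^2"
 have "e * (c / 2) * (c / 2 * g s + g' s) + (c / 2 * g' s + (k * g s - c * g' s)) * e = (c^2 / 4 + k) * (e * g s)"
  by (simp add: power2_eq_square field_simps)
 also have "\<dots> = (k - 1) * (e * g s)" unfolding c by (simp add: algebra_simps)
 finally show ?B
  using D unfolding e_def k_def by simp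
qed

text \<open>A real solution cannot be a multiple of a single complex exponential mode: its logarithmic derivative
 would be asymptotic to \<open>k = \<plusminus>\<i>\<close>.\<close>

lemma real_not_single_mode:
 assumes real: "\<And>s::real. s > 0 \<Longrightarrow> y (of_real s) \<in> \<real>" "\<And>s::real. s > 0 \<Longrightarrow> y' (of_real s) \<in> \<real>"
  and g: "(g \<longlongrightarrow> 1) re_top" "(g' \<longlongrightarrow> 0) re_top" and k: "Im k \<noteq> 0"
  and eq: "\<And>s. Re s > X \<Longrightarrow> y s * (k * g s + g' s) = y' s * g s"
 shows "\<exists>S. \<forall>s::real. s > S \<longrightarrow> y (of_real s) = 0"
proof -
 have "((\<lambda>s. Im (k + g' s / g s)) \<longlongrightarrow> Im (k + 0 / 1)) re_top" by (intro tendsto_intros g) simp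
 then have 1: "eventually (\<lambda>s. Im (k + g' s / g s) \<noteq> 0) re_top" by (rule tendsto_imp_eventually_ne) (use k in simp)
 have 2: "eventually (\<lambda>s. g s \<noteq> 0) re_top" by (rule tendsto_imp_eventually_ne[OF g(1)]) simp
 have "eventually (\<lambda>s. \<forall>r. s = of_real r \<longrightarrow> y s = 0) re_top"
  using 1 2 eventually_re_top_gt[of X] eventually_re_top_gt[of 0]
 proof eventually_elim
  case (elim s)
  show ?case
  proof (intro allI impI)
   fix r assume r: "s = of_real r"
   show "y s = 0"
   proof (rule ccontr)
    assume y: "y s \<noteq> 0"
    have "k + g' s / g s = (k * g s + g' s) / g s" using elim(2) by (simp add: add_divide_distrib)
    also have "\<dots> = y' s / y s" using eq[OF elim(3)] y elim(2) by (simp add: field_simps)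
    also have "\<dots> \<in> \<real>" using real[of r] elim(4) r by (intro Reals_divide) auto
    finally show False using elim(1) by (simp add: complex_is_Real_iff)
   qed
  qed
 qed
 then obtain S where S: "\<And>s. Re s > S \<Longrightarrow> \<forall>r. s = of_real r \<longrightarrow> y s = 0" by (rule eventually_re_topE) (rule that)
 have "y (of_real s) = 0" if "s > S" for s :: real using S[of "of_real s"] that by simp
 then show ?thesis by blast
qed

text \<open>Up to a constant, exp (Ln s / 2) G(- Ln s) is sqrt s times the Bessel function of order
  \<nu>. It is expanded in the two oscillating modes, the coefficients being Wronskians, which are
  constant on the half-plane.\<close>

lemma bessel_connection:
 fixes \<nu> :: real
 assumes \<nu>: "\<nu> > 0"
 defines "G \<equiv> dec_sol (of_real \<nu>) (- 1) 2" and "G' \<equiv> dec_sol' (of_real \<nu>) (- 1) 2" and "\<kappa> \<equiv> of_real (\<nu>^2 - 1 / 4) :: complex"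
 obtains X \<alpha> \<gamma> g1 g1' g2 g2' where "X > 0" "\<alpha> \<noteq> 0" "\<gamma> \<noteq> 0"
  "g1 holomorphic_on {s. Re s > X}" "g1' holomorphic_on {s. Re s > X}"
  "g2 holomorphic_on {s. Re s > X}" "g2' holomorphic_on {s. Re s > X}"
  "(g1 \<longlongrightarrow> 1) re_top" "((\<lambda>s. s^2 * g1' s) \<longlongrightarrow> \<kappa> / (2 * \<i>)) re_top"
  "(g2 \<longlongrightarrow> 1) re_top" "((\<lambda>s. s^2 * g2' s) \<longlongrightarrow> \<kappa> / (- 2 * \<i>)) re_top"
  "\<And>s. Re s > X \<Longrightarrow> exp (Ln s / 2) * G (- Ln s) = \<alpha> * exp (\<i> * s) * g1 s + \<gamma> * exp (- \<i> * s) * g2 s"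
  "\<And>s. Re s > X \<Longrightarrow> exp (- Ln s / 2) * (G (- Ln s) / 2 - G' (- Ln s)) =
    \<alpha> * exp (\<i> * s) * (\<i> * g1 s + g1' s) + \<gamma> * exp (- \<i> * s) * (- \<i> * g2 s + g2' s)"
proof -
 have c1: "Re (2 * \<i>) = 0" "cmod (2 * \<i>) = 2" and c2: "Re (- 2 * \<i>) = 0" "cmod (- 2 * \<i>) = 2" by (simp_all add: norm_mult)
 obtain X1 g1 g1' where g1: "X1 > 0"
  "\<And>w. Re w > X1 \<Longrightarrow> (g1 has_field_derivative g1' w) (at w)"
  "\<And>w. Re w > X1 \<Longrightarrow> (g1' has_field_derivative \<kappa> / w^2 * g1 w - (2 * \<i>) * g1' w) (at w)"
  "(g1 \<longlongrightarrow> 1) re_top" "((\<lambda>w. w^2 * g1' w) \<longlongrightarrow> \<kappa> / (2 * \<i>)) re_top"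
  by (rule jost_limits[OF c1]) (rule that)
 obtain X2 g2 g2' where g2: "X2 > 0"
  "\<And>w. Re w > X2 \<Longrightarrow> (g2 has_field_derivative g2' w) (at w)"
  "\<And>w. Re w > X2 \<Longrightarrow> (g2' has_field_derivative \<kappa> / w^2 * g2 w - (- 2 * \<i>) * g2' w) (at w)"
  "(g2 \<longlongrightarrow> 1) re_top" "((\<lambda>w. w^2 * g2' w) \<longlongrightarrow> \<kappa> / (- 2 * \<i>)) re_top"
  by (rule jost_limits[OF c2]) (rule that)
 note g1' = tendsto_of_square_re_top(2)[OF g1(5)] and g2' = tendsto_of_square_re_top(2)[OF g2(5)]
 define X where "X = max X1 X2"
 have X: "X > 0" and X12: "Re s > X1" "Re s > X2" "s \<noteq> 0" if "Re s > X" for s using that g1(1) by (auto simp: X_def)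
 have Xp: "X > 0" using g1(1) by (simp add: X_def)
 define h1 where "h1 = (\<lambda>s. exp (\<i> * s) * g1 s)"
 define h1' where "h1' = (\<lambda>s. exp (\<i> * s) * (\<i> * g1 s + g1' s))"
 define h2 where "h2 = (\<lambda>s. exp (- \<i> * s) * g2 s)"
 define h2' where "h2' = (\<lambda>s. exp (- \<i> * s) * (- \<i> * g2 s + g2' s))"
 have D1: "(h1 has_field_derivative h1' s) (at s)" "(h1' has_field_derivative (\<kappa> / s^2 - 1) * h1 s) (at s)" if "Re s > X" for s
  using jost_mode[OF _ X12(3)[OF that] g1(2,3)[OF X12(1)[OF that]]] unfolding h1_def h1'_def by simp_all
 have D2: "(h2 has_field_derivative h2' s) (at s)" "(h2' has_field_derivative (\<kappa> / s^2 - 1) * h2 s) (at s)" if "Re s > X" for s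
  using jost_mode[OF _ X12(3)[OF that] g2(2,3)[OF X12(2)[OF that]]] unfolding h2_def h2'_def by simp_all
 have sh: "cmod (2 * of_real \<nu> / 2 + 1 + of_nat k) \<ge> 1" for k
 proof -
  have "2 * of_real \<nu> / 2 + 1 + of_nat k = (of_real (\<nu> + 1 + real k) :: complex)" by simp
  then have "cmod (2 * of_real \<nu> / 2 + 1 + of_nat k) = \<bar>\<nu> + 1 + real k\<bar>" by (simp only: norm_of_real)
  then show ?thesis using \<nu> by simp
 qed
 have GD: "(G has_field_derivative G' t) (at t)" "(G' has_field_derivative (of_real (\<nu>^2) - exp (- 2 * t)) * G t) (at t)" for t
  using dec_sol_deriv[OF sh, where B = "- 1" and t = t] unfolding G_def G'_def by simp_all
 define y where "y = (\<lambda>s. exp (Ln s / 2) * G (- Ln s))"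
 define y' where "y' = (\<lambda>s. exp (- Ln s / 2) * (G (- Ln s) / 2 - G' (- Ln s)))"
 have Dy: "(y has_field_derivative y' s) (at s)" "(y' has_field_derivative (\<kappa> / s^2 - 1) * y s) (at s)" if "Re s > X" for s
 proof -
  have s: "s \<noteq> 0" by (rule X12(3)[OF that])
  have sn: "s \<notin> \<real>\<^sub>\<le>\<^sub>0" using that Xp by (auto simp: complex_nonpos_Reals_iff)
  define e where "e = exp (Ln s / 2)"
  have e: "exp (- Ln s / 2) = inverse e" "e \<noteq> 0" by (simp_all add: e_def exp_minus[symmetric])
  have "e * e = exp (Ln s)" unfolding e_def exp_add[symmetric] by simp
  then have ss: "e * e = s" using s by simp
  have L: "(Ln has_field_derivative inverse s) (at s)" by (rule has_field_derivative_Ln[OF sn])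
  have Lm: "((\<lambda>s. - Ln s) has_field_derivative - inverse s) (at s)" by (rule DERIV_minus[OF L])
  have E1: "((\<lambda>s. exp (Ln s / 2)) has_field_derivative e * (inverse s / 2)) (at s)"
   unfolding e_def by (rule DERIV_chain2[OF DERIV_exp DERIV_cdivide[OF L]])
  have E2: "((\<lambda>s. exp (- Ln s / 2)) has_field_derivative inverse e * (- inverse s / 2)) (at s)"
   unfolding e(1)[symmetric] by (rule DERIV_chain2[OF DERIV_exp DERIV_cdivide[OF Lm]])
  note G1 = DERIV_chain2[OF GD(1) Lm] and G2 = DERIV_chain2[OF GD(2) Lm]
  have "exp (- 2 * (- Ln s)) = exp (Ln s + Ln s)" by (simp add: algebra_simps)
  also have "\<dots> = s * s" using s unfolding exp_add by simp
  finally have x2: "exp (- 2 * (- Ln s)) = s * s" .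
  define A A' where "A = G (- Ln s)" and "A' = G' (- Ln s)"
  have "(y has_field_derivative e * (inverse s / 2) * A + (A' * - inverse s) * e) (at s)"
   unfolding y_def A_def A'_def using DERIV_mult[OF E1 G1] unfolding e_def[symmetric] .
  moreover have y'A: "y' s = inverse e * (A / 2 - A')" unfolding y'_def e(1) A_def A'_def ..
  have "inverse s = inverse e * inverse e" by (simp add: ss[symmetric])
  then have "e * (inverse s / 2) * A + (A' * - inverse s) * e = y' s" unfolding y'A using e(2) by (simp add: field_simps)
  ultimately show "(y has_field_derivative y' s) (at s)" by simp
  have "(y' has_field_derivative inverse e * (- inverse s / 2) * (A / 2 - A')
    + ((A' * - inverse s) / 2 - ((of_real (\<nu>^2) - s * s) * A) * - inverse s) * inverse e) (at s)" unfolding y'_def A_def A'_def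
   using DERIV_mult[OF E2 DERIV_diff[OF DERIV_cdivide[OF G1, of 2] G2]] unfolding e(1) x2 .
  moreover have "inverse e * (- inverse s / 2) * (A / 2 - A')
    + ((A' * - inverse s) / 2 - ((of_real (\<nu>^2) - s * s) * A) * - inverse s) * inverse e = (\<kappa> / s^2 - 1) * y s"
  proof -
   define N where "N = (of_real (\<nu>^2) :: complex)"
   have \<kappa>N: "\<kappa> = N - 1 / 4" by (simp add: \<kappa>_def N_def)
   have yA: "y s = e * A" by (simp add: y_def e_def A_def)
   show ?thesis unfolding N_def[symmetric] \<kappa>N yA unfolding ss[symmetric] using e(2) by (simp add: field_simps power2_eq_square)
  qed
  ultimately show "(y' has_field_derivative (\<kappa> / s^2 - 1) * y s) (at s)" by simp
 qed
 have "\<exists>C. \<forall>s. Re s > X \<longrightarrow> h1 s * h2' s - h1' s * h2 s = C" by (rule halfplane_wronskian_constant; erule D1 D2)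
 then obtain C where C: "\<And>s. Re s > X \<Longrightarrow> h1 s * h2' s - h1' s * h2 s = C" by blast
 have "\<exists>C. \<forall>s. Re s > X \<longrightarrow> y s * h2' s - y' s * h2 s = C" by (rule halfplane_wronskian_constant; erule Dy D2)
 then obtain C1 where C1: "\<And>s. Re s > X \<Longrightarrow> y s * h2' s - y' s * h2 s = C1" by blast
 have "\<exists>C. \<forall>s. Re s > X \<longrightarrow> y s * h1' s - y' s * h1 s = C" by (rule halfplane_wronskian_constant; erule Dy D1)
 then obtain C2 where C2: "\<And>s. Re s > X \<Longrightarrow> y s * h1' s - y' s * h1 s = C2" by blast
 have ee: "exp (\<i> * s) * exp (- \<i> * s) = 1" for s by (simp add: exp_minus field_simps)
 \<comment> \<open>In the product of the modes the exponentials cancel, so the constant can be read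
   off from the limits of \<open>g1\<close>, \<open>g2\<close> and their derivatives.\<close>
 have "C = - 2 * \<i>"
 proof (rule tendsto_unique[OF re_top_neq_bot])
  have "eventually (\<lambda>s. g1 s * (- \<i> * g2 s + g2' s) - (\<i> * g1 s + g1' s) * g2 s = C) re_top" using eventually_re_top_gt[of X]
  proof eventually_elim
   case (elim s)
   have "C = (exp (\<i> * s) * exp (- \<i> * s)) * (g1 s * (- \<i> * g2 s + g2' s) - (\<i> * g1 s + g1' s) * g2 s)"
    unfolding C[OF elim, symmetric] h1_def h1'_def h2_def h2'_def by (simp add: algebra_simps)
   then show ?case unfolding ee by simp
  qed
  moreover have "((\<lambda>s. g1 s * (- \<i> * g2 s + g2' s) - (\<i> * g1 s + g1' s) * g2 s) \<longlongrightarrow> 1 * (- \<i> * 1 + 0) - (\<i> * 1 + 0) * 1) re_top"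
   by (intro tendsto_intros g1 g2 g1' g2')
  ultimately have "((\<lambda>s. C) \<longlongrightarrow> 1 * (- \<i> * 1 + 0) - (\<i> * 1 + 0) * 1) re_top" by (rule Lim_transform_eventually[rotated])
  then show "((\<lambda>s. C) \<longlongrightarrow> - 2 * \<i>) re_top" by simp
 qed (rule tendsto_const)
 note C = C[unfolded this]
 have real: "y (of_real s) \<in> \<real>" "y' (of_real s) \<in> \<real>" if "s > 0" for s :: real
 proof -
  have Ls: "Ln (of_real s) = of_real (ln s)" by (rule Ln_of_real[OF that])
  have E: "exp (of_real t :: complex) \<in> \<real>" for t :: real unfolding exp_of_real by simp
  define E2 where "E2 = exp (- 2 * - ln s)"
  define x where "x = - 1 / 4 * E2"
  have e2: "exp (- 2 * - of_real (ln s)) = (of_real E2 :: complex)" by (simp add: exp_of_real[symmetric] E2_def)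
  have x: "- 1 / 2^2 * of_real E2 = (of_real x :: complex)" by (simp add: x_def)
  have p: "\<nu> + 1 > 0" "\<nu> + 2 > 0" using \<nu> by simp_all
  have n1: "2 * of_real \<nu> / 2 + 1 = (of_real (\<nu> + 1) :: complex)" and n2: "2 * of_real \<nu> / 2 + 2 = (of_real (\<nu> + 2) :: complex)" by simp_all
  have n3: "- of_real \<nu> * - of_real (ln s) = (of_real (\<nu> * ln s) :: complex)" by simp
  have Gr: "G (- of_real (ln s)) \<in> \<real>" "G' (- of_real (ln s)) \<in> \<real>" unfolding G_def G'_def dec_sol_def dec_sol'_def e2 x n1 n2 n3
   by (intro Reals_mult E hyp01_real p)
    (intro Reals_mult Reals_diff Reals_divide Reals_minus_iff[THEN iffD2] E hyp01_real Reals_of_real Reals_1 Reals_numeral p)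
  have "of_real (ln s) / 2 = (of_real (ln s / 2) :: complex)" "- of_real (ln s) / 2 = (of_real (- ln s / 2) :: complex)" by simp_all
  then show "y (of_real s) \<in> \<real>" "y' (of_real s) \<in> \<real>"
   unfolding y_def y'_def Ls using Gr E by (simp_all only:) (auto intro!: Reals_mult Reals_diff Reals_divide)
 qed
 \<comment> \<open>If y vanished on a real half-line, so would the entire function \<open>u\<close>,
   hence everywhere; but u(0) = 1.\<close>
 have nv: False if S: "\<And>s::real. s > S \<Longrightarrow> y (of_real s) = 0" for S
 proof -
  define S' where "S' = max S 0"
  define U where "U = (of_real ` {S'<..} :: complex set)"
  define u where "u = (\<lambda>s::complex. hyp01 (2 * of_real \<nu> / 2 + 1) (- 1 / 4 * s^2))"
  have hol: "u holomorphic_on UNIV" unfolding u_def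
  proof (rule hyp01_holomorphic[OF open_UNIV])
   show "\<exists>V d. open V \<and> z \<in> V \<and> d > 0 \<and> (\<forall>w\<in>V. \<forall>k. cmod (2 * of_real \<nu> / 2 + 1 + of_nat k) \<ge> d)" for z :: complex
    by (rule exI[of _ UNIV], rule exI[of _ 1]) (use sh in auto)
  qed (intro holomorphic_intros)+
  have z: "u s = 0" if "s \<in> U" for s
  proof -
   from that obtain r where "s = of_real r" "r > S'" unfolding U_def by blast
   then have r: "s = of_real r" "r > S" "r > 0" by (simp_all add: S'_def)
   have "exp (- 2 * (- Ln s)) = exp (Ln s + Ln s)" by (simp add: algebra_simps)
   also have "\<dots> = s^2" using r unfolding exp_add by (simp add: power2_eq_square)
   finally have "- 1 / 2^2 * exp (- 2 * (- Ln s)) = - 1 / 4 * s^2" by simp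
   then have "G (- Ln s) = exp (- of_real \<nu> * - Ln s) * u s" unfolding G_def dec_sol_def u_def by (simp only:)
   then show ?thesis using S[OF r(2)] r(1) by (simp add: y_def)
  qed
  have lp: "of_real (S' + 1) islimpt U" unfolding islimpt_approachable
  proof (intro allI impI)
   fix e :: real assume "e > 0"
   have "dist (of_real (S' + 1 + e / 2)) (of_real (S' + 1) :: complex) = \<bar>e / 2\<bar>" unfolding dist_of_real dist_real_def by simp
   then show "\<exists>x'\<in>U. x' \<noteq> of_real (S' + 1) \<and> dist x' (of_real (S' + 1)) < e"
    unfolding U_def using \<open>e > 0\<close> by (intro bexI[of _ "of_real (S' + 1 + e / 2)"] conjI imageI) auto
  qed
  have "u 0 = 0" by (rule analytic_continuation[OF hol open_UNIV connected_UNIV subset_UNIV UNIV_I lp z UNIV_I])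
  then show False by (simp add: u_def)
 qed
 \<comment> \<open>Cramer's rule with the Wronskian - 2 i of the two modes.\<close>
 define \<alpha> where "\<alpha> = C1 / (- 2 * \<i>)"
 define \<gamma> where "\<gamma> = C2 / (2 * \<i>)"
 \<comment> \<open>A vanishing Wronskian would make y proportional to a single mode, which is
   impossible for a function that is real on the real axis and not eventually 0.\<close>
 have "C1 \<noteq> 0"
 proof
  assume 0: "C1 = 0"
  have eq: "y s * (- \<i> * g2 s + g2' s) = y' s * g2 s" if "Re s > X" for s
  proof -
   have "exp (- \<i> * s) * (y s * (- \<i> * g2 s + g2' s)) = exp (- \<i> * s) * (y' s * g2 s)"
    using C1[OF that] unfolding 0 h2_def h2'_def by (simp only: right_minus_eq mult.left_commute)
   then show ?thesis by simp
  qed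
  have "\<exists>S. \<forall>s::real. s > S \<longrightarrow> y (of_real s) = 0" by (rule real_not_single_mode[OF real g2(4) g2' _ eq]) simp_all
  then show False using nv by blast
 qed
 then have \<alpha>0: "\<alpha> \<noteq> 0" by (simp add: \<alpha>_def)
 have "C2 \<noteq> 0"
 proof
  assume 0: "C2 = 0"
  have eq: "y s * (\<i> * g1 s + g1' s) = y' s * g1 s" if "Re s > X" for s
  proof -
   have "exp (\<i> * s) * (y s * (\<i> * g1 s + g1' s)) = exp (\<i> * s) * (y' s * g1 s)"
    using C2[OF that] unfolding 0 h1_def h1'_def by (simp only: right_minus_eq mult.left_commute)
   then show ?thesis by simp
  qed
  have "\<exists>S. \<forall>s::real. s > S \<longrightarrow> y (of_real s) = 0" by (rule real_not_single_mode[OF real g1(4) g1' _ eq]) simp_all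
  then show False using nv by blast
 qed
 then have \<gamma>0: "\<gamma> \<noteq> 0" by (simp add: \<gamma>_def)
 have rep: "y s = \<alpha> * h1 s + \<gamma> * h2 s" "y' s = \<alpha> * h1' s + \<gamma> * h2' s" if "Re s > X" for s
 proof -
  have i2: "- 2 * \<i> \<noteq> 0" by simp
  have "(- 2 * \<i>) * y s = h1 s * C1 - h2 s * C2" "(- 2 * \<i>) * y' s = h1' s * C1 - h2' s * C2"
   unfolding C1[OF that, symmetric] C2[OF that, symmetric] C[OF that, symmetric] by (simp_all add: algebra_simps)
  moreover have "h1 s * C1 - h2 s * C2 = (- 2 * \<i>) * (\<alpha> * h1 s + \<gamma> * h2 s)" "h1' s * C1 - h2' s * C2 = (- 2 * \<i>) * (\<alpha> * h1' s + \<gamma> * h2' s)"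
   by (simp_all add: \<alpha>_def \<gamma>_def field_simps)
  ultimately show "y s = \<alpha> * h1 s + \<gamma> * h2 s" "y' s = \<alpha> * h1' s + \<gamma> * h2' s" using mult_left_cancel[OF i2] by metis+
 qed
 have hol: "g1 holomorphic_on {s. Re s > X}" "g1' holomorphic_on {s. Re s > X}"
  "g2 holomorphic_on {s. Re s > X}" "g2' holomorphic_on {s. Re s > X}"
  unfolding holomorphic_on_open[OF open_halfspace_Re_gt] using g1(2,3) g2(2,3) X12 by blast+
 show ?thesis by (rule that[OF Xp \<alpha>0 \<gamma>0 hol g1(4,5) g2(4,5)])
   (use rep in \<open>simp_all only: y_def y'_def h1_def h1'_def h2_def h2'_def mult.assoc\<close>)
qed

section \<open>Asymptotics of the Wronskian\<close>

text \<open>The majorant of \<open>hyp01_coeff_bound\<close> with the term of index 0, which is 1 on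
  both sides, taken off.\<close>

lemma hyp01_near_1:
 assumes d: "\<And>k. cmod (B + of_nat k) \<ge> d" "d > 0"
 shows "cmod (hyp01 B x - 1) \<le> exp (cmod x / d) - 1"
proof -
 define F where "F = (\<lambda>k. fps_nth (hyp01_fps B) k * x ^ k)"
 define H where "H = (\<lambda>k. (cmod x / d) ^ k / fact k)"
 have le: "cmod (F k) \<le> H k" for k unfolding F_def H_def by (rule hyp01_coeff_bound[OF d])
 have sH: "summable H" unfolding H_def by (rule summable_exp_real)
 have sN: "summable (\<lambda>k. cmod (F k))" by (rule summable_comparison_test'[OF sH, of 0]) (use le in simp)
 have sF: "summable F" using sN by (rule summable_norm_cancel)
 have s1: "summable (\<lambda>k. cmod (F (Suc k)))" using sN summable_Suc_iff[of "\<lambda>k. cmod (F k)"] by simp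
 have s2: "summable (\<lambda>k. H (Suc k))" using sH summable_Suc_iff[of H] by simp
 have F0: "F 0 = 1" by (simp add: F_def hyp01_fps_def)
 have H0: "H 0 = 1" by (simp add: H_def)
 have "hyp01 B x - 1 = (\<Sum>k. F (Suc k))" using suminf_split_head[OF sF] F0 by (simp add: hyp01_def eval_fps_def F_def)
 also have "cmod \<dots> \<le> (\<Sum>k. cmod (F (Suc k)))" by (rule summable_norm[OF s1])
 also have "\<dots> \<le> (\<Sum>k. H (Suc k))" by (rule suminf_le[OF le s1 s2])
 also have "\<dots> = suminf H - 1" using suminf_split_head[OF sH] H0 by simp
 also have "suminf H = exp (cmod x / d)" by (simp add: H_def exp_def divide_inverse_commute)
 finally show ?thesis .
qed

lemma hyp01_tendsto_1:
 assumes d: "eventually (\<lambda>z. d z > 0 \<and> (\<forall>k. cmod (B z + of_nat k) \<ge> d z)) F" and l: "filterlim d at_top F"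
 shows "((\<lambda>z. hyp01 (B z) x) \<longlongrightarrow> 1) F"
proof -
 have "((\<lambda>z. exp (cmod x * inverse (d z)) - 1) \<longlongrightarrow> exp (cmod x * 0) - 1) F"
  by (intro tendsto_intros tendsto_inverse_0_at_top[OF l])
 then have l0: "((\<lambda>z. exp (cmod x * inverse (d z)) - 1) \<longlongrightarrow> 0) F" by simp
 have "((\<lambda>z. hyp01 (B z) x - 1) \<longlongrightarrow> 0) F"
 proof (rule Lim_null_comparison[OF _ l0])
  show "eventually (\<lambda>z. norm (hyp01 (B z) x - 1) \<le> exp (cmod x * inverse (d z)) - 1) F"
   using d by eventually_elim (use hyp01_near_1 in \<open>simp add: divide_inverse\<close>)
 qed
 then show ?thesis by (simp only: LIM_zero_iff)
qed

context radial
begin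

text \<open>All four limits come from (\<sigma> - z)(\<sigma> + z) = - \<beta>^2 / 4 together with
  Re (z + \<sigma>) \<ge> Re z.\<close>

lemma sigma_limits:
 "((\<lambda>z. \<sigma> z - z) \<longlongrightarrow> 0) re_top" (is ?A)
 "((\<lambda>z. z * (\<sigma> z - z)) \<longlongrightarrow> - of_real (\<beta>^2 / 8)) re_top" (is ?B)
 "((\<lambda>z. (z + \<sigma> z) * inverse z) \<longlongrightarrow> 2) re_top" (is ?C)
 "filterlim (\<lambda>z. Re (\<sigma> z)) at_top re_top" (is ?D)
proof -
 have ev: "eventually (\<lambda>z. Re z > max (\<beta> / 2) 0) re_top" by (rule eventually_re_top_gt)
 have nz: "z + \<sigma> z \<noteq> 0" "z \<noteq> 0" "Re z \<le> Re (z + \<sigma> z)" "Re z > 0" if "Re z > max (\<beta> / 2) 0" for z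
 proof -
  have s: "Re (\<sigma> z) > 0" using \<sigma>_right(2)[of z] that by simp
  have "Re (z + \<sigma> z) > 0" using s that by simp
  then show "z + \<sigma> z \<noteq> 0" by (metis less_irrefl zero_complex.sel(1))
  show "z \<noteq> 0" "Re z > 0" using that by auto
  show "Re z \<le> Re (z + \<sigma> z)" using s by simp
 qed
 have prod: "(\<sigma> z - z) * (z + \<sigma> z) = - of_real (\<beta>^2 / 4)" for z
 proof -
  have "(\<sigma> z - z) * (z + \<sigma> z) = (\<sigma> z)^2 - z^2" by (simp add: power2_eq_square algebra_simps)
  then show ?thesis by (simp only: \<sigma>_square) simp
 qed
 have "eventually (\<lambda>z. Re z \<le> Re (z + \<sigma> z)) re_top" using ev by eventually_elim (rule nz(3))
 with Re_at_re_top have "filterlim (\<lambda>z. Re (z + \<sigma> z)) at_top re_top" by (rule filterlim_at_top_mono)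
 then have inv: "((\<lambda>z. inverse (z + \<sigma> z)) \<longlongrightarrow> 0) re_top"
  using filterlim_compose[OF inverse_re_top, of "\<lambda>z. z + \<sigma> z" re_top] unfolding re_top_def filterlim_filtercomap_iff o_def by simp
 have "((\<lambda>z. - of_real (\<beta>^2 / 4) * inverse (z + \<sigma> z)) \<longlongrightarrow> 0) re_top" by (rule tendsto_mult_right_zero[OF inv])
 moreover have "eventually (\<lambda>z. - of_real (\<beta>^2 / 4) * inverse (z + \<sigma> z) = \<sigma> z - z) re_top" using ev
 proof eventually_elim
  case (elim z)
  show ?case unfolding prod[of z, symmetric] using nz(1)[OF elim] by simp
 qed
 ultimately show 1: ?A by (rule Lim_transform_eventually)
 have "((\<lambda>z. 2 + (\<sigma> z - z) * inverse z) \<longlongrightarrow> 2 + 0 * 0) re_top" by (intro tendsto_intros 1 inverse_re_top)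
 moreover have "eventually (\<lambda>z. 2 + (\<sigma> z - z) * inverse z = (z + \<sigma> z) * inverse z) re_top"
  using ev by eventually_elim (use nz(2) in \<open>simp add: field_simps\<close>)
 ultimately have "((\<lambda>z. (z + \<sigma> z) * inverse z) \<longlongrightarrow> 2 + 0 * 0) re_top" by (rule Lim_transform_eventually)
 then show 3: ?C by simp
 have "((\<lambda>z. - of_real (\<beta>^2 / 4) * inverse ((z + \<sigma> z) * inverse z)) \<longlongrightarrow> - of_real (\<beta>^2 / 4) * inverse 2) re_top"
  by (intro tendsto_mult tendsto_const tendsto_inverse 3) simp
 moreover have "eventually (\<lambda>z. - of_real (\<beta>^2 / 4) * inverse ((z + \<sigma> z) * inverse z) = z * (\<sigma> z - z)) re_top" using ev
 proof eventually_elim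
  case (elim z)
  show ?case unfolding prod[of z, symmetric] using nz[OF elim] by simp
 qed
 ultimately have "((\<lambda>z. z * (\<sigma> z - z)) \<longlongrightarrow> - of_real (\<beta>^2 / 4) * inverse 2) re_top" by (rule Lim_transform_eventually)
 then show ?B by simp
 have "filterlim (\<lambda>z. Re (\<sigma> z - z) + Re z) at_top re_top" by (rule filterlim_tendsto_add_at_top[OF tendsto_Re[OF 1] Re_at_re_top])
 then show ?D by simp
qed

text \<open>The deviation of the funnel solution at 0 from the pure wave exp (i \<sigma> r),
  measured in the derivative.\<close>

definition R1 :: "complex \<Rightarrow> complex" where "R1 z = FR' z 0 - \<i> * \<sigma> z * FR z 0"

text \<open>The parameter of 0F1 grows like - i z / \<beta>, so the series tends to 1.
  \<open>R1\<close> stems from differentiating the argument of the series and carries m^2 divided by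
  this parameter.\<close>

lemma FR_limits:
 "((\<lambda>z. FR z 0) \<longlongrightarrow> 1) re_top" (is ?A)
 "((\<lambda>z. z * R1 z) \<longlongrightarrow> - \<i> * of_real (m2 / 2)) re_top" (is ?B)
 "(R1 \<longlongrightarrow> 0) re_top" (is ?C)
proof -
 define c :: complex where "c = of_real (2 * \<beta>)"
 define q where "q = (\<lambda>z. 2 * (- \<i> * \<sigma> z) / c + 1)"
 define x where "x = ((of_int m)^2 / c^2 :: complex)"
 have \<beta>0: "\<beta> > 0" by (rule \<beta>\<nu>)
 have c0: "c \<noteq> 0" using \<beta>0 by (simp add: c_def)
 define d where "d = (\<lambda>z. Re (\<sigma> z) / \<beta>)"
 have ld: "filterlim d at_top re_top"
 proof -
  have "filterlim (\<lambda>z. inverse \<beta> * Re (\<sigma> z)) at_top re_top"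
   by (rule filterlim_tendsto_pos_mult_at_top[OF tendsto_const _ sigma_limits(4)]) (use \<beta>0 in simp)
  then show ?thesis by (simp add: d_def divide_inverse mult.commute)
 qed
 have ev: "eventually (\<lambda>z. Re z > max (\<beta> / 2) 0) re_top" by (rule eventually_re_top_gt)
 have dq: "d z > 0" "cmod (q z + of_nat k) \<ge> d z" if "Re z > \<beta> / 2" for z k
  using right_shift(2)[OF that, of k] \<sigma>_right(2)[OF that] \<beta>0 by (simp_all add: d_def q_def c_def)
 have h1: "((\<lambda>z. hyp01 (q z) x) \<longlongrightarrow> 1) re_top"
  by (rule hyp01_tendsto_1[OF _ ld]) (use ev dq in \<open>auto elim!: eventually_mono\<close>)
 have h2: "((\<lambda>z. hyp01 (q z + 1) x) \<longlongrightarrow> 1) re_top"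
  by (rule hyp01_tendsto_1[OF _ ld]) (use ev dq(1) shift_norm_ge(1)[OF dq(2)] in \<open>auto elim!: eventually_mono\<close>)
 have q2: "2 * (- \<i> * \<sigma> z) / c + 2 = q z + 1" for z by (simp add: q_def)
 have qz: "2 * (- \<i> * \<sigma> z) / c + 1 = q z" for z by (simp add: q_def)
 have FRe: "FR z 0 = hyp01 (q z) x" for z by (simp add: FR_def dec_sol_def q_def x_def c_def)
 have R1e: "R1 z = - ((of_int m)^2 / c) * inverse (q z) * hyp01 (q z + 1) x" for z
 proof -
  have "FR' z 0 = \<i> * \<sigma> z * hyp01 (q z) x - (of_int m)^2 / c / q z * hyp01 (q z + 1) x"
   unfolding FR'_def dec_sol'_def c_def[symmetric] q2 qz by (simp add: x_def)
  then show ?thesis unfolding R1_def FRe by (simp add: divide_inverse)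
 qed
 show ?A unfolding FRe by (rule h1)
 have "((\<lambda>z. inverse z - (2 * \<i> / c) * ((z + \<sigma> z) * inverse z - 1)) \<longlongrightarrow> 0 - (2 * \<i> / c) * (2 - 1)) re_top"
  by (intro tendsto_intros inverse_re_top sigma_limits)
 moreover have "eventually (\<lambda>z. inverse z - (2 * \<i> / c) * ((z + \<sigma> z) * inverse z - 1) = inverse z * q z) re_top" using ev
 proof eventually_elim
  case (elim z)
  then have "z \<noteq> 0" by auto
  then show ?case using c0 by (simp add: q_def field_simps)
 qed
 ultimately have "((\<lambda>z. inverse z * q z) \<longlongrightarrow> 0 - (2 * \<i> / c) * (2 - 1)) re_top" by (rule Lim_transform_eventually)
 then have lq: "((\<lambda>z. inverse z * q z) \<longlongrightarrow> - (2 * \<i> / c)) re_top" by simp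
 have "((\<lambda>z. - ((of_int m)^2 / c) * inverse (inverse z * q z) * hyp01 (q z + 1) x) \<longlongrightarrow>
   - ((of_int m)^2 / c) * inverse (- (2 * \<i> / c)) * 1) re_top" by (intro tendsto_intros lq h2) (use c0 in auto)
 moreover have "- ((of_int m)^2 / c) * inverse (inverse z * q z) * hyp01 (q z + 1) x = z * R1 z" for z unfolding R1e by (simp add: mult_ac)
 moreover have "- ((of_int m)^2 / c) * inverse (- (2 * \<i> / c)) * 1 = - \<i> * of_real (m2 / 2)" using c0 by (simp add: field_simps)
 ultimately show l: ?B by simp
 have "((\<lambda>z. inverse z * (z * R1 z)) \<longlongrightarrow> 0 * (- \<i> * of_real (m2 / 2))) re_top" by (intro tendsto_mult inverse_re_top l)
 moreover have "eventually (\<lambda>z. inverse z * (z * R1 z) = R1 z) re_top" using ev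
 proof eventually_elim
  case (elim z)
  then have "z \<noteq> 0" by auto
  then show ?case by simp
 qed
 ultimately have "(R1 \<longlongrightarrow> 0 * (- \<i> * of_real (m2 / 2))) re_top" by (rule Lim_transform_eventually)
 then show ?C by simp
qed

text \<open>The potential depends on z and t only through s exp (- t), so a shift of t by Ln s
  replaces z / a by 1. The factor exp (\<nu> Ln s) accounts for the normalisation at
  infinity.\<close>

lemma FL_scaling:
 assumes s: "s = z / of_real a" "s \<noteq> 0"
 shows "exp (of_real \<nu> * Ln s) * FL z 0 = dec_sol (of_real \<nu>) (- 1) 2 (- Ln s)" (is ?A)
  and "exp (of_real \<nu> * Ln s) * FL' z 0 = dec_sol' (of_real \<nu>) (- 1) 2 (- Ln s)"
proof -
 have "exp (- 2 * (- Ln s)) = exp (Ln s + Ln s)" by (simp add: algebra_simps)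
 also have "\<dots> = s^2" using s(2) unfolding exp_add by (simp add: power2_eq_square)
 finally have e: "exp (- 2 * (- Ln s)) = s^2" .
 have e0: "exp (- of_real \<nu> * 0) = (1::complex)" "exp (- 2 * 0) = (1::complex)" by simp_all
 show ?A
  "exp (of_real \<nu> * Ln s) * FL' z 0 = dec_sol' (of_real \<nu>) (- 1) 2 (- Ln s)"
  unfolding FL_def FL'_def dec_sol_def dec_sol'_def of_real_numeral e e0 s(1)[symmetric] by simp_all
qed

text \<open>Up to a factor without zeros the Wronskian is \<alpha> exp (i s) P + \<gamma> exp (- i
  s) Q with s = z / a. Setting it to 0 determines exp (2 i s), and the orders of \<open>P\<close>
  and \<open>Q\<close> in z give the exponent.\<close>

lemma Wr_equation:
 obtains L C0 \<epsilon> where "L > 0" "L \<ge> \<beta> / 2" "C0 \<noteq> 0" "\<epsilon> holomorphic_on {z. Re z > L}"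
  "\<And>z. Re z > L \<Longrightarrow> cmod (\<epsilon> z) < 1 / 2"
  "\<And>z. Re z > L \<Longrightarrow> Wr z = 0 \<longleftrightarrow> exp (2 * \<i> * z / of_real a) = C0 * z ^ (if \<beta> \<noteq> a then 1 else 2) * (1 + \<epsilon> z)"
proof -
 define \<kappa> :: complex where "\<kappa> = of_real (\<nu>^2 - 1 / 4)"
 obtain X \<alpha> \<gamma> g1 g1' g2 g2' where X: "X > 0" and nz: "\<alpha> \<noteq> 0" "\<gamma> \<noteq> 0"
  and hol: "g1 holomorphic_on {s. Re s > X}" "g1' holomorphic_on {s. Re s > X}"
   "g2 holomorphic_on {s. Re s > X}" "g2' holomorphic_on {s. Re s > X}"
  and g: "(g1 \<longlongrightarrow> 1) re_top" "((\<lambda>s. s^2 * g1' s) \<longlongrightarrow> \<kappa> / (2 * \<i>)) re_top"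
   "(g2 \<longlongrightarrow> 1) re_top" "((\<lambda>s. s^2 * g2' s) \<longlongrightarrow> \<kappa> / (- 2 * \<i>)) re_top"
  and y: "\<And>s. Re s > X \<Longrightarrow> exp (Ln s / 2) * dec_sol (of_real \<nu>) (- 1) 2 (- Ln s) = \<alpha> * exp (\<i> * s) * g1 s + \<gamma> * exp (- \<i> * s) * g2 s"
  and y': "\<And>s. Re s > X \<Longrightarrow> exp (- Ln s / 2) * (dec_sol (of_real \<nu>) (- 1) 2 (- Ln s) / 2 - dec_sol' (of_real \<nu>) (- 1) 2 (- Ln s)) =
    \<alpha> * exp (\<i> * s) * (\<i> * g1 s + g1' s) + \<gamma> * exp (- \<i> * s) * (- \<i> * g2 s + g2' s)"
  by (rule bessel_connection[OF \<beta>\<nu>(2), folded \<kappa>_def])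
   (rule that, assumption, assumption, assumption, assumption, assumption, assumption, assumption,
    assumption, assumption, assumption, assumption, assumption, assumption)
 define A :: complex where "A = of_real a"
 have A: "A \<noteq> 0" using a by (simp add: A_def)
 \<comment> \<open>Half the jump of f' / f at 0, that is, the contribution of the kink.\<close>
 define D :: complex where "D = of_real ((\<beta> - a) / 2)"
 \<comment> \<open>\<open>P\<close> measures how far the mode exp (i s) is from matching the funnel
   solution at 0, and is bounded or small; \<open>Q\<close> does this for exp (- i s) and grows like
   - 2 i z.\<close>
 define P where "P = (\<lambda>z. FR z 0 * (- \<i> * (\<sigma> z - z) * g1 (z / A) + A * (z / A * g1' (z / A)) + D * g1 (z / A)) - g1 (z / A) * R1 z)"
 define Q where "Q = (\<lambda>z. FR z 0 * (- \<i> * (z + \<sigma> z) * g2 (z / A) + A * (z / A * g2' (z / A)) + D * g2 (z / A)) - g2 (z / A) * R1 z)"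
 define j :: nat where "j = (if \<beta> \<noteq> a then 1 else 2)"
 have sc: "filterlim (\<lambda>z. z / A) re_top re_top" unfolding A_def by (rule scale_re_top[OF a])
 note G1 = filterlim_compose[OF g(1) sc] and G2 = filterlim_compose[OF g(3) sc]
  and G1' = filterlim_compose[OF tendsto_of_square_re_top(1)[OF g(2)] sc]
  and G2' = filterlim_compose[OF tendsto_of_square_re_top(1)[OF g(4)] sc]
  and G1'' = filterlim_compose[OF g(2) sc]
 have ev: "eventually (\<lambda>z. Re z > max (\<beta> / 2) 0) re_top" by (rule eventually_re_top_gt)
 \<comment> \<open>If a + b \<noteq> 0, the limit of \<open>P\<close> is the kink term
   \<open>D\<close>. Otherwise \<open>D\<close> = 0 and the order 1 / z decides.\<close>
 have "\<exists>cP. cP \<noteq> 0 \<and> ((\<lambda>z. z ^ (j - 1) * P z) \<longlongrightarrow> cP) re_top"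
 proof (cases "\<beta> = a")
  case False
  have "(P \<longlongrightarrow> 1 * (- \<i> * 0 * 1 + A * 0 + D * 1) - 1 * 0) re_top"
   unfolding P_def by (intro tendsto_intros FR_limits sigma_limits G1 G1')
  then have "((\<lambda>z. z ^ (j - 1) * P z) \<longlongrightarrow> D) re_top" using False by (simp add: j_def)
  moreover have "D \<noteq> 0" using False by (simp add: D_def)
  ultimately show ?thesis by blast
 next
  case True
  have D0: "D = 0" using True by (simp add: D_def)
  \<comment> \<open>Three sources at order 1 / z: the shift \<sigma> - z, the term \<kappa> / s^2 of
    the Bessel equation, and the m^2 term of the funnel.\<close>
  define l where "l = 1 * (- \<i> * (- of_real (\<beta>^2 / 8)) * 1 + A^2 * (\<kappa> / (2 * \<i>))) - 1 * (- \<i> * of_real (m2 / 2))"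
  have "((\<lambda>z. FR z 0 * (- \<i> * (z * (\<sigma> z - z)) * g1 (z / A) + A^2 * ((z / A)^2 * g1' (z / A))) - g1 (z / A) * (z * R1 z)) \<longlongrightarrow> l) re_top"
   unfolding l_def by (intro tendsto_intros FR_limits sigma_limits G1 G1'')
  moreover have "FR z 0 * (- \<i> * (z * (\<sigma> z - z)) * g1 (z / A) + A^2 * ((z / A)^2 * g1' (z / A))) - g1 (z / A) * (z * R1 z) = z ^ (j - 1) * P z" for z
  proof -
   have "A^2 * ((z / A)^2 * g1' (z / A)) = z * (A * (z / A * g1' (z / A)))" using A by (simp add: power2_eq_square)
   then show ?thesis using True by (simp only: P_def D0 j_def) (simp add: algebra_simps)
  qed
  ultimately have "((\<lambda>z. z ^ (j - 1) * P z) \<longlongrightarrow> l) re_top" by simp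
  \<comment> \<open>With \<beta> = a the two m^2 terms cancel, and two contributions i a^2 / 8 are
    left.\<close>
  moreover have "l = \<i> * of_real (a^2 / 4)"
  proof -
   have "A^2 * \<kappa> = of_real (m2 - a^2 / 4)"
   proof -
    have "a^2 * (\<nu>^2 - 1 / 4) = m2 - a^2 / 4" using a by (simp add: \<nu>_def power_divide right_diff_distrib)
    then show ?thesis unfolding A_def \<kappa>_def by (simp only: of_real_power[symmetric] of_real_mult[symmetric])
   qed
   moreover have "\<kappa> / (2 * \<i>) = - (\<i> / 2) * \<kappa>" by (simp add: field_simps)
   ultimately have e: "A^2 * (\<kappa> / (2 * \<i>)) = - (\<i> / 2) * of_real (m2 - a^2 / 4)" by (metis mult.left_commute)
   show ?thesis unfolding l_def e True by (simp add: complex_eq_iff field_simps)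
  qed
  moreover have "\<i> * of_real (a^2 / 4) \<noteq> 0" using a by simp
  ultimately show ?thesis by blast
 qed
 then obtain cP where cP: "cP \<noteq> 0" "((\<lambda>z. z ^ (j - 1) * P z) \<longlongrightarrow> cP) re_top" by blast
 have "((\<lambda>z. FR z 0 * (- \<i> * ((z + \<sigma> z) * inverse z) * g2 (z / A) + (A * (z / A * g2' (z / A)) + D * g2 (z / A)) * inverse z) - g2 (z / A) * R1 z * inverse z)
   \<longlongrightarrow> 1 * (- \<i> * 2 * 1 + (A * 0 + D * 1) * 0) - 1 * 0 * 0) re_top"
  by (intro tendsto_intros FR_limits sigma_limits G2 G2' inverse_re_top)
 moreover have "FR z 0 * (- \<i> * ((z + \<sigma> z) * inverse z) * g2 (z / A) + (A * (z / A * g2' (z / A)) + D * g2 (z / A)) * inverse z) - g2 (z / A) * R1 z * inverse z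
   = Q z * inverse z" for z
 proof -
  have "F * (J * (S * w) * u + (A * p + D * u) * w) - u * R * w = (F * (J * S * u + A * p + D * u) - u * R) * w"
   for F J S w u p R :: complex by (simp add: algebra_simps)
  then show ?thesis unfolding Q_def .
 qed
 ultimately have "((\<lambda>z. Q z * inverse z) \<longlongrightarrow> 1 * (- \<i> * 2 * 1 + (A * 0 + D * 1) * 0) - 1 * 0 * 0) re_top" by (simp only:)
 moreover have "1 * (- \<i> * 2 * 1 + (A * 0 + D * 1) * 0) - 1 * 0 * 0 = - 2 * \<i>" by simp
 ultimately have lQ: "((\<lambda>z. Q z * inverse z) \<longlongrightarrow> - 2 * \<i>) re_top" by (simp only:)
 \<comment> \<open>By the two limits, - \<gamma> Q / (\<alpha> P) is asymptotic to C0 z^j;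
   \<open>\<epsilon>\<close> is the relative error.\<close>
 define C0 where "C0 = 2 * \<i> * \<gamma> / (\<alpha> * cP)"
 have C0: "C0 \<noteq> 0" using nz cP by (simp add: C0_def)
 define \<epsilon> where "\<epsilon> = (\<lambda>z. - \<gamma> * Q z / (\<alpha> * P z * (C0 * z ^ j)) - 1)"
 have j1: "j = Suc (j - 1)" by (simp add: j_def)
 have l\<epsilon>: "((\<lambda>z. (Q z * inverse z) * (- cP / (2 * \<i>)) * inverse (z ^ (j - 1) * P z) - 1) \<longlongrightarrow> (- 2 * \<i>) * (- cP / (2 * \<i>)) * inverse cP - 1) re_top"
  by (intro tendsto_intros lQ cP)
 have l0: "(- 2 * \<i>) * (- cP / (2 * \<i>)) * inverse cP - 1 = 0" using cP by simp
 have e\<epsilon>: "(Q z * inverse z) * (- cP / (2 * \<i>)) * inverse (z ^ (j - 1) * P z) - 1 = \<epsilon> z" for z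
 proof -
  have "- \<gamma> * Q z / (\<alpha> * P z * (C0 * (z * z ^ (j - 1)))) = (Q z * inverse z) * (- cP / (2 * \<i>)) * inverse (z ^ (j - 1) * P z)"
  proof -
   define k w where "k = 2 * \<i>" and "w = z ^ (j - 1)"
   have "\<alpha> * P z * (C0 * (z * w)) = \<gamma> * (P z * k * z * w / cP)" unfolding C0_def k_def[symmetric] using nz(1) by simp
   then have "- \<gamma> * Q z / (\<alpha> * P z * (C0 * (z * w))) = - Q z / (P z * k * z * w / cP)" using nz(2) by simp
   also have "\<dots> = (Q z * inverse z) * (- cP / k) * inverse (w * P z)" by (simp add: divide_inverse mult_ac)
   finally show ?thesis unfolding k_def w_def .
  qed
  moreover have "z ^ j = z * z ^ (j - 1)" using j1 power_Suc by metis
  ultimately show ?thesis by (simp only: \<epsilon>_def)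
 qed
 have "(\<epsilon> \<longlongrightarrow> 0) re_top" using l\<epsilon> unfolding e\<epsilon> l0 .
 then have "eventually (\<lambda>z. dist (\<epsilon> z) 0 < 1 / 2) re_top" by (rule tendstoD) simp
 then have e1: "eventually (\<lambda>z. cmod (\<epsilon> z) < 1 / 2) re_top" by simp
 have "eventually (\<lambda>z. z ^ (j - 1) * P z \<noteq> 0) re_top" by (rule tendsto_imp_eventually_ne[OF cP(2,1)])
 then have e2: "eventually (\<lambda>z. P z \<noteq> 0) re_top" by eventually_elim auto
 obtain L0 where L0: "\<And>z. Re z > L0 \<Longrightarrow> cmod (\<epsilon> z) < 1 / 2 \<and> P z \<noteq> 0"
  using eventually_conj[OF e1 e2] by (rule eventually_re_topE) (rule that)
 define L where "L = Max {L0, \<beta> / 2, a * X}"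
 have L: "L \<ge> L0" "L \<ge> \<beta> / 2" "L \<ge> a * X" by (simp_all add: L_def)
 have Lp: "L > 0" using L(2) \<beta>\<nu>(1) by simp
 define H where "H = {z. Re z > L}"
 have H: "Re (z / A) > X" "z \<in> \<Omega>" "z \<noteq> 0" "cmod (\<epsilon> z) < 1 / 2" "P z \<noteq> 0" if "z \<in> H" for z
 proof -
  have z: "Re z > L" using that by (simp add: H_def)
  show "Re (z / A) > X" using z L(3) a by (simp add: A_def Re_divide_of_real field_simps)
  show "z \<in> \<Omega>" "z \<noteq> 0" "cmod (\<epsilon> z) < 1 / 2" "P z \<noteq> 0" using z L Lp L0[of z] by (auto simp: \<Omega>_def)
 qed
 have hs: "(\<lambda>z. h (z / A)) holomorphic_on H" if "h holomorphic_on {s. Re s > X}" for h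
 proof -
  have "(h \<circ> (\<lambda>z. z / A)) holomorphic_on H"
   by (rule holomorphic_on_compose_gen[OF _ that]) (use A H(1) in \<open>auto intro!: holomorphic_intros\<close>)
  then show ?thesis by (simp only: o_def)
 qed
 have sub: "H \<subseteq> \<Omega>" using H(2) by blast
 have hF: "\<sigma> holomorphic_on H" "(\<lambda>z. FR z 0) holomorphic_on H" "(\<lambda>z. FR' z 0) holomorphic_on H"
  using holomorphic_on_subset[OF _ sub] \<sigma>_holomorphic F_holomorphic(3,4) by blast+
 have hR: "R1 holomorphic_on H" unfolding R1_def[abs_def] by (intro holomorphic_intros hF)
 have hPQ: "P holomorphic_on H" "Q holomorphic_on H" unfolding P_def Q_def by (intro holomorphic_intros hF hR hs hol A)+
 have "\<epsilon> holomorphic_on H" unfolding \<epsilon>_def by (intro holomorphic_intros hPQ) (use H nz C0 in auto)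
 then have h\<epsilon>: "\<epsilon> holomorphic_on {z. Re z > L}" by (simp only: H_def)
 have main: "Wr z = 0 \<longleftrightarrow> exp (2 * \<i> * z / of_real a) = C0 * z ^ j * (1 + \<epsilon> z)" if z: "Re z > L" for z
 proof -
  have zH: "z \<in> H" using z by (simp add: H_def)
  note h = H[OF zH]
  define s where "s = z / A"
  have s: "Re s > X" "s \<noteq> 0" "z = A * s" using h A by (auto simp: s_def)
  define e where "e = exp (Ln s / 2)"
  define n where "n = exp (of_real \<nu> * Ln s)"
  have "e * e = exp (Ln s)" unfolding e_def exp_add[symmetric] by simp
  then have es: "e * e = s" using s by simp
  have e0: "e \<noteq> 0" "n \<noteq> 0" "exp (- Ln s / 2) = inverse e" by (simp_all add: e_def n_def exp_minus[symmetric])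
  define K where "K = dec_sol (of_real \<nu>) (- 1) 2 (- Ln s)"
  define K' where "K' = dec_sol' (of_real \<nu>) (- 1) 2 (- Ln s)"
  define Y where "Y = \<alpha> * exp (\<i> * s) * g1 s + \<gamma> * exp (- \<i> * s) * g2 s"
  define Y' where "Y' = \<alpha> * exp (\<i> * s) * (\<i> * g1 s + g1' s) + \<gamma> * exp (- \<i> * s) * (- \<i> * g2 s + g2' s)"
  have FLK: "n * FL z 0 = K" "n * FL' z 0 = K'" unfolding n_def K_def K'_def by (rule FL_scaling[OF s_def[unfolded A_def] s(2)])+
  have eK: "e * K = Y" using y[OF s(1)] by (simp only: e_def K_def Y_def)
  have "inverse e * (K / 2 - K') = Y'" using y'[OF s(1)] unfolding e0(3) by (simp only: K_def K'_def Y'_def)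
  then have "K / 2 - K' = e * Y'" using e0 by (simp add: field_simps)
  then have "e * K' = e * K / 2 - (e * e) * Y'" by (simp add: algebra_simps)
  then have eK': "e * K' = Y / 2 - s * Y'" unfolding eK es .
  define B2 :: complex where "B2 = of_real (\<beta> / 2)"
  have DB: "D = B2 - A / 2" by (simp add: D_def B2_def A_def diff_divide_distrib)
  \<comment> \<open>The factor \<open>n\<close> normalises the cone solution to parameter -1, and
    \<open>e\<close> turns it into the function \<open>Y\<close> of the connection formula.\<close>
  have "e * n * Wr z = - A * (e * (n * FL' z 0)) * FR z 0 - (e * (n * FL z 0)) * (FR' z 0 - B2 * FR z 0)"
   unfolding Wr_def A_def B2_def by (simp add: algebra_simps)
  also have "\<dots> = - A * (Y / 2 - s * Y') * FR z 0 - Y * (\<i> * \<sigma> z * FR z 0 + R1 z - B2 * FR z 0)"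
   unfolding FLK eK eK' by (simp add: R1_def)
  also have "\<dots> = \<alpha> * exp (\<i> * s) * P z + \<gamma> * exp (- \<i> * s) * Q z"
  proof -
   define E1 E2 where "E1 = exp (\<i> * s)" and "E2 = exp (- \<i> * s)"
   define F R S u u' v v' where "F = FR z 0" and "R = R1 z" and "S = \<sigma> z"
    and "u = g1 s" and "u' = g1' s" and "v = g2 s" and "v' = g2' s"
   have "- A * ((\<alpha> * E1 * u + \<gamma> * E2 * v) / 2 - s * (\<alpha> * E1 * (\<i> * u + u') + \<gamma> * E2 * (- \<i> * v + v'))) * F
     - (\<alpha> * E1 * u + \<gamma> * E2 * v) * (\<i> * S * F + R - B2 * F)
    = \<alpha> * E1 * (F * (- \<i> * (S - A * s) * u + A * (s * u') + (B2 - A / 2) * u) - u * R)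
     + \<gamma> * E2 * (F * (- \<i> * (A * s + S) * v + A * (s * v') + (B2 - A / 2) * v) - v * R)"
   proof -
    define H J where "H = A / 2" and "J = \<i>"
    have "- A * ((\<alpha> * E1 * u + \<gamma> * E2 * v) / 2 - s * (\<alpha> * E1 * (J * u + u') + \<gamma> * E2 * (- J * v + v'))) * F
      = (A * (s * (\<alpha> * E1 * (J * u + u') + \<gamma> * E2 * (- J * v + v'))) - H * (\<alpha> * E1 * u + \<gamma> * E2 * v)) * F"
     by (simp add: H_def right_diff_distrib)
    moreover have "(A * (s * (p * x + q * y)) - H * (p * u + q * v)) * F - (p * u + q * v) * T
      = p * (A * (s * x) * F - H * u * F - u * T) + q * (A * (s * y) * F - H * v * F - v * T)" for p q x y T by (simp add: algebra_simps)
    moreover have "A * (s * (J * u + u')) * F - H * u * F - u * (J * S * F + R - B2 * F)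
      = F * (- J * (S - A * s) * u + A * (s * u') + (B2 - H) * u) - u * R" by (simp add: algebra_simps)
    moreover have "A * (s * (- J * v + v')) * F - H * v * F - v * (J * S * F + R - B2 * F)
      = F * (- J * (A * s + S) * v + A * (s * v') + (B2 - H) * v) - v * R" by (simp add: algebra_simps)
    ultimately show ?thesis unfolding J_def[symmetric] H_def[symmetric] by (simp only:)
   qed
   then show ?thesis
    unfolding P_def Q_def s_def[symmetric] DB Y_def Y'_def E1_def E2_def F_def R_def S_def u_def u'_def v_def v'_def s(3)[symmetric] .
  qed
  finally have W: "e * n * Wr z = \<alpha> * exp (\<i> * s) * P z + \<gamma> * exp (- \<i> * s) * Q z" .
  define E where "E = exp (\<i> * s)"
  have E: "E \<noteq> 0" "exp (- \<i> * s) = inverse E" by (simp_all add: E_def exp_minus)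
  have "E * E = exp (\<i> * s + \<i> * s)" unfolding E_def exp_add ..
  also have "\<i> * s + \<i> * s = 2 * \<i> * z / of_real a" by (simp add: s_def A_def field_simps)
  finally have EE: "exp (2 * \<i> * z / of_real a) = E * E" ..
  have zj: "C0 * z ^ j \<noteq> 0" using C0 h(3) by simp
  have "C0 * z ^ j * (1 + \<epsilon> z) = - \<gamma> * Q z / (\<alpha> * P z)"
  proof -
   have "w * (1 + (N / (M * w) - 1)) = N / M" if "w \<noteq> 0" for w N M :: complex using that by simp
   from this[OF zj] show ?thesis unfolding \<epsilon>_def .
  qed
  moreover have "Wr z = 0 \<longleftrightarrow> \<alpha> * E * P z + \<gamma> * inverse E * Q z = 0"
   using W e0 unfolding E(2) E_def[symmetric] by (metis mult_eq_0_iff)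
  moreover have "\<alpha> * E * P z + \<gamma> * inverse E * Q z = 0 \<longleftrightarrow> E * E = - \<gamma> * Q z / (\<alpha> * P z)"
  proof -
   have "\<alpha> * E * P z + \<gamma> * inverse E * Q z = 0 \<longleftrightarrow> E * (\<alpha> * E * P z + \<gamma> * inverse E * Q z) = 0"
    using E(1) by simp
   also have "E * (\<alpha> * E * P z + \<gamma> * inverse E * Q z) = \<alpha> * P z * (E * E) + \<gamma> * Q z"
    using E(1) by (simp add: algebra_simps)
   also have "\<dots> = 0 \<longleftrightarrow> E * E = - \<gamma> * Q z / (\<alpha> * P z)"
   proof -
    have "p * x + q = 0 \<longleftrightarrow> x = - q / p" if "p \<noteq> 0" for p q x :: complex
     unfolding nonzero_eq_divide_eq[OF that] add_eq_0_iff2 by (simp add: mult.commute)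
    from this[of "\<alpha> * P z"] show ?thesis using nz(1) h(5) by simp
   qed
   finally show ?thesis .
  qed
  ultimately show ?thesis unfolding EE by simp
 qed
 show ?thesis by (rule that[OF Lp L(2) C0 h\<epsilon>]) (use H main in \<open>simp_all add: H_def j_def\<close>)
qed

end

theorem proposition3p1:
 fixes a b :: real and m :: int
 assumes "b < 0" and "0 < a" and "m > 0"
 shows "\<exists>(lam\<^sub>0 :: real) (k\<^sub>0 :: nat) (lam :: nat \<Rightarrow> complex).
  lam\<^sub>0 > 0 \<and> lam\<^sub>0 > \<bar>b\<bar> / 2 \<and>
  bij_betw lam {k\<^sub>0..} {z \<in> resonances a b m. Re z \<ge> lam\<^sub>0} \<and>
  (let j = (if a + b \<noteq> 0 then 1 else 2 :: nat)
   in (\<lambda>k. lam k - (of_real (pi * a * real k)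
            - \<i> * of_real (real j * a / 2 * ln (real k)))) \<in> O(\<lambda>_. 1))"
proof -
 interpret radial a b m using assms by unfold_locales auto
 obtain L C0 \<epsilon> where h: "L > 0" "L \<ge> \<beta> / 2" "C0 \<noteq> 0" "\<epsilon> holomorphic_on {z. Re z > L}"
  "\<And>z. Re z > L \<Longrightarrow> cmod (\<epsilon> z) < 1 / 2"
  "\<And>z. Re z > L \<Longrightarrow> Wr z = 0 \<longleftrightarrow> exp (2 * \<i> * z / of_real a) = C0 * z ^ (if \<beta> \<noteq> a then 1 else 2) * (1 + \<epsilon> z)"
  by (rule Wr_equation) (rule that)
 have Z: "z \<in> resonances a b m \<longleftrightarrow> exp (2 * \<i> * z / of_real a) = C0 * z ^ (if \<beta> \<noteq> a then 1 else 2) * (1 + \<epsilon> z)" if "Re z > L" for z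
  using h(6)[OF that] that h(2) unfolding resonances_iff by simp
 have j: "(if a + b \<noteq> 0 then 1 else 2) = (if \<beta> \<noteq> a then 1 else 2 :: nat)" by (auto simp: \<beta>_def)
 obtain lam0 k0 lam where r: "lam0 > \<beta> / 2" "lam0 > L" "bij_betw lam {k0..} {z. z \<in> resonances a b m \<and> Re z \<ge> lam0}"
  "(\<lambda>k. lam k - (of_real (pi * a * real k) - \<i> * of_real (real (if \<beta> \<noteq> a then 1 else 2) * a / 2 * ln (real k)))) \<in> O(\<lambda>_. 1)"
  using zero_sequence_asymptotics[OF a h(1,3,4,5) Z, of "\<beta> / 2"] by blast
 have "lam0 > 0" "\<beta> = \<bar>b\<bar>" using r(2) h(1) b by (simp_all add: \<beta>_def)
 then show ?thesis unfolding j Let_def using r by (intro exI[of _ lam0] exI[of _ k0] exI[of _ lam] conjI) simp_all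
qed

end
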